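(* Let $(R,\mathfrak m,k)$ be a regular local ring of dimension $d\ge2$ with infinite residue field $k$, and let $I$ be a complete $\mathfrak m$-primary ideal of $R$. Let $x\in\mathfrak m\setminus\mathfrak m^2$ be such that $xV=\mathfrak mV$ for each $V\in\operatorname{Rees}I$, let $S_1=R[\frac{\mathfrak m}{x}]$, let $r=\operatorname{ord}_RI$, and let $I_1$ be the transform of $I$ in $S_1$, so that $IS_1=x^rI_1$. If $I_1$ is projectively full in $S_1$, then $I$ is projectively full in $R$.
   Context: $\overline I$ denotes the integral closure of an ideal $I$; $I$ is complete if $I=\overline I$. $\operatorname{ord}_RI=r$ if $I\subseteq\mathfrak m^r$ and $I\not\subseteq\mathfrak m^{r+1}$. Projective fullness: let $I$ be a regular proper ideal of a Noetherian ring $R$ (regular meaning that it contains a non-zero-divisor). An ideal $J$ of $R$ is projectively equivalent to $I$ if $\overline{I^j}=\overline{J^i}$ for some positive integers $i,j$. The ideal $I$ is projectively full if the only complete ideals projectively equivalent to $I$ are the ideals $\overline{I^k}$ with $k$ a positive integer. Rees valuations: for a nonzero ideal $I$ of a Noetherian domain $R$, $\operatorname{Rees}I$ is the set of DVRs $\big(\overline{R[I/a]}\big)_Q$, where $0\ne a\in I$, the bar is integral closure in the fraction field, and $Q$ is a height-one prime of $\overline{R[I/a]}$ with $I\subset Q$. Transform: $S_1$ is a regular UFD with the same field of fractions as $R$. The transform of $I$ in $S_1$ is $a^{-1}IS_1$, where $aS_1$ is the smallest principal ideal of $S_1$ containing $IS_1$; here $a=x^r$. *)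

theory Defs
  imports
    "HOL-Algebra.QuotRing"
    "HOL-Algebra.Ideal_Product"
    "HOL-Algebra.Generated_Rings"
    "HOL-Algebra.Subrings"
    "HOL-Algebra.Ring_Divisibility"
    "HOL-Library.Extended_Nat"
begin

section \<open>Dimension and regular local rings\<close>

definition prime_chain :: "('a, 'b) ring_scheme \<Rightarrow> nat \<Rightarrow> (nat \<Rightarrow> 'a set) \<Rightarrow> bool" where
  "prime_chain A n P \<longleftrightarrow>
     (\<forall>i\<le>n. primeideal (P i) A) \<and> (\<forall>i<n. P i \<subset> P (Suc i))"

definition krull_dim :: "('a, 'b) ring_scheme \<Rightarrow> enat" where
  "krull_dim A = Sup {enat n | n. \<exists>P. prime_chain A n P}"

definition prime_height :: "('a, 'b) ring_scheme \<Rightarrow> 'a set \<Rightarrow> enat" where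
  "prime_height A Q = Sup {enat n | n. \<exists>P. prime_chain A n P \<and> P n = Q}"

definition regular_local_ring :: "('a, 'b) ring_scheme \<Rightarrow> 'a set \<Rightarrow> bool" where
  "regular_local_ring A m \<longleftrightarrow>
     cring A \<and> noetherian_ring A \<and>
     maximalideal m A \<and> (\<forall>M. maximalideal M A \<longrightarrow> M = m) \<and>
     (\<exists>X \<subseteq> carrier A. finite X \<and> m = Idl\<^bsub>A\<^esub> X \<and> enat (card X) = krull_dim A)"

section \<open>Ideals: powers, order, primary ideals, integral closure\<close>

text \<open>The ideals of a ring form a multiplicative monoid, whose unit is the whole ring;
  in particular the zeroth power of an ideal is the whole ring.\<close>

abbreviation ideal_power :: "('a, 'b) ring_scheme \<Rightarrow> 'a set \<Rightarrow> nat \<Rightarrow> 'a set" where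
  "ideal_power A I n \<equiv> I [^]\<^bsub>ideals_set A\<^esub> n"

definition ideal_ord :: "('a, 'b) ring_scheme \<Rightarrow> 'a set \<Rightarrow> 'a set \<Rightarrow> nat \<Rightarrow> bool" where
  "ideal_ord A m I r \<longleftrightarrow> I \<subseteq> ideal_power A m r \<and> \<not> I \<subseteq> ideal_power A m (Suc r)"

definition ideal_radical :: "('a, 'b) ring_scheme \<Rightarrow> 'a set \<Rightarrow> 'a set" where
  "ideal_radical A I = {a \<in> carrier A. \<exists>n::nat. a [^]\<^bsub>A\<^esub> n \<in> I}"

definition primary_ideal :: "('a, 'b) ring_scheme \<Rightarrow> 'a set \<Rightarrow> bool" where
  "primary_ideal A I \<longleftrightarrow>
     ideal I A \<and> I \<noteq> carrier A \<and>
     (\<forall>a \<in> carrier A. \<forall>b \<in> carrier A. a \<otimes>\<^bsub>A\<^esub> b \<in> I \<longrightarrow> a \<in> I \<or> b \<in> ideal_radical A I)"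

text \<open>The elements \<open>z\<close> satisfying an equation
  \<open>z^n + c_1 z^(n-1) + ... + c_n = 0\<close> with \<open>c_i\<close> in the \<open>i\<close>-th power of the ideal.\<close>

definition ideal_closure :: "('a, 'b) ring_scheme \<Rightarrow> 'a set \<Rightarrow> 'a set" where
  "ideal_closure A I = {z \<in> carrier A. \<exists>n\<ge>1. \<exists>c.
     (\<forall>i \<in> {1..n}. c i \<in> ideal_power A I i) \<and>
     z [^]\<^bsub>A\<^esub> n \<oplus>\<^bsub>A\<^esub> (\<Oplus>\<^bsub>A\<^esub> i \<in> {1..n}. c i \<otimes>\<^bsub>A\<^esub> z [^]\<^bsub>A\<^esub> (n - i)) = \<zero>\<^bsub>A\<^esub>}"

definition complete_ideal :: "('a, 'b) ring_scheme \<Rightarrow> 'a set \<Rightarrow> bool" where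
  "complete_ideal A I \<longleftrightarrow> ideal I A \<and> ideal_closure A I = I"

section \<open>Projective equivalence and projective fullness\<close>

definition regular_ideal :: "('a, 'b) ring_scheme \<Rightarrow> 'a set \<Rightarrow> bool" where
  "regular_ideal A I \<longleftrightarrow>
     ideal I A \<and> (\<exists>a \<in> I. \<forall>b \<in> carrier A. a \<otimes>\<^bsub>A\<^esub> b = \<zero>\<^bsub>A\<^esub> \<longrightarrow> b = \<zero>\<^bsub>A\<^esub>)"

definition projectively_equivalent :: "('a, 'b) ring_scheme \<Rightarrow> 'a set \<Rightarrow> 'a set \<Rightarrow> bool" where
  "projectively_equivalent A I J \<longleftrightarrow>
     (\<exists>i j :: nat. 0 < i \<and> 0 < j \<and>
        ideal_closure A (ideal_power A I j) = ideal_closure A (ideal_power A J i))"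

text \<open>Projective fullness is a property of regular proper ideals only, so these requirements
  are part of the definition; in particular the unit ideal is not projectively full.\<close>

definition projectively_full :: "('a, 'b) ring_scheme \<Rightarrow> 'a set \<Rightarrow> bool" where
  "projectively_full A I \<longleftrightarrow>
     regular_ideal A I \<and> I \<noteq> carrier A \<and>
     (\<forall>J. complete_ideal A J \<and> projectively_equivalent A I J \<longrightarrow>
        (\<exists>k::nat. 0 < k \<and> J = ideal_closure A (ideal_power A I k)))"

section \<open>Subrings of a field\<close>

text \<open>From here on all rings are subrings of a fixed field \<open>K\<close>, given by their carriers.\<close>

definition fraction_field_of :: "('a, 'b) ring_scheme \<Rightarrow> 'a set \<Rightarrow> bool" where
  "fraction_field_of K R \<longleftrightarrow>
     field K \<and> subring R K \<and>
     (\<forall>z \<in> carrier K. \<exists>a \<in> R. \<exists>b \<in> R - {\<zero>\<^bsub>K\<^esub>}. z = a \<otimes>\<^bsub>K\<^esub> inv\<^bsub>K\<^esub> b)"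

text \<open>The ring \<open>R[I/a]\<close>.\<close>

definition adjoin_quotients :: "('a, 'b) ring_scheme \<Rightarrow> 'a set \<Rightarrow> 'a set \<Rightarrow> 'a \<Rightarrow> 'a set" where
  "adjoin_quotients K R I a = generate_ring K (R \<union> {z \<otimes>\<^bsub>K\<^esub> inv\<^bsub>K\<^esub> a | z. z \<in> I})"

definition integral_closure_in :: "('a, 'b) ring_scheme \<Rightarrow> 'a set \<Rightarrow> 'a set" where
  "integral_closure_in K B = {z \<in> carrier K. \<exists>n\<ge>1. \<exists>c.
     (\<forall>i \<in> {1..n}. c i \<in> B) \<and>
     z [^]\<^bsub>K\<^esub> n \<oplus>\<^bsub>K\<^esub> (\<Oplus>\<^bsub>K\<^esub> i \<in> {1..n}. c i \<otimes>\<^bsub>K\<^esub> z [^]\<^bsub>K\<^esub> (n - i :: nat)) = \<zero>\<^bsub>K\<^esub>}"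

definition localization_in :: "('a, 'b) ring_scheme \<Rightarrow> 'a set \<Rightarrow> 'a set \<Rightarrow> 'a set" where
  "localization_in K B Q = {b \<otimes>\<^bsub>K\<^esub> inv\<^bsub>K\<^esub> s | b s. b \<in> B \<and> s \<in> B - Q}"

text \<open>The Rees valuation rings of a nonzero ideal \<open>I\<close> of a Noetherian domain \<open>R\<close> with
  fraction field \<open>K\<close>. The localizations below are automatically discrete valuation rings
  (by the Mori-Nagata theorem), so this is not imposed as a further condition.\<close>

definition Rees :: "('a, 'b) ring_scheme \<Rightarrow> 'a set \<Rightarrow> 'a set \<Rightarrow> 'a set set" where
  "Rees K R I = {localization_in K B Q | B Q a.
     a \<in> I \<and> a \<noteq> \<zero>\<^bsub>K\<^esub> \<and>
     B = integral_closure_in K (adjoin_quotients K R I a) \<and>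
     primeideal Q (K\<lparr>carrier := B\<rparr>) \<and> prime_height (K\<lparr>carrier := B\<rparr>) Q = 1 \<and>
     I \<subseteq> Q}"

text \<open>\<open>I1\<close> is the transform of \<open>I\<close> in the overring \<open>S\<close>. The generator \<open>a\<close> of the smallest
  principal ideal containing \<open>I S\<close> is unique only up to units, but \<open>I1\<close> does not depend on it.\<close>

definition is_transform :: "('a, 'b) ring_scheme \<Rightarrow> 'a set \<Rightarrow> 'a set \<Rightarrow> 'a set \<Rightarrow> bool" where
  "is_transform K S I I1 \<longleftrightarrow>
     (let A = K\<lparr>carrier := S\<rparr> in
      \<exists>a \<in> S. a \<noteq> \<zero>\<^bsub>K\<^esub> \<and> Idl\<^bsub>A\<^esub> I \<subseteq> PIdl\<^bsub>A\<^esub> a \<and>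
        (\<forall>b \<in> S. Idl\<^bsub>A\<^esub> I \<subseteq> PIdl\<^bsub>A\<^esub> b \<longrightarrow> PIdl\<^bsub>A\<^esub> a \<subseteq> PIdl\<^bsub>A\<^esub> b) \<and>
        I1 = {inv\<^bsub>K\<^esub> a \<otimes>\<^bsub>K\<^esub> z | z. z \<in> Idl\<^bsub>A\<^esub> I})"

end

theory Submission
  imports Defs
begin

text \<open>
  Since the residue field is infinite, forms over \<open>R\<close> can be specialized along linear coordinates until
  only one coordinate is left, so that Krull's height theorem makes the order of \<open>R\<close> multiplicative.
  Hence \<open>x\<close> is prime in \<open>S1\<close>, and the transform divides the extension of an ideal of order \<open>r\<close>
  exactly by \<open>x^r\<close>.

  If \<open>z\<close> is not integral over \<open>I^k\<close>, then \<open>z/a^k\<close> lies outside the integral closure \<open>B\<close> of some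
  \<open>R[I/a]\<close>, and it lies outside \<open>B_Q\<close> for a height-one prime \<open>Q\<close> of \<open>B\<close> that contains \<open>I\<close>: after
  localizing at an associated prime, an integral overring that is Noetherian by the Krull-Akizuki argument
  has a prime which becomes principal. The hypothesis \<open>xV = mV\<close> puts \<open>S1\<close> inside \<open>V = B_Q\<close>, so the
  closure of \<open>I^k\<close> in \<open>R\<close> consists of the elements of \<open>R\<close> in the closure of \<open>I^k S1\<close>.

  Let \<open>J\<close> be complete and projectively equivalent to \<open>I\<close>. The closure of the transform of \<open>J\<close> is
  projectively equivalent to \<open>I1\<close>, hence is the closure of some \<open>I1^k\<close>; comparing orders gives
  \<open>ord J = k r\<close>, so \<open>J\<close> and \<open>I^k\<close> have the same closure over \<open>S1\<close> and therefore over \<open>R\<close>.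
\<close>

text \<open>The hypothesis speaks of localizations of the integral closure \<open>B\<close> of
  \<open>R[I/a]\<close>, and \<open>B\<close> need not be Noetherian, so chain conditions are not at
  hand in \<open>B\<close> itself. The arguments that need them take place in a Noetherian ring
  between \<open>R[I/a]\<close> and \<open>B\<close>, or over a localization of one, and only the
  valuation ring that results is carried back, as the localization of \<open>B\<close> at its
  center.

  Ideals are compared through all valuation rings \<open>V\<close> of \<open>K\<close> over a ring,
  of whatever rank: an element is integral over an ideal iff each such \<open>V\<close> makes it a
  multiple of some element of the ideal. Powers, transforms and roots then become manipulations of
  divisibility in \<open>V\<close>, and an element of least value stands for a finitely generated
  ideal.

  Multiplicativity of the order makes the powers of \<open>m\<close> complete, which gives a first
  equation \<open>r j = s i\<close> for the order \<open>s\<close> of \<open>J\<close>. A valuation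
  ring over \<open>S1\<close> in which \<open>I1\<close> consists of nonunits gives a second,
  \<open>j = k i\<close>. Together they say \<open>s = r k\<close>.\<close>

locale ambient_field = field K for K (structure)
begin

section \<open>Arithmetic of fractions in the ambient field\<close>

lemma inv_carr [simp]: "a \<in> carrier K \<Longrightarrow> a \<noteq> \<zero> \<Longrightarrow> inv a \<in> carrier K"
  and r_inv_carr [simp]: "a \<in> carrier K \<Longrightarrow> a \<noteq> \<zero> \<Longrightarrow> a \<otimes> inv a = \<one>"
  and l_inv_carr [simp]: "a \<in> carrier K \<Longrightarrow> a \<noteq> \<zero> \<Longrightarrow> inv a \<otimes> a = \<one>"
  using field_Units by auto

lemma inv_nz [simp]: "a \<in> carrier K \<Longrightarrow> a \<noteq> \<zero> \<Longrightarrow> inv a \<noteq> \<zero>"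
  using r_inv_carr[of a] by (metis r_null one_not_zero)

lemma inv_inv' [simp]: "a \<in> carrier K \<Longrightarrow> a \<noteq> \<zero> \<Longrightarrow> inv (inv a) = a"
  using field_Units by (simp add: Units_inv_inv)

lemma mult_nz [simp]: "a \<in> carrier K \<Longrightarrow> b \<in> carrier K \<Longrightarrow> a \<otimes> b = \<zero> \<longleftrightarrow> a = \<zero> \<or> b = \<zero>"
  by (simp add: integral_iff)

lemma pow_nz [simp]: "a \<in> carrier K \<Longrightarrow> a \<noteq> \<zero> \<Longrightarrow> a [^] (n::nat) \<noteq> \<zero>"
  by (induction n) auto

lemma inv_mult': "a \<in> carrier K \<Longrightarrow> b \<in> carrier K \<Longrightarrow> a \<noteq> \<zero> \<Longrightarrow> b \<noteq> \<zero> \<Longrightarrow> inv (a \<otimes> b) = inv a \<otimes> inv b"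
  by (rule comm_inv_char) (auto simp: m_ac)

lemma inv_pow: "a \<in> carrier K \<Longrightarrow> a \<noteq> \<zero> \<Longrightarrow> inv (a [^] (n::nat)) = inv a [^] n"
  by (induction n) (auto simp: inv_mult')

lemma cancel_l: "a \<in> carrier K \<Longrightarrow> a \<noteq> \<zero> \<Longrightarrow> b \<in> carrier K \<Longrightarrow> c \<in> carrier K \<Longrightarrow> a \<otimes> b = a \<otimes> c \<longleftrightarrow> b = c"
  using m_lcancel by blast

lemma inv_cancel [simp]:
  assumes "a \<in> carrier K" "a \<noteq> \<zero>" "b \<in> carrier K"
  shows "a \<otimes> (inv a \<otimes> b) = b" "inv a \<otimes> (a \<otimes> b) = b" "b \<otimes> a \<otimes> inv a = b" "b \<otimes> inv a \<otimes> a = b"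
    "a \<otimes> (b \<otimes> inv a) = b" "inv a \<otimes> (b \<otimes> a) = b" 
proof -
  have 1: "a \<otimes> (b \<otimes> inv a) = b \<otimes> (a \<otimes> inv a)" "inv a \<otimes> (b \<otimes> a) = b \<otimes> (inv a \<otimes> a)"
    using assms m_lcomm[of a b "inv a"] m_lcomm[of "inv a" b a] by (simp_all del: r_inv_carr l_inv_carr)
  show "a \<otimes> (inv a \<otimes> b) = b" "inv a \<otimes> (a \<otimes> b) = b" 
    using assms by (simp_all add: m_assoc[symmetric])
  show "b \<otimes> a \<otimes> inv a = b" "b \<otimes> inv a \<otimes> a = b"
    using assms by (simp_all add: m_assoc)
  show "a \<otimes> (b \<otimes> inv a) = b" "inv a \<otimes> (b \<otimes> a) = b" 
    using assms unfolding 1 by simp_all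
qed

lemma div_eq_iff:
  assumes "a \<in> carrier K" "b \<in> carrier K" "c \<in> carrier K" "b \<noteq> \<zero>"
  shows "a \<otimes> inv b = c \<longleftrightarrow> a = c \<otimes> b" "c = a \<otimes> inv b \<longleftrightarrow> c \<otimes> b = a"
  using assms by (auto simp: m_assoc)

lemma div_mult:
  assumes "a \<in> carrier K" "b \<in> carrier K" "c \<in> carrier K" "d \<in> carrier K" "b \<noteq> \<zero>" "d \<noteq> \<zero>"
  shows "(a \<otimes> inv b) \<otimes> (c \<otimes> inv d) = (a \<otimes> c) \<otimes> inv (b \<otimes> d)"
  using assms by (simp add: inv_mult' m_ac)

lemma div_add:
  assumes "a \<in> carrier K" "b \<in> carrier K" "c \<in> carrier K" "d \<in> carrier K" "b \<noteq> \<zero>" "d \<noteq> \<zero>"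
  shows "(a \<otimes> inv b) \<oplus> (c \<otimes> inv d) = (a \<otimes> d \<oplus> c \<otimes> b) \<otimes> inv (b \<otimes> d)"
proof -
  have "(a \<otimes> d \<oplus> c \<otimes> b) \<otimes> inv (b \<otimes> d) = a \<otimes> inv b \<otimes> (d \<otimes> inv d) \<oplus> c \<otimes> inv d \<otimes> (b \<otimes> inv b)"
    using assms by (simp add: inv_mult' l_distr r_distr m_ac del: r_inv_carr l_inv_carr inv_cancel)
  then show ?thesis using assms by simp
qed

lemma div_eq_div:
  assumes "a \<in> carrier K" "b \<in> carrier K" "c \<in> carrier K" "d \<in> carrier K" "b \<noteq> \<zero>" "d \<noteq> \<zero>"
  shows "a \<otimes> inv b = c \<otimes> inv d \<longleftrightarrow> a \<otimes> d = c \<otimes> b"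
proof -
  have "a \<otimes> inv b = c \<otimes> inv d \<longleftrightarrow> a = c \<otimes> inv d \<otimes> b" using assms by (intro div_eq_iff(1)) auto
  also have "c \<otimes> inv d \<otimes> b = c \<otimes> b \<otimes> inv d" using assms by (simp add: m_ac)
  finally show ?thesis using assms by (simp add: div_eq_iff)
qed

section \<open>Ideals of subrings\<close>

text \<open>Ideals of the subring \<open>A\<close> as plain subsets of the field, so that all
  arithmetic stays in \<open>K\<close> although many subrings are in play. Additive inverses come
  from multiplication by \<open>\<ominus> \<one>\<close>.\<close>

definition ideal_of :: "'a set \<Rightarrow> 'a set \<Rightarrow> bool" where
  "ideal_of A E \<longleftrightarrow> E \<subseteq> A \<and> \<zero> \<in> E \<and> (\<forall>a\<in>E. \<forall>b\<in>E. a \<oplus> b \<in> E) \<and> (\<forall>s\<in>A. \<forall>a\<in>E. s \<otimes> a \<in> E)"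

definition prime_of :: "'a set \<Rightarrow> 'a set \<Rightarrow> bool" where
  "prime_of A P \<longleftrightarrow> ideal_of A P \<and> \<one> \<notin> P \<and> (\<forall>a\<in>A. \<forall>b\<in>A. a \<otimes> b \<in> P \<longrightarrow> a \<in> P \<or> b \<in> P)"

lemma ideal_ofI:
  assumes "E \<subseteq> A" "\<zero> \<in> E" "\<And>a b. a \<in> E \<Longrightarrow> b \<in> E \<Longrightarrow> a \<oplus> b \<in> E" "\<And>s a. s \<in> A \<Longrightarrow> a \<in> E \<Longrightarrow> s \<otimes> a \<in> E"
  shows "ideal_of A E"
  using assms unfolding ideal_of_def by blast

lemma ideal_ofD:
  assumes "ideal_of A E"
  shows "E \<subseteq> A" "\<zero> \<in> E" "\<And>a b. a \<in> E \<Longrightarrow> b \<in> E \<Longrightarrow> a \<oplus> b \<in> E" "\<And>s a. s \<in> A \<Longrightarrow> a \<in> E \<Longrightarrow> s \<otimes> a \<in> E"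
  using assms unfolding ideal_of_def by blast+

lemma subringD:
  assumes "subring A K"
  shows "A \<subseteq> carrier K" "\<zero> \<in> A" "\<one> \<in> A" "\<And>a. a \<in> A \<Longrightarrow> a \<in> carrier K"
    "\<And>a. a \<in> A \<Longrightarrow> \<ominus> a \<in> A" "\<And>a b. a \<in> A \<Longrightarrow> b \<in> A \<Longrightarrow> a \<otimes> b \<in> A"
    "\<And>a b. a \<in> A \<Longrightarrow> b \<in> A \<Longrightarrow> a \<oplus> b \<in> A" "\<And>a b. a \<in> A \<Longrightarrow> b \<in> A \<Longrightarrow> a \<ominus> b \<in> A"
    "\<And>a n. a \<in> A \<Longrightarrow> a [^] (n::nat) \<in> A"
proof -
  note * = subringE[OF assms]
  show "A \<subseteq> carrier K" "\<zero> \<in> A" "\<one> \<in> A" "\<And>a. a \<in> A \<Longrightarrow> a \<in> carrier K"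
    "\<And>a. a \<in> A \<Longrightarrow> \<ominus> a \<in> A" "\<And>a b. a \<in> A \<Longrightarrow> b \<in> A \<Longrightarrow> a \<otimes> b \<in> A"
    "\<And>a b. a \<in> A \<Longrightarrow> b \<in> A \<Longrightarrow> a \<oplus> b \<in> A" "\<And>a b. a \<in> A \<Longrightarrow> b \<in> A \<Longrightarrow> a \<ominus> b \<in> A"
    using * by (auto simp: a_minus_def)
  show "\<And>a n. a \<in> A \<Longrightarrow> a [^] (n::nat) \<in> A"
  proof -
    fix a n assume "a \<in> A" then show "a [^] (n::nat) \<in> A"
      using * by (induction n) auto
  qed
qed

lemma ideal_of_minus:
  assumes "subring A K" "ideal_of A E"
  shows "\<And>a. a \<in> E \<Longrightarrow> \<ominus> a \<in> E" "\<And>a b. a \<in> E \<Longrightarrow> b \<in> E \<Longrightarrow> a \<ominus> b \<in> E"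
proof -
  note A = subringD[OF assms(1)] and E = ideal_ofD[OF assms(2)]
  show *: "\<ominus> a \<in> E" if "a \<in> E" for a
  proof -
    have "\<ominus> a = (\<ominus> \<one>) \<otimes> a" using that A(4) E(1) by (auto simp: l_minus)
    then show ?thesis using that A E by auto
  qed
  show "\<And>a b. a \<in> E \<Longrightarrow> b \<in> E \<Longrightarrow> a \<ominus> b \<in> E" using * E by (auto simp: a_minus_def)
qed

lemma ideal_of_iff:
  assumes "subring A K"
  shows "ideal E (K\<lparr>carrier := A\<rparr>) \<longleftrightarrow> ideal_of A E"
proof
  note A = subringD[OF assms]
  assume "ideal E (K\<lparr>carrier := A\<rparr>)"
  then interpret I: ideal E "K\<lparr>carrier := A\<rparr>" .
  show "ideal_of A E"
    using I.a_subset additive_subgroup.zero_closed[OF I.is_additive_subgroup]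
      additive_subgroup.a_closed[OF I.is_additive_subgroup] I.I_l_closed by (intro ideal_ofI) auto
next
  note A = subringD[OF assms]
  assume E': "ideal_of A E"
  note E = ideal_ofD[OF E']
  interpret A: ring "K\<lparr>carrier := A\<rparr>" using subring_is_ring[OF assms] .
  show "ideal E (K\<lparr>carrier := A\<rparr>)"
  proof (rule idealI)
    show "ring (K\<lparr>carrier := A\<rparr>)" by (rule A.ring_axioms)
    show "subgroup E (add_monoid (K\<lparr>carrier := A\<rparr>))"
    proof (rule A.add.subgroupI)
      fix a assume a: "a \<in> E"
      then have aA: "a \<in> A" using E by auto
      have "\<ominus>\<^bsub>K\<lparr>carrier := A\<rparr>\<^esub> a = \<ominus> a"
        using aA A by (intro A.minus_equality) (auto simp: l_neg)
      then show "\<ominus>\<^bsub>K\<lparr>carrier := A\<rparr>\<^esub> a \<in> E"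
        using ideal_of_minus(1)[OF assms E'] a by simp
    qed (use E in auto)
  qed (use E A m_comm in \<open>auto, metis subsetD\<close>)
qed

lemma cring_subring: "subring A K \<Longrightarrow> cring (K\<lparr>carrier := A\<rparr>)"
  using subcring_iff subcringI' subringE(1) by blast

lemma prime_of_iff:
  assumes "subring A K"
  shows "primeideal P (K\<lparr>carrier := A\<rparr>) \<longleftrightarrow> prime_of A P"
proof
  note A = subringD[OF assms]
  assume "primeideal P (K\<lparr>carrier := A\<rparr>)"
  then interpret I: primeideal P "K\<lparr>carrier := A\<rparr>" .
  have "ideal_of A P" using I.is_ideal ideal_of_iff[OF assms] by blast
  moreover have "\<one> \<notin> P"
    using I.one_imp_carrier I.I_notcarr by auto
  ultimately show "prime_of A P"
    using I.I_prime unfolding prime_of_def by auto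
next
  note A = subringD[OF assms]
  assume P: "prime_of A P"
  show "primeideal P (K\<lparr>carrier := A\<rparr>)"
  proof (rule primeidealI)
    show "ideal P (K\<lparr>carrier := A\<rparr>)" using P ideal_of_iff[OF assms] unfolding prime_of_def by blast
    show "cring (K\<lparr>carrier := A\<rparr>)" by (rule cring_subring[OF assms])
  qed (use P A in \<open>auto simp: prime_of_def\<close>)
qed

lemma prime_ofD:
  assumes "prime_of A P"
  shows "ideal_of A P" "\<one> \<notin> P" "\<And>a b. a \<in> A \<Longrightarrow> b \<in> A \<Longrightarrow> a \<otimes> b \<in> P \<Longrightarrow> a \<in> P \<or> b \<in> P"
    "P \<subseteq> A" "\<zero> \<in> P" "\<And>a b. a \<in> P \<Longrightarrow> b \<in> P \<Longrightarrow> a \<oplus> b \<in> P" "\<And>s a. s \<in> A \<Longrightarrow> a \<in> P \<Longrightarrow> s \<otimes> a \<in> P"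
  using assms ideal_ofD[of A P] unfolding prime_of_def by blast+

lemma prime_of_pow:
  assumes "subring A K" "prime_of A P" "a \<in> A" "a [^] (n::nat) \<in> P"
  shows "a \<in> P"
  using assms(4)
proof (induction n)
  case 0 then show ?case using prime_ofD[OF assms(2)] by simp
next
  case (Suc n)
  then show ?case using prime_ofD(3)[OF assms(2), of "a [^] n" a] assms subringD[OF assms(1)] by auto
qed

lemma zero_ideal_of: "subring A K \<Longrightarrow> ideal_of A {\<zero>}"
  by (rule ideal_ofI) (auto simp: subringD(2,4))

lemma self_ideal_of: "subring A K \<Longrightarrow> ideal_of A A"
  by (rule ideal_ofI) (auto simp: subringD(2,6,7))

lemma Union_chain_ideal:
  assumes "\<And>n. ideal_of A (E n)" "\<And>n. E n \<subseteq> E (Suc n)"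
  shows "ideal_of A (\<Union>n::nat. E n)"
proof (rule ideal_ofI)
  have mono: "E n \<subseteq> E m" if "n \<le> m" for n m using lift_Suc_mono_le[of E, OF assms(2) that] .
  show "\<Union>(range E) \<subseteq> A" by (rule UN_least) (rule ideal_ofD(1)[OF assms(1)])
  show "\<zero> \<in> \<Union>(range E)" using ideal_ofD(2)[OF assms(1), of 0] by blast
  show "a \<oplus> b \<in> \<Union>(range E)" if ab: "a \<in> \<Union>(range E)" "b \<in> \<Union>(range E)" for a b
  proof -
    obtain n m where "a \<in> E n" "b \<in> E m" using ab by blast
    then have "a \<in> E (max n m)" "b \<in> E (max n m)" 
      using subsetD[OF mono[of n "max n m"]] subsetD[OF mono[of m "max n m"]] by simp_all
    then have "a \<oplus> b \<in> E (max n m)" by (rule ideal_ofD(3)[OF assms(1)])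
    then show ?thesis by blast
  qed
  show "s \<otimes> a \<in> \<Union>(range E)" if sa: "s \<in> A" "a \<in> \<Union>(range E)" for s a
  proof -
    obtain n where "a \<in> E n" using sa by blast
    then have "s \<otimes> a \<in> E n" by (rule ideal_ofD(4)[OF assms(1) sa(1)])
    then show ?thesis by blast
  qed
qed

definition plus_gen :: "'a set \<Rightarrow> 'a set \<Rightarrow> 'a \<Rightarrow> 'a set" where
  "plus_gen A E y = {e \<oplus> a \<otimes> y | e a. e \<in> E \<and> a \<in> A}"

lemma plus_gen_ideal:
  assumes "subring A K" "ideal_of A E" "y \<in> A"
  shows "ideal_of A (plus_gen A E y)" "E \<subseteq> plus_gen A E y" "y \<in> plus_gen A E y"
proof -
  note A = subringD[OF assms(1)] and E = ideal_ofD[OF assms(2)]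
  note [simp] = A E(2-4) subsetD[OF E(1)] and y = assms(3)
  have EK: "e \<in> carrier K" if "e \<in> E" for e using that by simp
  show "ideal_of A (plus_gen A E y)"
  proof (rule ideal_ofI)
    show "plus_gen A E y \<subseteq> A" unfolding plus_gen_def using y by auto
    have "\<zero> = \<zero> \<oplus> \<zero> \<otimes> y" using y by simp
    then show "\<zero> \<in> plus_gen A E y" unfolding plus_gen_def using A(2) E(2) by blast
    show "a \<oplus> b \<in> plus_gen A E y" if ab: "a \<in> plus_gen A E y" "b \<in> plus_gen A E y" for a b
    proof -
      obtain e s e' s' where *: "a = e \<oplus> s \<otimes> y" "b = e' \<oplus> s' \<otimes> y" "e \<in> E" "e' \<in> E" "s \<in> A" "s' \<in> A"
        using ab unfolding plus_gen_def by blast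
      have "a \<oplus> b = (e \<oplus> e') \<oplus> (s \<oplus> s') \<otimes> y" 
        using * EK y by (simp add: l_distr a_ac)
      moreover have "e \<oplus> e' \<in> E" "s \<oplus> s' \<in> A" using * by simp_all
      ultimately show ?thesis unfolding plus_gen_def by blast
    qed
    show "t \<otimes> a \<in> plus_gen A E y" if ab: "t \<in> A" "a \<in> plus_gen A E y" for t a
    proof -
      obtain e s where *: "a = e \<oplus> s \<otimes> y" "e \<in> E" "s \<in> A"
        using ab unfolding plus_gen_def by blast
      have "t \<otimes> a = t \<otimes> e \<oplus> (t \<otimes> s) \<otimes> y" 
        using * EK y ab by (simp add: r_distr m_ac)
      moreover have "t \<otimes> e \<in> E" "t \<otimes> s \<in> A" using * ab by simp_all
      ultimately show ?thesis unfolding plus_gen_def by blast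
    qed
  qed
  show "E \<subseteq> plus_gen A E y"
  proof
    fix e assume "e \<in> E"
    moreover have "e = e \<oplus> \<zero> \<otimes> y" using EK[OF \<open>e \<in> E\<close>] y by simp
    ultimately show "e \<in> plus_gen A E y" unfolding plus_gen_def using A(2) by blast
  qed
  have "y = \<zero> \<oplus> \<one> \<otimes> y" using y by simp
  then show "y \<in> plus_gen A E y" unfolding plus_gen_def using A(3) E(2) by blast
qed

lemma plus_gen_subset:
  assumes "ideal_of A F" "E \<subseteq> F" "y \<in> F"
  shows "plus_gen A E y \<subseteq> F"
  using subsetD[OF assms(2)] assms(3) unfolding plus_gen_def by (auto simp: ideal_ofD(3,4)[OF assms(1)])

text \<open>Generators are adjoined one at a time and kept in a list, so that the height theorem can
  be an induction on the list that compares its length with the length of a prime chain.\<close>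

fun gens :: "'a set \<Rightarrow> 'a set \<Rightarrow> 'a list \<Rightarrow> 'a set" where
  "gens A E [] = E"
| "gens A E (y # ys) = gens A (plus_gen A E y) ys"

lemma gens_ideal:
  assumes "subring A K" "ideal_of A E" "set ys \<subseteq> A"
  shows "ideal_of A (gens A E ys) \<and> E \<subseteq> gens A E ys \<and> set ys \<subseteq> gens A E ys"
  using assms(2,3)
proof (induction ys arbitrary: E)
  case (Cons y ys)
  have "ideal_of A (plus_gen A E y)" "E \<subseteq> plus_gen A E y" "y \<in> plus_gen A E y"
    using plus_gen_ideal assms(1) Cons.prems by auto
  then show ?case using Cons.IH[of "plus_gen A E y"] Cons.prems by auto
qed simp

text \<open>Here \<open>X\<close> may lie outside \<open>A\<close>. Later it consists of the
  elements whose multiple by a fixed fraction lies in an overring, or of those divisible by a given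
  element in a valuation ring.\<close>

lemma gens_subset_general:
  assumes "E \<subseteq> X" "set ys \<subseteq> X" "\<And>a b. a \<in> X \<Longrightarrow> b \<in> X \<Longrightarrow> a \<oplus> b \<in> X" "\<And>s a. s \<in> A \<Longrightarrow> a \<in> X \<Longrightarrow> s \<otimes> a \<in> X"
  shows "gens A E ys \<subseteq> X"
  using assms(1,2)
proof (induction ys arbitrary: E)
  case (Cons y ys)
  have "plus_gen A E y \<subseteq> X" using subsetD[OF Cons.prems(1)] Cons.prems(2) unfolding plus_gen_def by (auto simp: assms(3,4))
  then show ?case using Cons by auto
qed simp

lemma gens_subset:
  assumes "ideal_of A F" "E \<subseteq> F" "set ys \<subseteq> F"
  shows "gens A E ys \<subseteq> F"
  by (rule gens_subset_general[OF assms(2,3)]) (simp_all add: ideal_ofD(3,4)[OF assms(1)])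

lemma gens_append: "gens A E (xs @ ys) = gens A (gens A E xs) ys"
  by (induction xs arbitrary: E) auto

section \<open>Noetherian subrings\<close>

text \<open>The ascending chain condition passes to \<open>A[u]\<close> and to localizations by
  comparing chains, and it yields maximal members of families of ideals, which is how it is mostly
  applied.\<close>

definition noeth :: "'a set \<Rightarrow> bool" where
  "noeth A \<longleftrightarrow> subring A K \<and> (\<forall>E::nat \<Rightarrow> 'a set. (\<forall>n. ideal_of A (E n)) \<and> (\<forall>n. E n \<subseteq> E (Suc n)) \<longrightarrow>
     (\<exists>N. \<forall>n\<ge>N. E n = E N))"

lemma noethD:
  assumes "noeth A" "\<And>n. ideal_of A (E n)" "\<And>n. E n \<subseteq> E (Suc n)"
  obtains N where "\<And>n::nat. n \<ge> N \<Longrightarrow> E n = E N"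
  using assms unfolding noeth_def by meson

lemma noeth_subring: "noeth A \<Longrightarrow> subring A K" unfolding noeth_def by blast

lemma noeth_wf:
  assumes "noeth A"
  shows "wf {(F, E). ideal_of A E \<and> ideal_of A F \<and> E \<subset> F}"
  unfolding wf_iff_no_infinite_down_chain
proof
  assume "\<exists>f::nat \<Rightarrow> 'a set. \<forall>i. (f (Suc i), f i) \<in> {(F, E). ideal_of A E \<and> ideal_of A F \<and> E \<subset> F}"
  then obtain f :: "nat \<Rightarrow> 'a set" 
    where f': "\<forall>i. (f (Suc i), f i) \<in> {(F, E). ideal_of A E \<and> ideal_of A F \<and> E \<subset> F}" by blast
  have f: "ideal_of A (f i)" "f i \<subset> f (Suc i)" for i using spec[OF f', of i] by auto
  obtain N where "\<And>n. n \<ge> N \<Longrightarrow> f n = f N"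
    using noethD[OF assms, of f] f by blast
  then show False using f(2)[of N] by (metis le_Suc_eq le_refl psubset_eq)
qed

lemma noeth_max:
  assumes "noeth A" "E0 \<in> \<F>" "\<And>E. E \<in> \<F> \<Longrightarrow> ideal_of A E"
  obtains M where "M \<in> \<F>" "\<And>E. E \<in> \<F> \<Longrightarrow> M \<subseteq> E \<Longrightarrow> E = M"
proof -
  obtain M where M: "M \<in> \<F>" "\<forall>y. (y, M) \<in> {(F, E). ideal_of A E \<and> ideal_of A F \<and> E \<subset> F} \<longrightarrow> y \<notin> \<F>"
    using noeth_wf[OF assms(1), unfolded wf_eq_minimal, THEN spec, THEN spec, THEN mp, OF assms(2)] by (elim bexE)
  have "E = M" if "E \<in> \<F>" "M \<subseteq> E" for E
    using spec[OF M(2), of E] that assms(3)[OF that(1)] assms(3)[OF M(1)] by auto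
  then show thesis using that M(1) by blast
qed

text \<open>Among the ideals generated by lists of elements of \<open>E\<close>, a largest one
  absorbs every further element of \<open>E\<close>.\<close>

lemma noeth_fg:
  assumes "noeth A" "ideal_of A E"
  obtains ys where "set ys \<subseteq> E" "E = gens A {\<zero>} ys"
proof -
  note sA = noeth_subring[OF assms(1)]
  note E = ideal_ofD[OF assms(2)]
  let ?F = "{gens A {\<zero>} ys | ys. set ys \<subseteq> E}"
  have id: "ideal_of A F" if "F \<in> ?F" for F
    using that gens_ideal[OF sA zero_ideal_of[OF sA]] subset_trans[OF _ E(1)] by blast
  have e: "gens A {\<zero>} [] \<in> ?F" by (intro CollectI exI[of _ "[]"]) simp
  obtain M where M: "M \<in> ?F" "\<And>F. F \<in> ?F \<Longrightarrow> M \<subseteq> F \<Longrightarrow> F = M"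
    using noeth_max[OF assms(1) e id] by blast
  obtain ys where ys: "M = gens A {\<zero>} ys" "set ys \<subseteq> E" using M(1) by blast
  have "M = E"
  proof
    show "M \<subseteq> E" using ys(2) gens_subset[OF assms(2), of "{\<zero>}"] E(2) unfolding ys(1) by simp
    show "E \<subseteq> M"
    proof
      fix e assume e: "e \<in> E"
      have eA: "e \<in> A" using e E(1) by blast
      have "gens A {\<zero>} (ys @ [e]) = plus_gen A M e" using ys by (simp add: gens_append)
      moreover have "gens A {\<zero>} (ys @ [e]) \<in> ?F" using ys e by (intro CollectI exI[of _ "ys @ [e]"]) auto
      ultimately have "plus_gen A M e \<in> ?F" by (simp only:)
      then have "plus_gen A M e = M" by (rule M(2)) (rule plus_gen_ideal(2)[OF sA id[OF M(1)] eA])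
      then show "e \<in> M" using plus_gen_ideal(3)[OF sA id[OF M(1)] eA] by simp
    qed
  qed
  from trans[OF sym[OF this] ys(1)] show thesis by (rule that[OF ys(2)])
qed

text \<open>A finite set that generates the union of a chain already lies in one of its members.
  "Generates" is expressed by minimality among ideals containing \<open>F\<close>.\<close>

lemma noethI_fg:
  assumes "subring A K" "\<And>E. ideal_of A E \<Longrightarrow> \<exists>F. finite F \<and> F \<subseteq> E \<and> (\<forall>E'. ideal_of A E' \<and> F \<subseteq> E' \<longrightarrow> E \<subseteq> E')"
  shows "noeth A"
  unfolding noeth_def
proof (intro conjI allI impI assms(1))
  fix E :: "nat \<Rightarrow> 'a set"
  assume E: "(\<forall>n. ideal_of A (E n)) \<and> (\<forall>n. E n \<subseteq> E (Suc n))"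
  have mono: "E n \<subseteq> E m" if "n \<le> m" for n m using lift_Suc_mono_le[of E, OF _ that] E by blast
  obtain F where F: "finite F" "F \<subseteq> (\<Union>n. E n)" "\<And>E'. ideal_of A E' \<Longrightarrow> F \<subseteq> E' \<Longrightarrow> (\<Union>n. E n) \<subseteq> E'"
    using assms(2)[OF Union_chain_ideal[of A E, OF spec[OF conjunct1[OF E]] spec[OF conjunct2[OF E]]]] by meson
  have "\<forall>f\<in>F. \<exists>n. f \<in> E n" using F(2) by blast
  then obtain n where n: "\<And>f. f \<in> F \<Longrightarrow> f \<in> E (n f)" by metis
  define N where "N = Max (insert 0 (n ` F))"
  have "n f \<le> N" if "f \<in> F" for f using that F(1) unfolding N_def by simp
  then have "F \<subseteq> E N" using n mono by blast
  then have "(\<Union>n. E n) \<subseteq> E N" using F(3) E by blast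
  then have "E m = E N" if "m \<ge> N" for m using mono[OF that] by blast
  then show "\<exists>N. \<forall>n\<ge>N. E n = E N" by blast
qed

text \<open>An ideal maximal among those containing \<open>E\<close> and missing the multiplicative
  set \<open>S\<close> is prime: if \<open>a\<close> and \<open>b\<close> are outside it, adjoining
  either one meets \<open>S\<close>, and the product of the two meeting elements would lie in the
  ideal if \<open>a \<otimes> b\<close> did.\<close>

lemma prime_avoiding:
  assumes "noeth A" "ideal_of A E" "E \<inter> S = {}" "S \<subseteq> A" "\<one> \<in> S" "\<And>s t. s \<in> S \<Longrightarrow> t \<in> S \<Longrightarrow> s \<otimes> t \<in> S"
  obtains P where "prime_of A P" "E \<subseteq> P" "P \<inter> S = {}"
proof -
  note sA = noeth_subring[OF assms(1)]
  note A = subringD[OF sA]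
  let ?F = "{F. ideal_of A F \<and> E \<subseteq> F \<and> F \<inter> S = {}}"
  obtain M where M: "M \<in> ?F" "\<And>F. F \<in> ?F \<Longrightarrow> M \<subseteq> F \<Longrightarrow> F = M"
  proof (rule noeth_max[OF assms(1), of E ?F])
    show "E \<in> ?F" using assms(2,3) by simp
  qed auto
  have Mi: "ideal_of A M" using M(1) by blast
  note MM = ideal_ofD[OF Mi]
  have meet: "\<exists>s\<in>S. \<exists>m\<in>M. \<exists>c\<in>A. s = m \<oplus> c \<otimes> a" if "a \<in> A" "a \<notin> M" for a
  proof -
    note p = plus_gen_ideal[OF sA Mi that(1)]
    have "plus_gen A M a \<notin> ?F" using M(2)[OF _ p(2)] p(3) that(2) by metis
    moreover have "E \<subseteq> plus_gen A M a" using p(2) M(1) by blast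
    ultimately have "plus_gen A M a \<inter> S \<noteq> {}" using p(1) by simp
    then show ?thesis unfolding plus_gen_def by blast
  qed
  have "prime_of A M"
    unfolding prime_of_def
  proof (intro conjI Mi ballI impI)
    show "\<one> \<notin> M" using M(1) assms(5) by blast
    fix a b assume ab: "a \<in> A" "b \<in> A" "a \<otimes> b \<in> M"
    show "a \<in> M \<or> b \<in> M"
    proof (rule ccontr)
      assume "\<not> (a \<in> M \<or> b \<in> M)"
      then obtain s m c s' m' c' where *: "s \<in> S" "m \<in> M" "c \<in> A" "s = m \<oplus> c \<otimes> a"
        "s' \<in> S" "m' \<in> M" "c' \<in> A" "s' = m' \<oplus> c' \<otimes> b"
        using meet[OF ab(1)] meet[OF ab(2)] by blast
      have carr: "m \<in> carrier K" "m' \<in> carrier K" "c \<in> carrier K" "c' \<in> carrier K" "a \<in> carrier K" "b \<in> carrier K"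
        using * ab A(4) MM(1) by auto
      have "s \<otimes> s' = s' \<otimes> m \<oplus> ((c \<otimes> a) \<otimes> m' \<oplus> (c \<otimes> c') \<otimes> (a \<otimes> b))"
        unfolding *(4) *(8) using carr by algebra
      moreover have "\<dots> \<in> M" using * ab subsetD[OF assms(4)] by (simp add: A(6) MM(3,4))
      ultimately show False using assms(6)[OF *(1) *(5)] M(1) by auto
    qed
  qed
  then show thesis using that M(1) by blast
qed

section \<open>Adjoining an element\<close>

text \<open>Horner evaluation, constant coefficient first. Lists may end in zeros, so the length is
  only a formal degree plus one.\<close>

fun pev :: "'a list \<Rightarrow> 'a \<Rightarrow> 'a" where
  "pev [] u = \<zero>"
| "pev (c # p) u = c \<oplus> u \<otimes> pev p u"

fun padd :: "'a list \<Rightarrow> 'a list \<Rightarrow> 'a list" where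
  "padd [] q = q"
| "padd p [] = p"
| "padd (a # p) (b # q) = (a \<oplus> b) # padd p q"

lemma pev_carr [simp]: "set p \<subseteq> carrier K \<Longrightarrow> u \<in> carrier K \<Longrightarrow> pev p u \<in> carrier K"
  by (induction p) auto

lemma length_padd [simp]: "length (padd p q) = max (length p) (length q)"
  by (induction p q rule: padd.induct) auto

lemma set_padd:
  assumes "set p \<subseteq> X" "set q \<subseteq> X" "\<And>a b. a \<in> X \<Longrightarrow> b \<in> X \<Longrightarrow> a \<oplus> b \<in> X"
  shows "set (padd p q) \<subseteq> X"
  using assms(1,2) by (induction p q rule: padd.induct) (auto simp: assms(3))

lemma pev_padd:
  assumes "set p \<subseteq> carrier K" "set q \<subseteq> carrier K" "u \<in> carrier K"
  shows "pev (padd p q) u = pev p u \<oplus> pev q u"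
  using assms(1,2)
proof (induction p q rule: padd.induct)
  case (3 a p b q)
  then have "pev (padd p q) u = pev p u \<oplus> pev q u" by simp
  moreover have "a \<in> carrier K" "b \<in> carrier K" "pev p u \<in> carrier K" "pev q u \<in> carrier K" 
    using 3 assms(3) by auto
  ultimately show ?case using assms(3) by (simp add: r_distr a_ac)
qed (use assms(3) in auto)

lemma pev_smult:
  assumes "set p \<subseteq> carrier K" "s \<in> carrier K" "u \<in> carrier K"
  shows "pev (map (\<lambda>c. s \<otimes> c) p) u = s \<otimes> pev p u"
  using assms(1) 
proof (induction p)
  case (Cons a p)
  then have "a \<in> carrier K" "pev p u \<in> carrier K" using assms(3) by auto
  then show ?case using Cons assms by (simp add: r_distr m_lcomm)
qed (use assms in simp)

lemma pev_append:
  assumes "set p \<subseteq> carrier K" "set q \<subseteq> carrier K" "u \<in> carrier K"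
  shows "pev (p @ q) u = pev p u \<oplus> u [^] length p \<otimes> pev q u"
  using assms(1)
proof (induction p)
  case (Cons a p)
  then have c: "a \<in> carrier K" "pev p u \<in> carrier K" "pev q u \<in> carrier K" "u [^] length p \<in> carrier K"
    using assms by auto
  have "pev ((a # p) @ q) u = a \<oplus> u \<otimes> (pev p u \<oplus> u [^] length p \<otimes> pev q u)"
    using Cons by simp
  also have "\<dots> = (a \<oplus> u \<otimes> pev p u) \<oplus> (u [^] length p \<otimes> u) \<otimes> pev q u"
    using c assms(3) by algebra
  finally show ?case by simp
qed (use assms in simp)

lemma pev_replicate_zero: "u \<in> carrier K \<Longrightarrow> pev (replicate n \<zero>) u = \<zero>"
  by (induction n) auto

text \<open>Clearing denominators in \<open>p(1/z)\<close> reverses the coefficients. The extra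
  factor \<open>z\<close> on the right appears because the length exceeds the degree by one.\<close>

lemma pev_rev:
  assumes "set p \<subseteq> carrier K" "z \<in> carrier K" "z \<noteq> \<zero>"
  shows "z [^] length p \<otimes> pev p (inv z) = z \<otimes> pev (rev p) z"
  using assms(1)
proof (induction p)
  case (Cons a p)
  have c: "a \<in> carrier K" "pev p (inv z) \<in> carrier K" "pev (rev p) z \<in> carrier K"
    "z [^] length p \<in> carrier K" "inv z \<in> carrier K"
    using Cons.prems assms(2,3) by auto
  have "z [^] length (a # p) \<otimes> pev (a # p) (inv z)
      = z \<otimes> (z [^] length p \<otimes> a) \<oplus> (z \<otimes> inv z) \<otimes> (z [^] length p \<otimes> pev p (inv z))"
    unfolding pev.simps length_Cons nat_pow_Suc using c assms(2) by algebra
  also have "\<dots> = z \<otimes> (z [^] length p \<otimes> a) \<oplus> z \<otimes> pev (rev p) z"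
    using c assms Cons by simp
  also have "\<dots> = z \<otimes> (pev (rev p) z \<oplus> z [^] length p \<otimes> pev [a] z)"
    using c assms(2) by (simp add: r_distr a_ac)
  also have "\<dots> = z \<otimes> pev (rev (a # p)) z"
    using Cons.prems assms(2) by (simp add: pev_append)
  finally show ?case .
qed (use assms in simp)

definition adj :: "'a set \<Rightarrow> 'a \<Rightarrow> 'a set" where
  "adj A u = {pev p u | p. set p \<subseteq> A}"

lemma pev_in:
  assumes "subring B K" "set p \<subseteq> B" "u \<in> B"
  shows "pev p u \<in> B"
  using assms(2) by (induction p) (auto simp: subringD[OF assms(1)] assms(3))

lemma adj_min: "subring B K \<Longrightarrow> A \<subseteq> B \<Longrightarrow> u \<in> B \<Longrightarrow> adj A u \<subseteq> B"
  unfolding adj_def using pev_in by blast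

lemma adj_facts:
  assumes "subring A K" "u \<in> carrier K"
  shows "subring (adj A u) K" "A \<subseteq> adj A u" "u \<in> adj A u"
proof -
  note A = subringD[OF assms(1)]
  note [simp] = A(2-9)
  have AK: "set p \<subseteq> carrier K" if "set p \<subseteq> A" for p using that A(1) by blast
  have add: "x \<oplus> y \<in> adj A u" if xy: "x \<in> adj A u" "y \<in> adj A u" for x y
  proof -
    obtain p q where pq: "x = pev p u" "y = pev q u" "set p \<subseteq> A" "set q \<subseteq> A" using xy unfolding adj_def by blast
    have "x \<oplus> y = pev (padd p q) u" using pq AK assms(2) by (simp add: pev_padd)
    moreover have "set (padd p q) \<subseteq> A" using set_padd[OF pq(3,4)] by simp
    ultimately show ?thesis unfolding adj_def by blast
  qed
  have smul: "s \<otimes> x \<in> adj A u" if xy: "s \<in> A" "x \<in> adj A u" for s x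
  proof -
    obtain p where p: "x = pev p u" "set p \<subseteq> A" using xy unfolding adj_def by blast
    have "s \<otimes> x = pev (map (\<lambda>c. s \<otimes> c) p) u" using p AK[OF p(2)] assms(2) xy(1) by (simp add: pev_smult)
    moreover have "set (map (\<lambda>c. s \<otimes> c) p) \<subseteq> A" using p(2) xy(1) by auto
    ultimately show ?thesis unfolding adj_def by blast
  qed
  have sub: "adj A u \<subseteq> carrier K" unfolding adj_def using AK assms(2) by auto
  have umul: "u \<otimes> x \<in> adj A u" if xy: "x \<in> adj A u" for x
  proof -
    obtain p where p: "x = pev p u" "set p \<subseteq> A" using xy unfolding adj_def by blast
    have "u \<otimes> x = pev (\<zero> # p) u" using p AK[OF p(2)] assms(2) by simp
    moreover have "set (\<zero> # p) \<subseteq> A" using p(2) by simp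
    ultimately show ?thesis unfolding adj_def by blast
  qed
  show sA: "A \<subseteq> adj A u"
  proof
    fix a assume a: "a \<in> A"
    then have "a = pev [a] u" using assms(2) by simp
    then show "a \<in> adj A u" unfolding adj_def using a by (intro CollectI exI[of _ "[a]"]) auto
  qed
  have o: "\<one> \<in> adj A u" using sA by auto
  then show "u \<in> adj A u" using umul[of \<one>] assms(2) by simp
  have mul: "pev p u \<otimes> y \<in> adj A u" if "set p \<subseteq> A" "y \<in> adj A u" for p y
    using that(1)
  proof (induction p)
    case Nil
    have "\<zero> \<otimes> y = \<zero>" using that(2) sub by auto
    then show ?case using sA by auto
  next
    case (Cons a p)
    have c: "a \<in> carrier K" "pev p u \<in> carrier K" "y \<in> carrier K"
      using Cons.prems AK that(2) sub assms(2) by auto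
    have "pev (a # p) u \<otimes> y = a \<otimes> y \<oplus> u \<otimes> (pev p u \<otimes> y)"
      using c assms(2) by (simp add: l_distr m_assoc)
    then show ?case using Cons add smul umul that(2) by simp
  qed
  show "subring (adj A u) K"
  proof (rule subringI[OF sub o])
    fix h assume h: "h \<in> adj A u"
    then have "\<ominus> h = (\<ominus> \<one>) \<otimes> h" using sub by (auto simp: l_minus)
    then show "\<ominus> h \<in> adj A u" using smul[OF _ h] by simp
  next
    fix h1 h2 assume "h1 \<in> adj A u" "h2 \<in> adj A u"
    then show "h1 \<otimes> h2 \<in> adj A u" "h1 \<oplus> h2 \<in> adj A u" using mul add unfolding adj_def by auto
  qed
qed

lemma pev_snoc:
  assumes "set p \<subseteq> carrier K" "c \<in> carrier K" "u \<in> carrier K"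
  shows "pev (p @ [c]) u = pev p u \<oplus> u [^] length p \<otimes> c"
  using pev_append[of p "[c]" u] assms by simp

theorem hilbert_basis:
  assumes "noeth A" "u \<in> carrier K"
  shows "noeth (adj A u)"
proof -
  note sA = noeth_subring[OF assms(1)]
  note A = subringD[OF sA]
  note B = adj_facts[OF sA assms(2)]
  note BB = subringD[OF B(1)]
  have AK: "set p \<subseteq> carrier K" if "set p \<subseteq> A" for p using that A(1) by blast
  \<comment> \<open>The coefficients of \<open>u^n\<close> in expressions of formal degree
    \<open>n\<close> whose value lies in \<open>E\<close>. When \<open>u\<close> is algebraic over
    \<open>A\<close> a value has many expressions, but the argument only asks for one of
    them.\<close>
  define L where "L n E = {c \<in> A. \<exists>p. length p = n \<and> set p \<subseteq> A \<and> pev (p @ [c]) u \<in> E}" for n E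
  have Lid: "ideal_of A (L n E)" if E: "ideal_of (adj A u) E" for n E
  proof (rule ideal_ofI)
    show "L n E \<subseteq> A" unfolding L_def by blast
    have "pev (replicate n \<zero> @ [\<zero>]) u = \<zero>" using pev_replicate_zero[OF assms(2), of "Suc n"] 
      by (simp add: replicate_append_same)
    then show "\<zero> \<in> L n E" unfolding L_def using ideal_ofD(2)[OF E] A(2) 
      by (intro CollectI conjI exI[of _ "replicate n \<zero>"]) auto
    fix a b assume "a \<in> L n E" "b \<in> L n E"
    then obtain p q where pq: "a \<in> A" "b \<in> A" "length p = n" "length q = n" "set p \<subseteq> A" "set q \<subseteq> A"
      "pev (p @ [a]) u \<in> E" "pev (q @ [b]) u \<in> E" unfolding L_def by blast
    have c: "a \<in> carrier K" "b \<in> carrier K" "pev p u \<in> carrier K" "pev q u \<in> carrier K" "u [^] n \<in> carrier K"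
      using pq AK A(4) assms(2) by auto
    have "pev (padd p q @ [a \<oplus> b]) u = pev (padd p q) u \<oplus> u [^] n \<otimes> (a \<oplus> b)"
      using pq c AK[OF set_padd[OF pq(5,6) A(7)]] assms(2) by (simp add: pev_snoc)
    also have "\<dots> = (pev p u \<oplus> pev q u) \<oplus> u [^] n \<otimes> (a \<oplus> b)"
      using pq AK assms(2) by (simp add: pev_padd)
    also have "\<dots> = (pev p u \<oplus> u [^] n \<otimes> a) \<oplus> (pev q u \<oplus> u [^] n \<otimes> b)"
      using c by algebra
    also have "\<dots> = pev (p @ [a]) u \<oplus> pev (q @ [b]) u"
      using pq c AK assms(2) by (simp add: pev_snoc)
    finally have "pev (padd p q @ [a \<oplus> b]) u \<in> E" using ideal_ofD(3)[OF E] pq by simp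
    then show "a \<oplus> b \<in> L n E" unfolding L_def using A(7) pq set_padd[OF pq(5,6) A(7)]
      by (intro CollectI conjI exI[of _ "padd p q"]) auto
  next
    fix s a assume s: "s \<in> A" and "a \<in> L n E"
    then obtain p where p: "a \<in> A" "length p = n" "set p \<subseteq> A" "pev (p @ [a]) u \<in> E" unfolding L_def by blast
    have "set (p @ [a]) \<subseteq> carrier K" using p AK A(4) by auto
    then have "pev (map (\<lambda>c. s \<otimes> c) p @ [s \<otimes> a]) u = s \<otimes> pev (p @ [a]) u"
      using pev_smult[of "p @ [a]" s u] A(4)[OF s] assms(2) by simp
    moreover have "\<dots> \<in> E" using ideal_ofD(4)[OF E] p(4) s B(2) by blast
    ultimately show "s \<otimes> a \<in> L n E" unfolding L_def using A(6) s p
      by (intro CollectI conjI exI[of _ "map (\<lambda>c. s \<otimes> c) p"]) auto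
  qed
  have LSuc: "L n E \<subseteq> L (Suc n) E" if E: "ideal_of (adj A u) E" for n E
  proof
    fix a assume "a \<in> L n E"
    then obtain p where p: "a \<in> A" "length p = n" "set p \<subseteq> A" "pev (p @ [a]) u \<in> E" unfolding L_def by blast
    have "pev ((\<zero> # p) @ [a]) u = u \<otimes> pev (p @ [a]) u" using p AK A(4) assms(2) by simp
    moreover have "\<dots> \<in> E" using ideal_ofD(4)[OF E B(3) p(4)] .
    ultimately show "a \<in> L (Suc n) E" unfolding L_def using p A(2)
      by (intro CollectI conjI exI[of _ "\<zero> # p"]) auto
  qed
  have Lmono: "L n E \<subseteq> L n E'" if "E \<subseteq> E'" for n E E' using that unfolding L_def by blast
  \<comment> \<open>Leading coefficients detect equality of nested ideals: from an element of the
    larger one subtract an element of the smaller one with the same top term, and induct on the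
    formal degree.\<close>
  have Leq: "E' \<subseteq> E" if E: "ideal_of (adj A u) E" "ideal_of (adj A u) E'" "E \<subseteq> E'" "\<And>n. L n E = L n E'" for E E'
  proof
    fix w assume w: "w \<in> E'"
    then obtain p where p: "w = pev p u" "set p \<subseteq> A" using ideal_ofD(1)[OF E(2)] unfolding adj_def by blast
    show "w \<in> E" using w p
    proof (induction "length p" arbitrary: p w)
      case 0
      then show ?case using ideal_ofD(2)[OF E(1)] by simp
    next
      case (Suc n)
      then obtain p' c where p': "p = p' @ [c]" "length p' = n" by (metis length_Suc_conv_rev)
      have "c \<in> L n E'" unfolding L_def using p' Suc.prems by auto
      then have "c \<in> L n E" using E(4) by blast
      then obtain q where q: "length q = n" "set q \<subseteq> A" "pev (q @ [c]) u \<in> E" "c \<in> A" unfolding L_def by blast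
      have p'A: "set p' \<subseteq> A" using p' Suc.prems by auto
      let ?q = "map (\<lambda>c. \<ominus> \<one> \<otimes> c) q"
      have m1: "\<ominus> \<one> \<in> A" using A by simp
      have sq: "set ?q \<subseteq> A" using q(2) m1 A(6) by auto
      have c: "c \<in> carrier K" "pev p' u \<in> carrier K" "pev q u \<in> carrier K" "u [^] n \<in> carrier K"
        using q p'A AK A(4) assms(2) by auto
      have "pev (padd p' ?q) u = pev p' u \<oplus> (\<ominus> \<one>) \<otimes> pev q u"
        using pev_padd[OF AK[OF p'A] AK[OF sq] assms(2)] pev_smult[OF AK[OF q(2)] A(4)[OF m1] assms(2)] by simp
      also have "\<dots> = (pev p' u \<oplus> u [^] n \<otimes> c) \<ominus> (pev q u \<oplus> u [^] n \<otimes> c)"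
        using c by algebra
      also have "\<dots> = w \<ominus> pev (q @ [c]) u"
        using p' p'A q AK c assms(2) Suc.prems by (simp add: pev_snoc)
      finally have eq: "pev (padd p' ?q) u = w \<ominus> pev (q @ [c]) u" .
      have "w \<ominus> pev (q @ [c]) u \<in> E'" using ideal_of_minus(2)[OF B(1) E(2)] Suc.prems(1) q(3) E(3) by blast
      then have "w \<ominus> pev (q @ [c]) u \<in> E"
        using Suc.hyps(1)[of "padd p' ?q"] eq set_padd[OF p'A sq A(7)] p'(2) q(1) by simp
      then have "(w \<ominus> pev (q @ [c]) u) \<oplus> pev (q @ [c]) u \<in> E" using ideal_ofD(3)[OF E(1)] q(3) by blast
      moreover have "w \<in> carrier K" "pev (q @ [c]) u \<in> carrier K"
        using Suc.prems(1) q(3) ideal_ofD(1)[OF E(1)] ideal_ofD(1)[OF E(2)] BB(1) by blast+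
      then have "(w \<ominus> pev (q @ [c]) u) \<oplus> pev (q @ [c]) u = w" by algebra
      ultimately show ?case by simp
    qed
  qed
  show ?thesis
    unfolding noeth_def
  proof (intro conjI allI impI B(1))
    fix E :: "nat \<Rightarrow> 'a set"
    assume "(\<forall>n. ideal_of (adj A u) (E n)) \<and> (\<forall>n. E n \<subseteq> E (Suc n))"
    then have E: "\<And>n. ideal_of (adj A u) (E n)" "\<And>n. E n \<subseteq> E (Suc n)" by blast+
    have Em: "E n \<subseteq> E m" if "n \<le> m" for n m by (rule lift_Suc_mono_le[of E, OF E(2) that])
    have Lm: "L n (E k) \<subseteq> L m (E l)" if nm: "n \<le> m" "k \<le> l" for n m k l
    proof -
      have "L n (E k) \<subseteq> L m (E k)" 
        by (rule lift_Suc_mono_le[of "\<lambda>n. L n (E k)", OF LSuc[OF E(1)] nm(1)])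
      also have "\<dots> \<subseteq> L m (E l)" by (rule Lmono[OF Em[OF nm(2)]])
      finally show ?thesis .
    qed
    \<comment> \<open>The diagonal chain takes care of all degrees from \<open>N\<close> on at once.
      The finitely many degrees up to \<open>N\<close> become stationary separately, and
      \<open>T\<close> is a common bound.\<close>
    obtain N where N: "\<And>n. n \<ge> N \<Longrightarrow> L n (E n) = L N (E N)"
    proof (rule noethD[OF assms(1), of "\<lambda>n. L n (E n)"])
      show "\<And>n. L n (E n) \<subseteq> L (Suc n) (E (Suc n))" using Lm by simp
    qed (use Lid[OF E(1)] in auto)
    have "\<exists>M. \<forall>k\<ge>M. L n (E k) = L n (E M)" for n
    proof (rule noethD[OF assms(1), of "\<lambda>k. L n (E k)"])
      show "\<And>k. L n (E k) \<subseteq> L n (E (Suc k))" using Lm by simp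
    qed (use Lid[OF E(1)] in auto)
    then obtain M where M: "\<And>n k. k \<ge> M n \<Longrightarrow> L n (E k) = L n (E (M n))" by metis
    define T where "T = Max (insert N (M ` {..N}))"
    have T: "N \<le> T" "\<And>n. n \<le> N \<Longrightarrow> M n \<le> T" unfolding T_def by (rule Max_ge, simp, simp)+
    have "E k = E T" if k: "k \<ge> T" for k
    proof
      show "E T \<subseteq> E k" using Em k by blast
      show "E k \<subseteq> E T"
      proof (rule Leq[OF E(1) E(1) Em[OF k]])
        fix n
        show "L n (E T) = L n (E k)"
        proof (cases "n \<le> N")
          case True
          have "L n (E T) = L n (E (M n))" using M T(2)[OF True] by blast
          moreover have "L n (E k) = L n (E (M n))" using M order_trans[OF T(2)[OF True] k] by blast
          ultimately show ?thesis by simp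
        next
          case False
          have "L N (E N) \<subseteq> L n (E T)" using Lm[of N n N T] False T(1) by simp
          moreover have "L n (E T) \<subseteq> L n (E k)" using Lm[of n n T k] k by simp
          moreover have "L n (E k) \<subseteq> L (max n k) (E (max n k))" by (rule Lm) simp_all
          moreover have "L (max n k) (E (max n k)) = L N (E N)" using N[of "max n k"] False by simp
          ultimately show ?thesis by simp
        qed
      qed
    qed
    then show "\<exists>N. \<forall>n\<ge>N. E n = E N" by blast
  qed
qed

fun adjs :: "'a set \<Rightarrow> 'a list \<Rightarrow> 'a set" where
  "adjs A [] = A"
| "adjs A (u # us) = adjs (adj A u) us"

lemma adjs_facts:
  assumes "subring A K" "set us \<subseteq> carrier K"
  shows "subring (adjs A us) K \<and> A \<subseteq> adjs A us \<and> set us \<subseteq> adjs A us"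
  using assms
proof (induction us arbitrary: A)
  case (Cons u us)
  have "subring (adj A u) K" "A \<subseteq> adj A u" "u \<in> adj A u" using adj_facts Cons.prems by auto
  then show ?case using Cons.IH[of "adj A u"] Cons.prems by auto
qed auto

lemma adjs_min: "subring B K \<Longrightarrow> A \<subseteq> B \<Longrightarrow> set us \<subseteq> B \<Longrightarrow> adjs A us \<subseteq> B"
proof (induction us arbitrary: A)
  case (Cons u us)
  then have "adj A u \<subseteq> B" using adj_min by auto
  then show ?case using Cons by auto
qed auto

lemma noeth_adjs: "noeth A \<Longrightarrow> set us \<subseteq> carrier K \<Longrightarrow> noeth (adjs A us)"
  by (induction us arbitrary: A) (auto simp: hilbert_basis)

section \<open>Localization\<close>

definition lcl :: "'a set \<Rightarrow> 'a set \<Rightarrow> 'a set" where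
  "lcl A P = {a \<otimes> inv s | a s. a \<in> A \<and> s \<in> A - P}"

lemma lcl_localization: "lcl A P = localization_in K A P"
  unfolding lcl_def localization_in_def by blast

lemma lclI: "a \<in> A \<Longrightarrow> s \<in> A \<Longrightarrow> s \<notin> P \<Longrightarrow> a \<otimes> inv s \<in> lcl A P"
  unfolding lcl_def by blast

lemma lcl_facts:
  assumes "subring A K" "prime_of A P"
  shows "subring (lcl A P) K" "A \<subseteq> lcl A P" "\<And>s. s \<in> A \<Longrightarrow> s \<notin> P \<Longrightarrow> inv s \<in> lcl A P \<and> s \<noteq> \<zero>"
proof -
  note A = subringD[OF assms(1)] and P = prime_ofD[OF assms(2)]
  have nz: "s \<noteq> \<zero>" if "s \<in> A" "s \<notin> P" for s using that P(5) by blast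
  show incl: "A \<subseteq> lcl A P"
  proof
    fix a assume "a \<in> A"
    then have "a = a \<otimes> inv \<one>" using A(4) by simp
    then show "a \<in> lcl A P" using lclI[of a A \<one> P] \<open>a \<in> A\<close> A(3) P(2) by metis
  qed
  show "\<And>s. s \<in> A \<Longrightarrow> s \<notin> P \<Longrightarrow> inv s \<in> lcl A P \<and> s \<noteq> \<zero>"
    using lclI[of \<one> A _ P] A(3,4) nz by (metis inv_carr l_one)
  have sP: "s \<otimes> t \<in> A" "s \<otimes> t \<notin> P" if "s \<in> A" "s \<notin> P" "t \<in> A" "t \<notin> P" for s t
    using that A(6) P(3) by blast+
  show "subring (lcl A P) K"
  proof (rule subringI)
    show "lcl A P \<subseteq> carrier K" unfolding lcl_def using A(4) nz by auto
    show "\<one> \<in> lcl A P" using incl A(3) by blast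
    fix h assume "h \<in> lcl A P"
    then obtain a s where *: "h = a \<otimes> inv s" "a \<in> A" "s \<in> A" "s \<notin> P" unfolding lcl_def by blast
    have "\<ominus> h = (\<ominus> a) \<otimes> inv s" using * A(4) nz by (simp add: l_minus)
    then show "\<ominus> h \<in> lcl A P" using lclI A(5) * by simp
    fix h' assume "h' \<in> lcl A P"
    then obtain a' s' where **: "h' = a' \<otimes> inv s'" "a' \<in> A" "s' \<in> A" "s' \<notin> P" unfolding lcl_def by blast
    have "h \<otimes> h' = (a \<otimes> a') \<otimes> inv (s \<otimes> s')" using * ** A(4) nz by (simp add: div_mult)
    then show "h \<otimes> h' \<in> lcl A P" using lclI A(6) sP * ** by simp
    have "h \<oplus> h' = (a \<otimes> s' \<oplus> a' \<otimes> s) \<otimes> inv (s \<otimes> s')" using * ** A(4) nz by (simp add: div_add)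
    then show "h \<oplus> h' \<in> lcl A P" using lclI A(6,7) sP * ** by simp
  qed
qed

lemma lcl_clear:
  assumes "subring A K" "prime_of A P" "z \<in> lcl A P"
  obtains s where "s \<in> A" "s \<notin> P" "s \<otimes> z \<in> A"
proof -
  note A = subringD[OF assms(1)] and P = prime_ofD[OF assms(2)]
  obtain a s where *: "z = a \<otimes> inv s" "a \<in> A" "s \<in> A" "s \<notin> P" using assms(3) unfolding lcl_def by blast
  then have "s \<noteq> \<zero>" using P(5) by blast
  then have "s \<otimes> z = a" using * A(4) by simp
  then show thesis using that * by blast
qed

text \<open>An ideal of the localization is determined by its contraction to \<open>A\<close>, since
  denominators can be cleared and are units.\<close>

lemma noeth_lcl:
  assumes "noeth A" "prime_of A P"
  shows "noeth (lcl A P)"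
proof -
  note sA = noeth_subring[OF assms(1)]
  note A = subringD[OF sA] and P = prime_ofD[OF assms(2)] and L = lcl_facts[OF sA assms(2)]
  note LL = subringD[OF L(1)]
  show ?thesis
    unfolding noeth_def
  proof (intro conjI allI impI L(1))
    fix E :: "nat \<Rightarrow> 'a set"
    assume "(\<forall>n. ideal_of (lcl A P) (E n)) \<and> (\<forall>n. E n \<subseteq> E (Suc n))"
    then have E: "\<And>n. ideal_of (lcl A P) (E n)" "\<And>n. E n \<subseteq> E (Suc n)" by blast+
    have Em: "E n \<subseteq> E m" if "n \<le> m" for n m by (rule lift_Suc_mono_le[of E, OF E(2) that])
    have id: "ideal_of A (E n \<inter> A)" for n
      using subsetD[OF L(2)] by (intro ideal_ofI) (auto simp: ideal_ofD(2-4)[OF E(1)] A(2,6,7))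
    have inc: "E n \<inter> A \<subseteq> E (Suc n) \<inter> A" for n using E(2)[of n] by (rule Int_mono) simp
    obtain N where N: "\<And>n. n \<ge> N \<Longrightarrow> E n \<inter> A = E N \<inter> A"
      using noethD[of A "\<lambda>n. E n \<inter> A", OF assms(1) id inc] by blast
    have "E n = E N" if n: "n \<ge> N" for n
    proof
      show "E N \<subseteq> E n" by (rule Em[OF n])
      show "E n \<subseteq> E N"
      proof
        fix z assume z: "z \<in> E n"
        then have zL: "z \<in> lcl A P" using ideal_ofD(1)[OF E(1)] by blast
        obtain s where s: "s \<in> A" "s \<notin> P" "s \<otimes> z \<in> A" by (rule lcl_clear[OF sA assms(2) zL])
        have "s \<otimes> z \<in> E n" using ideal_ofD(4)[OF E(1) _ z] s(1) L(2) by blast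
        then have "s \<otimes> z \<in> E N" using N[OF n] s(3) by blast
        then have "inv s \<otimes> (s \<otimes> z) \<in> E N" using ideal_ofD(4)[OF E(1)] L(3)[OF s(1,2)] by blast
        then show "z \<in> E N" using A(4)[OF s(1)] L(3)[OF s(1,2)] LL(4)[OF zL] by simp
      qed
    qed
    then show "\<exists>N. \<forall>n\<ge>N. E n = E N" by blast
  qed
qed

section \<open>Valuation rings\<close>

definition vring :: "'a set \<Rightarrow> bool" where
  "vring V \<longleftrightarrow> subring V K \<and> (\<forall>z\<in>carrier K. z \<noteq> \<zero> \<longrightarrow> z \<in> V \<or> inv z \<in> V)"

text \<open>The maximal ideal of a valuation ring. Zero is listed separately because its inverse is
  unspecified.\<close>

definition nonunits :: "'a set \<Rightarrow> 'a set" where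
  "nonunits V = {z \<in> V. z = \<zero> \<or> inv z \<notin> V}"

section \<open>Chevalley's extension theorem\<close>

lemma ideal_prod_carr:
  assumes "C \<subseteq> carrier K" "E \<subseteq> carrier K"
  shows "ideal_prod K C E \<subseteq> carrier K"
proof
  fix w assume "w \<in> ideal_prod K C E" then show "w \<in> carrier K"
    by (induction rule: ideal_prod.induct) (use assms in auto)
qed

lemma ideal_prod_ideal:
  assumes "subring A K" "ideal_of A C" "E \<subseteq> A" "E \<noteq> {}"
  shows "ideal_of A (ideal_prod K C E)"
proof (rule ideal_ofI)
  note A = subringD[OF assms(1)] and C = ideal_ofD[OF assms(2)]
  have EK: "e \<in> carrier K" if "e \<in> E" for e using that assms(3) A(1) by blast
  have CK: "e \<in> carrier K" if "e \<in> C" for e using that C(1) A(1) by blast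
  show sub: "ideal_prod K C E \<subseteq> A"
  proof
    fix w assume "w \<in> ideal_prod K C E" then show "w \<in> A"
      by (induction rule: ideal_prod.induct) (use assms(3) C(1) in \<open>auto simp: A(6,7) subset_iff\<close>)
  qed
  obtain e where e: "e \<in> E" using assms(4) by blast
  have "\<zero> \<otimes> e \<in> ideal_prod K C E" using C(2) e by (rule ideal_prod.prod)
  then show "\<zero> \<in> ideal_prod K C E" using EK[OF e] by simp
  show "\<And>a b. a \<in> ideal_prod K C E \<Longrightarrow> b \<in> ideal_prod K C E \<Longrightarrow> a \<oplus> b \<in> ideal_prod K C E"
    by (rule ideal_prod.sum)
  fix s a assume s: "s \<in> A" and a: "a \<in> ideal_prod K C E"
  show "s \<otimes> a \<in> ideal_prod K C E" using a
  proof (induction rule: ideal_prod.induct)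
    case (prod i j)
    then have "s \<otimes> (i \<otimes> j) = (s \<otimes> i) \<otimes> j" using A(4)[OF s] CK EK by (simp add: m_assoc)
    moreover have "(s \<otimes> i) \<otimes> j \<in> ideal_prod K C E" using C(4)[OF s] prod by (intro ideal_prod.prod) auto
    ultimately show ?case by simp
  next
    case (sum s1 s2)
    then have "s1 \<in> carrier K" "s2 \<in> carrier K" using sub A(1) by blast+
    then show ?case using sum A(4)[OF s] by (simp add: r_distr ideal_prod.sum)
  qed
qed

lemma ideal_prod_mono: "C \<subseteq> D \<Longrightarrow> ideal_prod K C E \<subseteq> ideal_prod K D E"
proof
  fix w assume cd: "C \<subseteq> D" and "w \<in> ideal_prod K C E"
  from this(2) show "w \<in> ideal_prod K D E"
    by (induction rule: ideal_prod.induct) (use cd in \<open>auto intro: ideal_prod.intros\<close>)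
qed

text \<open>Applied to \<open>\<one>\<close>, this turns the statement that \<open>E\<close>
  generates the unit ideal of \<open>C[y]\<close> into a polynomial relation for \<open>y\<close>
  with coefficients in the ideal generated by \<open>E\<close> in \<open>C\<close>.\<close>

lemma ideal_prod_adj:
  assumes "subring C K" "E \<subseteq> C" "E \<noteq> {}" "y \<in> carrier K" "w \<in> ideal_prod K (adj C y) E"
  obtains p where "set p \<subseteq> ideal_prod K C E" "w = pev p y"
proof -
  note C = subringD[OF assms(1)]
  have J: "ideal_of C (ideal_prod K C E)" using ideal_prod_ideal[OF assms(1) self_ideal_of[OF assms(1)] assms(2,3)] .
  have "\<exists>p. set p \<subseteq> ideal_prod K C E \<and> w = pev p y" using assms(5)
  proof (induction rule: ideal_prod.induct)
    case (prod i j)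
    then obtain p where p: "i = pev p y" "set p \<subseteq> C" unfolding adj_def by blast
    have jK: "j \<in> carrier K" using prod(2) assms(2) C(1) by blast
    have pK: "set p \<subseteq> carrier K" using p(2) C(1) by blast
    have "i \<otimes> j = pev (map (\<lambda>c. j \<otimes> c) p) y"
      using pev_smult[OF pK jK assms(4)] p(1) jK pK assms(4) by (simp add: m_comm)
    moreover have "set (map (\<lambda>c. j \<otimes> c) p) \<subseteq> ideal_prod K C E"
    proof
      fix x assume "x \<in> set (map (\<lambda>c. j \<otimes> c) p)"
      then obtain c where c: "c \<in> C" "x = j \<otimes> c" using p(2) by auto
      then have "x = c \<otimes> j" using jK C(4) by (simp add: m_comm)
      then show "x \<in> ideal_prod K C E" using ideal_prod.prod[OF c(1) prod(2)] by simp
    qed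
    ultimately show ?case by blast
  next
    case (sum s1 s2)
    then obtain p q where pq: "set p \<subseteq> ideal_prod K C E" "s1 = pev p y" "set q \<subseteq> ideal_prod K C E" "s2 = pev q y" by blast
    have K: "ideal_prod K C E \<subseteq> carrier K" using ideal_ofD(1)[OF J] C(1) by blast
    have "s1 \<oplus> s2 = pev (padd p q) y" using pev_padd[OF subset_trans[OF pq(1) K] subset_trans[OF pq(3) K] assms(4)] pq by simp
    moreover have "set (padd p q) \<subseteq> ideal_prod K C E" by (rule set_padd[OF pq(1,3) ideal_prod.sum])
    ultimately show ?case by blast
  qed
  then show thesis using that by blast
qed

text \<open>One step of the descent showing that a subring maximal among those in which the given ideal
  stays proper contains \<open>z\<close> or \<open>inv z\<close>: the relation for \<open>inv z\<close>, whose constant term is a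
  non-unit, lowers the degree of the relation for \<open>z\<close>.\<close>

lemma relation_descent:
  assumes C: "subring C K" and J: "ideal_of C J" and un: "\<And>j. j \<in> J \<Longrightarrow> \<one> \<ominus> j \<noteq> \<zero> \<and> inv (\<one> \<ominus> j) \<in> C"
    and z: "z \<in> carrier K" "z \<noteq> \<zero>"
    and p: "set p \<subseteq> J" "pev p z = \<one>" and q: "set q \<subseteq> J" "pev q (inv z) = \<one>" "length q \<le> length p"
  shows "\<exists>p'. length p' < length p \<and> set p' \<subseteq> J \<and> pev p' z = \<one>"
proof -
  note CC = subringD[OF C] and JJ = ideal_ofD[OF J]
  have JK: "J \<subseteq> carrier K" using JJ(1) CC(1) by blast
  obtain q0 q1 where q01: "q = q0 # q1" using q(2) by (cases q) auto
  obtain p1 c where p1: "p = p1 @ [c]" using q(3) q01 by (cases p rule: rev_cases) auto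
  let ?k = "length q1" and ?n = "length p1"
  have kn: "?k \<le> ?n" using q(3) q01 p1 by simp
  define t where "t = \<one> \<ominus> q0"
  have q0: "q0 \<in> J" "set q1 \<subseteq> J" using q(1) q01 by auto
  have t: "t \<noteq> \<zero>" "inv t \<in> C" using un[OF q0(1)] unfolding t_def by auto
  have q1K: "set q1 \<subseteq> carrier K" "q0 \<in> carrier K" using q0 JK by auto
  then have tK: "t \<in> carrier K" unfolding t_def by simp
  have vK: "inv z \<in> carrier K" using z by simp
  have c: "pev q1 (inv z) \<in> carrier K" using q1K vK by simp
  have rK: "pev (rev q1) z \<in> carrier K" using q1K z by simp
  have "q0 \<oplus> inv z \<otimes> pev q1 (inv z) = \<one>" using q(2) q01 by simp
  then have "t = inv z \<otimes> pev q1 (inv z)" unfolding t_def using q1K vK c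
    by (metis a_minus_def add.inv_solve_right' m_closed one_closed a_comm minus_eq)
  then have "z \<otimes> t = pev q1 (inv z)" using z c by simp
  then have "z [^] ?k \<otimes> (z \<otimes> t) = z \<otimes> pev (rev q1) z" using pev_rev[OF q1K(1) z] by simp
  then have "z \<otimes> (z [^] ?k \<otimes> t) = z \<otimes> pev (rev q1) z" using z tK by (simp add: m_lcomm)
  then have zt: "z [^] ?k \<otimes> t = pev (rev q1) z" using m_lcancel[OF z(2)] z(1) tK rK by simp
  \<comment> \<open>With \<open>t\<close> a unit, \<open>z^k\<close> is a polynomial in
    \<open>z\<close> of degree below \<open>k\<close> with coefficients in \<open>J\<close>. As
    \<open>k\<close> is at most \<open>n\<close>, the top term \<open>c z^n\<close> of the relation
    for \<open>z\<close> can be rewritten in lower degree; \<open>r\<close> lists the result, padded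
    with zeros to length \<open>n\<close>.\<close>
  have zk: "z [^] ?k = inv t \<otimes> pev (rev q1) z"
    unfolding zt[symmetric] using z(1) tK t(1) by simp
  have cJ: "c \<in> J" "set p1 \<subseteq> J" using p(1) p1 by auto
  have cK: "c \<in> carrier K" "set p1 \<subseteq> carrier K" using cJ JK by auto
  define s where "s = c \<otimes> inv t"
  have sK: "s \<in> carrier K" unfolding s_def using cK tK t by simp
  define r where "r = replicate (?n - ?k) \<zero> @ map (\<lambda>x. s \<otimes> x) (rev q1)"
  have lr: "length r = ?n" unfolding r_def using kn by simp
  have sC: "s \<in> C" unfolding s_def using cJ JJ(1) t(2) CC(6) by blast
  have rJ: "set r \<subseteq> J" unfolding r_def using JJ(2) q0(2) JJ(4)[OF sC] by (auto simp: set_replicate_conv_if)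
  have "pev r z = z [^] (?n - ?k) \<otimes> (s \<otimes> pev (rev q1) z)"
  proof -
    have "set (replicate (?n - ?k) \<zero>) \<subseteq> carrier K" "set (map (\<lambda>x. s \<otimes> x) (rev q1)) \<subseteq> carrier K"
      using q1K(1) sK by (auto simp: set_replicate_conv_if)
    from pev_append[OF this z(1)] show ?thesis
      unfolding r_def using pev_smult[of "rev q1" s z] q1K sK z rK by (simp add: pev_replicate_zero)
  qed
  also have "\<dots> = z [^] (?n - ?k) \<otimes> (c \<otimes> z [^] ?k)"
    unfolding zk s_def using cK tK t rK by (simp add: m_assoc)
  also have "\<dots> = (z [^] (?n - ?k) \<otimes> z [^] ?k) \<otimes> c" using z cK by (simp add: m_ac)
  also have "\<dots> = z [^] ?n \<otimes> c" using z kn by (simp add: nat_pow_mult)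
  finally have pr: "pev r z = z [^] ?n \<otimes> c" .
  have "pev (padd p1 r) z = \<one>"
    using pev_padd[OF cK(2) subset_trans[OF rJ JK] z(1)] pr pev_snoc[OF cK(2,1) z(1)] p(2) p1 by simp
  moreover have "length (padd p1 r) < length p" using lr p1 by simp
  moreover have "set (padd p1 r) \<subseteq> J" by (rule set_padd[OF cJ(2) rJ JJ(3)])
  ultimately show ?thesis by blast
qed

text \<open>Infinite descent on the total length. Whichever relation is the longer one is shortened,
  \<open>z\<close> and \<open>inv z\<close> exchanging roles when necessary.\<close>

lemma no_relations:
  assumes C: "subring C K" and J: "ideal_of C J" and un: "\<And>j. j \<in> J \<Longrightarrow> \<one> \<ominus> j \<noteq> \<zero> \<and> inv (\<one> \<ominus> j) \<in> C"
    and z: "z \<in> carrier K" "z \<noteq> \<zero>"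
  shows "set p \<subseteq> J \<Longrightarrow> pev p z = \<one> \<Longrightarrow> set q \<subseteq> J \<Longrightarrow> pev q (inv z) = \<one> \<Longrightarrow> False"
proof (induction "length p + length q" arbitrary: p q rule: less_induct)
  case less
  show False
  proof (cases "length q \<le> length p")
    case True
    then obtain p' where p': "length p' < length p" "set p' \<subseteq> J" "pev p' z = \<one>"
      using relation_descent[OF C J un z less.prems(1,2,3,4)] by blast
    then show False using less.hyps[of p' q] less.prems(3,4) by simp
  next
    case False
    then obtain q' where q': "length q' < length q" "set q' \<subseteq> J" "pev q' (inv z) = \<one>"
      using relation_descent[OF C J un, of "inv z" q p] z less.prems by auto
    then show False using less.hyps[of p q'] less.prems(1,2) by simp
  qed
qed

text \<open>Zorn's lemma gives a subring \<open>C\<close> that is maximal among those in which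
  \<open>E\<close> generates a proper ideal \<open>J\<close>. Every element outside \<open>C\<close>
  then satisfies a relation \<open>p(y) = 1\<close> with coefficients in \<open>J\<close>, and such
  relations cannot hold for both \<open>z\<close> and \<open>inv z\<close>.\<close>

theorem chevalley:
  assumes "subring A K" "ideal_of A E" "\<one> \<notin> E"
  obtains V where "vring V" "A \<subseteq> V" "E \<subseteq> nonunits V"
proof -
  note A = subringD[OF assms(1)] and E = ideal_ofD[OF assms(2)]
  have EK: "E \<subseteq> carrier K" using E(1) A(1) by blast
  have Ene: "E \<noteq> {}" using E(2) by blast
  define CC where "CC = {C. subring C K \<and> A \<subseteq> C \<and> \<one> \<notin> ideal_prod K C E}"
  have "ideal_prod K A E \<subseteq> E"
  proof
    fix w assume "w \<in> ideal_prod K A E" then show "w \<in> E"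
      by (induction rule: ideal_prod.induct) (auto simp: E(3,4))
  qed
  then have "A \<in> CC" unfolding CC_def using assms(1,3) by blast
  then have "CC \<noteq> {}" by blast
  moreover have "\<Union>\<D> \<in> CC" if D: "\<D> \<noteq> {}" "subset.chain CC \<D>" for \<D>
  proof -
    have sub: "D \<in> \<D> \<Longrightarrow> D \<in> CC" for D using D(2) unfolding subset.chain_def by blast
    have lin: "D \<subseteq> D' \<or> D' \<subseteq> D" if "D \<in> \<D>" "D' \<in> \<D>" for D D' using D(2) that unfolding subset.chain_def by blast
    have sr: "D \<in> \<D> \<Longrightarrow> subring D K" for D using sub unfolding CC_def by blast
    have common: "\<exists>D\<in>\<D>. a \<in> D \<and> b \<in> D" if "a \<in> \<Union>\<D>" "b \<in> \<Union>\<D>" for a b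
      using that lin by blast
    have 1: "subring (\<Union>\<D>) K"
    proof (rule subringI)
      show "\<Union>\<D> \<subseteq> carrier K" using sr subringD(1) by blast
      show "\<one> \<in> \<Union>\<D>" using D(1) sr subringD(3) by blast
      fix h assume h: "h \<in> \<Union>\<D>" then show "\<ominus> h \<in> \<Union>\<D>" using sr subringD(5) by blast
      fix h' assume h': "h' \<in> \<Union>\<D>" 
      obtain D where D: "D \<in> \<D>" "h \<in> D" "h' \<in> D" using common[OF h h'] by blast
      then have "h \<otimes> h' \<in> D" "h \<oplus> h' \<in> D" using subringD(6,7)[OF sr[OF D(1)]] by auto
      then show "h \<otimes> h' \<in> \<Union>\<D>" "h \<oplus> h' \<in> \<Union>\<D>" using D(1) by blast+
    qed
    have 2: "A \<subseteq> \<Union>\<D>" using D(1) sub unfolding CC_def by blast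
    have "\<exists>D\<in>\<D>. w \<in> ideal_prod K D E" if "w \<in> ideal_prod K (\<Union>\<D>) E" for w
      using that
    proof (induction rule: ideal_prod.induct)
      case (prod i j)
      then show ?case using ideal_prod.prod by (metis UnionE)
    next
      case (sum s1 s2)
      then obtain D D' where DD: "D \<in> \<D>" "D' \<in> \<D>" "s1 \<in> ideal_prod K D E" "s2 \<in> ideal_prod K D' E" by blast
      from lin[OF DD(1,2)] show ?case
      proof
        assume "D \<subseteq> D'" then show ?thesis using DD ideal_prod_mono[of D D'] ideal_prod.sum[of s1 K D' E s2] by blast
      next
        assume "D' \<subseteq> D" then show ?thesis using DD ideal_prod_mono[of D' D] ideal_prod.sum[of s1 K D E s2] by blast
      qed
    qed
    then have "\<one> \<notin> ideal_prod K (\<Union>\<D>) E" using sub unfolding CC_def by blast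
    then show ?thesis unfolding CC_def using 1 2 by blast
  qed
  ultimately obtain C where C: "C \<in> CC" "\<And>X. X \<in> CC \<Longrightarrow> C \<subseteq> X \<Longrightarrow> X = C"
    using subset_Zorn_nonempty[of CC] by metis
  have sC: "subring C K" "A \<subseteq> C" "\<one> \<notin> ideal_prod K C E" using C(1) unfolding CC_def by auto
  note CD = subringD[OF sC(1)]
  define J where "J = ideal_prod K C E"
  have EC: "E \<subseteq> C" using E(1) sC(2) by blast
  have J: "ideal_of C J" unfolding J_def by (rule ideal_prod_ideal[OF sC(1) self_ideal_of[OF sC(1)] EC Ene])
  note JJ = ideal_ofD[OF J]
  have J1: "\<one> \<notin> J" using sC(3) unfolding J_def .
  have rel: "\<exists>p. set p \<subseteq> J \<and> pev p y = \<one>" if y: "y \<in> carrier K" "y \<notin> C" for y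
  proof -
    note aj = adj_facts[OF sC(1) y(1)]
    have "adj C y \<notin> CC" using C(2)[OF _ aj(2)] aj(3) y(2) by metis
    then have "\<one> \<in> ideal_prod K (adj C y) E" unfolding CC_def using aj sC(2) by blast
    then obtain p where p: "set p \<subseteq> ideal_prod K C E" "\<one> = pev p y"
      by (rule ideal_prod_adj[OF sC(1) EC Ene y(1)])
    show ?thesis unfolding J_def by (rule exI[of _ p]) (simp add: p(1) p(2)[symmetric])
  qed
  \<comment> \<open>If \<open>t = \<one> \<ominus> j\<close> were not invertible in
    \<open>C\<close>, the relation for \<open>inv t\<close> multiplied by a power of
    \<open>t\<close> would put that power into \<open>J\<close>. But \<open>t\<close> is congruent
    to \<open>\<one>\<close> modulo \<open>J\<close>, so no power of it lies in the proper ideal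
    \<open>J\<close>.\<close>
  have un: "\<one> \<ominus> j \<noteq> \<zero> \<and> inv (\<one> \<ominus> j) \<in> C" if j: "j \<in> J" for j
  proof -
    have jK: "j \<in> carrier K" by (rule CD(4)[OF subsetD[OF JJ(1) j]])
    have t0: "\<one> \<ominus> j \<noteq> \<zero>"
    proof
      assume "\<one> \<ominus> j = \<zero>"
      then have "\<one> = j" using jK by (simp add: r_right_minus_eq)
      then show False using j J1 by simp
    qed
    define t where "t = \<one> \<ominus> j"
    have tC: "t \<in> C" unfolding t_def using subsetD[OF JJ(1) j] by (simp add: CD(3,8))
    have tK: "t \<in> carrier K" by (rule CD(4)[OF tC])
    have tz: "t \<noteq> \<zero>" using t0 t_def by simp
    have pow: "t [^] n \<notin> J" for n :: nat
    proof (induction n)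
      case 0 then show ?case using J1 by simp
    next
      case (Suc n)
      show ?case
      proof
        assume a: "t [^] Suc n \<in> J"
        have pK: "t [^] n \<in> carrier K" using tK by simp
        have "t [^] n = t [^] n \<otimes> t \<oplus> t [^] n \<otimes> j" unfolding t_def[symmetric]
        proof -
          have "\<one> = t \<oplus> j" unfolding t_def using jK by algebra
          then have "t [^] n \<otimes> \<one> = t [^] n \<otimes> (t \<oplus> j)" by simp
          then show ?thesis using pK tK jK by (simp add: r_distr)
        qed
        moreover have "t [^] n \<otimes> t \<oplus> t [^] n \<otimes> j \<in> J" using a JJ(3) JJ(4)[OF CD(9)[OF tC] j] by simp
        ultimately show False using Suc by simp
      qed
    qed
    have "inv t \<in> C"
    proof (rule ccontr)
      assume "inv t \<notin> C"
      then obtain p where p: "set p \<subseteq> J" "pev p (inv t) = \<one>" using rel[of "inv t"] tK tz by auto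
      have JK: "J \<subseteq> carrier K" using JJ(1) CD(1) by blast
      have "t [^] length p \<otimes> pev p (inv t) = t \<otimes> pev (rev p) t" using pev_rev[OF subset_trans[OF p(1) JK] tK tz] .
      then have *: "t [^] length p = t \<otimes> pev (rev p) t" using p(2) tK by simp
      have "pev r t \<in> J" if "set r \<subseteq> J" for r using that
        by (induction r) (auto simp: JJ(2,3) JJ(4)[OF tC])
      then have "pev (rev p) t \<in> J" using p(1) by simp
      then have "t [^] length p \<in> J" unfolding * by (rule JJ(4)[OF tC])
      then show False using pow by blast
    qed
    then show ?thesis using t0 unfolding t_def by blast
  qed
  have "vring C" unfolding vring_def
  proof (intro conjI ballI impI sC(1))
    fix z assume z: "z \<in> carrier K" "z \<noteq> \<zero>"
    show "z \<in> C \<or> inv z \<in> C"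
    proof (rule ccontr)
      assume n: "\<not> (z \<in> C \<or> inv z \<in> C)"
      obtain p where "set p \<subseteq> J" "pev p z = \<one>" using rel[of z] z n by blast
      moreover obtain q where "set q \<subseteq> J" "pev q (inv z) = \<one>" using rel[of "inv z"] z n by auto
      ultimately show False using no_relations[OF sC(1) J un z] by blast
    qed
  qed
  moreover have "E \<subseteq> nonunits C"
  proof
    fix e assume e: "e \<in> E"
    have "inv e \<notin> C" if "e \<noteq> \<zero>"
    proof
      assume "inv e \<in> C"
      then have "inv e \<otimes> e \<in> J" unfolding J_def using e by (rule ideal_prod.prod)
      then show False using J1 that e EK by auto
    qed
    then show "e \<in> nonunits C" unfolding nonunits_def using e EC by blast
  qed
  ultimately show thesis using that sC(2) by blast
qed

section \<open>Divisibility in a valuation ring\<close>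

lemma vringD:
  assumes "vring V"
  shows "subring V K" "\<And>z. z \<in> carrier K \<Longrightarrow> z \<noteq> \<zero> \<Longrightarrow> z \<notin> V \<Longrightarrow> inv z \<in> V"
  using assms unfolding vring_def by blast+

text \<open>For a valuation ring this is the inequality \<open>v(a) \<le> v(b)\<close>, stated
  without a value group; zero has the largest value.\<close>

definition vdvd :: "'a set \<Rightarrow> 'a \<Rightarrow> 'a \<Rightarrow> bool" where
  "vdvd V a b \<longleftrightarrow> (\<exists>v\<in>V. b = a \<otimes> v)"

lemma vdvd_iff:
  assumes "subring V K" "a \<in> carrier K" "b \<in> carrier K" "a \<noteq> \<zero>"
  shows "vdvd V a b \<longleftrightarrow> b \<otimes> inv a \<in> V"
proof
  assume "vdvd V a b" then obtain v where v: "v \<in> V" "b = a \<otimes> v" unfolding vdvd_def by blast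
  have "v \<in> carrier K" using subringD(4)[OF assms(1) v(1)] .
  then have "b \<otimes> inv a = v" using v assms by (simp add: m_comm)
  then show "b \<otimes> inv a \<in> V" using v by simp
next
  assume *: "b \<otimes> inv a \<in> V"
  have "b = a \<otimes> (b \<otimes> inv a)" using assms by simp
  then show "vdvd V a b" unfolding vdvd_def using * by blast
qed

lemma vdvd_zero: "subring V K \<Longrightarrow> a \<in> carrier K \<Longrightarrow> vdvd V a \<zero>"
  unfolding vdvd_def using subringD(2) by (metis r_null)

lemma vdvd_refl: "subring V K \<Longrightarrow> a \<in> carrier K \<Longrightarrow> vdvd V a a"
  unfolding vdvd_def using subringD(3) by (metis r_one)

lemma vdvd_trans:
  assumes "subring V K" "a \<in> carrier K" "vdvd V a b" "vdvd V b c"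
  shows "vdvd V a c"
proof -
  obtain v w where "v \<in> V" "w \<in> V" "b = a \<otimes> v" "c = b \<otimes> w" using assms(3,4) unfolding vdvd_def by blast
  then show ?thesis unfolding vdvd_def using subringD(4,6)[OF assms(1)] assms(2) by (metis m_assoc)
qed

lemma vdvd_linear:
  assumes "vring V" "a \<in> carrier K" "b \<in> carrier K"
  shows "vdvd V a b \<or> vdvd V b a"
proof (cases "a = \<zero> \<or> b = \<zero>")
  case True
  then show ?thesis using vdvd_zero vringD(1)[OF assms(1)] assms by blast
next
  case False
  have "b \<otimes> inv a \<in> V \<or> inv (b \<otimes> inv a) \<in> V" using vringD(2)[OF assms(1), of "b \<otimes> inv a"] assms False by auto
  moreover have "inv (b \<otimes> inv a) = a \<otimes> inv b" using assms False by (simp add: inv_mult' m_comm)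
  ultimately show ?thesis using vdvd_iff[OF vringD(1)[OF assms(1)]] assms False by auto
qed

lemma vdvd_mult:
  assumes "subring V K" "a \<in> carrier K" "c \<in> carrier K" "vdvd V a b" "vdvd V c d"
  shows "vdvd V (a \<otimes> c) (b \<otimes> d)"
proof -
  obtain v w where *: "v \<in> V" "w \<in> V" "b = a \<otimes> v" "d = c \<otimes> w" using assms(4,5) unfolding vdvd_def by blast
  then have "v \<in> carrier K" "w \<in> carrier K" using subringD(4)[OF assms(1)] by auto
  then have "b \<otimes> d = (a \<otimes> c) \<otimes> (v \<otimes> w)" using * assms by (simp add: m_ac)
  then show ?thesis unfolding vdvd_def using subringD(6)[OF assms(1)] * by blast
qed

lemma vdvd_pow:
  assumes "subring V K" "a \<in> carrier K" "vdvd V a b"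
  shows "vdvd V (a [^] (n::nat)) (b [^] n)"
proof (induction n)
  case 0 then show ?case using vdvd_refl[OF assms(1), of \<one>] by simp
next
  case (Suc n)
  then show ?case using vdvd_mult[OF assms(1) _ assms(2) _ assms(3)] assms(2) by simp
qed

lemma vdvd_add:
  assumes "subring V K" "a \<in> carrier K" "vdvd V a b" "vdvd V a c"
  shows "vdvd V a (b \<oplus> c)"
proof -
  obtain v w where *: "v \<in> V" "w \<in> V" "b = a \<otimes> v" "c = a \<otimes> w" using assms(3,4) unfolding vdvd_def by blast
  then have "v \<in> carrier K" "w \<in> carrier K" using subringD(4)[OF assms(1)] by auto
  then have "b \<oplus> c = a \<otimes> (v \<oplus> w)" using * assms by (simp add: r_distr)
  then show ?thesis unfolding vdvd_def using subringD(7)[OF assms(1)] * by blast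
qed

lemma vdvd_mult_right:
  assumes "subring V K" "a \<in> carrier K" "vdvd V a b" "v \<in> V"
  shows "vdvd V a (b \<otimes> v)" "vdvd V a (v \<otimes> b)"
proof -
  obtain w where *: "w \<in> V" "b = a \<otimes> w" using assms(3) unfolding vdvd_def by blast
  have c: "v \<in> carrier K" "w \<in> carrier K" using subringD(4)[OF assms(1)] * assms by auto
  then have "b \<otimes> v = a \<otimes> (w \<otimes> v)" "v \<otimes> b = a \<otimes> (w \<otimes> v)" using * assms by (simp_all add: m_ac)
  then show "vdvd V a (b \<otimes> v)" "vdvd V a (v \<otimes> b)" unfolding vdvd_def using subringD(6)[OF assms(1)] * assms(4) by blast+
qed

text \<open>Values may be divided by \<open>n\<close>. If \<open>a\<close> does not divide
  \<open>b\<close>, then \<open>u = a/b\<close> lies in \<open>V\<close>, and the hypothesis puts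
  the inverse of \<open>u^n\<close> into \<open>V\<close>; multiplied by \<open>u^(n-1)\<close> this
  is the inverse of \<open>u\<close>, so \<open>a\<close> divides \<open>b\<close> after
  all.\<close>

lemma vdvd_pow_cancel:
  assumes "vring V" "a \<in> carrier K" "b \<in> carrier K" "0 < (n::nat)" "vdvd V (a [^] n) (b [^] n)"
  shows "vdvd V a b"
proof (rule ccontr)
  assume n: "\<not> vdvd V a b"
  note sV = vringD(1)[OF assms(1)]
  have d: "vdvd V b a" using n vdvd_linear[OF assms(1-3)] by blast
  have b0: "b \<noteq> \<zero>" using n vdvd_zero[OF sV assms(2)] by blast
  have a0: "a \<noteq> \<zero>" using d n assms vdvd_refl[OF sV] 
  proof -
    have "a = \<zero> \<Longrightarrow> b [^] n = \<zero>" using assms vdvd_def[of V "a [^] n" "b [^] n"] subringD(4)[OF sV]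
      by (auto simp: nat_pow_zero)
    then show ?thesis using b0 assms(3) by auto
  qed
  define u where "u = a \<otimes> inv b"
  have u: "u \<in> V" "u \<noteq> \<zero>" "u \<in> carrier K" using d vdvd_iff[OF sV assms(3,2) b0] a0 b0 assms unfolding u_def by auto
  have "inv (u [^] n) = b [^] n \<otimes> inv (a [^] n)"
    unfolding u_def using assms a0 b0 by (simp add: nat_pow_distrib inv_mult' inv_pow[symmetric] m_comm)
  then have *: "inv (u [^] n) \<in> V" using vdvd_iff[OF sV _ _ _, of "a [^] n" "b [^] n"] assms a0 by simp
  have "inv u = inv (u [^] n) \<otimes> u [^] (n - 1)"
  proof -
    have "u [^] n = u [^] (n - 1) \<otimes> u" using assms(4) nat_pow_Suc[of u "n - 1"] by simp
    then have "inv (u [^] n) = inv (u [^] (n - 1)) \<otimes> inv u" using u by (simp add: inv_mult')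
    then have "inv (u [^] n) \<otimes> u [^] (n - 1) = inv u \<otimes> inv (u [^] (n - 1)) \<otimes> u [^] (n - 1)" using u by (simp add: m_comm)
    then show ?thesis using u by simp
  qed
  then have "inv u \<in> V" using * subringD(6,9)[OF sV] u(1) by simp
  moreover have "inv u = b \<otimes> inv a" unfolding u_def using assms a0 b0 by (simp add: inv_mult' m_comm)
  ultimately show False using n vdvd_iff[OF sV assms(2,3) a0] by simp
qed

lemma nonunits_ideal:
  assumes "vring V"
  shows "ideal_of V (nonunits V)" "\<one> \<notin> nonunits V"
proof -
  note sV = vringD(1)[OF assms]
  note V = subringD[OF sV]
  have mult: "s \<otimes> a \<in> nonunits V" if sa: "s \<in> V" "a \<in> nonunits V" for s a
  proof -
    have aV: "a \<in> V" using sa(2) unfolding nonunits_def by blast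
    have "inv (s \<otimes> a) \<notin> V" if "s \<otimes> a \<noteq> \<zero>"
    proof
      assume i: "inv (s \<otimes> a) \<in> V"
      have nz: "s \<noteq> \<zero>" "a \<noteq> \<zero>" "s \<in> carrier K" "a \<in> carrier K" using that V(4) sa(1) aV by auto
      have "s \<otimes> inv (s \<otimes> a) = inv a" using nz by (simp add: inv_mult')
      then have "inv a \<in> V" using V(6)[OF sa(1) i] by simp
      then show False using sa(2) nz unfolding nonunits_def by blast
    qed
    then show ?thesis unfolding nonunits_def using V(6)[OF sa(1) aV] by blast
  qed
  have "inv \<one> = \<one>" by (simp add: comm_inv_char)
  then show 1: "\<one> \<notin> nonunits V" unfolding nonunits_def using V(3) by simp
  show "ideal_of V (nonunits V)"
  proof (rule ideal_ofI)
    show "nonunits V \<subseteq> V" unfolding nonunits_def by blast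
    show "\<zero> \<in> nonunits V" unfolding nonunits_def using V(2) by blast
    show "\<And>s a. s \<in> V \<Longrightarrow> a \<in> nonunits V \<Longrightarrow> s \<otimes> a \<in> nonunits V" by (rule mult)
    fix a b assume ab: "a \<in> nonunits V" "b \<in> nonunits V"
    have abV: "a \<in> V" "b \<in> V" using ab unfolding nonunits_def by auto
    have *: "c \<oplus> d \<in> nonunits V" if cd: "vdvd V c d" "c \<in> nonunits V" "c \<in> V" for c d
    proof -
      obtain v where v: "v \<in> V" "d = c \<otimes> v" using cd(1) unfolding vdvd_def by blast
      have "c \<oplus> d = (\<one> \<oplus> v) \<otimes> c" using v V(4)[OF v(1)] V(4)[OF cd(3)] by (simp add: l_distr m_comm[of v])
      then show ?thesis using mult[OF _ cd(2)] V(3,7) v(1) by simp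
    qed
    have "vdvd V a b \<or> vdvd V b a" using vdvd_linear[OF assms] abV V(4) by blast
    moreover have "a \<oplus> b = b \<oplus> a" using abV V(4) by (simp add: a_comm)
    ultimately show "a \<oplus> b \<in> nonunits V" using * ab abV by metis
  qed
qed

lemma not_vdvd_nonunit:
  assumes "vring V" "a \<in> carrier K" "b \<in> carrier K" "\<not> vdvd V a b"
  shows "b \<noteq> \<zero>" "a \<otimes> inv b \<in> nonunits V"
proof -
  note sV = vringD(1)[OF assms(1)]
  show b0: "b \<noteq> \<zero>" using vdvd_zero[OF sV assms(2)] assms(4) by blast
  have "vdvd V b a" using vdvd_linear[OF assms(1-3)] assms(4) by blast
  then have 1: "a \<otimes> inv b \<in> V" using vdvd_iff[OF sV assms(3,2) b0] by simp
  show "a \<otimes> inv b \<in> nonunits V"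
  proof (cases "a = \<zero>")
    case True then show ?thesis using nonunits_ideal(1)[OF assms(1)] assms(3) b0 by (simp add: ideal_ofD(2))
  next
    case False
    have "inv (a \<otimes> inv b) = b \<otimes> inv a" using assms b0 False by (simp add: inv_mult' m_comm)
    then show ?thesis unfolding nonunits_def using 1 assms vdvd_iff[OF sV assms(2,3) False] by simp
  qed
qed

lemma vdvd_nonunit:
  assumes "vring V" "a \<in> carrier K" "b \<in> carrier K" "b \<noteq> \<zero>" "a \<otimes> inv b \<in> nonunits V" "a \<noteq> \<zero>"
  shows "\<not> vdvd V a b"
proof
  note sV = vringD(1)[OF assms(1)]
  assume "vdvd V a b"
  then have "b \<otimes> inv a \<in> V" using vdvd_iff[OF sV assms(2,3,6)] by simp
  moreover have "inv (a \<otimes> inv b) = b \<otimes> inv a" using assms by (simp add: inv_mult' m_comm)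
  ultimately show False using assms unfolding nonunits_def by auto
qed

section \<open>Integral dependence and valuations\<close>

text \<open>\<open>dep D z n\<close> collects the sums \<open>c_1 z^(n-1) + ... + c_n\<close> with \<open>c_i\<close> in \<open>D i\<close>.\<close>

fun dep :: "(nat \<Rightarrow> 'a set) \<Rightarrow> 'a \<Rightarrow> nat \<Rightarrow> 'a set" where
  "dep D z 0 = {\<zero>}"
| "dep D z (Suc n) = {z \<otimes> w \<oplus> c | w c. w \<in> dep D z n \<and> c \<in> D (Suc n)}"

lemma dep_carr: "z \<in> carrier K \<Longrightarrow> (\<And>i. D i \<subseteq> carrier K) \<Longrightarrow> dep D z n \<subseteq> carrier K"
  by (induction n) (auto simp: subset_iff)

lemma dep_iff:
  assumes "z \<in> carrier K" "\<And>i. D i \<subseteq> carrier K"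
  shows "w \<in> dep D z n \<longleftrightarrow> (\<exists>c. (\<forall>i\<in>{1..n}. c i \<in> D i) \<and> w = (\<Oplus>i\<in>{1..n}. c i \<otimes> z [^] (n - i)))"
proof (induction n arbitrary: w)
  case 0 then show ?case by simp
next
  case (Suc n)
  have step: "(\<Oplus>i\<in>{1..Suc n}. c i \<otimes> z [^] (Suc n - i)) = z \<otimes> (\<Oplus>i\<in>{1..n}. c i \<otimes> z [^] (n - i)) \<oplus> c (Suc n)"
    if c: "\<forall>i\<in>{1..Suc n}. c i \<in> D i" for c
  proof -
    have cK: "c i \<in> carrier K" if "i \<in> {1..Suc n}" for i using c assms(2) that by blast
    have "(\<Oplus>i\<in>{1..Suc n}. c i \<otimes> z [^] (Suc n - i)) 
        = c (Suc n) \<oplus> (\<Oplus>i\<in>{1..n}. c i \<otimes> z [^] (Suc n - i))"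
      using cK assms(1) by (subst atLeastAtMostSuc_conv, simp, subst finsum_insert) auto
    also have "(\<Oplus>i\<in>{1..n}. c i \<otimes> z [^] (Suc n - i)) = (\<Oplus>i\<in>{1..n}. z \<otimes> (c i \<otimes> z [^] (n - i)))"
    proof (rule finsum_cong')
      fix i assume i: "i \<in> {1..n}"
      have "z [^] (Suc n - i) = z [^] (n - i) \<otimes> z" using i by (simp add: Suc_diff_le)
      then show "c i \<otimes> z [^] (Suc n - i) = z \<otimes> (c i \<otimes> z [^] (n - i))"
        using cK[of i] i assms(1) by (simp add: m_ac)
    qed (use cK assms(1) in auto)
    also have "\<dots> = z \<otimes> (\<Oplus>i\<in>{1..n}. c i \<otimes> z [^] (n - i))"
      using cK assms(1) by (subst finsum_rdistr) auto
    finally have "(\<Oplus>i\<in>{1..Suc n}. c i \<otimes> z [^] (Suc n - i)) = c (Suc n) \<oplus> z \<otimes> (\<Oplus>i\<in>{1..n}. c i \<otimes> z [^] (n - i))" .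
    moreover have "(\<Oplus>i\<in>{1..n}. c i \<otimes> z [^] (n - i)) \<in> carrier K" using cK assms(1) by (intro finsum_closed) auto
    ultimately show ?thesis using cK[of "Suc n"] assms(1) by (simp add: a_comm)
  qed
  show ?case
  proof
    assume "w \<in> dep D z (Suc n)"
    then obtain w' d where *: "w = z \<otimes> w' \<oplus> d" "w' \<in> dep D z n" "d \<in> D (Suc n)" by auto
    then obtain c where c: "\<forall>i\<in>{1..n}. c i \<in> D i" "w' = (\<Oplus>i\<in>{1..n}. c i \<otimes> z [^] (n - i))" using Suc.IH by blast
    define c' where "c' = c(Suc n := d)"
    have c': "\<forall>i\<in>{1..Suc n}. c' i \<in> D i" using c(1) * unfolding c'_def by auto
    have "(\<Oplus>i\<in>{1..n}. c' i \<otimes> z [^] (n - i)) = (\<Oplus>i\<in>{1..n}. c i \<otimes> z [^] (n - i))"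
    proof (rule finsum_cong')
      show "(\<lambda>i. c i \<otimes> z [^] (n - i)) \<in> {1..n} \<rightarrow> carrier K"
        using c(1) assms by (auto simp: subset_iff)
    qed (auto simp: c'_def)
    then have "w = (\<Oplus>i\<in>{1..Suc n}. c' i \<otimes> z [^] (Suc n - i))"
      using step[OF c'] * c(2) by (simp add: c'_def)
    then show "\<exists>c. (\<forall>i\<in>{1..Suc n}. c i \<in> D i) \<and> w = (\<Oplus>i\<in>{1..Suc n}. c i \<otimes> z [^] (Suc n - i))"
      using c' by blast
  next
    assume "\<exists>c. (\<forall>i\<in>{1..Suc n}. c i \<in> D i) \<and> w = (\<Oplus>i\<in>{1..Suc n}. c i \<otimes> z [^] (Suc n - i))"
    then obtain c where c: "\<forall>i\<in>{1..Suc n}. c i \<in> D i" "w = (\<Oplus>i\<in>{1..Suc n}. c i \<otimes> z [^] (Suc n - i))" by blast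
    have "(\<Oplus>i\<in>{1..n}. c i \<otimes> z [^] (n - i)) \<in> dep D z n" unfolding Suc.IH using c(1) by (intro exI[of _ c]) auto
    moreover have "c (Suc n) \<in> D (Suc n)" using c(1) by simp
    ultimately show "w \<in> dep D z (Suc n)" unfolding dep.simps c(2) step[OF c(1)] by blast
  qed
qed

text \<open>One frame for two notions: the constant sequence \<open>A\<close> gives integrality over
  the ring, the powers of an ideal give integrality over the ideal.\<close>

definition grading :: "'a set \<Rightarrow> (nat \<Rightarrow> 'a set) \<Rightarrow> bool" where
  "grading A D \<longleftrightarrow> subring A K \<and> D 0 = A \<and> (\<forall>i. ideal_of A (D i)) \<and> (\<forall>i j. \<forall>a\<in>D i. \<forall>b\<in>D j. a \<otimes> b \<in> D (i + j))"

lemma gradingD: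
  assumes "grading A D"
  shows "subring A K" "D 0 = A" "\<And>i. ideal_of A (D i)" "\<And>i j a b. a \<in> D i \<Longrightarrow> b \<in> D j \<Longrightarrow> a \<otimes> b \<in> D (i + j)"
    "\<And>i. D i \<subseteq> carrier K"
proof -
  show *: "subring A K" "D 0 = A" "\<And>i. ideal_of A (D i)" "\<And>i j a b. a \<in> D i \<Longrightarrow> b \<in> D j \<Longrightarrow> a \<otimes> b \<in> D (i + j)"
    using assms unfolding grading_def by blast+
  show "\<And>i. D i \<subseteq> carrier K" using ideal_ofD(1)[OF *(3)] subringD(1)[OF *(1)] by blast
qed

text \<open>The sign of the usual equation is absorbed, because \<open>dep\<close> is closed under
  negation; \<open>int_over_iff\<close> restores the usual form.\<close>

definition int_over :: "(nat \<Rightarrow> 'a set) \<Rightarrow> 'a \<Rightarrow> bool" where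
  "int_over D z \<longleftrightarrow> (\<exists>n\<ge>1. z [^] n \<in> dep D z n)"

lemma dep_closed:
  assumes "grading A D" "z \<in> carrier K"
  shows "\<zero> \<in> dep D z n" "\<And>v w. v \<in> dep D z n \<Longrightarrow> w \<in> dep D z n \<Longrightarrow> v \<oplus> w \<in> dep D z n"
    "\<And>w. w \<in> dep D z n \<Longrightarrow> \<ominus> w \<in> dep D z n" "\<And>w. w \<in> dep D z n \<Longrightarrow> z [^] (k::nat) \<otimes> w \<in> dep D z (k + n)"
    "\<And>c. c \<in> D n \<Longrightarrow> 1 \<le> n \<Longrightarrow> c \<in> dep D z n"
proof -
  note g = gradingD[OF assms(1)]
  have dK: "dep D z n \<subseteq> carrier K" for n by (rule dep_carr[OF assms(2) g(5)])
  show z: "\<zero> \<in> dep D z n" for n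
  proof (induction n)
    case (Suc n)
    have "\<zero> = z \<otimes> \<zero> \<oplus> \<zero>" using assms(2) by simp
    then show ?case using Suc ideal_ofD(2)[OF g(3)] by fastforce
  qed simp
  show "\<And>v w. v \<in> dep D z n \<Longrightarrow> w \<in> dep D z n \<Longrightarrow> v \<oplus> w \<in> dep D z n" for n
  proof (induction n)
    case (Suc n)
    obtain v' c w' d where *: "v = z \<otimes> v' \<oplus> c" "w = z \<otimes> w' \<oplus> d" "v' \<in> dep D z n" "w' \<in> dep D z n" "c \<in> D (Suc n)" "d \<in> D (Suc n)"
      using Suc.prems by auto
    have c: "v' \<in> carrier K" "w' \<in> carrier K" "c \<in> carrier K" "d \<in> carrier K" using * dK g(5) by blast+
    have "v \<oplus> w = z \<otimes> (v' \<oplus> w') \<oplus> (c \<oplus> d)" unfolding *(1,2) using c assms(2) by algebra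
    moreover have "c \<oplus> d \<in> D (Suc n)" using ideal_ofD(3)[OF g(3)] * by blast
    moreover have "v' \<oplus> w' \<in> dep D z n" using Suc.IH * by blast
    ultimately show ?case by auto
  qed simp
  show "\<And>w. w \<in> dep D z n \<Longrightarrow> \<ominus> w \<in> dep D z n" for n
  proof (induction n)
    case (Suc n)
    obtain w' d where *: "w = z \<otimes> w' \<oplus> d" "w' \<in> dep D z n" "d \<in> D (Suc n)"
      using Suc.prems by auto
    have c: "w' \<in> carrier K" "d \<in> carrier K" using * dK g(5) by blast+
    have "\<ominus> w = z \<otimes> (\<ominus> w') \<oplus> (\<ominus> d)" unfolding *(1) using c assms(2) by algebra
    moreover have "\<ominus> d \<in> D (Suc n)" using ideal_of_minus(1)[OF g(1,3)] * by blast
    moreover have "\<ominus> w' \<in> dep D z n" using Suc.IH * by blast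
    ultimately show ?case by auto
  qed simp
  have zw: "z \<otimes> w \<in> dep D z (Suc n)" if w: "w \<in> dep D z n" for w n
  proof -
    have "z \<otimes> w = z \<otimes> w \<oplus> \<zero>" using w dK assms(2) by (metis m_closed r_zero subsetD)
    then show ?thesis using w ideal_ofD(2)[OF g(3)] by fastforce
  qed
  show "\<And>w. w \<in> dep D z n \<Longrightarrow> z [^] (k::nat) \<otimes> w \<in> dep D z (k + n)" for k
  proof (induction k)
    case 0 then show ?case using subsetD[OF dK 0] by simp
  next
    case (Suc k)
    have "z [^] Suc k \<otimes> w = z \<otimes> (z [^] k \<otimes> w)" using assms(2) Suc.prems subsetD[OF dK] by (simp add: m_ac)
    then show ?case using zw[OF Suc.IH[OF Suc.prems]] by simp
  qed
  show "\<And>c. c \<in> D n \<Longrightarrow> 1 \<le> n \<Longrightarrow> c \<in> dep D z n"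
  proof -
    fix c assume c: "c \<in> D n" "1 \<le> n"
    then obtain n' where n': "n = Suc n'" by (cases n) auto
    have "c = z \<otimes> \<zero> \<oplus> c" using subsetD[OF g(5) c(1)] assms(2) by simp
    then show "c \<in> dep D z n" unfolding n' using c(1) n' z by auto
  qed
qed

text \<open>The sums of terms from \<open>D i\<close> times \<open>u^i\<close> with
  \<open>i \<ge> k\<close>. For \<open>k = 0\<close> this is the image of a Rees algebra with its
  variable sent to \<open>u\<close>, and for \<open>k = 1\<close> the image of the ideal of positive
  degree.\<close>

inductive_set forms :: "nat \<Rightarrow> (nat \<Rightarrow> 'a set) \<Rightarrow> 'a \<Rightarrow> 'a set" for k D u where
  mono: "k \<le> i \<Longrightarrow> c \<in> D i \<Longrightarrow> c \<otimes> u [^] i \<in> forms k D u"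
| plus: "v \<in> forms k D u \<Longrightarrow> w \<in> forms k D u \<Longrightarrow> v \<oplus> w \<in> forms k D u"

lemma forms_facts:
  assumes "grading A D" "u \<in> carrier K"
  shows "subring (forms 0 D u) K" "ideal_of (forms 0 D u) (forms 1 D u)" "A \<subseteq> forms 0 D u"
proof -
  note g = gradingD[OF assms(1)]
  have c: "forms k D u \<subseteq> carrier K" for k
  proof
    fix w assume "w \<in> forms k D u" then show "w \<in> carrier K"
      by induction (use g(5) assms(2) in auto)
  qed
  have mul: "v \<otimes> w \<in> forms (k + l) D u" if vw: "v \<in> forms k D u" "w \<in> forms l D u" for v w k l
    using vw(1)
  proof induction
    case (mono i a)
    show ?case using vw(2)
    proof induction
      case (mono j b)
      have ab: "a \<in> carrier K" "b \<in> carrier K" using g(5) mono \<open>a \<in> D i\<close> by blast+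
      have "a \<otimes> u [^] i \<otimes> (b \<otimes> u [^] j) = (a \<otimes> b) \<otimes> (u [^] i \<otimes> u [^] j)" using ab assms(2) by (simp add: m_ac)
      also have "\<dots> = (a \<otimes> b) \<otimes> u [^] (i + j)" using assms(2) by (simp add: nat_pow_mult)
      finally show ?case using forms.mono[of "k + l" "i + j" "a \<otimes> b" D u] g(4) mono \<open>k \<le> i\<close> \<open>a \<in> D i\<close> by simp
    next
      case (plus w w')
      then have "w \<in> carrier K" "w' \<in> carrier K" using c by blast+
      moreover have "a \<otimes> u [^] i \<in> carrier K" using \<open>a \<in> D i\<close> g(5) assms(2) by blast
      ultimately show ?case using plus by (simp add: r_distr forms.plus)
    qed
  next
    case (plus v v')
    have "v \<in> carrier K" "v' \<in> carrier K" "w \<in> carrier K" using plus vw c by blast+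
    then show ?case using plus by (simp add: l_distr forms.plus)
  qed
  show A: "A \<subseteq> forms 0 D u"
  proof
    fix a assume a: "a \<in> A"
    then have "a \<otimes> u [^] (0::nat) \<in> forms 0 D u" using forms.mono[of 0 0 a D u] g(2) by simp
    then show "a \<in> forms 0 D u" using a subringD(4)[OF g(1)] by simp
  qed
  note AA = subringD[OF g(1)]
  show "subring (forms 0 D u) K"
  proof (rule subringI[OF c])
    show "\<one> \<in> forms 0 D u" using A AA(3) by blast
    fix h assume h: "h \<in> forms 0 D u"
    have "\<ominus> \<one> \<in> forms 0 D u" using A AA(3,5) by blast
    then have "\<ominus> \<one> \<otimes> h \<in> forms 0 D u" using mul[of "\<ominus> \<one>" 0 h 0] h by simp
    moreover have "\<ominus> \<one> \<otimes> h = \<ominus> h" using subsetD[OF c h] by (simp add: l_minus)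
    ultimately show "\<ominus> h \<in> forms 0 D u" by simp
    fix h' assume "h' \<in> forms 0 D u"
    then show "h \<otimes> h' \<in> forms 0 D u" "h \<oplus> h' \<in> forms 0 D u" using mul[of h 0 h' 0] h forms.plus by auto
  qed
  show "ideal_of (forms 0 D u) (forms 1 D u)"
  proof (rule ideal_ofI)
    show "forms 1 D u \<subseteq> forms 0 D u"
    proof
      fix w assume "w \<in> forms 1 D u" then show "w \<in> forms 0 D u"
        by induction (auto intro: forms.intros)
    qed
    have "\<zero> \<otimes> u [^] (1::nat) \<in> forms 1 D u" using forms.mono[of 1 1 \<zero> D u] ideal_ofD(2)[OF g(3)] by simp
    then show "\<zero> \<in> forms 1 D u" using assms(2) by simp
    show "\<And>a b. a \<in> forms 1 D u \<Longrightarrow> b \<in> forms 1 D u \<Longrightarrow> a \<oplus> b \<in> forms 1 D u" by (rule forms.plus)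
    show "\<And>s a. s \<in> forms 0 D u \<Longrightarrow> a \<in> forms 1 D u \<Longrightarrow> s \<otimes> a \<in> forms 1 D u" using mul[of _ 0 _ 1] by simp
  qed
qed

text \<open>Multiplication by a power of \<open>z\<close> clears the denominators. For
  \<open>w = \<one>\<close> the outcome is an integral equation of \<open>z\<close>.\<close>

lemma forms_dep:
  assumes "grading A D" "z \<in> carrier K" "z \<noteq> \<zero>" "w \<in> forms 1 D (inv z)"
  shows "\<exists>n\<ge>1. z [^] n \<otimes> w \<in> dep D z n"
  using assms(4)
proof induction
  case (mono i c)
  note g = gradingD[OF assms(1)]
  have cK: "c \<in> carrier K" using mono g(5) by blast
  have "z [^] i \<otimes> (c \<otimes> inv z [^] i) = c \<otimes> (z [^] i \<otimes> inv (z [^] i))" using assms(2,3) cK by (simp add: m_lcomm inv_pow del: r_inv_carr)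
  also have "\<dots> = c" using assms(2,3) cK by simp
  finally have "z [^] i \<otimes> (c \<otimes> inv z [^] i) \<in> dep D z i" using dep_closed(5)[OF assms(1,2)] mono by simp
  then show ?case using mono by blast
next
  case (plus v w)
  note g = gradingD[OF assms(1)]
  obtain n m where nm: "n \<ge> 1" "m \<ge> 1" "z [^] n \<otimes> v \<in> dep D z n" "z [^] m \<otimes> w \<in> dep D z m" using plus by blast
  have iz: "inv z \<in> carrier K" using assms(2,3) by simp
  have "forms 1 D (inv z) \<subseteq> carrier K"
    using ideal_ofD(1)[OF forms_facts(2)[OF assms(1) iz]] subringD(1)[OF forms_facts(1)[OF assms(1) iz]] by blast
  then have c: "v \<in> carrier K" "w \<in> carrier K" using plus by blast+
  have p: "z [^] (n + m) = z [^] n \<otimes> z [^] m" using assms(2) by (simp add: nat_pow_mult)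
  have "z [^] (n + m) \<otimes> (v \<oplus> w) = z [^] m \<otimes> (z [^] n \<otimes> v) \<oplus> z [^] n \<otimes> (z [^] m \<otimes> w)"
    unfolding p using c assms(2) by (simp add: r_distr m_ac)
  moreover have "z [^] m \<otimes> (z [^] n \<otimes> v) \<in> dep D z (n + m)" using dep_closed(4)[OF assms(1,2) nm(3), of m] by (simp add: add.commute)
  moreover have "z [^] n \<otimes> (z [^] m \<otimes> w) \<in> dep D z (n + m)" using dep_closed(4)[OF assms(1,2) nm(4), of n] by simp
  ultimately have "z [^] (n + m) \<otimes> (v \<oplus> w) \<in> dep D z (n + m)" using dep_closed(2)[OF assms(1,2)] by simp
  then show ?case using nm(1) by (intro exI[of _ "n + m"]) auto
qed

text \<open>If \<open>z\<close> satisfies no integral equation, the elements of positive degree in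
  \<open>1/z\<close> generate a proper ideal by \<open>forms_dep\<close>, and Chevalley's theorem
  puts this ideal into the nonunits of some \<open>V\<close>.\<close>

lemma not_int_over:
  assumes "grading A D" "z \<in> carrier K" "z \<noteq> \<zero>" "\<not> int_over D z"
  shows "\<exists>V. vring V \<and> A \<subseteq> V \<and> (\<forall>i\<ge>1. \<forall>c\<in>D i. c \<otimes> inv z [^] i \<in> nonunits V)"
proof -
  have iz: "inv z \<in> carrier K" using assms(2,3) by simp
  note f = forms_facts[OF assms(1) iz]
  have "\<one> \<notin> forms 1 D (inv z)"
  proof
    assume "\<one> \<in> forms 1 D (inv z)"
    then obtain n where "n \<ge> 1" "z [^] n \<otimes> \<one> \<in> dep D z n" using forms_dep[OF assms(1-3)] by blast
    then show False using assms(2,4) unfolding int_over_def by auto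
  qed
  then obtain V where V: "vring V" "forms 0 D (inv z) \<subseteq> V" "forms 1 D (inv z) \<subseteq> nonunits V"
    using chevalley[OF f(1,2)] by metis
  have "c \<otimes> inv z [^] i \<in> nonunits V" if "i \<ge> 1" "c \<in> D i" for i c
    using forms.mono[of 1 i c D "inv z"] that V(3) by auto
  then show ?thesis using V f(3) by blast
qed

text \<open>Divided by \<open>z^n\<close>, an integral equation writes \<open>\<one>\<close> as a
  sum of nonunits.\<close>

lemma int_over_contra:
  assumes "grading A D" "z \<in> carrier K" "z \<noteq> \<zero>" "int_over D z" "vring V"
    "\<And>i c. i \<ge> 1 \<Longrightarrow> c \<in> D i \<Longrightarrow> c \<otimes> inv z [^] i \<in> nonunits V"
  shows False
proof -
  note g = gradingD[OF assms(1)]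
  note sV = vringD(1)[OF assms(5)]
  note N = nonunits_ideal[OF assms(5)]
  note NN = ideal_ofD[OF N(1)]
  have NK: "nonunits V \<subseteq> carrier K" using NN(1) subringD(1)[OF sV] by blast
  have *: "\<exists>m\<in>nonunits V. w = z [^] n \<otimes> m" if "w \<in> dep D z n" for w n
    using that
  proof (induction n arbitrary: w)
    case 0
    then show ?case using NN(2) by (intro bexI[of _ \<zero>]) auto
  next
    case (Suc n)
    then obtain w' c where w: "w = z \<otimes> w' \<oplus> c" "w' \<in> dep D z n" "c \<in> D (Suc n)" by auto
    obtain m where m: "m \<in> nonunits V" "w' = z [^] n \<otimes> m" using Suc.IH w(2) by blast
    define m' where "m' = c \<otimes> inv z [^] Suc n"
    have m': "m' \<in> nonunits V" unfolding m'_def using assms(6)[OF _ w(3)] by simp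
    have cK: "c \<in> carrier K" "m \<in> carrier K" "m' \<in> carrier K" using w(3) g(5) m m' NK by blast+
    have i: "inv z [^] Suc n = inv (z [^] Suc n)" by (rule inv_pow[OF assms(2,3), symmetric])
    have c: "c = z [^] Suc n \<otimes> m'"
      unfolding m'_def i by (rule inv_cancel(5)[symmetric]) (use assms(2,3) cK pow_nz[of z "Suc n"] in auto)
    have "w = z [^] Suc n \<otimes> m \<oplus> z [^] Suc n \<otimes> m'"
      unfolding w(1) m(2) c[symmetric] using assms(2) cK by (simp add: m_ac)
    also have "\<dots> = z [^] Suc n \<otimes> (m \<oplus> m')" using assms(2) cK by (simp add: r_distr del: nat_pow_Suc)
    finally show ?case using NN(3)[OF m(1) m'] by blast
  qed
  obtain n where "n \<ge> 1" "z [^] n \<in> dep D z n" using assms(4) unfolding int_over_def by blast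
  then obtain m where m: "m \<in> nonunits V" "z [^] n = z [^] n \<otimes> m" using * by blast
  then have "z [^] n \<otimes> \<one> = z [^] n \<otimes> m" using assms(2) by simp
  then have "m = \<one>" using m_lcancel[of "z [^] n" \<one> m] assms(2,3) m(1) NK by auto
  then show False using m(1) N(2) by simp
qed

section \<open>Valuative criteria for integral dependence over rings and ideals\<close>

lemma const_grading: "subring A K \<Longrightarrow> grading A (\<lambda>_. A)"
  unfolding grading_def using self_ideal_of subringD(6) by blast

lemma int_over_zero: 
  assumes "grading A D" shows "int_over D \<zero>"
proof -
  have "\<zero> [^] (1::nat) \<in> dep D \<zero> 1" using dep_closed(1)[OF assms zero_closed, of 1] by simp
  then show ?thesis unfolding int_over_def by blast
qed

lemma int_over_iff:
  assumes "grading A D" "z \<in> carrier K"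
  shows "int_over D z \<longleftrightarrow> (\<exists>n\<ge>1. \<exists>c. (\<forall>i\<in>{1..n}. c i \<in> D i) \<and>
     z [^] n \<oplus> (\<Oplus>i\<in>{1..n}. c i \<otimes> z [^] (n - i)) = \<zero>)" (is "_ \<longleftrightarrow> ?R")
proof -
  note g = gradingD[OF assms(1)]
  have dK: "dep D z n \<subseteq> carrier K" for n by (rule dep_carr[OF assms(2) g(5)])
  have "z [^] n \<in> dep D z n \<longleftrightarrow> (\<exists>w\<in>dep D z n. z [^] n \<oplus> w = \<zero>)" for n
  proof
    assume "z [^] n \<in> dep D z n"
    then have "\<ominus> (z [^] n) \<in> dep D z n" by (rule dep_closed(3)[OF assms])
    moreover have "z [^] n \<oplus> \<ominus> (z [^] n) = \<zero>" using assms(2) by (simp add: r_neg)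
    ultimately show "\<exists>w\<in>dep D z n. z [^] n \<oplus> w = \<zero>" by blast
  next
    assume "\<exists>w\<in>dep D z n. z [^] n \<oplus> w = \<zero>"
    then obtain w where w: "w \<in> dep D z n" "z [^] n \<oplus> w = \<zero>" by blast
    then have "z [^] n = \<ominus> w" using minus_equality[of "z [^] n" w] subsetD[OF dK w(1)] assms(2) by simp
    then show "z [^] n \<in> dep D z n" using dep_closed(3)[OF assms w(1)] by simp
  qed
  moreover have "(\<exists>w\<in>dep D z n. z [^] n \<oplus> w = \<zero>) \<longleftrightarrow> (\<exists>c. (\<forall>i\<in>{1..n}. c i \<in> D i) \<and>
     z [^] n \<oplus> (\<Oplus>i\<in>{1..n}. c i \<otimes> z [^] (n - i)) = \<zero>)" for n
    unfolding Bex_def dep_iff[of z D, OF assms(2) g(5)] by blast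
  ultimately show ?thesis unfolding int_over_def by simp
qed

text \<open>For the constant grading, the case \<open>c = \<one>\<close>, \<open>i = 1\<close> of
  \<open>not_int_over\<close> makes \<open>inv z\<close> a nonunit of \<open>V\<close>, so
  \<open>z \<notin> V\<close>. Conversely \<open>z \<notin> V\<close> makes every
  \<open>c \<otimes> inv z [^] i\<close> a nonunit, which an integral equation excludes.\<close>

theorem integral_closure_iff:
  assumes "subring A K"
  shows "z \<in> integral_closure_in K A \<longleftrightarrow> z \<in> carrier K \<and> (\<forall>V. vring V \<and> A \<subseteq> V \<longrightarrow> z \<in> V)"
proof -
  note g = const_grading[OF assms]
  have "z \<in> integral_closure_in K A \<longleftrightarrow> z \<in> carrier K \<and> int_over (\<lambda>_. A) z"
    unfolding integral_closure_in_def using int_over_iff[OF g, of z] by auto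
  moreover have "int_over (\<lambda>_. A) z \<longleftrightarrow> (\<forall>V. vring V \<and> A \<subseteq> V \<longrightarrow> z \<in> V)" if z: "z \<in> carrier K"
  proof (cases "z = \<zero>")
    case True
    then show ?thesis using int_over_zero[OF g] vringD(1) subringD(2) by blast
  next
    case False
    have iz: "inv z \<in> carrier K" "inv z \<noteq> \<zero>" using z False by auto
    show ?thesis
    proof (intro iffI allI impI)
      fix V assume i: "int_over (\<lambda>_. A) z" and V: "vring V \<and> A \<subseteq> V"
      note sV = vringD(1)[OF conjunct1[OF V]]
      note N = nonunits_ideal(1)[OF conjunct1[OF V]]
      show "z \<in> V"
      proof (rule ccontr)
        assume "z \<notin> V"
        then have n: "inv z \<in> nonunits V" unfolding nonunits_def using vringD(2)[OF conjunct1[OF V] z False] z False by simp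
        have p: "inv z [^] i \<in> nonunits V" if i: "i \<ge> 1" for i :: nat
        proof -
          obtain j where "i = Suc j" using i by (cases i) auto
          moreover have "inv z [^] j \<in> V" using n subringD(9)[OF sV] unfolding nonunits_def by blast
          ultimately show ?thesis using ideal_ofD(4)[OF N _ n] by simp
        qed
        show False
          by (rule int_over_contra[OF g z False i conjunct1[OF V]]) (use ideal_ofD(4)[OF N] p V in blast)
      qed
    next
      assume V: "\<forall>V. vring V \<and> A \<subseteq> V \<longrightarrow> z \<in> V"
      show "int_over (\<lambda>_. A) z"
      proof (rule ccontr)
        assume "\<not> int_over (\<lambda>_. A) z"
        then obtain V where W: "vring V" "A \<subseteq> V" "\<forall>i\<ge>1. \<forall>c\<in>A. c \<otimes> inv z [^] (i::nat) \<in> nonunits V"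
          using not_int_over[OF g z False] by blast
        have "\<one> \<otimes> inv z [^] (1::nat) \<in> nonunits V" using W(3) subringD(3)[OF assms] by blast
        then have "inv z \<in> nonunits V" using iz by simp
        then have "z \<notin> V" unfolding nonunits_def using iz z False by simp
        then show False using V W by blast
      qed
    qed
  qed
  ultimately show ?thesis by blast
qed

fun ipw :: "'a set \<Rightarrow> 'a set \<Rightarrow> nat \<Rightarrow> 'a set" where
  "ipw A E 0 = A"
| "ipw A E (Suc n) = ideal_prod K (ipw A E n) E"

lemma ipw_eq: "ideal_power (K\<lparr>carrier := A\<rparr>) E n = ipw A E n"
proof (induction n)
  case 0 then show ?case by (simp add: ideals_set_def)
next
  case (Suc n)
  have "ideal_prod (K\<lparr>carrier := A\<rparr>) I J = ideal_prod K I J" for I J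
  proof (rule equalityI; rule subsetI)
    fix w assume "w \<in> ideal_prod (K\<lparr>carrier := A\<rparr>) I J" then show "w \<in> ideal_prod K I J"
      by induction (auto intro: ideal_prod.intros)
  next
    fix w assume "w \<in> ideal_prod K I J" then show "w \<in> ideal_prod (K\<lparr>carrier := A\<rparr>) I J"
    proof induction
      case (prod i j) then show ?case using ideal_prod.prod[of i I j J "K\<lparr>carrier := A\<rparr>"] by simp
    next
      case (sum s t) then show ?case using ideal_prod.sum[of s "K\<lparr>carrier := A\<rparr>" I J t] by simp
    qed
  qed
  then show ?case using Suc by (simp add: ideals_set_def)
qed

lemma ipw_ideal:
  assumes "subring A K" "ideal_of A E"
  shows "ideal_of A (ipw A E n)"
proof (induction n)
  case 0 then show ?case using self_ideal_of[OF assms(1)] by simp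
next
  case (Suc n)
  show ?case using ideal_prod_ideal[OF assms(1) Suc ideal_ofD(1)[OF assms(2)]] ideal_ofD(2)[OF assms(2)] by auto
qed

lemma ipw_carr: "subring A K \<Longrightarrow> ideal_of A E \<Longrightarrow> ipw A E n \<subseteq> carrier K"
  using ipw_ideal[of A E n] ideal_ofD(1) subringD(1) by blast

lemma ipw_mult:
  assumes "subring A K" "ideal_of A E" "a \<in> ipw A E n" "b \<in> ipw A E m"
  shows "a \<otimes> b \<in> ipw A E (n + m)"
  using assms(4)
proof (induction m arbitrary: b)
  case 0
  then show ?case using ideal_ofD(4)[OF ipw_ideal[OF assms(1,2)], of b a n] assms(3) subringD(4)[OF assms(1)] 
    ipw_carr[OF assms(1,2), of n] by (auto simp: m_comm)
next
  case (Suc m)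
  have aK: "a \<in> carrier K" using assms(3) ipw_carr[OF assms(1,2)] by blast
  from Suc.prems have "b \<in> ideal_prod K (ipw A E m) E" by simp
  then have "a \<otimes> b \<in> ideal_prod K (ipw A E (n + m)) E"
  proof induction
    case (prod i j)
    have "i \<in> carrier K" "j \<in> carrier K"
      using prod ipw_carr[OF assms(1,2)] ideal_ofD(1)[OF assms(2)] subringD(1)[OF assms(1)] by blast+
    then have "a \<otimes> (i \<otimes> j) = (a \<otimes> i) \<otimes> j" using aK by (simp add: m_assoc)
    then show ?case using ideal_prod.prod[OF Suc.IH[OF prod(1)] prod(2)] by simp
  next
    case (sum s t)
    have "ideal_prod K (ipw A E m) E \<subseteq> carrier K" using ipw_carr[OF assms(1,2), of "Suc m"] by simp
    then have "s \<in> carrier K" "t \<in> carrier K" using sum by blast+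
    then show ?case using sum aK by (simp add: r_distr ideal_prod.sum)
  qed
  then show ?case by simp
qed

lemma ipw_grading: "subring A K \<Longrightarrow> ideal_of A E \<Longrightarrow> grading A (ipw A E)"
  unfolding grading_def using ipw_ideal ipw_mult by simp

lemma ipw_1:
  assumes "subring A K" "ideal_of A E"
  shows "ipw A E 1 = E"
proof
  note E = ideal_ofD[OF assms(2)]
  have "ideal_prod K A E \<subseteq> E"
  proof
    fix w assume "w \<in> ideal_prod K A E" then show "w \<in> E"
      by induction (simp_all add: E(3,4))
  qed
  then show "ipw A E 1 \<subseteq> E" by simp
  show "E \<subseteq> ipw A E 1"
  proof
    fix e assume e: "e \<in> E"
    have "\<one> \<otimes> e \<in> ideal_prod K A E" using subringD(3)[OF assms(1)] e by (rule ideal_prod.prod)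
    then show "e \<in> ipw A E 1" using e E(1) subringD(4)[OF assms(1)] by auto
  qed
qed

lemma ipw_pow:
  assumes "subring A K" "ideal_of A E" "e \<in> ipw A E k"
  shows "e [^] (n::nat) \<in> ipw A E (k * n)"
proof (induction n)
  case 0 then show ?case using subringD(3)[OF assms(1)] by simp
next
  case (Suc n)
  then show ?case using ipw_mult[OF assms(1,2) Suc assms(3)] by (simp add: add.commute)
qed

lemma ipw_antimono:
  assumes "subring A K" "ideal_of A E" "n \<le> m"
  shows "ipw A E m \<subseteq> ipw A E n"
  using assms(3)
proof (induction m rule: dec_induct)
  case (step m)
  have "ipw A E (Suc m) \<subseteq> ipw A E m"
  proof
    fix w assume "w \<in> ipw A E (Suc m)"
    then have "w \<in> ideal_prod K (ipw A E m) E" by simp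
    then show "w \<in> ipw A E m"
    proof induction
      case (prod i j)
      have "i \<otimes> j = j \<otimes> i" using prod ipw_carr[OF assms(1,2)] ideal_ofD(1)[OF assms(2)] subringD(1)[OF assms(1)] 
        by (meson m_comm subsetD)
      then show ?case using ideal_ofD(4)[OF ipw_ideal[OF assms(1,2)] _ prod(1)] prod(2) ideal_ofD(1)[OF assms(2)] by auto
    next
      case (sum s t) then show ?case using ideal_ofD(3)[OF ipw_ideal[OF assms(1,2)]] by blast
    qed
  qed
  then show ?case using step by blast
qed simp

text \<open>An element of \<open>E^n\<close> involves finitely many elements of \<open>E\<close>,
  and one of these divides the others in \<open>V\<close>. Its \<open>n\<close>-th power then
  divides the whole expression.\<close>

lemma ipw_vdvd:
  assumes "vring V" "A \<subseteq> V" "E \<noteq> {}" "E \<subseteq> carrier K" "c \<in> ipw A E n"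
  shows "\<exists>e\<in>E. vdvd V (e [^] n) c"
  using assms(5)
proof (induction n arbitrary: c)
  case 0
  obtain e where e: "e \<in> E" using assms(3) by blast
  have "c \<in> V" using 0 assms(2) by auto
  then have "vdvd V \<one> c" unfolding vdvd_def using subringD(4)[OF vringD(1)[OF assms(1)]] by (metis l_one)
  then show ?case using e by auto
next
  case (Suc n)
  note sV = vringD(1)[OF assms(1)]
  have comp: "\<exists>e''\<in>E. vdvd V (e'' [^] k) (e [^] k) \<and> vdvd V (e'' [^] l) (e' [^] l)" if e: "e \<in> E" "e' \<in> E" for e e' and k l :: nat
  proof -
    have K: "e \<in> carrier K" "e' \<in> carrier K" using e assms(4) by auto
    show ?thesis
      using vdvd_linear[OF assms(1) K] vdvd_pow[OF sV K(1), of e' l] vdvd_pow[OF sV K(2), of e k] 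
        vdvd_refl[OF sV, of "e [^] k"] vdvd_refl[OF sV, of "e' [^] l"] e K by auto
  qed
  from Suc.prems have "c \<in> ideal_prod K (ipw A E n) E" by simp
  then show ?case
  proof induction
    case (prod i j)
    obtain e where e: "e \<in> E" "vdvd V (e [^] n) i" using Suc.IH[OF prod(1)] by blast
    obtain f where f: "f \<in> E" "vdvd V (f [^] n) (e [^] n)" "vdvd V (f [^] (1::nat)) (j [^] (1::nat))" 
      using comp[OF e(1) prod(2)] by blast
    have fK: "f \<in> carrier K" "j \<in> carrier K" using f prod(2) assms(4) by auto
    have "vdvd V (f [^] n) i" using vdvd_trans[OF sV _ f(2) e(2)] fK by simp
    then have "vdvd V (f [^] n \<otimes> f) (i \<otimes> j)" using vdvd_mult[OF sV _ fK(1), of "f [^] n" i j] f(3) fK by simp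
    then show ?case using f(1) by auto
  next
    case (sum s t)
    then obtain e e' where e: "e \<in> E" "vdvd V (e [^] Suc n) s" "e' \<in> E" "vdvd V (e' [^] Suc n) t" by blast
    obtain f where f: "f \<in> E" "vdvd V (f [^] Suc n) (e [^] Suc n)" "vdvd V (f [^] Suc n) (e' [^] Suc n)" 
      using comp[OF e(1,3)] by blast
    have fK: "f [^] Suc n \<in> carrier K" using f assms(4) by auto
    show ?case using f(1) vdvd_add[OF sV fK vdvd_trans[OF sV fK f(2) e(2)] vdvd_trans[OF sV fK f(3) e(4)]] by blast
  qed
qed

lemma nat_pow_carrier_update: "x [^]\<^bsub>K\<lparr>carrier := A\<rparr>\<^esub> (n::nat) = x [^] n"
  unfolding nat_pow_def by simp

lemma finsum_carrier_update:
  assumes "subring A K" "finite I" "\<And>i. i \<in> I \<Longrightarrow> f i \<in> A"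
  shows "finsum (K\<lparr>carrier := A\<rparr>) f I = finsum K f I"
  using assms(2,3)
proof (induction I)
  interpret A: cring "K\<lparr>carrier := A\<rparr>" by (rule cring_subring[OF assms(1)])
  {
    case empty
    then show ?case by simp
  }
  case (insert i I)
  have fA: "f \<in> insert i I \<rightarrow> A" using insert.prems by blast
  then have fK: "f \<in> insert i I \<rightarrow> carrier K" using subringD(1)[OF assms(1)] by blast
  have "finsum (K\<lparr>carrier := A\<rparr>) f (insert i I) = f i \<oplus> finsum (K\<lparr>carrier := A\<rparr>) f I"
    using A.finsum_insert[OF insert(1,2), of f] fA by auto
  also have "\<dots> = f i \<oplus> finsum K f I" using insert by simp
  also have "\<dots> = finsum K f (insert i I)" using finsum_insert[OF insert(1,2), of f] fK by auto
  finally show ?case .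
qed

lemma ideal_closure_int_over:
  assumes "subring A K" "ideal_of A E"
  shows "z \<in> ideal_closure (K\<lparr>carrier := A\<rparr>) E \<longleftrightarrow> z \<in> A \<and> int_over (ipw A E) z"
proof -
  note AA = subringD[OF assms(1)]
  note g = ipw_grading[OF assms]
  note gD = gradingD[OF g]
  show ?thesis
  proof (cases "z \<in> A")
    case False then show ?thesis unfolding ideal_closure_def by simp
  next
    case z: True
    have fs: "(\<Oplus>\<^bsub>K\<lparr>carrier := A\<rparr>\<^esub> i\<in>{1..n}. c i \<otimes> z [^] (n - i)) = (\<Oplus>i\<in>{1..n}. c i \<otimes> z [^] (n - i))"
      if "\<forall>i\<in>{1..n}. c i \<in> ipw A E i" for n and c :: "nat \<Rightarrow> 'a"
    proof (rule finsum_carrier_update[OF assms(1)])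
      fix i assume "i \<in> {1..n}"
      then have "c i \<in> A" using that subsetD[OF ideal_ofD(1)[OF gD(3)]] by blast
      then show "c i \<otimes> z [^] (n - i) \<in> A" using AA(6,9) z by simp
    qed simp
    have "z \<in> ideal_closure (K\<lparr>carrier := A\<rparr>) E \<longleftrightarrow> (\<exists>n\<ge>1. \<exists>c. (\<forall>i\<in>{1..n}. c i \<in> ipw A E i) \<and>
     z [^] n \<oplus> (\<Oplus>\<^bsub>K\<lparr>carrier := A\<rparr>\<^esub> i\<in>{1..n}. c i \<otimes> z [^] (n - i)) = \<zero>)"
      unfolding ideal_closure_def using z by (simp add: nat_pow_carrier_update ipw_eq)
    also have "\<dots> \<longleftrightarrow> int_over (ipw A E) z"
    proof -
      have "(\<forall>i\<in>{1..n}. c i \<in> ipw A E i) \<and> z [^] n \<oplus> (\<Oplus>\<^bsub>K\<lparr>carrier := A\<rparr>\<^esub> i\<in>{1..n}. c i \<otimes> z [^] (n - i)) = \<zero>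
        \<longleftrightarrow> (\<forall>i\<in>{1..n}. c i \<in> ipw A E i) \<and> z [^] n \<oplus> (\<Oplus>i\<in>{1..n}. c i \<otimes> z [^] (n - i)) = \<zero>" 
        for n and c :: "nat \<Rightarrow> 'a"
        by (rule conj_cong[OF refl]) (simp only: fs)
      then show ?thesis unfolding int_over_iff[OF g AA(4)[OF z]] by simp
    qed
    finally show ?thesis using z by simp
  qed
qed

text \<open>If no element of \<open>E\<close> divides \<open>z\<close> in \<open>V\<close>, all
  \<open>e/z\<close> are nonunits, and by \<open>ipw_vdvd\<close> so are the quotients
  \<open>c/z^i\<close> with \<open>c\<close> in \<open>E^i\<close>; this contradicts an integral
  equation. Conversely the ring given by \<open>not_int_over\<close> makes every \<open>e/z\<close>
  a nonunit, by its case \<open>i = 1\<close>.\<close>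

theorem ideal_closure_iff:
  assumes "subring A K" "ideal_of A E"
  shows "z \<in> ideal_closure (K\<lparr>carrier := A\<rparr>) E \<longleftrightarrow>
    z \<in> A \<and> (\<forall>V. vring V \<and> A \<subseteq> V \<longrightarrow> (\<exists>e\<in>E. vdvd V e z))"
proof -
  note AA = subringD[OF assms(1)] and EE = ideal_ofD[OF assms(2)]
  note g = ipw_grading[OF assms]
  note gD = gradingD[OF g]
  have 2: "int_over (ipw A E) z \<longleftrightarrow> (\<forall>V. vring V \<and> A \<subseteq> V \<longrightarrow> (\<exists>e\<in>E. vdvd V e z))" if zA: "z \<in> A"
  proof (cases "z = \<zero>")
    case True
    then show ?thesis using int_over_zero[OF g] vdvd_zero[OF vringD(1) zero_closed] EE(2) by blast
  next
    case False
    have z: "z \<in> carrier K" using AA(4)[OF zA] .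
    have iz: "inv z \<in> carrier K" "inv z \<noteq> \<zero>" using z False by auto
    have EK: "E \<subseteq> carrier K" using EE(1) AA(1) by blast
    show ?thesis
    proof (intro iffI allI impI)
      fix V assume io: "int_over (ipw A E) z" and V: "vring V \<and> A \<subseteq> V"
      note sV = vringD(1)[OF conjunct1[OF V]]
      note N = nonunits_ideal(1)[OF conjunct1[OF V]]
      show "\<exists>e\<in>E. vdvd V e z"
      proof (rule ccontr)
        assume "\<not> (\<exists>e\<in>E. vdvd V e z)"
        then have n: "e \<otimes> inv z \<in> nonunits V" if "e \<in> E" for e 
          using not_vdvd_nonunit(2)[OF conjunct1[OF V] _ z] that EK by blast
        have "c \<otimes> inv z [^] i \<in> nonunits V" if i: "i \<ge> 1" "c \<in> ipw A E i" for i c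
        proof -
          obtain e where e: "e \<in> E" "vdvd V (e [^] i) c" 
            using ipw_vdvd[OF conjunct1[OF V] conjunct2[OF V] _ EK i(2)] EE(2) by blast
          then obtain v where v: "v \<in> V" "c = e [^] i \<otimes> v" unfolding vdvd_def by blast
          have eK: "e \<in> carrier K" "v \<in> carrier K" using e EK v subringD(4)[OF sV] by auto
          obtain j where j: "i = Suc j" using i(1) by (cases i) auto
          have ez: "e \<otimes> inv z \<in> V" using n[OF e(1)] unfolding nonunits_def by blast
          have "c \<otimes> inv z [^] i = v \<otimes> (e \<otimes> inv z) [^] i" 
            unfolding v(2) using eK iz by (simp add: nat_pow_distrib m_ac)
          also have "\<dots> = (v \<otimes> (e \<otimes> inv z) [^] j) \<otimes> (e \<otimes> inv z)"
            unfolding j using eK iz by (simp add: m_assoc)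
          also have "\<dots> \<in> nonunits V"
            using ideal_ofD(4)[OF N _ n[OF e(1)]] subringD(6,9)[OF sV] v(1) ez by simp
          finally show ?thesis .
        qed
        then show False by (rule int_over_contra[OF g z False io conjunct1[OF V]])
      qed
    next
      assume V: "\<forall>V. vring V \<and> A \<subseteq> V \<longrightarrow> (\<exists>e\<in>E. vdvd V e z)"
      show "int_over (ipw A E) z"
      proof (rule ccontr)
        assume "\<not> int_over (ipw A E) z"
        then obtain V where W: "vring V" "A \<subseteq> V" "\<forall>i\<ge>1. \<forall>c\<in>ipw A E i. c \<otimes> inv z [^] i \<in> nonunits V"
          using not_int_over[OF g z False] by blast
        obtain e where e: "e \<in> E" "vdvd V e z" using V W by blast
        have eK: "e \<in> carrier K" using e EK by blast
        have e0: "e \<noteq> \<zero>" using e(2) False subringD(4)[OF vringD(1)[OF W(1)]] unfolding vdvd_def by auto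
        have "e \<in> ipw A E 1" using e(1) ipw_1[OF assms] by blast
        then have "e \<otimes> inv z [^] (1::nat) \<in> nonunits V" using W(3) by blast
        then have "e \<otimes> inv z \<in> nonunits V" using iz by simp
        then show False using vdvd_nonunit[OF W(1) eK z False _ e0] e(2) by blast
      qed
    qed
  qed
  show ?thesis unfolding ideal_closure_int_over[OF assms] using 2 by blast
qed

section \<open>Heights of primes\<close>

text \<open>The contraction to \<open>A\<close> of the extension of \<open>E\<close> to the
  localization at \<open>P\<close>. Local arguments are phrased with it so that they stay among the
  ideals of \<open>A\<close>.\<close>

definition psat :: "'a set \<Rightarrow> 'a set \<Rightarrow> 'a set \<Rightarrow> 'a set" where
  "psat A P E = {a \<in> A. \<exists>s\<in>A. s \<notin> P \<and> s \<otimes> a \<in> E}"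

lemma psatI: "a \<in> A \<Longrightarrow> s \<in> A \<Longrightarrow> s \<notin> P \<Longrightarrow> s \<otimes> a \<in> E \<Longrightarrow> a \<in> psat A P E"
  unfolding psat_def by blast

lemma psat_facts:
  assumes "subring A K" "prime_of A P" "ideal_of A E"
  shows "ideal_of A (psat A P E)" "E \<subseteq> psat A P E" "psat A P (psat A P E) \<subseteq> psat A P E"
proof -
  note A = subringD[OF assms(1)] and P = prime_ofD[OF assms(2)] and E = ideal_ofD[OF assms(3)]
  have out: "s \<otimes> t \<in> A \<and> s \<otimes> t \<notin> P" if "s \<in> A" "s \<notin> P" "t \<in> A" "t \<notin> P" for s t
    using that P(3)[of s t] A(6)[of s t] by blast
  show E': "E \<subseteq> psat A P E"
  proof
    fix a assume a: "a \<in> E"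
    then have "a \<in> A" using E(1) by blast
    then show "a \<in> psat A P E" using psatI[of a A \<one> P E] a A(3,4) P(2) by simp
  qed
  show "psat A P (psat A P E) \<subseteq> psat A P E"
  proof
    fix a assume "a \<in> psat A P (psat A P E)"
    then obtain s t where *: "a \<in> A" "s \<in> A" "s \<notin> P" "t \<in> A" "t \<notin> P" "t \<otimes> (s \<otimes> a) \<in> E"
      unfolding psat_def by blast
    then have "(t \<otimes> s) \<otimes> a \<in> E" using A(4) by (simp add: m_assoc)
    then show "a \<in> psat A P E" using psatI out[of t s] * by blast
  qed
  show "ideal_of A (psat A P E)"
  proof (rule ideal_ofI)
    show "psat A P E \<subseteq> A" unfolding psat_def by blast
    show "\<zero> \<in> psat A P E" using E' E(2) by blast
    fix a b assume "a \<in> psat A P E" "b \<in> psat A P E"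
    then obtain s t where *: "a \<in> A" "s \<in> A" "s \<notin> P" "s \<otimes> a \<in> E" "b \<in> A" "t \<in> A" "t \<notin> P" "t \<otimes> b \<in> E"
      unfolding psat_def by blast
    have "(s \<otimes> t) \<otimes> (a \<oplus> b) = t \<otimes> (s \<otimes> a) \<oplus> s \<otimes> (t \<otimes> b)"
      using * A(4) by (simp add: r_distr m_ac)
    also have "\<dots> \<in> E" using E(3,4) * by simp
    finally show "a \<oplus> b \<in> psat A P E" using psatI[of "a \<oplus> b" A "s \<otimes> t" P E] out[of s t] A(7) * by blast
  next
    fix r a assume r: "r \<in> A" and "a \<in> psat A P E"
    then obtain s where *: "a \<in> A" "s \<in> A" "s \<notin> P" "s \<otimes> a \<in> E" unfolding psat_def by blast
    have "s \<otimes> (r \<otimes> a) = r \<otimes> (s \<otimes> a)" using * r A(4) by (simp add: m_lcomm)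
    then show "r \<otimes> a \<in> psat A P E" using psatI[of "r \<otimes> a" A s P E] * r A(6) E(4) by simp
  qed
qed

lemma psat_mono: "E \<subseteq> F \<Longrightarrow> psat A P E \<subseteq> psat A P F"
  unfolding psat_def by blast

text \<open>In the localization at \<open>P\<close> and modulo \<open>E\<close>, the hypothesis says
  that \<open>c\<close> is nonzero and killed by a power of each element of \<open>P\<close>. A
  multiple of \<open>c\<close> with largest annihilator is killed by \<open>P\<close>
  itself.\<close>

lemma socle_element:
  assumes "noeth A" "prime_of A P" "ideal_of A E" "c \<in> A" "c \<notin> psat A P E"
    and "\<And>e. e \<in> P \<Longrightarrow> \<exists>s\<in>A. \<exists>k::nat. s \<notin> P \<and> s \<otimes> (e [^] k \<otimes> c) \<in> E"
  obtains a where "a \<in> A" "a \<otimes> c \<notin> psat A P E" "\<And>e. e \<in> P \<Longrightarrow> e \<otimes> (a \<otimes> c) \<in> psat A P E"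
proof -
  note sA = noeth_subring[OF assms(1)]
  note A = subringD[OF sA] and P = prime_ofD[OF assms(2)] and E = ideal_ofD[OF assms(3)]
  let ?S = "psat A P E"
  have S: "ideal_of A ?S" by (rule psat_facts(1)[OF sA assms(2,3)])
  note SS = ideal_ofD[OF S]
  have cK: "c \<in> carrier K" using assms(4) A(4) by blast
  define ann where "ann a = {t \<in> A. t \<otimes> (a \<otimes> c) \<in> ?S}" for a
  have annid: "ideal_of A (ann a)" if a: "a \<in> A" for a
  proof (rule ideal_ofI)
    have acK: "a \<otimes> c \<in> carrier K" using a cK A(4) by simp
    show "ann a \<subseteq> A" unfolding ann_def by blast
    show "\<zero> \<in> ann a" unfolding ann_def using A(2) acK SS(2) by simp
    show "s \<oplus> t \<in> ann a" if "s \<in> ann a" "t \<in> ann a" for s t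
      using that acK A(4,7) SS(3) unfolding ann_def by (auto simp: l_distr)
    show "s \<otimes> t \<in> ann a" if "s \<in> A" "t \<in> ann a" for s t
    proof -
      have "(s \<otimes> t) \<otimes> (a \<otimes> c) = s \<otimes> (t \<otimes> (a \<otimes> c))" using that acK A(4) unfolding ann_def by (simp add: m_assoc)
      then show ?thesis using that A(6) SS(4) unfolding ann_def by simp
    qed
  qed
  let ?F = "{ann a | a. a \<in> A \<and> a \<otimes> c \<notin> ?S}"
  have "ann \<one> \<in> ?F" using A(3) assms(5) cK by (intro CollectI exI[of _ \<one>]) simp
  then obtain M where M: "M \<in> ?F" "\<And>N. N \<in> ?F \<Longrightarrow> M \<subseteq> N \<Longrightarrow> N = M"
    using noeth_max[OF assms(1), of _ ?F] annid by blast
  then obtain a where a: "M = ann a" "a \<in> A" "a \<otimes> c \<notin> ?S" by blast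
  have "e \<otimes> (a \<otimes> c) \<in> ?S" if e: "e \<in> P" for e
  proof -
    have eA: "e \<in> A" using e P(4) by blast
    have aK: "a \<in> carrier K" "e \<in> carrier K" using a(2) eA A(4) by auto
    obtain s k where sk: "s \<in> A" "s \<notin> P" "s \<otimes> (e [^] (k::nat) \<otimes> c) \<in> E" using assms(6)[OF e] by blast
    have sK: "s \<in> carrier K" using sk A(4) by blast
    have "s \<otimes> (e [^] k \<otimes> (a \<otimes> c)) = a \<otimes> (s \<otimes> (e [^] k \<otimes> c))" using aK cK sK by (simp add: m_ac)
    then have "s \<otimes> (e [^] k \<otimes> (a \<otimes> c)) \<in> E" using E(4) a(2) sk by simp
    then have ex: "e [^] k \<otimes> (a \<otimes> c) \<in> ?S" using psatI[OF _ sk(1,2)] A(6,9) eA a(2) assms(4) by simp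
    \<comment> \<open>If \<open>l\<close> is the first exponent for which \<open>e^l\<close> kills
      \<open>a c\<close>, then \<open>e^(l-1) a c\<close> is a nonzero multiple whose annihilator
      contains that of \<open>a c\<close> and also \<open>e\<close>. Maximality of the annihilator
      gives \<open>e\<close> back to \<open>a c\<close>.\<close>
    define l where "l = (LEAST l. e [^] (l::nat) \<otimes> (a \<otimes> c) \<in> ?S)"
    have l: "e [^] l \<otimes> (a \<otimes> c) \<in> ?S" unfolding l_def using ex by (rule LeastI[of "\<lambda>l. e [^] (l::nat) \<otimes> (a \<otimes> c) \<in> ?S"])
    have "l \<noteq> 0" using l a aK cK by (cases l) auto
    then obtain j where j: "l = Suc j" by (cases l) auto
    have nj: "e [^] j \<otimes> (a \<otimes> c) \<notin> ?S" using not_less_Least[of j "\<lambda>l. e [^] (l::nat) \<otimes> (a \<otimes> c) \<in> ?S"] j l_def by simp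
    define a' where "a' = e [^] j \<otimes> a"
    have a'A: "a' \<in> A" unfolding a'_def using A(6,9) eA a(2) by simp
    have a'c: "a' \<otimes> c = e [^] j \<otimes> (a \<otimes> c)" unfolding a'_def using aK cK by (simp add: m_assoc)
    have "ann a' \<in> ?F" using a'A nj a'c by auto
    moreover have "M \<subseteq> ann a'"
    proof
      fix t assume t: "t \<in> M"
      then have tA: "t \<in> A" "t \<otimes> (a \<otimes> c) \<in> ?S" unfolding a ann_def by auto
      have "t \<otimes> (a' \<otimes> c) = e [^] j \<otimes> (t \<otimes> (a \<otimes> c))" unfolding a'c using aK cK A(4)[OF tA(1)] by (simp add: m_lcomm)
      then show "t \<in> ann a'" unfolding ann_def using tA SS(4)[OF A(9)[OF eA]] by simp
    qed
    ultimately have "ann a' = M" by (rule M(2))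
    moreover have "e \<otimes> (a' \<otimes> c) = e [^] l \<otimes> (a \<otimes> c)" unfolding a'c j using aK cK by (simp add: m_ac)
    then have "e \<in> ann a'" unfolding ann_def using eA l by simp
    ultimately show ?thesis using a(1) unfolding ann_def by auto
  qed
  then show thesis using that a by blast
qed

text \<open>A descending chain condition in the localization at \<open>P\<close>, replacing the
  notion of finite length. The induction is Noetherian on the lower bound \<open>E\<close>, which is
  enlarged by a socle element taken from the first ideal of the chain.\<close>

lemma local_dcc:
  assumes "noeth A" "prime_of A P" "ideal_of A E" "\<And>n. ideal_of A (C n)" "\<And>n. C (Suc n) \<subseteq> C n" "\<And>n. E \<subseteq> C n"
    and "\<And>c e. c \<in> C 0 \<Longrightarrow> e \<in> P \<Longrightarrow> \<exists>s\<in>A. \<exists>k::nat. s \<notin> P \<and> s \<otimes> (e [^] k \<otimes> c) \<in> E"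
  shows "\<exists>N. \<forall>n\<ge>N. C n \<subseteq> psat A P (C (Suc n))"
proof -
  note sA = noeth_subring[OF assms(1)]
  note A = subringD[OF sA] and P = prime_ofD[OF assms(2)]
  have "ideal_of A E \<longrightarrow> (\<forall>C::nat \<Rightarrow> 'a set. (\<forall>n. ideal_of A (C n)) \<and> (\<forall>n. C (Suc n) \<subseteq> C n) \<and> (\<forall>n. E \<subseteq> C n) \<and>
     (\<forall>c\<in>C 0. \<forall>e\<in>P. \<exists>s\<in>A. \<exists>k::nat. s \<notin> P \<and> s \<otimes> (e [^] k \<otimes> c) \<in> E) \<longrightarrow> (\<exists>N. \<forall>n\<ge>N. C n \<subseteq> psat A P (C (Suc n))))"
    for E
  proof (induction E rule: wf_induct_rule[OF noeth_wf[OF assms(1)]])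
    case (1 E)
    show ?case
    proof (intro impI allI, elim conjE)
      fix C :: "nat \<Rightarrow> 'a set"
      assume E: "ideal_of A E" and C: "\<forall>n. ideal_of A (C n)" "\<forall>n. C (Suc n) \<subseteq> C n" "\<forall>n. E \<subseteq> C n"
        and loc: "\<forall>c\<in>C 0. \<forall>e\<in>P. \<exists>s\<in>A. \<exists>k::nat. s \<notin> P \<and> s \<otimes> (e [^] k \<otimes> c) \<in> E"
      have Ci: "ideal_of A (C n)" for n using C(1) by blast
      have Cm: "C m \<subseteq> C n" if "n \<le> m" for n m using lift_Suc_antimono_le[of C n m] C(2) that by blast
      have satmono: "psat A P E \<subseteq> psat A P (C n)" for n using psat_mono C(3) by blast
      show "\<exists>N. \<forall>n\<ge>N. C n \<subseteq> psat A P (C (Suc n))"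
      proof (cases "C 0 \<subseteq> psat A P E")
        case True
        then have "C n \<subseteq> psat A P (C (Suc n))" for n using Cm[of 0 n] satmono[of "Suc n"] by simp
        then show ?thesis by blast
      next
        case False
        then obtain c where c: "c \<in> C 0" "c \<notin> psat A P E" by blast
        have cA: "c \<in> A" using c(1) ideal_ofD(1)[OF Ci] by blast
        have loc': "\<exists>s\<in>A. \<exists>k::nat. s \<notin> P \<and> s \<otimes> (e [^] k \<otimes> c) \<in> E" if "e \<in> P" for e using loc c(1) that by blast
        obtain a where a: "a \<in> A" "a \<otimes> c \<notin> psat A P E" "\<And>e. e \<in> P \<Longrightarrow> e \<otimes> (a \<otimes> c) \<in> psat A P E"
          using socle_element[OF assms(1,2) E cA c(2) loc'] by blast
        define f where "f = a \<otimes> c"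
        have fC: "f \<in> C 0" unfolding f_def using ideal_ofD(4)[OF Ci a(1) c(1)] .
        have fA: "f \<in> A" using fC ideal_ofD(1)[OF Ci] by blast
        have fK: "f \<in> carrier K" using fA A(4) by blast
        have f: "f \<notin> psat A P E" "\<And>e. e \<in> P \<Longrightarrow> e \<otimes> f \<in> psat A P E" using a unfolding f_def by auto
        \<comment> \<open>Adding the socle element \<open>f\<close> to the lower bound and to every
          member of the chain makes the induction hypothesis applicable.\<close>
        define E' where "E' = plus_gen A E f"
        note E' = plus_gen_ideal[OF sA E fA, folded E'_def]
        define C' where "C' n = plus_gen A (C n) f" for n
        note C' = plus_gen_ideal[OF sA Ci fA, folded C'_def]
        have EE: "E \<subset> E'" using E'(2,3) f(1) psat_facts(2)[OF sA assms(2) E] by blast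
        have "\<exists>N. \<forall>n\<ge>N. C' n \<subseteq> psat A P (C' (Suc n))"
        proof (rule 1[of E', THEN mp, THEN spec, THEN mp])
          show "(E', E) \<in> {(F, E). ideal_of A E \<and> ideal_of A F \<and> E \<subset> F}" using E E'(1) EE by blast
          show "ideal_of A E'" by (rule E'(1))
          have "C' (Suc n) \<subseteq> C' n" for n
            using plus_gen_subset[OF C'(1)[of n] subset_trans[OF spec[OF C(2), of n] C'(2)[of n]] C'(3)[of n]]
            unfolding C'_def by blast
          moreover have "E' \<subseteq> C' n" for n
            unfolding E'_def using plus_gen_subset[OF C'(1)[of n] subset_trans[OF spec[OF C(3)] C'(2)] C'(3)] .
          moreover have "C' 0 \<subseteq> C 0" unfolding C'_def by (rule plus_gen_subset[OF Ci order_refl fC])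
          then have "\<forall>c\<in>C' 0. \<forall>e\<in>P. \<exists>s\<in>A. \<exists>k::nat. s \<notin> P \<and> s \<otimes> (e [^] k \<otimes> c) \<in> E'"
            using loc E'(2) by blast
          ultimately show "(\<forall>n. ideal_of A (C' n)) \<and> (\<forall>n. C' (Suc n) \<subseteq> C' n) \<and> (\<forall>n. E' \<subseteq> C' n) \<and>
            (\<forall>c\<in>C' 0. \<forall>e\<in>P. \<exists>s\<in>A. \<exists>k::nat. s \<notin> P \<and> s \<otimes> (e [^] k \<otimes> c) \<in> E')"
            using C'(1) by blast
        qed
        then obtain N where N: "\<And>n. n \<ge> N \<Longrightarrow> C' n \<subseteq> psat A P (C' (Suc n))" by blast
        have key: "\<exists>s\<in>A. s \<notin> P \<and> (\<exists>t\<in>A. \<exists>d\<in>C (Suc n). s \<otimes> b = d \<oplus> t \<otimes> f)" if "n \<ge> N" "b \<in> C n" for n b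
          using N[OF that(1)] that(2) C'(2)[of n] unfolding psat_def C'_def plus_gen_def by blast
        have Sid: "ideal_of A (psat A P (C n))" for n by (rule psat_facts(1)[OF sA assms(2) Ci])
        have finish: "b \<in> psat A P (C (Suc n))" if "s \<in> A" "s \<notin> P" "b \<in> A" "s \<otimes> b = d \<oplus> w" "d \<in> C (Suc n)" 
            "w \<in> psat A P (C (Suc n))" for b s d w n
        proof -
          have "s \<otimes> b \<in> psat A P (C (Suc n))" unfolding that(4)
            using ideal_ofD(3)[OF Sid] that(6) subsetD[OF psat_facts(2)[OF sA assms(2) Ci] that(5)] by blast
          then show ?thesis using psatI[OF that(3,1,2)] psat_facts(3)[OF sA assms(2) Ci] by blast
        qed
        \<comment> \<open>Modulo \<open>f\<close> the chain is locally stationary; what remains is a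
          multiple \<open>t f\<close>. Either \<open>f\<close> lies locally in every member, or from
          some index on it does not, and then \<open>t f\<close> in the ideal forces
          \<open>t \<in> P\<close>, so that \<open>t f\<close> lies locally in
          \<open>E\<close>.\<close>
        show ?thesis
        proof (cases "\<forall>n. f \<in> psat A P (C n)")
          case True
          have "C n \<subseteq> psat A P (C (Suc n))" if n: "n \<ge> N" for n
          proof
            fix b assume b: "b \<in> C n"
            obtain s t d where *: "s \<in> A" "s \<notin> P" "t \<in> A" "d \<in> C (Suc n)" "s \<otimes> b = d \<oplus> t \<otimes> f" using key[OF n b] by blast
            have "b \<in> A" using b ideal_ofD(1)[OF Ci] by blast
            moreover have "t \<otimes> f \<in> psat A P (C (Suc n))" using ideal_ofD(4)[OF Sid *(3)] True by blast
            ultimately show "b \<in> psat A P (C (Suc n))" using finish * by blast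
          qed
          then show ?thesis by blast
        next
          case False
          then obtain M where M: "f \<notin> psat A P (C M)" by blast
          have "C n \<subseteq> psat A P (C (Suc n))" if n: "n \<ge> max M N" for n
          proof
            fix b assume b: "b \<in> C n"
            obtain s t d where *: "s \<in> A" "s \<notin> P" "t \<in> A" "d \<in> C (Suc n)" "s \<otimes> b = d \<oplus> t \<otimes> f" using key[of n b] b n by auto
            have bA: "b \<in> A" using b ideal_ofD(1)[OF Ci] by blast
            have dC: "d \<in> C n" using *(4) C(2) by blast
            have dK: "d \<in> carrier K" "b \<in> carrier K" "s \<in> carrier K" "t \<in> carrier K"
              using dC ideal_ofD(1)[OF Ci] A(4) bA * by blast+
            have "t \<otimes> f = (s \<otimes> b) \<ominus> d" unfolding *(5) using dK fK by algebra
            then have tf: "t \<otimes> f \<in> C n" using ideal_of_minus(2)[OF sA Ci] ideal_ofD(4)[OF Ci *(1) b] dC by simp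
            have "t \<in> P"
            proof (rule ccontr)
              assume "t \<notin> P"
              then have "f \<in> psat A P (C n)" using psatI[OF fA *(3) _ tf] by blast
              then show False using M psat_mono[OF Cm[of M n]] n by auto
            qed
            then have "t \<otimes> f \<in> psat A P (C (Suc n))" using f(2) satmono by blast
            then show "b \<in> psat A P (C (Suc n))" using finish * bA by blast
          qed
          then show ?thesis by blast
        qed
      qed
    qed
  qed
  then show ?thesis using assms(3-7) by simp
qed

text \<open>Nakayama at \<open>P\<close>: an ideal \<open>M\<close> maximal among those containing
  \<open>N0\<close> but not locally containing \<open>N\<close> reduces the claim to one generator
  \<open>y\<close> modulo \<open>M\<close>. There the hypothesis becomes
  \<open>(t s - p) y \<in> M\<close> with \<open>t s - p\<close> outside \<open>P\<close>.\<close>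

lemma local_nakayama:
  assumes "noeth A" "prime_of A P" "ideal_of A N" "ideal_of A N0"
    and "\<And>a. a \<in> N \<Longrightarrow> \<exists>s\<in>A. s \<notin> P \<and> (\<exists>u\<in>N0. \<exists>w\<in>ideal_prod K P N. s \<otimes> a = u \<oplus> w)"
  shows "N \<subseteq> psat A P N0"
proof (rule ccontr)
  note sA = noeth_subring[OF assms(1)]
  note A = subringD[OF sA] and P = prime_ofD[OF assms(2)]
  assume neg: "\<not> N \<subseteq> psat A P N0"
  let ?F = "{M. ideal_of A M \<and> N0 \<subseteq> M \<and> \<not> N \<subseteq> psat A P M}"
  have N0F: "N0 \<in> ?F" using neg assms(4) by blast
  have Fid: "M \<in> ?F \<Longrightarrow> ideal_of A M" for M by simp
  obtain M where M: "M \<in> ?F" "\<And>M'. M' \<in> ?F \<Longrightarrow> M \<subseteq> M' \<Longrightarrow> M' = M"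
  proof (rule noeth_max[OF assms(1) N0F Fid])
    fix M assume "M \<in> ?F" "\<And>E. E \<in> ?F \<Longrightarrow> M \<subseteq> E \<Longrightarrow> E = M"
    then show thesis by (rule that)
  qed
  have Mi: "ideal_of A M" "N0 \<subseteq> M" using M(1) by auto
  note MM = ideal_ofD[OF Mi(1)]
  obtain y where y: "y \<in> N" "y \<notin> psat A P M" using M(1) by blast
  have yA: "y \<in> A" using y(1) ideal_ofD(1)[OF assms(3)] by blast
  have yK: "y \<in> carrier K" using yA A(4) by blast
  note M' = plus_gen_ideal[OF sA Mi(1) yA]
  have yM: "y \<notin> M" using y(2) psat_facts(2)[OF sA assms(2) Mi(1)] by blast
  then have "plus_gen A M y \<notin> ?F" using M(2)[OF _ M'(2)] M'(3) by blast
  then have NM: "N \<subseteq> psat A P (plus_gen A M y)" using M' Mi by blast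
  have out: "s \<otimes> t \<in> A" "s \<otimes> t \<notin> P" if "s \<in> A" "s \<notin> P" "t \<in> A" "t \<notin> P" for s t
    using that P(3)[of s t] A(6)[of s t] by blast+
  have *: "\<exists>t\<in>A. t \<notin> P \<and> (\<exists>m\<in>M. \<exists>p\<in>P. t \<otimes> w = m \<oplus> p \<otimes> y)" if "w \<in> ideal_prod K P N" for w
    using that
  proof induction
    case (prod p n)
    obtain s where s: "s \<in> A" "s \<notin> P" "s \<otimes> n \<in> plus_gen A M y" using NM prod(2) unfolding psat_def by blast
    then obtain m a where ma: "m \<in> M" "a \<in> A" "s \<otimes> n = m \<oplus> a \<otimes> y" unfolding plus_gen_def by blast
    have pA: "p \<in> A" "n \<in> A" using prod P(4) ideal_ofD(1)[OF assms(3)] by blast+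
    have c: "p \<in> carrier K" "n \<in> carrier K" "s \<in> carrier K" "a \<in> carrier K" "m \<in> carrier K"
      using pA s ma MM(1) A(4) by blast+
    have "s \<otimes> (p \<otimes> n) = p \<otimes> (s \<otimes> n)" using c by (simp add: m_lcomm)
    also have "\<dots> = p \<otimes> m \<oplus> (a \<otimes> p) \<otimes> y" unfolding ma(3) using c yK by (simp add: r_distr m_ac)
    finally have "s \<otimes> (p \<otimes> n) = p \<otimes> m \<oplus> (a \<otimes> p) \<otimes> y" .
    moreover have "p \<otimes> m \<in> M" "a \<otimes> p \<in> P" using MM(4) pA ma P(7) prod(1) by blast+
    ultimately show ?case using s by blast
  next
    case (sum w w')
    then obtain t m p t' m' p' where *: "t \<in> A" "t \<notin> P" "m \<in> M" "p \<in> P" "t \<otimes> w = m \<oplus> p \<otimes> y"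
      "t' \<in> A" "t' \<notin> P" "m' \<in> M" "p' \<in> P" "t' \<otimes> w' = m' \<oplus> p' \<otimes> y" by blast
    have "ideal_prod K P N \<subseteq> carrier K"
      using ideal_prod_carr[of P N] P(4) ideal_ofD(1)[OF assms(3)] A(1) by (meson order_trans)
    then have c: "w \<in> carrier K" "w' \<in> carrier K" using sum by blast+
    have c2: "t \<in> carrier K" "t' \<in> carrier K" "m \<in> carrier K" "m' \<in> carrier K" "p \<in> carrier K" "p' \<in> carrier K"
      using * A(4) MM(1) P(4) by blast+
    have "(t \<otimes> t') \<otimes> (w \<oplus> w') = t' \<otimes> (t \<otimes> w) \<oplus> t \<otimes> (t' \<otimes> w')" using c c2 by (simp add: r_distr m_ac)
    also have "\<dots> = (t' \<otimes> m \<oplus> t \<otimes> m') \<oplus> (t' \<otimes> p \<oplus> t \<otimes> p') \<otimes> y" unfolding *(5,10) using c2 yK by algebra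
    finally have "(t \<otimes> t') \<otimes> (w \<oplus> w') = (t' \<otimes> m \<oplus> t \<otimes> m') \<oplus> (t' \<otimes> p \<oplus> t \<otimes> p') \<otimes> y" .
    moreover have "t' \<otimes> m \<oplus> t \<otimes> m' \<in> M" "t' \<otimes> p \<oplus> t \<otimes> p' \<in> P" using MM(3,4) P(6,7) * by simp_all
    ultimately show ?case using out[of t t'] * by blast
  qed
  obtain s u w where suw: "s \<in> A" "s \<notin> P" "u \<in> N0" "w \<in> ideal_prod K P N" "s \<otimes> y = u \<oplus> w" using assms(5)[OF y(1)] by blast
  obtain t m p where tmp: "t \<in> A" "t \<notin> P" "m \<in> M" "p \<in> P" "t \<otimes> w = m \<oplus> p \<otimes> y" using *[OF suw(4)] by blast
  have uM: "u \<in> M" using suw(3) Mi(2) by blast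
  have "ideal_prod K P N \<subseteq> carrier K"
    using ideal_prod_carr[of P N] P(4) ideal_ofD(1)[OF assms(3)] A(1) by (meson order_trans)
  then have c: "s \<in> carrier K" "t \<in> carrier K" "u \<in> carrier K" "w \<in> carrier K" "m \<in> carrier K" "p \<in> carrier K"
    using suw tmp A(4) uM MM(1) P(4) by blast+
  have pA: "p \<in> A" using tmp(4) P(4) by blast
  have "(t \<otimes> s \<ominus> p) \<otimes> y = t \<otimes> (s \<otimes> y) \<ominus> p \<otimes> y" using c yK by algebra
  also have "\<dots> = t \<otimes> u \<oplus> (t \<otimes> w \<ominus> p \<otimes> y)" unfolding suw(5) using c yK by algebra
  also have "\<dots> = t \<otimes> u \<oplus> m" unfolding tmp(5) using c yK by algebra
  finally have e: "(t \<otimes> s \<ominus> p) \<otimes> y \<in> M" using MM(3,4) uM tmp by simp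
  have "t \<otimes> s \<ominus> p \<notin> P"
  proof
    assume "t \<otimes> s \<ominus> p \<in> P"
    then have "(t \<otimes> s \<ominus> p) \<oplus> p \<in> P" using P(6) tmp(4) by blast
    moreover have "(t \<otimes> s \<ominus> p) \<oplus> p = t \<otimes> s" using c by algebra
    ultimately show False using out(2)[of t s] suw tmp by simp
  qed
  then have "y \<in> psat A P M" using psatI[OF yA _ _ e] A(6,8) suw tmp pA by simp
  then show False using y(2) by blast
qed

section \<open>Krull's principal ideal theorem\<close>

definition isum :: "'a set \<Rightarrow> 'a set \<Rightarrow> 'a set" where
  "isum E F = {e \<oplus> f | e f. e \<in> E \<and> f \<in> F}"

lemma isum_ideal:
  assumes "subring A K" "ideal_of A E" "ideal_of A F"
  shows "ideal_of A (isum E F)" "E \<subseteq> isum E F" "F \<subseteq> isum E F"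
proof -
  note A = subringD[OF assms(1)] and E = ideal_ofD[OF assms(2)] and F = ideal_ofD[OF assms(3)]
  have EK: "e \<in> carrier K" if "e \<in> E" for e using that E(1) A(4) by blast
  have FK: "e \<in> carrier K" if "e \<in> F" for e using that F(1) A(4) by blast
  show "E \<subseteq> isum E F"
  proof
    fix e assume e: "e \<in> E"
    then have "e = e \<oplus> \<zero>" using EK by simp
    then show "e \<in> isum E F" unfolding isum_def using e F(2) by blast
  qed
  show "F \<subseteq> isum E F"
  proof
    fix e assume e: "e \<in> F"
    then have "e = \<zero> \<oplus> e" using FK by simp
    then show "e \<in> isum E F" unfolding isum_def using e E(2) by blast
  qed
  show "ideal_of A (isum E F)"
  proof (rule ideal_ofI)
    show "isum E F \<subseteq> A" unfolding isum_def using E(1) F(1) A(7) by blast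
    have "\<zero> = \<zero> \<oplus> \<zero>" by simp
    then show "\<zero> \<in> isum E F" unfolding isum_def using E(2) F(2) by blast
    fix a b assume "a \<in> isum E F" "b \<in> isum E F"
    then obtain e f e' f' where *: "a = e \<oplus> f" "b = e' \<oplus> f'" "e \<in> E" "e' \<in> E" "f \<in> F" "f' \<in> F" unfolding isum_def by blast
    have "a \<oplus> b = (e \<oplus> e') \<oplus> (f \<oplus> f')" using * EK FK by (simp add: a_ac)
    moreover have "e \<oplus> e' \<in> E" "f \<oplus> f' \<in> F" using * E(3) F(3) by simp_all
    ultimately show "a \<oplus> b \<in> isum E F" unfolding isum_def by blast
  next
    fix s a assume s: "s \<in> A" and "a \<in> isum E F"
    then obtain e f where *: "a = e \<oplus> f" "e \<in> E" "f \<in> F" unfolding isum_def by blast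
    have "s \<otimes> a = s \<otimes> e \<oplus> s \<otimes> f" using * EK FK A(4)[OF s] by (simp add: r_distr)
    moreover have "s \<otimes> e \<in> E" "s \<otimes> f \<in> F" using * s E(4) F(4) by simp_all
    ultimately show "s \<otimes> a \<in> isum E F" unfolding isum_def by blast
  qed
qed

lemma ideal_prod_comm:
  assumes "E \<subseteq> carrier K" "F \<subseteq> carrier K"
  shows "ideal_prod K E F \<subseteq> ideal_prod K F E"
proof
  fix w assume "w \<in> ideal_prod K E F" then show "w \<in> ideal_prod K F E"
  proof induction
    case (prod i j)
    then have "i \<otimes> j = j \<otimes> i" using assms by (meson m_comm subsetD)
    then show ?case using ideal_prod.prod[OF prod(2,1)] by simp
  next
    case (sum s t) then show ?case by (intro ideal_prod.sum)
  qed
qed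

text \<open>The contrapositive of the principal ideal theorem modulo \<open>Q1\<close>: since
  \<open>P\<close> has the chain \<open>Q1 \<subset> Q2 \<subset> P\<close> below it, it cannot be
  minimal over \<open>Q1\<close> and \<open>y\<close>. This form supplies the replacement prime
  needed to move \<open>y\<close> down a chain.\<close>

theorem krull_principal_ideal:
  assumes "noeth A" "prime_of A Q1" "prime_of A Q2" "prime_of A P" "Q1 \<subset> Q2" "Q2 \<subset> P" "y \<in> P"
  obtains P' where "prime_of A P'" "Q1 \<subseteq> P'" "y \<in> P'" "P' \<subset> P"
proof (rule ccontr)
  assume "\<not> thesis"
  then have no: "\<not> (prime_of A P' \<and> Q1 \<subseteq> P' \<and> y \<in> P' \<and> P' \<subset> P)" for P' using that by blast
  note sA = noeth_subring[OF assms(1)]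
  note A = subringD[OF sA]
  note P = prime_ofD[OF assms(4)] and Q1 = prime_ofD[OF assms(2)] and Q2 = prime_ofD[OF assms(3)]
  have yA: "y \<in> A" using assms(7) P(4) by blast
  have yK: "y \<in> carrier K" using A(4)[OF yA] .
  have yQ: "y \<notin> Q2" using no[of Q2] assms by blast
  define B where "B = plus_gen A Q1 y"
  note B = plus_gen_ideal[OF sA Q1(1) yA, folded B_def]
  \<comment> \<open>If no prime lies strictly below \<open>P\<close> over \<open>B\<close>, each
    \<open>e \<in> P\<close> is locally nilpotent modulo \<open>B\<close>: otherwise a prime over
    \<open>B\<close> avoids the products of powers of \<open>e\<close> with elements outside
    \<open>P\<close>, and it is strictly smaller than \<open>P\<close>.\<close>
  have H: "\<exists>s\<in>A. \<exists>k::nat. s \<notin> P \<and> s \<otimes> e [^] k \<in> B" if e: "e \<in> P" for e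
  proof (rule ccontr)
    assume neg: "\<not> ?thesis"
    have eA: "e \<in> A" using e P(4) by blast
    have eK: "e \<in> carrier K" using A(4)[OF eA] .
    let ?S = "{s \<otimes> e [^] (k::nat) | s k. s \<in> A \<and> s \<notin> P}"
    have inS: "s \<otimes> e [^] (k::nat) \<in> ?S" if "s \<in> A" "s \<notin> P" for s k using that by blast
    obtain P' where P': "prime_of A P'" "B \<subseteq> P'" "P' \<inter> ?S = {}"
    proof (rule prime_avoiding[OF assms(1) B(1), of ?S])
      show "B \<inter> ?S = {}" using neg by blast
      show "?S \<subseteq> A" using A(6,9) eA by blast
      show "\<one> \<in> ?S" using inS[of \<one> 0] A(3) P(2) by simp
      fix a b assume "a \<in> ?S" "b \<in> ?S"
      then obtain s t k l where *: "a = s \<otimes> e [^] (k::nat)" "b = t \<otimes> e [^] (l::nat)" "s \<in> A" "s \<notin> P" "t \<in> A" "t \<notin> P" by blast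
      have "a \<otimes> b = (s \<otimes> t) \<otimes> (e [^] k \<otimes> e [^] l)" using * eK A(4) by (simp add: m_ac)
      also have "\<dots> = (s \<otimes> t) \<otimes> e [^] (k + l)" using eK by (simp add: nat_pow_mult)
      finally have ab: "a \<otimes> b = (s \<otimes> t) \<otimes> e [^] (k + l)" .
      have "s \<otimes> t \<in> A" "s \<otimes> t \<notin> P" using A(6) P(3)[of s t] * by blast+
      then show "a \<otimes> b \<in> ?S" unfolding ab by (rule inS)
    qed
    have "P' \<subseteq> P"
    proof
      fix s assume s: "s \<in> P'"
      then have sA: "s \<in> A" using prime_ofD(4)[OF P'(1)] by blast
      have "s \<otimes> e [^] (0::nat) = s" using A(4)[OF sA] by simp
      then show "s \<in> P" using inS[OF sA, of 0] P'(3) s by auto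
    qed
    moreover have "e \<notin> P'" using inS[OF A(3) P(2), of 1] P'(3) eK by auto
    ultimately have "P' \<subset> P" using e by blast
    moreover have "Q1 \<subseteq> P'" "y \<in> P'" using B P'(2) by blast+
    ultimately show False using no[of P'] P'(1) by blast
  qed
  define D where "D n = ipw A Q2 n" for n
  have Di: "ideal_of A (D n)" for n unfolding D_def by (rule ipw_ideal[OF sA Q2(1)])
  have Dm: "D (Suc n) \<subseteq> D n" for n unfolding D_def by (rule ipw_antimono[OF sA Q2(1)]) simp
  \<comment> \<open>The symbolic powers of \<open>Q2\<close> modulo \<open>Q1\<close>. Because they
    are saturated at \<open>Q2\<close> and \<open>y \<notin> Q2\<close>, from
    \<open>t y \<in> S n\<close> one may conclude \<open>t \<in> S n\<close>.\<close>
  define S where "S n = psat A Q2 (isum (D n) Q1)" for n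
  have Si: "ideal_of A (S n)" for n unfolding S_def by (rule psat_facts(1)[OF sA assms(3) isum_ideal(1)[OF sA Di Q1(1)]])
  have DS: "D n \<subseteq> S n" "Q1 \<subseteq> S n" for n
    unfolding S_def using isum_ideal(2,3)[OF sA Di Q1(1)] psat_facts(2)[OF sA assms(3) isum_ideal(1)[OF sA Di Q1(1)]] by blast+
  have Sm: "S (Suc n) \<subseteq> S n" for n unfolding S_def isum_def using Dm[of n] unfolding psat_def by blast
  have SA: "a \<in> A" if "a \<in> S n" for a n using that ideal_ofD(1)[OF Si] by blast
  define C where "C n = plus_gen A (S n) y" for n
  note C = plus_gen_ideal[OF sA Si yA, folded C_def]
  have "\<exists>N. \<forall>n\<ge>N. C n \<subseteq> psat A P (C (Suc n))"
  proof (rule local_dcc[OF assms(1,4) B(1)])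
    show "ideal_of A (C n)" for n by (rule C(1))
    show "C (Suc n) \<subseteq> C n" for n
      using plus_gen_subset[OF C(1)[of n] subset_trans[OF Sm C(2)] C(3)] unfolding C_def .
    show "B \<subseteq> C n" for n
      using plus_gen_subset[OF C(1)[of n] subset_trans[OF DS(2) C(2)] C(3)] unfolding B_def .
    fix c e assume c: "c \<in> C 0" and e: "e \<in> P"
    have cA: "c \<in> A" using c ideal_ofD(1)[OF C(1)] by blast
    obtain s k where sk: "s \<in> A" "s \<notin> P" "s \<otimes> e [^] (k::nat) \<in> B" using H[OF e] by blast
    have eK: "e \<in> carrier K" using e P(4) A(4) by blast
    have "s \<otimes> (e [^] k \<otimes> c) = c \<otimes> (s \<otimes> e [^] k)" using A(4) cA sk eK by (simp add: m_ac)
    then have "s \<otimes> (e [^] k \<otimes> c) \<in> B" using ideal_ofD(4)[OF B(1) cA sk(3)] by simp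
    then show "\<exists>s\<in>A. \<exists>k::nat. s \<notin> P \<and> s \<otimes> (e [^] k \<otimes> c) \<in> B" using sk by blast
  qed
  then obtain n where n: "C n \<subseteq> psat A P (C (Suc n))" by blast
  have out2: "s \<otimes> t \<in> A" "s \<otimes> t \<notin> Q2" if "s \<in> A" "s \<notin> Q2" "t \<in> A" "t \<notin> Q2" for s t
    using that Q2(3)[of s t] A(6)[of s t] by blast+
  \<comment> \<open>The chain condition gives \<open>S n\<close> inside \<open>S (n+1) + y A\<close>
    locally, and the coefficient of \<open>y\<close> lies in \<open>S n\<close>. Since
    \<open>y \<in> P\<close>, Nakayama at \<open>P\<close> removes this term.\<close>
  have "S n \<subseteq> psat A P (S (Suc n))"
  proof (rule local_nakayama[OF assms(1,4) Si Si])
    fix a assume a: "a \<in> S n"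
    then have "a \<in> psat A P (C (Suc n))" using n C(2) by blast
    then obtain s u t where *: "s \<in> A" "s \<notin> P" "u \<in> S (Suc n)" "t \<in> A" "s \<otimes> a = u \<oplus> t \<otimes> y"
      unfolding psat_def C_def plus_gen_def by blast
    have uS: "u \<in> S n" using *(3) Sm by blast
    have c: "s \<in> carrier K" "a \<in> carrier K" "u \<in> carrier K" "t \<in> carrier K" 
      using * A(4) SA[OF a] SA[OF uS] by blast+
    have "t \<otimes> y = s \<otimes> a \<ominus> u" unfolding *(5) using c yK by algebra
    then have "t \<otimes> y \<in> S n" using ideal_of_minus(2)[OF sA Si] ideal_ofD(4)[OF Si *(1) a] uS by simp
    then obtain r where r: "r \<in> A" "r \<notin> Q2" "r \<otimes> (t \<otimes> y) \<in> isum (D n) Q1" unfolding S_def psat_def by blast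
    have "r \<otimes> (t \<otimes> y) = (r \<otimes> y) \<otimes> t" using A(4)[OF r(1)] c yK by (simp add: m_ac)
    then have tS: "t \<in> S n" unfolding S_def using psatI[OF *(4) out2[OF r(1,2) yA yQ]] r(3) by simp
    have "t \<otimes> y = y \<otimes> t" using c yK by (simp add: m_comm)
    then have "t \<otimes> y \<in> ideal_prod K P (S n)" using ideal_prod.prod[OF assms(7) tS] by simp
    then show "\<exists>s\<in>A. s \<notin> P \<and> (\<exists>u\<in>S (Suc n). \<exists>w\<in>ideal_prod K P (S n). s \<otimes> a = u \<oplus> w)" using * by blast
  qed
  also have "\<dots> \<subseteq> psat A Q2 (S (Suc n))" unfolding psat_def[of A P] psat_def[of A Q2 "S (Suc n)"] using assms(6) by blast
  also have "\<dots> \<subseteq> S (Suc n)"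
    unfolding S_def by (rule psat_facts(3)[OF sA assms(3) isum_ideal(1)[OF sA Di Q1(1)]])
  finally have SS: "S n \<subseteq> S (Suc n)" .
  \<comment> \<open>Equality of consecutive symbolic powers reads \<open>Q2^n\<close> inside
    \<open>Q1 + Q2 Q2^n\<close> locally at \<open>Q2\<close>, so a second use of Nakayama leaves
    only \<open>Q1\<close>. Hence a power of each element of \<open>Q2\<close> is in
    \<open>Q1\<close>, and the two primes coincide.\<close>
  have "D n \<subseteq> psat A Q2 Q1"
  proof (rule local_nakayama[OF assms(1,3) Di Q1(1)])
    fix a assume a: "a \<in> D n"
    then have "a \<in> S (Suc n)" using SS DS(1) by blast
    then obtain s w q where *: "s \<in> A" "s \<notin> Q2" "w \<in> D (Suc n)" "q \<in> Q1" "s \<otimes> a = w \<oplus> q"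
      unfolding S_def psat_def isum_def by blast
    have sub: "D n \<subseteq> carrier K" "Q2 \<subseteq> carrier K" using ideal_ofD(1)[OF Di] Q2(4) A(1) by blast+
    have "w \<in> ideal_prod K Q2 (D n)" using *(3) ideal_prod_comm[OF sub] unfolding D_def by auto
    moreover have "s \<otimes> a = q \<oplus> w"
    proof -
      have "w \<in> carrier K" "q \<in> carrier K" using *(3,4) ideal_ofD(1)[OF Di] Q1(4) A(1) by blast+
      then show ?thesis unfolding *(5) by (rule a_comm)
    qed
    ultimately show "\<exists>s\<in>A. s \<notin> Q2 \<and> (\<exists>u\<in>Q1. \<exists>w\<in>ideal_prod K Q2 (D n). s \<otimes> a = u \<oplus> w)" using * by blast
  qed
  have "Q2 \<subseteq> Q1"
  proof
    fix e assume e: "e \<in> Q2"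
    have eA: "e \<in> A" using e Q2(4) by blast
    have "e [^] n \<in> D n" unfolding D_def using ipw_pow[OF sA Q2(1), of e 1 n] e ipw_1[OF sA Q2(1)] by simp
    then obtain s where s: "s \<in> A" "s \<notin> Q2" "s \<otimes> e [^] n \<in> Q1" using \<open>D n \<subseteq> psat A Q2 Q1\<close> unfolding psat_def by blast
    then have "e [^] n \<in> Q1" using Q1(3)[OF s(1) A(9)[OF eA] s(3)] assms(5) by blast
    then show "e \<in> Q1" using prime_of_pow[OF sA assms(2) eA] by blast
  qed
  then show False using assms(5) by blast
qed

section \<open>Prime chains and the height theorem\<close>

inductive pch :: "'a set \<Rightarrow> nat \<Rightarrow> 'a set \<Rightarrow> 'a set \<Rightarrow> bool" for A where
  base: "prime_of A P \<Longrightarrow> pch A 0 P P"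
| step: "pch A n P Q \<Longrightarrow> prime_of A Q' \<Longrightarrow> Q \<subset> Q' \<Longrightarrow> pch A (Suc n) P Q'"

lemma pch_prime: "pch A n P Q \<Longrightarrow> prime_of A P \<and> prime_of A Q \<and> P \<subseteq> Q \<and> (n > 0 \<longrightarrow> P \<noteq> Q)"
  by (induction rule: pch.induct) auto

lemma pch_Suc:
  assumes "pch A (Suc n) P Q"
  shows "\<exists>Q1. pch A n P Q1 \<and> prime_of A Q \<and> Q1 \<subset> Q"
  using assms by (cases rule: pch.cases) blast

text \<open>Any element of the top prime can be moved to the bottom of a chain at the cost of one
  link.\<close>

lemma pch_shift:
  assumes "noeth A" "pch A (Suc n) P Q" "y \<in> Q"
  shows "\<exists>P'. pch A n P' Q \<and> P \<subseteq> P' \<and> y \<in> P'"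
  using assms(2,3)
proof (induction n arbitrary: Q)
  case 0
  then obtain Q1 where Q1: "pch A 0 P Q1" "prime_of A Q" "Q1 \<subset> Q" using pch_Suc by blast
  have "P \<subseteq> Q" using pch_prime[OF Q1(1)] Q1(3) by blast
  then show ?case using pch.base[OF Q1(2)] 0(2) by blast
next
  case (Suc k)
  obtain Q1 where Q1: "pch A (Suc k) P Q1" "prime_of A Q" "Q1 \<subset> Q" using pch_Suc[OF Suc.prems(1)] by blast
  show ?case
  proof (cases "y \<in> Q1")
    case True
    then obtain P' where "pch A k P' Q1" "P \<subseteq> P'" "y \<in> P'" using Suc.IH[OF Q1(1)] by blast
    then show ?thesis using pch.step[OF _ Q1(2,3)] by blast
  next
    case False
    obtain Q2 where Q2: "pch A k P Q2" "prime_of A Q1" "Q2 \<subset> Q1" using pch_Suc[OF Q1(1)] by blast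
    obtain P'' where P'': "prime_of A P''" "Q2 \<subseteq> P''" "y \<in> P''" "P'' \<subset> Q"
      using krull_principal_ideal[OF assms(1) _ Q2(2) Q1(2) Q2(3) Q1(3) Suc.prems(2)] pch_prime[OF Q2(1)] by blast
    \<comment> \<open>The prime \<open>P''\<close> replaces \<open>Q1\<close> in the chain. The
      inclusion is strict because \<open>y\<close> lies in \<open>P''\<close> and, with
      \<open>Q2\<close> below \<open>Q1\<close>, not in \<open>Q2\<close>.\<close>
    have "Q2 \<subset> P''" using P''(2,3) False Q2(3) by blast
    then have "pch A (Suc k) P P''" using pch.step[OF Q2(1) P''(1)] by blast
    then obtain P' where "pch A k P' P''" "P \<subseteq> P'" "y \<in> P'" using Suc.IH[OF _ P''(3)] by blast
    then show ?thesis using pch.step[OF _ Q1(2) P''(4)] by blast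
  qed
qed

lemma gens_mono: "E \<subseteq> F \<Longrightarrow> gens A E ys \<subseteq> gens A F ys"
proof (induction ys arbitrary: E F)
  case (Cons y ys)
  have "plus_gen A E y \<subseteq> plus_gen A F y" using Cons.prems unfolding plus_gen_def by blast
  then show ?case using Cons.IH by simp
qed simp

text \<open>Each generator uses up one link by \<open>pch_shift\<close>. When none is left, the
  hypothesis says that \<open>Q\<close> is the radical of \<open>P\<close> locally at
  \<open>Q\<close>, so the chain has length zero.\<close>

theorem krull_height:
  assumes "noeth A" "pch A k P Q" "set ys \<subseteq> Q" "\<And>e. e \<in> Q \<Longrightarrow> \<exists>s\<in>A. \<exists>j::nat. s \<notin> Q \<and> s \<otimes> e [^] j \<in> gens A P ys"
  shows "k \<le> length ys"
  using assms(2-4)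
proof (induction ys arbitrary: k P)
  case Nil
  note sA = noeth_subring[OF assms(1)]
  note A = subringD[OF sA]
  have pr: "prime_of A P" "prime_of A Q" "P \<subseteq> Q" using pch_prime[OF Nil(1)] by auto
  have "Q \<subseteq> P"
  proof
    fix e assume e: "e \<in> Q"
    have eA: "e \<in> A" using e prime_ofD(4)[OF pr(2)] by blast
    obtain s j where s: "s \<in> A" "s \<notin> Q" "s \<otimes> e [^] (j::nat) \<in> P" using Nil(3)[OF e] by auto
    then have "e [^] j \<in> P" using prime_ofD(3)[OF pr(1) s(1) A(9)[OF eA] s(3)] pr(3) by blast
    then show "e \<in> P" using prime_of_pow[OF sA pr(1) eA] by blast
  qed
  then show ?case using pch_prime[OF Nil(1)] by auto
next
  case (Cons y ys)
  show ?case
  proof (cases k)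
    case (Suc n)
    then obtain P' where P': "pch A n P' Q" "P \<subseteq> P'" "y \<in> P'" using pch_shift[OF assms(1)] Cons.prems by fastforce
    have "plus_gen A P y \<subseteq> P'" using plus_gen_subset[OF _ P'(2,3)] prime_ofD(1) pch_prime[OF P'(1)] by blast
    then have "gens A P (y # ys) \<subseteq> gens A P' ys" using gens_mono by simp
    then have "n \<le> length ys" using Cons.IH[OF P'(1)] Cons.prems(2,3) by (meson set_subset_Cons order_trans subsetD)
    then show ?thesis using Suc by simp
  qed simp
qed

lemma prime_chain_pch:
  assumes "subring A K" "prime_chain (K\<lparr>carrier := A\<rparr>) n P"
  shows "pch A n (P 0) (P n)"
proof -
  have "i \<le> n \<Longrightarrow> pch A i (P 0) (P i)" for i
  proof (induction i)
    case 0 then show ?case using assms prime_of_iff[OF assms(1)] unfolding prime_chain_def by (auto intro: pch.base)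
  next
    case (Suc i)
    then have "prime_of A (P (Suc i))" "P i \<subset> P (Suc i)" using assms prime_of_iff[OF assms(1)] unfolding prime_chain_def by auto
    then show ?case using pch.step Suc by simp
  qed
  then show ?thesis by simp
qed

section \<open>The order valuation of a regular local ring\<close>

text \<open>The last clause says that \<open>p\<close> can be recovered from the remainder and the
  quotient, so it transports vanishing modulo \<open>M\<close>. Truncated subtraction gives the
  empty list the empty quotient.\<close>

lemma synthetic_division:
  assumes "subring A K" "ideal_of A M" "set p \<subseteq> A" "s \<in> A"
  shows "\<exists>q. set q \<subseteq> A \<and> length q = length p - 1 \<and> (\<forall>t\<in>A. pev p t = pev p s \<oplus> (t \<ominus> s) \<otimes> pev q t) \<and>
    (set q \<subseteq> M \<and> pev p s \<in> M \<longrightarrow> set p \<subseteq> M)"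
  using assms(3)
proof (induction p)
  note A = subringD[OF assms(1)]
  case Nil
  have "t \<ominus> s \<in> carrier K" if "t \<in> A" for t using A(4) that assms(4) by simp
  then show ?case by (intro exI[of _ "[]"]) simp
next
  note A = subringD[OF assms(1)] and M = ideal_ofD[OF assms(2)]
  have sK: "s \<in> carrier K" using assms(4) A(4) by blast
  case (Cons c p)
  then have cp: "c \<in> A" "set p \<subseteq> A" by auto
  then have pK: "c \<in> carrier K" "set p \<subseteq> carrier K" using A(1) by auto
  show ?case
  proof (cases "p = []")
    case True
    have "pev [c] t = pev [c] s \<oplus> (t \<ominus> s) \<otimes> pev [] t" if "t \<in> A" for t
      using pK(1) sK A(4)[OF that] by simp
    then show ?thesis using True pK sK by (intro exI[of _ "[]"]) simp
  next
    case False
    obtain q where q: "set q \<subseteq> A" "length q = length p - 1" "\<And>t. t \<in> A \<Longrightarrow> pev p t = pev p s \<oplus> (t \<ominus> s) \<otimes> pev q t"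
      "set q \<subseteq> M \<and> pev p s \<in> M \<longrightarrow> set p \<subseteq> M" using Cons by auto
    have ps: "pev p s \<in> A" using pev_in[OF assms(1) cp(2) assms(4)] .
    have qK: "set q \<subseteq> carrier K" using q(1) A(1) by blast
    let ?q = "pev p s # q"
    have "pev (c # p) t = pev (c # p) s \<oplus> (t \<ominus> s) \<otimes> pev ?q t" if t: "t \<in> A" for t
    proof -
      have tK: "t \<in> carrier K" using A(4)[OF t] .
      have k: "pev p s \<in> carrier K" "pev q t \<in> carrier K" using pK qK sK tK by auto
      have "pev (c # p) t = c \<oplus> t \<otimes> (pev p s \<oplus> (t \<ominus> s) \<otimes> pev q t)" using q(3)[OF t] by simp
      also have "\<dots> = (c \<oplus> s \<otimes> pev p s) \<oplus> (t \<ominus> s) \<otimes> (pev p s \<oplus> t \<otimes> pev q t)"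
        using k tK sK pK(1) by algebra
      finally show ?thesis by simp
    qed
    moreover have "set (c # p) \<subseteq> M" if h: "set ?q \<subseteq> M" "pev (c # p) s \<in> M"
    proof -
      have pM: "set p \<subseteq> M" "pev p s \<in> M" using h(1) q(4) by auto
      have psK: "pev p s \<in> carrier K" using pK sK by simp
      have "c = pev (c # p) s \<ominus> s \<otimes> pev p s" unfolding pev.simps using psK pK(1) sK by algebra
      then have "c \<in> M" using ideal_of_minus(2)[OF assms(1,2) h(2) M(4)[OF assms(4) pM(2)]] by simp
      then show ?thesis using pM by simp
    qed
    moreover have "length ?q = length (c # p) - 1" using q(2) False by (cases p) auto
    ultimately show ?thesis using q(1) ps by (intro exI[of _ ?q]) auto
  qed
qed

text \<open>The elements of \<open>T\<close> are pairwise incongruent modulo the prime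
  \<open>M\<close>. Infinitely many roots of \<open>p\<close> leave infinitely many roots of its
  quotient by a linear factor, so by induction on the length all coefficients lie in
  \<open>M\<close>.\<close>

lemma finite_roots_mod:
  assumes "subring A K" "prime_of A M" "T \<subseteq> A" "\<And>s t. s \<in> T \<Longrightarrow> t \<in> T \<Longrightarrow> s \<noteq> t \<Longrightarrow> s \<ominus> t \<notin> M"
    and "set p \<subseteq> A" "\<not> set p \<subseteq> M"
  shows "finite {s \<in> T. pev p s \<in> M}"
proof -
  note A = subringD[OF assms(1)] and M = prime_ofD[OF assms(2)]
  have "set p \<subseteq> M" if "infinite S" "S \<subseteq> T" "set p \<subseteq> A" "\<And>s. s \<in> S \<Longrightarrow> pev p s \<in> M" for p S
    using that
  proof (induction "length p" arbitrary: p S)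
    case 0 then show ?case by simp
  next
    case (Suc n)
    obtain s where s: "s \<in> S" using Suc.prems(1) by (metis finite.emptyI ex_in_conv)
    have sA: "s \<in> A" using s Suc.prems(2) assms(3) by blast
    obtain q where q: "set q \<subseteq> A" "length q = length p - 1" "\<And>t. t \<in> A \<Longrightarrow> pev p t = pev p s \<oplus> (t \<ominus> s) \<otimes> pev q t"
      "set q \<subseteq> M \<and> pev p s \<in> M \<longrightarrow> set p \<subseteq> M"
      using synthetic_division[OF assms(1) M(1) Suc.prems(3) sA] by blast
    have "set q \<subseteq> M"
    proof (rule Suc.hyps(1)[of q "S - {s}"])
      show "n = length q" using q(2) Suc.hyps(2) by simp
      show "infinite (S - {s})" using Suc.prems(1) by simp
      show "S - {s} \<subseteq> T" using Suc.prems(2) by blast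
      show "set q \<subseteq> A" by (rule q(1))
      fix t assume t: "t \<in> S - {s}"
      have tA: "t \<in> A" using t Suc.prems(2) assms(3) by blast
      have k: "pev p s \<in> A" "pev q t \<in> A" "pev p t \<in> A" using pev_in[OF assms(1)] Suc.prems(3) q(1) tA sA by blast+
      have kK: "pev p s \<in> carrier K" "pev q t \<in> carrier K" "t \<in> carrier K" "s \<in> carrier K" using k tA sA A(4) by blast+
      have "(t \<ominus> s) \<otimes> pev q t = pev p t \<ominus> pev p s" unfolding q(3)[OF tA] using kK by algebra
      moreover have "pev p t \<ominus> pev p s \<in> M" using ideal_of_minus(2)[OF assms(1) M(1)] Suc.prems(4) t s by blast
      ultimately have "t \<ominus> s \<in> M \<or> pev q t \<in> M" using M(3)[OF A(8)[OF tA sA] k(2)] by simp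
      then show "pev q t \<in> M" using assms(4)[of t s] t s Suc.prems(2) by blast
    qed
    then show ?case using q(4) Suc.prems(4)[OF s] by blast
  qed
  then show ?thesis using assms(5,6) by (metis (no_types, lifting) mem_Collect_eq subsetI)
qed

end

text \<open>Regularity is the combination of \<open>gens_m\<close> and \<open>chain\<close>: some
  prime chain ending in \<open>m\<close> has at least as many links as \<open>xs\<close> has
  generators. \<open>residues\<close> is the infinite residue field, given by representatives in
  \<open>R\<close>.\<close>

locale reg_local = ambient_field +
  fixes R m :: "'a set" and xs :: "'a list"
  assumes noethR: "noeth R" and prime_m: "prime_of R m" and units: "\<And>a. a \<in> R \<Longrightarrow> a \<notin> m \<Longrightarrow> inv a \<in> R"
    and xs_R: "set xs \<subseteq> R" and gens_m: "m = gens R {\<zero>} xs" and xs_ne: "xs \<noteq> []"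
    and chain: "\<exists>k P. length xs \<le> k \<and> pch R k P m"
    and residues: "\<exists>T\<subseteq>R. infinite T \<and> (\<forall>s\<in>T. \<forall>t\<in>T. s \<noteq> t \<longrightarrow> s \<ominus> t \<notin> m)"
begin

lemma sR: "subring R K" using noeth_subring[OF noethR] .

lemmas RR = subringD[OF sR]
lemmas mm = prime_ofD[OF prime_m]

abbreviation mp :: "nat \<Rightarrow> 'a set" where "mp \<equiv> ipw R m"

lemma mp_ideal: "ideal_of R (mp n)" by (rule ipw_ideal[OF sR mm(1)])

lemmas mpD = ideal_ofD[OF mp_ideal]

lemma mp_carr: "a \<in> mp n \<Longrightarrow> a \<in> carrier K" using mpD(1) RR(4) by blast

lemma mp_mult: "a \<in> mp i \<Longrightarrow> b \<in> mp j \<Longrightarrow> a \<otimes> b \<in> mp (i + j)" by (rule ipw_mult[OF sR mm(1)])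

lemma mp_antimono: "i \<le> j \<Longrightarrow> mp j \<subseteq> mp i" by (rule ipw_antimono[OF sR mm(1)])

lemma mp_1: "mp 1 = m" by (rule ipw_1[OF sR mm(1)])

lemma mp_pow: "a \<in> mp i \<Longrightarrow> a [^] (n::nat) \<in> mp (i * n)" by (rule ipw_pow[OF sR mm(1)])

definition x0 where "x0 = hd xs"

text \<open>The ideal of \<open>x0\<close> and \<open>zs\<close>, with the head of the list as the
  last generator added, so that induction on \<open>zs\<close> peels off one coordinate and stops at
  the principal ideal of \<open>x0\<close>.\<close>

fun Mz :: "'a list \<Rightarrow> 'a set" where
  "Mz [] = plus_gen R {\<zero>} x0"
| "Mz (z # zs) = plus_gen R (Mz zs) z"

lemma Mz_gens: "Mz zs = gens R {\<zero>} (x0 # rev zs)"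
  by (induction zs) (simp_all add: gens_append)

lemma Mz_m: "Mz (rev (tl xs)) = m"
  unfolding Mz_gens gens_m x0_def using xs_ne by simp

lemma xs_m: "set xs \<subseteq> m"
  using gens_ideal[OF sR zero_ideal_of[OF sR] xs_R] unfolding gens_m[symmetric] by blast

text \<open>\<open>hl E a fs\<close>: the list \<open>fs\<close> of coefficients \<open>f_0, ..., f_a\<close> has \<open>f_j\<close> in the power \<open>a - j\<close> of \<open>E\<close>.\<close>

fun hl :: "'a set \<Rightarrow> nat \<Rightarrow> 'a list \<Rightarrow> bool" where
  "hl E 0 fs \<longleftrightarrow> (\<exists>r\<in>R. fs = [r])"
| "hl E (Suc a) fs \<longleftrightarrow> (\<exists>f fs'. fs = f # fs' \<and> f \<in> ipw R E (Suc a) \<and> hl E a fs')"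

lemma hl_facts:
  assumes "ideal_of R E" "hl E a fs"
  shows "length fs = Suc a \<and> set fs \<subseteq> R \<and> (\<forall>j\<le>a. fs ! j \<in> ipw R E (a - j))"
  using assms(2)
proof (induction a arbitrary: fs)
  case (Suc a)
  then obtain f fs' where *: "fs = f # fs'" "f \<in> ipw R E (Suc a)" "hl E a fs'" by auto
  have f: "f \<in> R" using *(2) ideal_ofD(1)[OF ipw_ideal[OF sR assms(1)]] by blast
  have IH: "length fs' = Suc a" "set fs' \<subseteq> R" "\<And>j. j \<le> a \<Longrightarrow> fs' ! j \<in> ipw R E (a - j)" using Suc.IH[OF *(3)] by auto
  have "fs ! j \<in> ipw R E (Suc a - j)" if "j \<le> Suc a" for j
    using that IH(3)[of "j - 1"] * by (cases j) auto
  then show ?case using * f IH by auto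
qed auto

lemma hl_add:
  assumes "ideal_of R E"
  shows "hl E a fs \<Longrightarrow> hl E a gs \<Longrightarrow> hl E a (padd fs gs)"
proof (induction a arbitrary: fs gs)
  case 0 then show ?case using RR(7) by auto
next
  case (Suc a)
  obtain f fs' g gs' where *: "fs = f # fs'" "f \<in> ipw R E (Suc a)" "hl E a fs'" "gs = g # gs'" "g \<in> ipw R E (Suc a)" "hl E a gs'"
    using Suc.prems by auto
  have "f \<oplus> g \<in> ipw R E (Suc a)" using ideal_ofD(3)[OF ipw_ideal[OF sR assms] *(2,5)] .
  then show ?case using * Suc.IH by simp
qed

lemma hl_smult:
  assumes "ideal_of R E" "r \<in> R"
  shows "hl E a fs \<Longrightarrow> hl E a (map (\<lambda>c. r \<otimes> c) fs)"
proof (induction a arbitrary: fs)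
  case 0 then show ?case using RR(6) assms(2) by auto
next
  case (Suc a)
  obtain f fs' where *: "fs = f # fs'" "f \<in> ipw R E (Suc a)" "hl E a fs'" using Suc.prems by auto
  have "r \<otimes> f \<in> ipw R E (Suc a)" using ideal_ofD(4)[OF ipw_ideal[OF sR assms(1)] assms(2) *(2)] .
  then show ?case using * Suc.IH by simp
qed

lemma hl_emult:
  assumes "ideal_of R E" "e \<in> E"
  shows "hl E a fs \<Longrightarrow> hl E (Suc a) (map (\<lambda>c. e \<otimes> c) fs @ [\<zero>])"
proof (induction a arbitrary: fs)
  case 0
  then obtain r where r: "r \<in> R" "fs = [r]" by auto
  have "r \<otimes> e \<in> ideal_prod K R E" using r(1) assms(2) by (rule ideal_prod.prod)
  moreover have "r \<otimes> e = e \<otimes> r" using r(1) assms(2) ideal_ofD(1)[OF assms(1)] RR(4) by (meson m_comm subsetD)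
  ultimately show ?case using r RR(2) by simp
next
  case (Suc a)
  obtain f fs' where *: "fs = f # fs'" "f \<in> ipw R E (Suc a)" "hl E a fs'" using Suc.prems by auto
  have "f \<otimes> e \<in> ideal_prod K (ipw R E (Suc a)) E" using *(2) assms(2) by (rule ideal_prod.prod)
  moreover have "f \<otimes> e = e \<otimes> f" using *(2) assms ideal_ofD(1)[OF assms(1)] ipw_carr[OF sR assms(1)] RR(4) by (meson m_comm subsetD)
  ultimately have "e \<otimes> f \<in> ipw R E (Suc (Suc a))" by simp
  then show ?case using * Suc.IH[OF *(3)] by simp
qed

text \<open>Forms of degree \<open>a\<close> in the generators of \<open>E\<close> and one further
  coordinate \<open>z\<close>, ordered by powers of \<open>z\<close>: the coefficient of
  \<open>z^j\<close> lies in \<open>E^(a-j)\<close>.\<close>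

lemma power_expansion:
  assumes "ideal_of R E" "z \<in> R" "f \<in> ipw R (plus_gen R E z) a"
  shows "\<exists>fs. hl E a fs \<and> f = pev fs z"
  using assms(3)
proof (induction a arbitrary: f)
  case 0
  then have "f \<in> R" by simp
  then have "hl E 0 [f] \<and> f = pev [f] z" using RR(4) assms(2) by simp
  then show ?case by blast
next
  case (Suc a)
  have zK: "z \<in> carrier K" using assms(2) RR(4) by blast
  have hK: "set fs \<subseteq> carrier K" if "hl E b fs" for b fs using hl_facts[OF assms(1) that] RR(1) by blast
  from Suc.prems have "f \<in> ideal_prod K (ipw R (plus_gen R E z) a) (plus_gen R E z)" by simp
  then show ?case
  proof induction
    case (prod i j)
    obtain fs where fs: "hl E a fs" "i = pev fs z" using Suc.IH[OF prod(1)] by blast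
    obtain e r where er: "e \<in> E" "r \<in> R" "j = e \<oplus> r \<otimes> z" using prod(2) unfolding plus_gen_def by blast
    have k: "e \<in> carrier K" "r \<in> carrier K" "pev fs z \<in> carrier K" 
      using er ideal_ofD(1)[OF assms(1)] RR(4) hK[OF fs(1)] zK by auto
    define g1 where "g1 = map (\<lambda>c. e \<otimes> c) fs @ [\<zero>]"
    define g2 where "g2 = \<zero> # map (\<lambda>c. r \<otimes> c) fs"
    have g1: "hl E (Suc a) g1" unfolding g1_def by (rule hl_emult[OF assms(1) er(1) fs(1)])
    have g2: "hl E (Suc a) g2" unfolding g2_def using hl_smult[OF assms(1) er(2) fs(1)] 
      ideal_ofD(2)[OF ipw_ideal[OF sR assms(1)], of "Suc a"] by simp
    have mK: "set (map (\<lambda>c. e \<otimes> c) fs) \<subseteq> carrier K" using hK[OF fs(1)] k by auto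
    have "pev g1 z = e \<otimes> pev fs z" unfolding g1_def using pev_snoc[OF mK zero_closed zK] pev_smult[OF hK[OF fs(1)] k(1) zK] k zK by simp
    moreover have "pev g2 z = z \<otimes> (r \<otimes> pev fs z)" unfolding g2_def using pev_smult[OF hK[OF fs(1)] k(2) zK] k zK by simp
    ultimately have "pev (padd g1 g2) z = e \<otimes> pev fs z \<oplus> z \<otimes> (r \<otimes> pev fs z)"
      using pev_padd[OF hK[OF g1] hK[OF g2] zK] by simp
    also have "\<dots> = i \<otimes> j" unfolding fs(2) er(3) using k zK by algebra
    finally show ?case using hl_add[OF assms(1) g1 g2] by metis
  next
    case (sum s t)
    then obtain fs gs where *: "hl E (Suc a) fs" "s = pev fs z" "hl E (Suc a) gs" "t = pev gs z" by blast
    have "pev (padd fs gs) z = s \<oplus> t" using pev_padd[OF hK[OF *(1)] hK[OF *(3)] zK] * by simp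
    then show ?case using hl_add[OF assms(1) *(1,3)] by metis
  qed
qed

text \<open>Its contrapositive is what matters: a form not in \<open>m^(a+1)\<close> has a
  coefficient, say of \<open>z^j\<close>, that is not in \<open>m^(a-j+1)\<close>.\<close>

lemma pev_in_mp:
  assumes "z \<in> m" "length fs = Suc a" "\<forall>j\<le>a. fs ! j \<in> mp (Suc (a - j))"
  shows "pev fs z \<in> mp (Suc a)"
  using assms(2,3)
proof (induction a arbitrary: fs)
  case 0
  then obtain r where "fs = [r]" by (cases fs) auto
  then show ?case using 0 mp_carr[of r 1] assms(1) mm(4) RR(4) by auto
next
  case (Suc a)
  then obtain f fs' where f: "fs = f # fs'" by (cases fs) auto
  have "f \<in> mp (Suc (Suc a))" using Suc.prems(2) f by force
  moreover have "pev fs' z \<in> mp (Suc a)"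
  proof (rule Suc.IH)
    show "\<forall>j\<le>a. fs' ! j \<in> mp (Suc (a - j))"
    proof (intro allI impI)
      fix j assume "j \<le> a" then show "fs' ! j \<in> mp (Suc (a - j))" using spec[OF Suc.prems(2), of "Suc j"] f by simp
    qed
  qed (use Suc.prems f in simp)
  then have "z \<otimes> pev fs' z \<in> mp (1 + Suc a)" using mp_mult[of z 1] assms(1) mp_1 by blast
  ultimately show ?case using f mpD(3) by (simp del: ipw.simps)
qed

text \<open>Substituting \<open>z = s x0\<close> into a form whose coefficients are already
  multiples of powers of \<open>x0\<close> modulo \<open>L\<close> turns it into \<open>x0^a\<close>
  times the dehomogenized polynomial \<open>p\<close> evaluated at \<open>s\<close>.\<close>

lemma pev_cong_mod:
  assumes "ideal_of R L" "z \<in> R" "s \<in> R" "x0 \<in> R" "z \<ominus> s \<otimes> x0 \<in> L" "length fs = Suc a" "length p = Suc a" "set fs \<subseteq> R" "set p \<subseteq> R"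
    "\<forall>j\<le>a. fs ! j \<ominus> p ! j \<otimes> x0 [^] (a - j) \<in> L"
  shows "pev fs z \<ominus> pev p s \<otimes> x0 [^] a \<in> L"
  using assms(6-10)
proof (induction a arbitrary: fs p)
  case 0
  then obtain f q where "fs = [f]" "p = [q]" by (cases fs; cases p) auto
  then show ?case using 0 assms RR(4) by simp
next
  case (Suc a)
  obtain f fs' where f: "fs = f # fs'" using Suc.prems by (cases fs) auto
  obtain q p' where q: "p = q # p'" using Suc.prems by (cases p) auto
  note L = ideal_ofD[OF assms(1)]
  have 1: "f \<ominus> q \<otimes> x0 [^] Suc a \<in> L" using spec[OF Suc.prems(5), of 0] f q by simp
  have 2: "pev fs' z \<ominus> pev p' s \<otimes> x0 [^] a \<in> L"
  proof (rule Suc.IH)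
    show "\<forall>j\<le>a. fs' ! j \<ominus> p' ! j \<otimes> x0 [^] (a - j) \<in> L"
    proof (intro allI impI)
      fix j assume "j \<le> a" then show "fs' ! j \<ominus> p' ! j \<otimes> x0 [^] (a - j) \<in> L" using spec[OF Suc.prems(5), of "Suc j"] f q by simp
    qed
  qed (use Suc.prems f q in auto)
  have R: "pev fs' z \<in> R" "pev p' s \<in> R" "f \<in> R" "q \<in> R" "x0 [^] a \<in> R"
    using pev_in[OF sR] Suc.prems f q assms RR(9) by auto
  then have k: "pev fs' z \<in> carrier K" "pev p' s \<in> carrier K" "f \<in> carrier K" "q \<in> carrier K" "x0 [^] a \<in> carrier K"
    "z \<in> carrier K" "s \<in> carrier K" "x0 \<in> carrier K" using RR(4) assms by blast+
  have "pev fs z \<ominus> pev p s \<otimes> x0 [^] Suc a = (f \<ominus> q \<otimes> x0 [^] Suc a) \<oplus>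
     (z \<otimes> (pev fs' z \<ominus> pev p' s \<otimes> x0 [^] a) \<oplus> (pev p' s \<otimes> x0 [^] a) \<otimes> (z \<ominus> s \<otimes> x0))"
    unfolding f q pev.simps nat_pow_Suc using k by algebra
  moreover have "\<dots> \<in> L" using 1 2 L(3,4) assms(2,5) RR(6) R by simp
  ultimately show ?case by simp
qed

text \<open>If \<open>E\<close> becomes principal modulo \<open>L\<close>, generated by
  \<open>x0\<close>, its \<open>n\<close>-th power is generated by \<open>x0^n\<close>.\<close>

lemma cong_powers:
  assumes "ideal_of R L" "ideal_of R E" "x0 \<in> R" "\<And>e. e \<in> E \<Longrightarrow> \<exists>w\<in>R. e \<ominus> w \<otimes> x0 \<in> L" "e \<in> ipw R E n"
  shows "\<exists>w\<in>R. e \<ominus> w \<otimes> x0 [^] n \<in> L"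
  using assms(5)
proof (induction n arbitrary: e)
  case 0
  then have "e \<in> R" by simp
  then have "e \<ominus> e \<otimes> x0 [^] (0::nat) = \<zero>" using RR(4) by simp
  then show ?case using ideal_ofD(2)[OF assms(1)] \<open>e \<in> R\<close> by metis
next
  case (Suc n)
  note L = ideal_ofD[OF assms(1)]
  have xK: "x0 \<in> carrier K" "x0 [^] n \<in> carrier K" "x0 [^] n \<in> R" using assms(3) RR(4,9) by auto
  from Suc.prems have "e \<in> ideal_prod K (ipw R E n) E" by simp
  then show ?case
  proof induction
    case (prod i j)
    obtain w where w: "w \<in> R" "i \<ominus> w \<otimes> x0 [^] n \<in> L" using Suc.IH[OF prod(1)] by blast
    obtain v where v: "v \<in> R" "j \<ominus> v \<otimes> x0 \<in> L" using assms(4)[OF prod(2)] by blast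
    have ij: "i \<in> R" "j \<in> R" using prod ideal_ofD(1)[OF ipw_ideal[OF sR assms(2)]] ideal_ofD(1)[OF assms(2)] by blast+
    have k: "i \<in> carrier K" "j \<in> carrier K" "w \<in> carrier K" "v \<in> carrier K" using ij w v RR(4) by blast+
    have "i \<otimes> j \<ominus> (w \<otimes> v) \<otimes> x0 [^] Suc n = j \<otimes> (i \<ominus> w \<otimes> x0 [^] n) \<oplus> (w \<otimes> x0 [^] n) \<otimes> (j \<ominus> v \<otimes> x0)"
      unfolding nat_pow_Suc using k xK by algebra
    moreover have "\<dots> \<in> L" using L(3,4) w v ij RR(6) xK(3) by simp
    ultimately show ?case using RR(6)[OF w(1) v(1)] by metis
  next
    case (sum s t)
    then obtain w v where w: "w \<in> R" "s \<ominus> w \<otimes> x0 [^] Suc n \<in> L" and v: "v \<in> R" "t \<ominus> v \<otimes> x0 [^] Suc n \<in> L" by blast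
    have st: "s \<in> carrier K" "t \<in> carrier K" "x0 [^] Suc n \<in> carrier K" using sum ipw_carr[OF sR assms(2), of "Suc n"] xK by auto
    have "s \<oplus> t \<ominus> (w \<oplus> v) \<otimes> x0 [^] Suc n = (s \<ominus> w \<otimes> x0 [^] Suc n) \<oplus> (t \<ominus> v \<otimes> x0 [^] Suc n)"
      using st RR(4)[OF w(1)] RR(4)[OF v(1)] by algebra
    then show ?case using L(3) w v RR(7) by metis
  qed
qed

text \<open>Specialization of coordinates: modulo \<open>length zs\<close> linear forms, the ideal becomes principal, generated by
  \<open>x0\<close>, while the given forms \<open>f\<close> and \<open>g\<close> stay of order \<open>a\<close> and \<open>b\<close>. The linear forms are found one at a time,
  avoiding the finitely many residues at which the coefficient polynomials of \<open>f\<close> and \<open>g\<close> vanish.\<close>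

lemma specialization:
  assumes x0m: "x0 \<in> m"
  shows "set zs \<subseteq> m \<Longrightarrow> f \<in> ipw R (Mz zs) a \<Longrightarrow> f \<notin> mp (Suc a) \<Longrightarrow> g \<in> ipw R (Mz zs) b \<Longrightarrow> g \<notin> mp (Suc b) \<Longrightarrow>
    \<exists>ws u v. length ws = length zs \<and> set ws \<subseteq> m \<and> u \<in> R - m \<and> v \<in> R - m \<and>
      f \<ominus> u \<otimes> x0 [^] a \<in> gens R {\<zero>} ws \<and> g \<ominus> v \<otimes> x0 [^] b \<in> gens R {\<zero>} ws \<and>
      (\<forall>e\<in>Mz zs. \<exists>w\<in>R. e \<ominus> w \<otimes> x0 \<in> gens R {\<zero>} ws)"
proof (induction zs arbitrary: f g a b)
  case Nil
  have x0R: "x0 \<in> R" using x0m mm(4) by blast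
  have x0K: "x0 \<in> carrier K" using x0R RR(4) by blast
  have Z: "ideal_of R {\<zero>}" by (rule zero_ideal_of[OF sR])
  have Mi: "ideal_of R (Mz [])" using plus_gen_ideal(1)[OF sR Z x0R] by simp
  have lin: "\<exists>w\<in>R. e \<ominus> w \<otimes> x0 \<in> {\<zero>}" if e: "e \<in> Mz []" for e
  proof -
    obtain w where w: "w \<in> R" "e = \<zero> \<oplus> w \<otimes> x0" using e unfolding Mz.simps plus_gen_def by blast
    then have "e \<ominus> w \<otimes> x0 = \<zero>" using RR(4)[OF w(1)] x0K by simp
    then show ?thesis using w(1) by blast
  qed
  have unit: "\<exists>u\<in>R - m. h \<ominus> u \<otimes> x0 [^] c \<in> {\<zero>}" if h: "h \<in> ipw R (Mz []) c" "h \<notin> mp (Suc c)" for h c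
  proof -
    obtain u where u: "u \<in> R" "h \<ominus> u \<otimes> x0 [^] c \<in> {\<zero>}" using cong_powers[OF Z Mi x0R lin h(1)] by blast
    have hK: "h \<in> carrier K" using h(1) ipw_carr[OF sR Mi] by blast
    have hu: "h = u \<otimes> x0 [^] c" using u x0K hK RR(4)[OF u(1)] by simp
    have "u \<notin> m"
    proof
      assume "u \<in> m"
      then have "u \<otimes> x0 [^] c \<in> mp (1 + c)" using mp_mult[of u 1] mp_pow[of x0 1 c] x0m mp_1 by simp
      then show False using h(2) hu by simp
    qed
    then show ?thesis using u by blast
  qed
  show ?case using unit[OF Nil(2,3)] unit[OF Nil(4,5)] lin by (intro exI[of _ "[]"]) auto
next
  case (Cons z zs)
  have x0R: "x0 \<in> R" using x0m mm(4) by blast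
  have x0K: "x0 \<in> carrier K" using x0R RR(4) by blast
  have zm: "z \<in> m" "set zs \<subseteq> m" using Cons.prems(1) by auto
  have zR: "z \<in> R" using zm(1) mm(4) by blast
  have Mi: "ideal_of R (Mz zs)" unfolding Mz_gens using gens_ideal[OF sR zero_ideal_of[OF sR], of "x0 # rev zs"] zm x0R mm(4) by auto
  \<comment> \<open>A coefficient of exact order is singled out, and the induction hypothesis is
    applied to one such coefficient of \<open>f\<close> and one of \<open>g\<close>, both with the
    same linear forms.\<close>
  have pick: "\<exists>fs j. hl (Mz zs) c fs \<and> h = pev fs z \<and> j \<le> c \<and> fs ! j \<in> ipw R (Mz zs) (c - j) \<and> fs ! j \<notin> mp (Suc (c - j))"
    if h: "h \<in> ipw R (Mz (z # zs)) c" "h \<notin> mp (Suc c)" for h c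
  proof -
    obtain fs where fs: "hl (Mz zs) c fs" "h = pev fs z" using power_expansion[OF Mi zR] h(1) by auto
    then obtain j where "j \<le> c" "fs ! j \<notin> mp (Suc (c - j))" using pev_in_mp[OF zm(1), of fs c] hl_facts[OF Mi fs(1)] h(2) by blast
    then show ?thesis using fs hl_facts[OF Mi fs(1)] by blast
  qed
  obtain fs j where f: "hl (Mz zs) a fs" "f = pev fs z" "j \<le> a" "fs ! j \<in> ipw R (Mz zs) (a - j)" "fs ! j \<notin> mp (Suc (a - j))"
    using pick[OF Cons.prems(2,3)] by blast
  obtain gs l where g: "hl (Mz zs) b gs" "g = pev gs z" "l \<le> b" "gs ! l \<in> ipw R (Mz zs) (b - l)" "gs ! l \<notin> mp (Suc (b - l))"
    using pick[OF Cons.prems(4,5)] by blast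
  obtain ws u v where W: "length ws = length zs" "set ws \<subseteq> m" "u \<in> R - m" "v \<in> R - m"
      "fs ! j \<ominus> u \<otimes> x0 [^] (a - j) \<in> gens R {\<zero>} ws" "gs ! l \<ominus> v \<otimes> x0 [^] (b - l) \<in> gens R {\<zero>} ws"
      "\<And>e. e \<in> Mz zs \<Longrightarrow> \<exists>w\<in>R. e \<ominus> w \<otimes> x0 \<in> gens R {\<zero>} ws"
    using Cons.IH[OF zm(2) f(4,5) g(4,5)] by blast
  define L where "L = gens R {\<zero>} ws"
  have wsR: "set ws \<subseteq> R" using W(2) mm(4) by blast
  have Li: "ideal_of R L" unfolding L_def using gens_ideal[OF sR zero_ideal_of[OF sR] wsR] by blast
  note W' = W(5-7)[folded L_def]
  have coeffs: "\<exists>p. length p = Suc c \<and> set p \<subseteq> R \<and> (\<forall>i\<le>c. hs ! i \<ominus> p ! i \<otimes> x0 [^] (c - i) \<in> L) \<and> \<not> set p \<subseteq> m"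
    if h: "hl (Mz zs) c hs" "i0 \<le> c" "w \<in> R - m" "hs ! i0 \<ominus> w \<otimes> x0 [^] (c - i0) \<in> L" for c hs i0 w
  proof -
    have "\<forall>i\<in>{..c}. \<exists>q\<in>R. hs ! i \<ominus> q \<otimes> x0 [^] (c - i) \<in> L"
      using cong_powers[OF Li Mi x0R W'(3)] hl_facts[OF Mi h(1)] by blast
    then obtain q where q: "\<And>i. i \<le> c \<Longrightarrow> q i \<in> R \<and> hs ! i \<ominus> q i \<otimes> x0 [^] (c - i) \<in> L" by (metis atMost_iff)
    \<comment> \<open>The multipliers from \<open>cong_powers\<close> are arbitrary; at the chosen
      index the one known to be a unit is put in, so that \<open>p\<close> does not vanish modulo
      \<open>m\<close>.\<close>
    define q' where "q' = q(i0 := w)"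
    have q': "q' i \<in> R \<and> hs ! i \<ominus> q' i \<otimes> x0 [^] (c - i) \<in> L" if "i \<le> c" for i
      unfolding q'_def using q[OF that] h by auto
    define p where "p = map q' [0..<Suc c]"
    have len: "length p = Suc c" unfolding p_def by simp
    have nth: "p ! i = q' i" if "i \<le> c" for i unfolding p_def using that nth_map_upt[of i "Suc c" 0 q'] by simp
    have setp: "set p = q' ` {..c}" unfolding p_def by (simp only: set_map set_upt atLeast0LessThan lessThan_Suc_atMost)
    have "w \<in> set p" unfolding setp q'_def using h(2) by (intro image_eqI[of _ _ i0]) auto
    then have "\<not> set p \<subseteq> m" using h(3) by blast
    then show ?thesis using q' len nth setp by (intro exI[of _ p]) auto
  qed
  obtain p where p: "length p = Suc a" "set p \<subseteq> R" "\<forall>i\<le>a. fs ! i \<ominus> p ! i \<otimes> x0 [^] (a - i) \<in> L" "\<not> set p \<subseteq> m"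
    using coeffs[OF f(1,3) W(3) W'(1)] by blast
  obtain q where q: "length q = Suc b" "set q \<subseteq> R" "\<forall>i\<le>b. gs ! i \<ominus> q ! i \<otimes> x0 [^] (b - i) \<in> L" "\<not> set q \<subseteq> m"
    using coeffs[OF g(1,3) W(4) W'(2)] by blast
  obtain T where T: "T \<subseteq> R" "infinite T" "\<And>s t. s \<in> T \<Longrightarrow> t \<in> T \<Longrightarrow> s \<noteq> t \<Longrightarrow> s \<ominus> t \<notin> m" using residues by blast
  \<comment> \<open>The next linear form is \<open>z - s x0\<close>, where \<open>s\<close> is a
    representative that is a root modulo \<open>m\<close> of neither residue polynomial; their
    values at \<open>s\<close> become the units \<open>u\<close> and \<open>v\<close>.\<close>
  have "finite ({s \<in> T. pev p s \<in> m} \<union> {s \<in> T. pev q s \<in> m})"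
    using finite_roots_mod[OF sR prime_m T(1,3)] p q by simp
  then have "\<not> T \<subseteq> {s \<in> T. pev p s \<in> m} \<union> {s \<in> T. pev q s \<in> m}" using T(2) finite_subset by blast
  then obtain s where s: "s \<in> T" "pev p s \<notin> m" "pev q s \<notin> m" by blast
  have sR': "s \<in> R" using s T by blast
  define y where "y = z \<ominus> s \<otimes> x0"
  have ym: "y \<in> m" unfolding y_def using ideal_of_minus(2)[OF sR mm(1) zm(1) mm(7)[OF sR' x0m]] .
  have yR: "y \<in> R" using ym mm(4) by blast
  define L' where "L' = plus_gen R L y"
  note L' = plus_gen_ideal[OF sR Li yR, folded L'_def]
  have yL: "z \<ominus> s \<otimes> x0 \<in> L'" using L'(3) unfolding y_def .
  have L'g: "L' = gens R {\<zero>} (ws @ [y])" unfolding L'_def L_def by (simp add: gens_append)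
  have "pev fs z \<ominus> pev p s \<otimes> x0 [^] a \<in> L'"
    using pev_cong_mod[OF L'(1) zR sR' x0R yL] hl_facts[OF Mi f(1)] p L'(2) by blast
  moreover have "pev gs z \<ominus> pev q s \<otimes> x0 [^] b \<in> L'"
    using pev_cong_mod[OF L'(1) zR sR' x0R yL] hl_facts[OF Mi g(1)] q L'(2) by blast
  moreover have "\<exists>w\<in>R. e \<ominus> w \<otimes> x0 \<in> L'" if e: "e \<in> Mz (z # zs)" for e
  proof -
    obtain e' r where er: "e' \<in> Mz zs" "r \<in> R" "e = e' \<oplus> r \<otimes> z" using e unfolding Mz.simps plus_gen_def by blast
    obtain w where w: "w \<in> R" "e' \<ominus> w \<otimes> x0 \<in> L" using W'(3)[OF er(1)] by blast
    have k: "e' \<in> carrier K" "r \<in> carrier K" "w \<in> carrier K" "z \<in> carrier K" "s \<in> carrier K"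
      using er(1,2) ideal_ofD(1)[OF Mi] w(1) zR sR' RR(4) by blast+
    have "e \<ominus> (w \<oplus> r \<otimes> s) \<otimes> x0 = (e' \<ominus> w \<otimes> x0) \<oplus> r \<otimes> (z \<ominus> s \<otimes> x0)"
      unfolding er(3) using k x0K by algebra
    moreover have "\<dots> \<in> L'" using ideal_ofD(3,4)[OF L'(1)] L'(2) w(2) er(2) yL by blast
    moreover have "w \<oplus> r \<otimes> s \<in> R" using RR(6,7) w er sR' by simp
    ultimately show ?thesis by metis
  qed
  moreover have "pev p s \<in> R - m" "pev q s \<in> R - m" using pev_in[OF sR] p(2) q(2) sR' s by auto
  moreover have "length (ws @ [y]) = length (z # zs)" "set (ws @ [y]) \<subseteq> m" using W(1,2) ym by auto
  ultimately show ?case unfolding f(2) g(2) L'g by blast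
qed

lemma x0_m: "x0 \<in> m" using xs_m xs_ne unfolding x0_def by auto

text \<open>The associated graded ring of \<open>R\<close> is a domain. If a product had excess
  order, then modulo one linear form fewer than there are generators a power of \<open>x0\<close>
  would vanish, and \<open>m\<close> would be the radical of an ideal with too few
  generators.\<close>

theorem order_mult:
  assumes "f \<in> mp a" "f \<notin> mp (Suc a)" "g \<in> mp b" "g \<notin> mp (Suc b)"
  shows "f \<otimes> g \<notin> mp (Suc (a + b))"
proof
  assume fg: "f \<otimes> g \<in> mp (Suc (a + b))"
  have x0R: "x0 \<in> R" using x0_m mm(4) by blast
  have x0K: "x0 \<in> carrier K" using x0R RR(4) by blast
  let ?zs = "rev (tl xs)"
  have zs: "set ?zs \<subseteq> m" using xs_m xs_ne by (cases xs) auto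
  obtain ws u v where W: "length ws = length ?zs" "set ws \<subseteq> m" "u \<in> R - m" "v \<in> R - m"
      "f \<ominus> u \<otimes> x0 [^] a \<in> gens R {\<zero>} ws" "g \<ominus> v \<otimes> x0 [^] b \<in> gens R {\<zero>} ws"
      "\<And>e. e \<in> m \<Longrightarrow> \<exists>w\<in>R. e \<ominus> w \<otimes> x0 \<in> gens R {\<zero>} ws"
    using specialization[OF x0_m zs, of f a g b] assms unfolding Mz_m by blast
  define L where "L = gens R {\<zero>} ws"
  have wsR: "set ws \<subseteq> R" using W(2) mm(4) by blast
  have Li: "ideal_of R L" unfolding L_def using gens_ideal[OF sR zero_ideal_of[OF sR] wsR] by blast
  note L = ideal_ofD[OF Li]
  note W' = W(5-7)[folded L_def]
  let ?n = "a + b"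
  have fgR: "f \<in> R" "g \<in> R" using assms mpD(1) by blast+
  have xR: "x0 [^] a \<in> R" "x0 [^] b \<in> R" "x0 [^] ?n \<in> R" using RR(9) x0R by blast+
  have uvR: "u \<in> R" "v \<in> R" "u \<notin> m" "v \<notin> m" using W by auto
  have k: "f \<in> carrier K" "g \<in> carrier K" "u \<in> carrier K" "v \<in> carrier K" 
    "x0 [^] a \<in> carrier K" "x0 [^] b \<in> carrier K" "x0 [^] ?n \<in> carrier K"
    using fgR uvR xR RR(4) by blast+
  have xn: "x0 [^] ?n = x0 [^] a \<otimes> x0 [^] b" using x0K by (simp add: nat_pow_mult)
  have "f \<otimes> g \<ominus> (u \<otimes> v) \<otimes> x0 [^] ?n = f \<otimes> (g \<ominus> v \<otimes> x0 [^] b) \<oplus> (v \<otimes> x0 [^] b) \<otimes> (f \<ominus> u \<otimes> x0 [^] a)"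
    unfolding xn using k by algebra
  also have "\<dots> \<in> L" using L(3,4) W'(1,2) fgR uvR xR RR(6) by simp
  finally have 1: "f \<otimes> g \<ominus> (u \<otimes> v) \<otimes> x0 [^] ?n \<in> L" .
  obtain w where w: "w \<in> R" "f \<otimes> g \<ominus> w \<otimes> x0 [^] Suc ?n \<in> L"
    using cong_powers[OF Li mm(1) x0R W'(3) fg] by blast
  have wK: "w \<in> carrier K" using w RR(4) by blast
  \<comment> \<open>Modulo \<open>L\<close> the product is \<open>u v x0^n\<close> and also a
    multiple \<open>w x0^(n+1)\<close>. The difference of the two expressions is
    \<open>t x0^n\<close> with \<open>t\<close> a unit.\<close>
  define t where "t = u \<otimes> v \<ominus> w \<otimes> x0"
  have tR: "t \<in> R" unfolding t_def using uvR w x0R RR(6,8) by simp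
  have tm: "t \<notin> m"
  proof
    assume "t \<in> m"
    then have "t \<oplus> w \<otimes> x0 \<in> m" using mm(6,7) w x0_m by blast
    moreover have "t \<oplus> w \<otimes> x0 = u \<otimes> v" unfolding t_def using k wK x0K by algebra
    ultimately show False using mm(3) uvR by auto
  qed
  have tK: "t \<in> carrier K" "t \<noteq> \<zero>" using tR RR(4) tm mm(5) by auto
  have "(f \<otimes> g \<ominus> w \<otimes> x0 [^] Suc ?n) \<ominus> (f \<otimes> g \<ominus> (u \<otimes> v) \<otimes> x0 [^] ?n) = t \<otimes> x0 [^] ?n"
    unfolding t_def nat_pow_Suc using k wK x0K by algebra
  then have "t \<otimes> x0 [^] ?n \<in> L" using ideal_of_minus(2)[OF sR Li w(2) 1] by simp
  then have "inv t \<otimes> (t \<otimes> x0 [^] ?n) \<in> L" using L(4)[OF units[OF tR tm]] by blast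
  then have xL: "x0 [^] ?n \<in> L" using tK k by simp
  \<comment> \<open>The list \<open>ws\<close> has one entry fewer than \<open>xs\<close>, whereas
    the chain has at least as many links as \<open>xs\<close> has entries. Every \<open>e^n\<close>
    with \<open>e \<in> m\<close> is a multiple of \<open>x0^n\<close> modulo \<open>L\<close>,
    hence lies in \<open>L\<close>, so the height theorem applies.\<close>
  obtain l P where P: "length xs \<le> l" "pch R l P m" using chain by blast
  have Pp: "prime_of R P" using pch_prime[OF P(2)] by blast
  have "l \<le> length ws"
  proof (rule krull_height[OF noethR P(2) W(2)])
    fix e assume e: "e \<in> m"
    have "e [^] ?n \<in> mp (1 * ?n)" using mp_pow[of e 1] e mp_1 by blast
    then have "e [^] ?n \<in> mp ?n" by simp
    then obtain w where w: "w \<in> R" "e [^] ?n \<ominus> w \<otimes> x0 [^] ?n \<in> L" using cong_powers[OF Li mm(1) x0R W'(3)] by blast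
    have eK: "e [^] ?n \<in> carrier K" "w \<in> carrier K" using e mm(4) RR(4) w by auto
    have "e [^] ?n = (e [^] ?n \<ominus> w \<otimes> x0 [^] ?n) \<oplus> w \<otimes> x0 [^] ?n" using eK k by algebra
    moreover have "\<dots> \<in> L" using L(3,4) w xL by blast
    ultimately have "e [^] ?n \<in> L" by metis
    moreover have "L \<subseteq> gens R P ws" unfolding L_def by (rule gens_mono) (use prime_ofD(5)[OF Pp] in blast)
    ultimately have "\<one> \<otimes> e [^] ?n \<in> gens R P ws" using eK by auto
    then show "\<exists>s\<in>R. \<exists>j::nat. s \<notin> m \<and> s \<otimes> e [^] j \<in> gens R P ws" using RR(3) mm(2) by blast
  qed
  then show False using P(1) W(1) xs_ne by (cases xs) auto
qed

lemma order_pow: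
  assumes "f \<in> mp a" "f \<notin> mp (Suc a)"
  shows "f [^] (n::nat) \<notin> mp (Suc (a * n))"
proof (induction n)
  case 0
  then show ?case using mp_1 mm(2) by simp
next
  case (Suc n)
  have "f [^] n \<otimes> f \<notin> mp (Suc (a * n + a))" using order_mult[OF mp_pow[OF assms(1)] Suc assms] .
  then show ?case by (simp add: add.commute)
qed

lemma ipw_mp:
  assumes "ideal_of R E" "E \<subseteq> mp e"
  shows "ipw R E n \<subseteq> mp (e * n)"
proof (induction n)
  case (Suc n)
  show ?case
  proof
    fix w assume "w \<in> ipw R E (Suc n)"
    then have "w \<in> ideal_prod K (ipw R E n) E" by simp
    then show "w \<in> mp (e * Suc n)"
    proof induction
      case (prod i j)
      then have "i \<otimes> j \<in> mp (e * n + e)" using mp_mult Suc assms(2) by blast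
      then show ?case by (simp add: add.commute)
    next
      case (sum s t) then show ?case using mpD(3) by blast
    qed
  qed
qed simp

lemma order_exists:
  assumes "f \<in> R" "f \<notin> mp e"
  shows "\<exists>k<e. f \<in> mp k \<and> f \<notin> mp (Suc k)"
proof -
  define l where "l = (LEAST l. f \<notin> mp l)"
  have l: "f \<notin> mp l" unfolding l_def using assms(2) by (rule LeastI[of "\<lambda>l. f \<notin> mp l"])
  have "l \<le> e" unfolding l_def using assms(2) by (rule Least_le[of "\<lambda>l. f \<notin> mp l"])
  have "l \<noteq> 0" using l assms(1) by (cases l) auto
  then obtain k where k: "l = Suc k" by (cases l) auto
  have "f \<in> mp k" using not_less_Least[of k "\<lambda>l. f \<notin> mp l"] k l_def by auto
  then show ?thesis using l[unfolded k] k \<open>l \<le> e\<close> by (intro exI[of _ k] conjI) simp_all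
qed

text \<open>The powers of \<open>m\<close> are complete. If \<open>z\<close> had order
  \<open>k < e\<close>, the lower terms of an integral equation of degree \<open>n\<close> would
  have order above \<open>k n\<close>, while \<open>z^n\<close> has order exactly
  \<open>k n\<close>.\<close>

theorem closure_order:
  assumes "ideal_of R E" "E \<subseteq> mp e" "z \<in> ideal_closure (K\<lparr>carrier := R\<rparr>) E"
  shows "z \<in> mp e"
proof (rule ccontr)
  assume "z \<notin> mp e"
  moreover have zR: "z \<in> R" "int_over (ipw R E) z" using assms(3) ideal_closure_int_over[OF sR assms(1)] by auto
  ultimately obtain k where k: "k < e" "z \<in> mp k" "z \<notin> mp (Suc k)" using order_exists by blast
  have dep: "w \<in> mp (Suc (k * n))" if "w \<in> dep (ipw R E) z n" for w n
    using that
  proof (induction n arbitrary: w)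
    case 0 then show ?case using mpD(2) by (auto simp del: ipw.simps)
  next
    case (Suc n)
    then obtain w' c where w: "w = z \<otimes> w' \<oplus> c" "w' \<in> dep (ipw R E) z n" "c \<in> ipw R E (Suc n)" by auto
    have "z \<otimes> w' \<in> mp (k + Suc (k * n))" using mp_mult[OF k(2) Suc.IH[OF w(2)]] .
    moreover have "Suc (k * Suc n) \<le> e * Suc n"
    proof -
      have "Suc k * Suc n \<le> e * Suc n" using k(1) by (intro mult_le_mono1) simp
      then show ?thesis by simp
    qed
    then have "c \<in> mp (Suc (k * Suc n))" using ipw_mp[OF assms(1,2)] w(3) mp_antimono by blast
    ultimately show ?case unfolding w(1) using mpD(3) by (simp del: ipw.simps)
  qed
  obtain n where "n \<ge> 1" "z [^] n \<in> dep (ipw R E) z n" using zR(2) unfolding int_over_def by blast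
  then show False using dep order_pow[OF k(2,3)] by blast
qed

end

context ambient_field
begin

section \<open>Height-one primes of integral closures\<close>

abbreviation ic :: "'a set \<Rightarrow> 'a set" where "ic A \<equiv> integral_closure_in K A"

lemma ic_int_over: "subring A K \<Longrightarrow> z \<in> ic A \<longleftrightarrow> z \<in> carrier K \<and> int_over (\<lambda>_. A) z"
  unfolding integral_closure_in_def using int_over_iff[OF const_grading, of A z] by auto

lemma ic_facts:
  assumes "subring A K"
  shows "subring (ic A) K" "A \<subseteq> ic A" "\<And>V. vring V \<Longrightarrow> A \<subseteq> V \<Longrightarrow> ic A \<subseteq> V"
proof -
  note iff = integral_closure_iff[OF assms]
  show "A \<subseteq> ic A" using iff subringD(1)[OF assms] by blast
  show "\<And>V. vring V \<Longrightarrow> A \<subseteq> V \<Longrightarrow> ic A \<subseteq> V" using iff by blast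
  show "subring (ic A) K"
  proof (rule subringI)
    show "ic A \<subseteq> carrier K" using iff by blast
    show "\<one> \<in> ic A" unfolding iff using vringD(1) subringD(3) by auto
    show "\<And>h. h \<in> ic A \<Longrightarrow> \<ominus> h \<in> ic A" unfolding iff using vringD(1) subringD(5) by auto
    show "\<And>h1 h2. h1 \<in> ic A \<Longrightarrow> h2 \<in> ic A \<Longrightarrow> h1 \<otimes> h2 \<in> ic A" unfolding iff using vringD(1) subringD(6) by auto
    show "\<And>h1 h2. h1 \<in> ic A \<Longrightarrow> h2 \<in> ic A \<Longrightarrow> h1 \<oplus> h2 \<in> ic A" unfolding iff using vringD(1) subringD(7) by auto
  qed
qed

lemma ic_between:
  assumes "subring A K" "subring B K" "A \<subseteq> B" "B \<subseteq> ic A"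
  shows "ic B = ic A"
proof (intro equalityI subsetI)
  fix z assume z: "z \<in> ic B"
  show "z \<in> ic A" unfolding integral_closure_iff[OF assms(1)]
  proof (intro conjI allI impI)
    show "z \<in> carrier K" using z integral_closure_iff[OF assms(2)] by blast
    fix V assume V: "vring V \<and> A \<subseteq> V"
    then have "B \<subseteq> V" using ic_facts(3)[OF assms(1)] assms(4) by blast
    then show "z \<in> V" using z integral_closure_iff[OF assms(2)] V by blast
  qed
next
  fix z assume z: "z \<in> ic A"
  then show "z \<in> ic B" unfolding integral_closure_iff[OF assms(1)] integral_closure_iff[OF assms(2)] using assms(3) by blast
qed

text \<open>Integral closure commutes with localization: a common denominator of the coefficients,
  multiplied onto \<open>z\<close>, makes its equation one over \<open>A\<close>.\<close>

lemma ic_lcl: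
  assumes "subring A K" "prime_of A P" "z \<in> ic (lcl A P)"
  obtains s where "s \<in> A" "s \<notin> P" "s \<otimes> z \<in> ic A"
proof -
  note A = subringD[OF assms(1)] and P = prime_ofD[OF assms(2)]
  note L = lcl_facts[OF assms(1,2)]
  note LL = subringD[OF L(1)]
  have z: "z \<in> carrier K" "int_over (\<lambda>_. lcl A P) z" using assms(3) ic_int_over[OF L(1)] by auto
  \<comment> \<open>The quantifier over \<open>t\<close> allows the denominator to be enlarged:
    passing from \<open>s\<close> to \<open>s \<otimes> r\<close>, with \<open>r\<close> clearing
    the next coefficient, must keep the earlier coefficients cleared.\<close>
  have *: "\<exists>s\<in>A. s \<notin> P \<and> (\<forall>t\<in>A. (s \<otimes> t) [^] n \<otimes> w \<in> dep (\<lambda>_. A) (s \<otimes> t \<otimes> z) n)" if "w \<in> dep (\<lambda>_. lcl A P) z n" for w n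
    using that
  proof (induction n arbitrary: w)
    case 0
    then show ?case using A(3,4) P(2) by (intro bexI[of _ \<one>]) auto
  next
    case (Suc n)
    then obtain w' c where w: "w = z \<otimes> w' \<oplus> c" "w' \<in> dep (\<lambda>_. lcl A P) z n" "c \<in> lcl A P" by auto
    obtain s where s: "s \<in> A" "s \<notin> P" "\<And>t. t \<in> A \<Longrightarrow> (s \<otimes> t) [^] n \<otimes> w' \<in> dep (\<lambda>_. A) (s \<otimes> t \<otimes> z) n"
      using Suc.IH[OF w(2)] by blast
    obtain r where r: "r \<in> A" "r \<notin> P" "r \<otimes> c \<in> A" by (rule lcl_clear[OF assms(1,2) w(3)])
    have wK: "w' \<in> carrier K" "c \<in> carrier K" using w(2,3) dep_carr[OF z(1), of "\<lambda>_. lcl A P"] LL(1) by blast+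
    have "(s \<otimes> r \<otimes> t) [^] Suc n \<otimes> w \<in> dep (\<lambda>_. A) (s \<otimes> r \<otimes> t \<otimes> z) (Suc n)" if t: "t \<in> A" for t
    proof -
      have k: "s \<in> carrier K" "r \<in> carrier K" "t \<in> carrier K" using s r t A(4) by auto
      define q where "q = s \<otimes> (r \<otimes> t)"
      have qA: "q \<in> A" unfolding q_def using s r t A(6) by simp
      have q: "s \<otimes> r \<otimes> t = q" unfolding q_def using k by (simp add: m_assoc)
      have qK: "q \<in> carrier K" "q [^] n \<in> carrier K" using qA A(4) by auto
      have 1: "q [^] n \<otimes> w' \<in> dep (\<lambda>_. A) (q \<otimes> z) n" unfolding q_def using s(3) A(6)[OF r(1) t] by blast
      have "q \<otimes> c = (s \<otimes> t) \<otimes> (r \<otimes> c)" unfolding q_def using k wK by (simp add: m_ac)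
      then have "q [^] n \<otimes> (q \<otimes> c) \<in> A" using A(6,9) qA s r t by simp
      moreover have "q [^] Suc n \<otimes> w = (q \<otimes> z) \<otimes> (q [^] n \<otimes> w') \<oplus> q [^] n \<otimes> (q \<otimes> c)"
        unfolding w(1) nat_pow_Suc using qK wK z(1) by algebra
      ultimately show ?thesis unfolding q using 1 by auto
    qed
    moreover have "s \<otimes> r \<in> A" "s \<otimes> r \<notin> P" using A(6) P(3) s r by blast+
    ultimately show ?case by blast
  qed
  obtain n where n: "n \<ge> 1" "z [^] n \<in> dep (\<lambda>_. lcl A P) z n" using z(2) unfolding int_over_def by blast
  obtain s where s: "s \<in> A" "s \<notin> P" "\<And>t. t \<in> A \<Longrightarrow> (s \<otimes> t) [^] n \<otimes> z [^] n \<in> dep (\<lambda>_. A) (s \<otimes> t \<otimes> z) n"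
    using *[OF n(2)] by blast
  have sK: "s \<in> carrier K" using s A(4) by blast
  have "(s \<otimes> z) [^] n \<in> dep (\<lambda>_. A) (s \<otimes> z) n" using s(3)[OF A(3)] sK z(1) by (simp add: nat_pow_distrib)
  then have "s \<otimes> z \<in> ic A" unfolding ic_int_over[OF assms(1)] int_over_def using n(1) sK z(1) by auto
  then show thesis using that s by blast
qed

lemma dep_pev:
  assumes AK: "A \<subseteq> carrier K" and zK: "z \<in> carrier K" and "w \<in> dep (\<lambda>_. A) z n"
  shows "\<exists>p. length p = n \<and> set p \<subseteq> A \<and> w = pev p z"
  using assms(3)
proof (induction n arbitrary: w)
  case 0 then show ?case by simp
next
  case (Suc n)
  then obtain w' c where w: "w = z \<otimes> w' \<oplus> c" "w' \<in> dep (\<lambda>_. A) z n" "c \<in> A" by auto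
  obtain p where p: "length p = n" "set p \<subseteq> A" "w' = pev p z" using Suc.IH[OF w(2)] by blast
  have k: "w' \<in> carrier K" "c \<in> carrier K" using w(2,3) dep_carr[OF zK, of "\<lambda>_. A"] AK by blast+
  have "w = pev (c # p) z" unfolding w(1) using p(3) k zK by (simp add: a_comm)
  then show ?case using p w(3) by (intro exI[of _ "c # p"]) auto
qed

text \<open>An integral equation for \<open>e \<in> N\<close>, read modulo \<open>P\<close>, splits into a power of \<open>e\<close> and a factor outside \<open>N\<close>.\<close>

lemma integral_trailing:
  assumes "subring A K" "prime_of A P" "subring C K" "A \<subseteq> C" "prime_of C N" "P \<subseteq> N" "N \<inter> A \<subseteq> P" "e \<in> N" "e \<in> ic A"
  obtains k f where "f \<in> C" "f \<notin> N" "e [^] (k::nat) \<otimes> f \<in> ideal_prod K C P"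
proof -
  note A = subringD[OF assms(1)] and P = prime_ofD[OF assms(2)] and C = subringD[OF assms(3)] and N = prime_ofD[OF assms(5)]
  have eC: "e \<in> C" using assms(8) N(4) by blast
  have eK: "e \<in> carrier K" using C(4)[OF eC] .
  have PC: "P \<subseteq> C" using P(4) assms(4) by blast
  define J where "J = ideal_prod K C P"
  have J: "ideal_of C J" unfolding J_def using ideal_prod_ideal[OF assms(3) self_ideal_of[OF assms(3)] PC] P(5) by blast
  \<comment> \<open>Coefficients in \<open>P\<close> are dropped from the low end, each time gaining
    a factor \<open>e\<close>. At the first coefficient outside \<open>P\<close> the remaining value
    is outside \<open>N\<close>, for it is congruent to that coefficient modulo
    \<open>e\<close>.\<close>
  have step: "\<exists>k f. f \<in> C \<and> f \<notin> N \<and> e [^] (k::nat) \<otimes> f \<in> J" if "set q \<subseteq> A" "\<not> set q \<subseteq> P" "e [^] (k::nat) \<otimes> pev q e \<in> J" for q k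
    using that
  proof (induction q arbitrary: k)
    case (Cons c q)
    have c: "c \<in> A" "set q \<subseteq> A" using Cons.prems(1) by auto
    have cC: "c \<in> C" "set q \<subseteq> C" using c assms(4) by auto
    have qC: "pev q e \<in> C" using pev_in[OF assms(3) cC(2) eC] .
    have k: "c \<in> carrier K" "pev q e \<in> carrier K" using cC qC C(4) by auto
    show ?case
    proof (cases "c \<in> P")
      case True
      have "e [^] k \<otimes> c \<in> J" unfolding J_def using C(9)[OF eC] True by (rule ideal_prod.prod)
      then have "e [^] k \<otimes> pev (c # q) e \<ominus> e [^] k \<otimes> c \<in> J" using ideal_of_minus(2)[OF assms(3) J Cons.prems(3)] by blast
      moreover have "e [^] k \<otimes> pev (c # q) e \<ominus> e [^] k \<otimes> c = e [^] Suc k \<otimes> pev q e"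
        unfolding pev.simps nat_pow_Suc using k eK nat_pow_closed[OF eK, of k] by algebra
      ultimately have "e [^] Suc k \<otimes> pev q e \<in> J" by simp
      moreover have "\<not> set q \<subseteq> P" using Cons.prems(2) True by simp
      ultimately show ?thesis using Cons.IH[OF c(2)] by blast
    next
      case False
      have "pev (c # q) e \<notin> N"
      proof
        assume a: "pev (c # q) e \<in> N"
        have "pev (c # q) e \<ominus> pev q e \<otimes> e \<in> N" using ideal_of_minus(2)[OF assms(3) N(1) a N(7)[OF qC assms(8)]] .
        moreover have "pev (c # q) e \<ominus> pev q e \<otimes> e = c" unfolding pev.simps using k eK by algebra
        ultimately show False using False assms(7) c(1) by auto
      qed
      moreover have "pev (c # q) e \<in> C" using pev_in[OF assms(3) _ eC, of "c # q"] cC by simp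
      ultimately show ?thesis using Cons.prems(3) by blast
    qed
  qed simp
  obtain n where n: "n \<ge> 1" "e [^] n \<in> dep (\<lambda>_. A) e n" using assms(9) unfolding ic_int_over[OF assms(1)] int_over_def by blast
  obtain p where p: "length p = n" "set p \<subseteq> A" "e [^] n = pev p e" using dep_pev[OF A(1) eK n(2)] by blast
  have pK: "set p \<subseteq> carrier K" using p(2) A(1) by blast
  \<comment> \<open>The equation is brought to one side. Its leading coefficient
    \<open>\<ominus> \<one>\<close> guarantees that the coefficients do not all lie in
    \<open>P\<close>.\<close>
  have "pev (p @ [\<ominus> \<one>]) e = pev p e \<oplus> e [^] n \<otimes> (\<ominus> \<one>)" using pev_snoc[OF pK _ eK, of "\<ominus> \<one>"] p(1) by simp
  also have "\<dots> = \<zero>" unfolding p(3)[symmetric] using nat_pow_closed[OF eK, of n] by algebra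
  finally have z: "pev (p @ [\<ominus> \<one>]) e = \<zero>" .
  have "\<ominus> \<one> \<notin> P"
  proof
    assume "\<ominus> \<one> \<in> P"
    then have "\<ominus> (\<ominus> \<one>) \<in> P" by (rule ideal_of_minus(1)[OF assms(1) P(1)])
    then show False using P(2) by simp
  qed
  then have "\<not> set (p @ [\<ominus> \<one>]) \<subseteq> P" by simp
  moreover have "set (p @ [\<ominus> \<one>]) \<subseteq> A" using p(2) A(3,5) by simp
  moreover have "e [^] (0::nat) \<otimes> pev (p @ [\<ominus> \<one>]) e \<in> J" unfolding z using ideal_ofD(2)[OF J] by simp
  ultimately obtain k f where "f \<in> C" "f \<notin> N" "e [^] (k::nat) \<otimes> f \<in> J" using step by blast
  then show thesis using that unfolding J_def by blast
qed

text \<open>An annihilator that is maximal among those of nonzero multiples of \<open>w\<close> in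
  the \<open>A\<close>-module \<open>K/B\<close> is prime. \<open>B\<close> is just a submodule: it
  will be an integral closure, a localization of one, or the ring itself.\<close>

lemma associated_prime:
  assumes "noeth A" "B \<subseteq> carrier K" "\<zero> \<in> B" "\<And>a b. a \<in> B \<Longrightarrow> b \<in> B \<Longrightarrow> a \<oplus> b \<in> B" "\<And>s b. s \<in> A \<Longrightarrow> b \<in> B \<Longrightarrow> s \<otimes> b \<in> B"
    "w \<in> carrier K" "w \<notin> B"
  obtains c where "c \<in> A" "c \<otimes> w \<notin> B" "prime_of A {s \<in> A. s \<otimes> (c \<otimes> w) \<in> B}"
proof -
  note sA = noeth_subring[OF assms(1)]
  note A = subringD[OF sA]
  define ann where "ann c = {s \<in> A. s \<otimes> (c \<otimes> w) \<in> B}" for c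
  have id: "ideal_of A (ann c)" if c: "c \<in> A" for c
  proof (rule ideal_ofI)
    have cw: "c \<otimes> w \<in> carrier K" using A(4)[OF c] assms(6) by simp
    show "ann c \<subseteq> A" unfolding ann_def by blast
    show "\<zero> \<in> ann c" unfolding ann_def using A(2) cw assms(3) by simp
    show "s \<oplus> t \<in> ann c" if "s \<in> ann c" "t \<in> ann c" for s t
      using that cw A(4,7) assms(4) unfolding ann_def by (auto simp: l_distr)
    show "s \<otimes> t \<in> ann c" if "s \<in> A" "t \<in> ann c" for s t
      using that cw A(4,6) assms(5) unfolding ann_def by (auto simp: m_assoc)
  qed
  let ?F = "{ann c | c. c \<in> A \<and> c \<otimes> w \<notin> B}"
  have F1: "ann \<one> \<in> ?F" using A(3) assms(6,7) by (intro CollectI exI[of _ \<one>]) simp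
  have Fid: "M \<in> ?F \<Longrightarrow> ideal_of A M" for M using id by blast
  obtain M where M: "M \<in> ?F" "\<And>N. N \<in> ?F \<Longrightarrow> M \<subseteq> N \<Longrightarrow> N = M"
  proof (rule noeth_max[OF assms(1) F1 Fid])
    fix M assume "M \<in> ?F" "\<And>E. E \<in> ?F \<Longrightarrow> M \<subseteq> E \<Longrightarrow> E = M"
    then show thesis by (rule that)
  qed
  obtain c where c: "M = ann c" "c \<in> A" "c \<otimes> w \<notin> B" using M(1) by blast
  have cK: "c \<in> carrier K" using A(4) c(2) by blast
  have "prime_of A (ann c)" unfolding prime_of_def
  proof (intro conjI id c(2) ballI impI)
    show "\<one> \<notin> ann c" unfolding ann_def using c(3) cK assms(6) by simp
    fix s t assume st: "s \<in> A" "t \<in> A" "s \<otimes> t \<in> ann c"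
    have stK: "s \<in> carrier K" "t \<in> carrier K" using st A(4) by auto
    show "s \<in> ann c \<or> t \<in> ann c"
    proof (rule disjCI)
      assume "t \<notin> ann c"
      have tc: "t \<otimes> c \<in> A" "(t \<otimes> c) \<otimes> w \<notin> B" using \<open>t \<notin> ann c\<close> st(2) A(6)[OF st(2) c(2)] stK cK assms(6) unfolding ann_def
        by (auto simp: m_assoc)
      then have "ann (t \<otimes> c) \<in> ?F" by blast
      moreover have "M \<subseteq> ann (t \<otimes> c)"
      proof
        fix r assume "r \<in> M"
        then have r: "r \<in> A" "r \<otimes> (c \<otimes> w) \<in> B" unfolding c(1) ann_def by auto
        have "r \<otimes> ((t \<otimes> c) \<otimes> w) = t \<otimes> (r \<otimes> (c \<otimes> w))" using A(4)[OF r(1)] stK cK assms(6) by (simp add: m_ac)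
        then show "r \<in> ann (t \<otimes> c)" unfolding ann_def using r(1) assms(5)[OF st(2) r(2)] by simp
      qed
      ultimately have "ann (t \<otimes> c) = M" by (rule M(2))
      moreover have "s \<otimes> ((t \<otimes> c) \<otimes> w) = (s \<otimes> t) \<otimes> (c \<otimes> w)" using stK cK assms(6) by (simp add: m_ac)
      then have "s \<in> ann (t \<otimes> c)" using st(1,3) unfolding ann_def by simp
      ultimately show "s \<in> ann c" unfolding c(1) by simp
    qed
  qed
  then show thesis using that c unfolding ann_def by blast
qed

section \<open>Noetherian overrings and the valuation rings they produce\<close>

definition frac :: "'a set \<Rightarrow> bool" where
  "frac A \<longleftrightarrow> (\<forall>z\<in>carrier K. \<exists>a\<in>A. \<exists>b\<in>A. b \<noteq> \<zero> \<and> z = a \<otimes> inv b)"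

lemma frac_mono: "frac A \<Longrightarrow> A \<subseteq> B \<Longrightarrow> frac B"
  unfolding frac_def by blast

text \<open>Rank at most one in terms of divisibility: the multiples of the value of a nonunit
  exceed every finite value.\<close>

definition archimedean :: "'a set \<Rightarrow> bool" where
  "archimedean V \<longleftrightarrow> (\<forall>e\<in>nonunits V. \<forall>q\<in>V. q \<noteq> \<zero> \<longrightarrow> (\<exists>n::nat. vdvd V q (e [^] n)))"

text \<open>The Krull-Akizuki argument in the form of Matijevic, for the elements \<open>c\<close> having a multiple by a power
  of each \<open>e \<in> M\<close> in \<open>A\<close>.\<close>

lemma transform_bound:
  assumes "noeth A" "prime_of A M" "\<And>a. a \<in> A \<Longrightarrow> a \<notin> M \<Longrightarrow> inv a \<in> A"
    "subring C K" "A \<subseteq> C" "\<And>c e. c \<in> C \<Longrightarrow> e \<in> M \<Longrightarrow> \<exists>k::nat. e [^] k \<otimes> c \<in> A" "y \<in> M" "y \<noteq> \<zero>"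
  shows "\<exists>n::nat. \<forall>c\<in>C. \<exists>a\<in>A. \<exists>c'\<in>C. c = a \<otimes> inv (y [^] n) \<oplus> y \<otimes> c'"
proof -
  note sA = noeth_subring[OF assms(1)]
  note A = subringD[OF sA] and M = prime_ofD[OF assms(2)] and C = subringD[OF assms(4)]
  have yA: "y \<in> A" using assms(7) M(4) by blast
  have yC: "y \<in> C" using yA assms(5) by blast
  have yK: "y \<in> carrier K" using A(4)[OF yA] .
  have ynK: "y [^] n \<in> carrier K" "y [^] n \<noteq> \<zero>" for n :: nat using yK assms(8) by auto
  \<comment> \<open>The trace on \<open>A\<close> of \<open>y^(n+1) C + y A\<close>. It is a
    descending chain of ideals over \<open>y A\<close>, and a power of each \<open>e \<in> M\<close>
    carries an element of the first member into \<open>y A\<close>, as the chain condition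
    requires.\<close>
  define I where "I n = {a \<in> A. \<exists>c\<in>C. \<exists>b\<in>A. a = y [^] Suc n \<otimes> c \<oplus> y \<otimes> b}" for n
  have I: "ideal_of A (I n)" for n
  proof (rule ideal_ofI)
    show "I n \<subseteq> A" unfolding I_def by blast
    have "\<zero> = y [^] Suc n \<otimes> \<zero> \<oplus> y \<otimes> \<zero>" using yK by simp
    then show "\<zero> \<in> I n" unfolding I_def using A(2) C(2) by blast
    fix a a' assume "a \<in> I n" "a' \<in> I n"
    then obtain c b c' b' where *: "a \<in> A" "a' \<in> A" "c \<in> C" "b \<in> A" "a = y [^] Suc n \<otimes> c \<oplus> y \<otimes> b"
      "c' \<in> C" "b' \<in> A" "a' = y [^] Suc n \<otimes> c' \<oplus> y \<otimes> b'" unfolding I_def by blast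
    have "a \<oplus> a' = y [^] Suc n \<otimes> (c \<oplus> c') \<oplus> y \<otimes> (b \<oplus> b')"
      unfolding *(5,8) using C(4)[OF *(3)] C(4)[OF *(6)] A(4)[OF *(4)] A(4)[OF *(7)] ynK(1)[of "Suc n"] yK by algebra
    then show "a \<oplus> a' \<in> I n" unfolding I_def using A(7) C(7) * by blast
  next
    fix s a assume s: "s \<in> A" and "a \<in> I n"
    then obtain c b where *: "a \<in> A" "c \<in> C" "b \<in> A" "a = y [^] Suc n \<otimes> c \<oplus> y \<otimes> b" unfolding I_def by blast
    have sC: "s \<in> C" using s assms(5) by blast
    have "s \<otimes> a = y [^] Suc n \<otimes> (s \<otimes> c) \<oplus> y \<otimes> (s \<otimes> b)"
      unfolding *(4) using C(4)[OF *(2)] A(4)[OF *(3)] A(4)[OF s] ynK(1)[of "Suc n"] yK by algebra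
    then show "s \<otimes> a \<in> I n" unfolding I_def using A(6)[OF s] C(6)[OF sC] * by blast
  qed
  have Iantimono: "I (Suc n) \<subseteq> I n" for n
  proof
    fix a assume "a \<in> I (Suc n)"
    then obtain c b where *: "a \<in> A" "c \<in> C" "b \<in> A" "a = y [^] Suc (Suc n) \<otimes> c \<oplus> y \<otimes> b" unfolding I_def by blast
    have "a = y [^] Suc n \<otimes> (y \<otimes> c) \<oplus> y \<otimes> b" unfolding *(4) using yK C(4)[OF *(2)] by (simp add: m_ac)
    then show "a \<in> I n" unfolding I_def using C(6)[OF yC] * by blast
  qed
  define E where "E = plus_gen A {\<zero>} y"
  note E = plus_gen_ideal[OF sA zero_ideal_of[OF sA] yA, folded E_def]
  have ymul: "y \<otimes> b \<in> E" if "b \<in> A" for b using ideal_ofD(4)[OF E(1) that E(3)] A(4)[OF that] yK by (simp add: m_comm)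
  have "\<exists>N. \<forall>n\<ge>N. I n \<subseteq> psat A M (I (Suc n))"
  proof (rule local_dcc[of A M E I, OF assms(1,2) E(1) I Iantimono])
    show "E \<subseteq> I n" for n
    proof -
      have "y = y [^] Suc n \<otimes> \<zero> \<oplus> y \<otimes> \<one>" using yK by simp
      then have "y \<in> I n" unfolding I_def using yA A(3) C(2) by blast
      then show ?thesis unfolding E_def using plus_gen_subset[OF I] ideal_ofD(2)[OF I] by simp
    qed
    fix a e assume a: "a \<in> I 0" and e: "e \<in> M"
    obtain c b where *: "a \<in> A" "c \<in> C" "b \<in> A" "a = y [^] Suc 0 \<otimes> c \<oplus> y \<otimes> b" using a unfolding I_def by blast
    obtain k where k: "e [^] (k::nat) \<otimes> c \<in> A" using assms(6)[OF *(2) e] by blast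
    have eA: "e \<in> A" using e M(4) by blast
    have K: "e [^] k \<in> carrier K" "c \<in> carrier K" "b \<in> carrier K" using A(4)[OF eA] C(4)[OF *(2)] A(4)[OF *(3)] by auto
    have y1: "y [^] Suc 0 = y" using yK by simp
    have "\<one> \<otimes> (e [^] k \<otimes> a) = y \<otimes> (e [^] k \<otimes> c \<oplus> e [^] k \<otimes> b)"
      unfolding *(4) y1 using K yK by algebra
    then have "\<one> \<otimes> (e [^] k \<otimes> a) \<in> E" using ymul A(6,7,9) k eA *(3) by simp
    then show "\<exists>s\<in>A. \<exists>k::nat. s \<notin> M \<and> s \<otimes> (e [^] k \<otimes> a) \<in> E" using A(3) M(2) by blast
  qed
  then obtain N where "\<And>n. n \<ge> N \<Longrightarrow> I n \<subseteq> psat A M (I (Suc n))" by blast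
  moreover have "psat A M (I n) \<subseteq> I n" for n
  proof
    fix a assume "a \<in> psat A M (I n)"
    then obtain s where s: "a \<in> A" "s \<in> A" "s \<notin> M" "s \<otimes> a \<in> I n" unfolding psat_def by blast
    have "inv s \<otimes> (s \<otimes> a) \<in> I n" using ideal_ofD(4)[OF I assms(3)[OF s(2,3)] s(4)] .
    moreover have "s \<noteq> \<zero>" using s(3) M(5) by blast
    ultimately show "a \<in> I n" using A(4) s by simp
  qed
  ultimately have N: "I n \<subseteq> I (Suc n)" if "n \<ge> N" for n using that by blast
  \<comment> \<open>Induction on an exponent \<open>k\<close> for which
    \<open>y^k c \<in> A\<close>. Beyond the stationary index, \<open>y^(k+1) c\<close> equals
    \<open>y^(k+2) c' + y b\<close>, so \<open>c - y c'\<close> is carried into \<open>A\<close> by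
    \<open>y^k\<close> already, and the correction is a multiple of \<open>y\<close>.\<close>
  have "\<exists>a\<in>A. \<exists>c'\<in>C. c = a \<otimes> inv (y [^] Suc N) \<oplus> y \<otimes> c'" if "c \<in> C" "y [^] k \<otimes> c \<in> A" for c and k :: nat
    using that
  proof (induction k arbitrary: c)
    case 0
    have cK: "c \<in> carrier K" "c \<in> A" using C(4)[OF 0(1)] 0(2) by auto
    have "c = (y [^] Suc N \<otimes> c) \<otimes> inv (y [^] Suc N) \<oplus> y \<otimes> \<zero>" using cK(1) ynK[of "Suc N"] yK by (simp del: nat_pow_Suc add: m_comm)
    moreover have "y [^] Suc N \<otimes> c \<in> A" using A(6)[OF A(9)[OF yA] cK(2)] .
    ultimately show ?case using C(2) by blast
  next
    case (Suc k)
    have cK: "c \<in> carrier K" using C(4)[OF Suc.prems(1)] .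
    show ?case
    proof (cases "k \<le> N")
      case True
      have "y [^] Suc N \<otimes> c = y [^] (N - k) \<otimes> (y [^] Suc k \<otimes> c)"
      proof -
        have "y [^] Suc N = y [^] (N - k) \<otimes> y [^] Suc k" using nat_pow_mult[OF yK, of "N - k" "Suc k"] True by simp
        then show ?thesis using yK cK by (simp add: m_assoc del: nat_pow_Suc)
      qed
      then have "y [^] Suc N \<otimes> c \<in> A" using A(6)[OF A(9)[OF yA] Suc.prems(2)] by simp
      moreover have "c = (y [^] Suc N \<otimes> c) \<otimes> inv (y [^] Suc N) \<oplus> y \<otimes> \<zero>" using cK(1) ynK[of "Suc N"] yK by (simp del: nat_pow_Suc add: m_comm)
      ultimately show ?thesis using C(2) by blast
    next
      case False
      have "y [^] Suc k \<otimes> c = y [^] Suc k \<otimes> c \<oplus> y \<otimes> \<zero>" using cK yK by simp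
      then have "y [^] Suc k \<otimes> c \<in> I k" unfolding I_def using Suc.prems A(2) by blast
      then have "y [^] Suc k \<otimes> c \<in> I (Suc k)" using N[of k] False by auto
      then obtain c' b where *: "c' \<in> C" "b \<in> A" "y [^] Suc k \<otimes> c = y [^] Suc (Suc k) \<otimes> c' \<oplus> y \<otimes> b" unfolding I_def by blast
      have k': "c' \<in> carrier K" "b \<in> carrier K" using C(4)[OF *(1)] A(4)[OF *(2)] .
      have "y \<otimes> (y [^] k \<otimes> (c \<ominus> y \<otimes> c')) = y [^] Suc k \<otimes> c \<ominus> y [^] Suc (Suc k) \<otimes> c'"
        unfolding nat_pow_Suc using cK yK k' ynK(1)[of k] by algebra
      also have "\<dots> = y \<otimes> b" unfolding *(3) using k' yK ynK(1)[of "Suc (Suc k)"] by algebra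
      finally have "y [^] k \<otimes> (c \<ominus> y \<otimes> c') = b" using cancel_l[OF yK assms(8)] cK k' yK by simp
      then have "y [^] k \<otimes> (c \<ominus> y \<otimes> c') \<in> A" using *(2) by simp
      moreover have "c \<ominus> y \<otimes> c' \<in> C" using C(6,8) Suc.prems(1) yC *(1) by simp
      ultimately obtain a c'' where a: "a \<in> A" "c'' \<in> C" "c \<ominus> y \<otimes> c' = a \<otimes> inv (y [^] Suc N) \<oplus> y \<otimes> c''" using Suc.IH by blast
      have aK: "a \<otimes> inv (y [^] Suc N) \<in> carrier K" "c'' \<in> carrier K" using A(4)[OF a(1)] C(4)[OF a(2)] ynK[of "Suc N"] by auto
      have "c = (c \<ominus> y \<otimes> c') \<oplus> y \<otimes> c'" using cK yK k' by algebra
      also have "\<dots> = a \<otimes> inv (y [^] Suc N) \<oplus> y \<otimes> (c'' \<oplus> c')" unfolding a(3) using aK yK k' by algebra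
      finally show ?thesis using a(1) C(7)[OF a(2) *(1)] by blast
    qed
  qed
  moreover have "\<exists>k::nat. y [^] k \<otimes> c \<in> A" if "c \<in> C" for c using assms(6)[OF that assms(7)] .
  ultimately show ?thesis by blast
qed

text \<open>Modulo \<open>y C\<close>, every element of \<open>C\<close> comes from the cyclic
  \<open>A\<close>-module generated by \<open>y^(-n)\<close>, by \<open>transform_bound\<close>.
  Hence an ideal containing \<open>y\<close> is generated by \<open>y\<close> together with
  generators of the \<open>A\<close>-module of its elements in \<open>y^(-n) A\<close>.\<close>

lemma transform_noeth:
  assumes "noeth A" "prime_of A M" "\<And>a. a \<in> A \<Longrightarrow> a \<notin> M \<Longrightarrow> inv a \<in> A" "frac A" "M \<noteq> {\<zero>}"
    "subring C K" "A \<subseteq> C" "\<And>c e. c \<in> C \<Longrightarrow> e \<in> M \<Longrightarrow> \<exists>k::nat. e [^] k \<otimes> c \<in> A"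
  shows "noeth C"
proof (rule noethI_fg[OF assms(6)])
  note sA = noeth_subring[OF assms(1)]
  note A = subringD[OF sA] and M = prime_ofD[OF assms(2)] and C = subringD[OF assms(6)]
  fix E assume Ei: "ideal_of C E"
  note E = ideal_ofD[OF Ei]
  show "\<exists>F. finite F \<and> F \<subseteq> E \<and> (\<forall>E'. ideal_of C E' \<and> F \<subseteq> E' \<longrightarrow> E \<subseteq> E')"
  proof (cases "E = {\<zero>}")
    case True
    then show ?thesis using ideal_ofD(2) by (intro exI[of _ "{}"]) auto
  next
    case False
    then obtain e where e: "e \<in> E" "e \<noteq> \<zero>" using E(2) by blast
    have eC: "e \<in> C" using e(1) E(1) by blast
    obtain a b where ab: "a \<in> A" "b \<in> A" "b \<noteq> \<zero>" "e = a \<otimes> inv b" using assms(4) C(4)[OF eC] unfolding frac_def by blast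
    obtain \<mu> where mu: "\<mu> \<in> M" "\<mu> \<noteq> \<zero>" using assms(5) M(5) by blast
    have muA: "\<mu> \<in> A" using mu(1) M(4) by blast
    have k: "a \<in> carrier K" "b \<in> carrier K" "\<mu> \<in> carrier K" using ab muA A(4) by auto
    have be: "b \<otimes> e = a" unfolding ab(4) using k ab(3) by simp
    \<comment> \<open>Clearing the denominator of \<open>e\<close> and multiplying by
      \<open>\<mu>\<close> gives a nonzero element that lies both in \<open>E\<close> and in
      \<open>M\<close>.\<close>
    define y where "y = \<mu> \<otimes> a"
    have "a \<noteq> \<zero>" using be e(2) ab(3) k C(4)[OF eC] by auto
    then have y0: "y \<noteq> \<zero>" unfolding y_def using k mu(2) by simp
    have yM: "y \<in> M" unfolding y_def using M(7)[OF ab(1) mu(1)] k by (simp add: m_comm)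
    have "\<mu> \<otimes> (b \<otimes> e) \<in> E" using E(4) ab(2) muA e(1) assms(7) by blast
    then have yE: "y \<in> E" unfolding y_def be .
    have yA: "y \<in> A" using yM M(4) by blast
    have yK: "y \<in> carrier K" using A(4)[OF yA] .
    obtain n where n: "\<And>c. c \<in> C \<Longrightarrow> \<exists>a\<in>A. \<exists>c'\<in>C. c = a \<otimes> inv (y [^] (n::nat)) \<oplus> y \<otimes> c'"
      using transform_bound[OF assms(1,2,3,6,7,8) yM y0] by blast
    define r where "r = inv (y [^] n)"
    have rK: "r \<in> carrier K" unfolding r_def using yK y0 by simp
    have pull: "ideal_of A {a \<in> A. a \<otimes> r \<in> E'}" if E': "ideal_of C E'" for E'
    proof (rule ideal_ofI)
      show "\<zero> \<in> {a \<in> A. a \<otimes> r \<in> E'}" using A(2) rK ideal_ofD(2)[OF E'] by simp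
      show "a \<oplus> b \<in> {a \<in> A. a \<otimes> r \<in> E'}" if "a \<in> {a \<in> A. a \<otimes> r \<in> E'}" "b \<in> {a \<in> A. a \<otimes> r \<in> E'}" for a b
        using that A(4,7) rK ideal_ofD(3)[OF E'] by (simp add: l_distr)
      show "s \<otimes> a \<in> {a \<in> A. a \<otimes> r \<in> E'}" if "s \<in> A" "a \<in> {a \<in> A. a \<otimes> r \<in> E'}" for s a
        using that A(4,6) rK ideal_ofD(4)[OF E'] subsetD[OF assms(7)] by (simp add: m_assoc)
    qed blast
    obtain ys where ys: "set ys \<subseteq> {a \<in> A. a \<otimes> r \<in> E}" "{a \<in> A. a \<otimes> r \<in> E} = gens A {\<zero>} ys"
      by (rule noeth_fg[OF assms(1) pull[OF Ei]])
    define F where "F = insert y ((\<lambda>a. a \<otimes> r) ` set ys)"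
    have "finite F" unfolding F_def by simp
    moreover have "F \<subseteq> E" unfolding F_def using yE ys(1) by auto
    moreover have "E \<subseteq> E'" if E': "ideal_of C E'" "F \<subseteq> E'" for E'
    proof
      fix e assume e: "e \<in> E"
      have eC: "e \<in> C" using e E(1) by blast
      obtain a c' where ac: "a \<in> A" "c' \<in> C" "e = a \<otimes> r \<oplus> y \<otimes> c'" using n[OF eC] unfolding r_def by blast
      have k: "a \<in> carrier K" "c' \<in> carrier K" "e \<in> carrier K" using A(4)[OF ac(1)] C(4)[OF ac(2)] C(4)[OF eC] .
      have "a \<otimes> r = e \<ominus> c' \<otimes> y" unfolding ac(3) using k(1,2) rK yK by algebra
      moreover have "e \<ominus> c' \<otimes> y \<in> E" using ideal_of_minus(2)[OF assms(6) Ei e E(4)[OF ac(2) yE]] .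
      ultimately have "a \<in> {a \<in> A. a \<otimes> r \<in> E}" using ac(1) by simp
      then have "a \<in> gens A {\<zero>} ys" unfolding ys(2) .
      moreover have "gens A {\<zero>} ys \<subseteq> {a \<in> A. a \<otimes> r \<in> E'}"
      proof (rule gens_subset[OF pull[OF E'(1)]])
        show "{\<zero>} \<subseteq> {a \<in> A. a \<otimes> r \<in> E'}" using rK A(2) ideal_ofD(2)[OF E'(1)] by simp
        show "set ys \<subseteq> {a \<in> A. a \<otimes> r \<in> E'}" using E'(2) ys(1) unfolding F_def by blast
      qed
      ultimately have "a \<otimes> r \<in> E'" by blast
      moreover have "c' \<otimes> y \<in> E'" using ideal_ofD(4)[OF E'(1) ac(2)] E'(2) unfolding F_def by blast
      moreover have "y \<otimes> c' = c' \<otimes> y" using k yK by (simp add: m_comm)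
      ultimately show "e \<in> E'" unfolding ac(3) using ideal_ofD(3)[OF E'(1)] by simp
    qed
    ultimately show ?thesis by blast
  qed
qed

lemma lcl_maximal:
  assumes "subring A K" "prime_of A P"
  defines "N \<equiv> {a \<otimes> inv s | a s. a \<in> P \<and> s \<in> A - P}"
  shows "prime_of (lcl A P) N" "\<And>a. a \<in> lcl A P \<Longrightarrow> a \<notin> N \<Longrightarrow> inv a \<in> lcl A P" "\<And>a. a \<in> A \<Longrightarrow> a \<in> N \<longleftrightarrow> a \<in> P"
    "\<And>a. a \<in> N \<Longrightarrow> a \<noteq> \<zero> \<Longrightarrow> inv a \<notin> lcl A P"
proof -
  note A = subringD[OF assms(1)] and P = prime_ofD[OF assms(2)]
  note L = lcl_facts[OF assms(1,2)]
  note LL = subringD[OF L(1)]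
  have nz: "s \<noteq> \<zero>" if "s \<notin> P" for s using that P(5) by blast
  have sP: "s \<otimes> t \<in> A - P" if "s \<in> A - P" "t \<in> A - P" for s t using that A(6) P(3) by blast
  have NI: "a \<otimes> inv s \<in> N" if "a \<in> P" "s \<in> A - P" for a s using that unfolding N_def by blast
  have PA: "a \<in> A" if "a \<in> P" for a using that P(4) by blast
  show mem: "a \<in> N \<longleftrightarrow> a \<in> P" if a: "a \<in> A" for a
  proof
    assume "a \<in> N"
    then obtain b s where *: "b \<in> P" "s \<in> A - P" "a = b \<otimes> inv s" unfolding N_def by blast
    then have "a \<otimes> s = b" using div_eq_iff(2)[of b s a] A(4) a nz PA by simp
    then show "a \<in> P" using P(3)[OF a, of s] * by auto
  next
    assume "a \<in> P"
    then have "a \<otimes> inv \<one> \<in> N" using NI A(3) P(2) by blast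
    then show "a \<in> N" using A(4)[OF a] by simp
  qed
  have NL: "N \<subseteq> lcl A P" unfolding N_def lcl_def using PA by blast
  have Ni: "ideal_of (lcl A P) N"
  proof (rule ideal_ofI[OF NL])
    show "\<zero> \<in> N" using mem[OF A(2)] P(5) by blast
    fix a b assume "a \<in> N" "b \<in> N"
    then obtain u s v t where *: "u \<in> P" "s \<in> A - P" "a = u \<otimes> inv s" "v \<in> P" "t \<in> A - P" "b = v \<otimes> inv t" unfolding N_def by blast
    have "a \<oplus> b = (u \<otimes> t \<oplus> v \<otimes> s) \<otimes> inv (s \<otimes> t)" unfolding *(3,6) using * A(4) nz PA by (simp add: div_add)
    moreover have "u \<otimes> t \<oplus> v \<otimes> s \<in> P" using P(6,7) * A(4) PA by (simp add: m_comm)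
    ultimately show "a \<oplus> b \<in> N" using NI sP * by metis
  next
    fix r a assume "r \<in> lcl A P" "a \<in> N"
    then obtain u s v t where *: "u \<in> P" "s \<in> A - P" "a = u \<otimes> inv s" "v \<in> A" "t \<in> A - P" "r = v \<otimes> inv t" unfolding N_def lcl_def by blast
    have "r \<otimes> a = (v \<otimes> u) \<otimes> inv (t \<otimes> s)" unfolding *(3,6) using * A(4) nz PA by (simp add: div_mult)
    then show "r \<otimes> a \<in> N" using NI sP * P(7) by metis
  qed
  have un: "inv a \<in> lcl A P" if a: "a \<in> lcl A P" "a \<notin> N" for a
  proof -
    obtain u s where *: "u \<in> A" "s \<in> A - P" "a = u \<otimes> inv s" using a(1) unfolding lcl_def by blast
    have u: "u \<notin> P" using a(2) * NI by blast
    have "inv a = s \<otimes> inv u" unfolding *(3) using * u nz A(4) by (simp add: inv_mult' m_comm)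
    then show ?thesis using lclI[of s A u P] * u by simp
  qed
  show "\<And>a. a \<in> lcl A P \<Longrightarrow> a \<notin> N \<Longrightarrow> inv a \<in> lcl A P" by (rule un)
  have one: "\<one> \<notin> N" using mem[OF A(3)] P(2) by blast
  show nu: "inv a \<notin> lcl A P" if a: "a \<in> N" "a \<noteq> \<zero>" for a
  proof
    assume "inv a \<in> lcl A P"
    then have "inv a \<otimes> a \<in> N" using ideal_ofD(4)[OF Ni _ a(1)] by blast
    then show False using one a NL LL(4) by auto
  qed
  show "prime_of (lcl A P) N"
    unfolding prime_of_def
  proof (intro conjI Ni one ballI impI)
    fix a b assume ab: "a \<in> lcl A P" "b \<in> lcl A P" "a \<otimes> b \<in> N"
    show "a \<in> N \<or> b \<in> N"
    proof (rule disjCI)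
      assume b: "b \<notin> N"
      have "b \<noteq> \<zero>" using b ideal_ofD(2)[OF Ni] by blast
      moreover have "inv b \<otimes> (a \<otimes> b) \<in> N" using ideal_ofD(4)[OF Ni un[OF ab(2) b] ab(3)] .
      ultimately show "a \<in> N" using LL(4) ab by simp
    qed
  qed
qed

text \<open>A Noetherian local domain whose maximal ideal is principal, generated by
  \<open>j\<close>: every nonzero element is a power of \<open>j\<close> times a unit, and both
  conclusions can be read off from the exponents.\<close>

lemma principal_maximal_vring:
  assumes "noeth C" "frac C" "prime_of C Q" "j \<in> Q" "j \<noteq> \<zero>" "\<And>e. e \<in> Q \<Longrightarrow> \<exists>v\<in>lcl C Q. e = j \<otimes> v"
  shows "vring (lcl C Q)" "archimedean (lcl C Q)"
proof -
  note sC = noeth_subring[OF assms(1)]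
  note C = subringD[OF sC] and Q = prime_ofD[OF assms(3)]
  define V where "V = lcl C Q"
  note L = lcl_facts[OF sC assms(3), folded V_def]
  note V = subringD[OF L(1)]
  define N where "N = {a \<otimes> inv s | a s. a \<in> Q \<and> s \<in> C - Q}"
  note M = lcl_maximal[OF sC assms(3), folded N_def V_def]
  have jC: "j \<in> C" using assms(4) Q(4) by blast
  have jV: "j \<in> V" using jC L(2) by blast
  have jK: "j \<in> carrier K" using V(4)[OF jV] .
  have jN: "j \<in> N" using M(3)[OF jC] assms(4) by blast
  have jn: "j [^] n \<noteq> \<zero>" "j [^] n \<in> carrier K" "j [^] n \<in> V" for n :: nat using jK assms(5) V(9)[OF jV] by auto
  have Nj: "\<exists>v\<in>V. a = j \<otimes> v" if a: "a \<in> N" for a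
  proof -
    obtain e s where *: "e \<in> Q" "s \<in> C - Q" "a = e \<otimes> inv s" using a unfolding N_def by blast
    obtain v where v: "v \<in> V" "e = j \<otimes> v" using assms(6)[OF *(1)] unfolding V_def by blast
    have s: "inv s \<in> V" using L(3)[of s] * by blast
    have "a = j \<otimes> (v \<otimes> inv s)" unfolding *(3) v(2) using jK V(4)[OF v(1)] V(4)[OF s] by (simp add: m_assoc)
    then show ?thesis using V(6)[OF v(1) s] by blast
  qed
  have NnV: "N = nonunits V"
  proof
    show "N \<subseteq> nonunits V" unfolding nonunits_def using M(4) prime_ofD(4)[OF M(1)] by blast
    show "nonunits V \<subseteq> N" unfolding nonunits_def using M(2) prime_ofD(5)[OF M(1)] by blast
  qed
  \<comment> \<open>If \<open>q\<close> were divisible by all powers of \<open>j\<close>, the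
    quotients \<open>v n = q/j^n\<close> would generate an ascending chain of ideals. Once it is
    stationary, \<open>v (n+1)\<close> is a multiple of \<open>v n = j v (n+1)\<close>, which makes
    \<open>j\<close> a unit.\<close>
  have rep: "\<exists>n. \<exists>v\<in>V. v \<notin> N \<and> q = j [^] (n::nat) \<otimes> v" if q: "q \<in> V" "q \<noteq> \<zero>" for q
  proof (rule ccontr)
    assume neg: "\<not> ?thesis"
    have qK: "q \<in> carrier K" using V(4)[OF q(1)] .
    have dv: "\<exists>v\<in>V. q = j [^] n \<otimes> v" for n :: nat
    proof (induction n)
      case 0 then show ?case using q qK by (intro bexI[of _ q]) auto
    next
      case (Suc n)
      then obtain v where v: "v \<in> V" "q = j [^] n \<otimes> v" by blast
      then have "v \<in> N" using neg by blast
      then obtain v' where v': "v' \<in> V" "v = j \<otimes> v'" using Nj by blast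
      have "q = j [^] Suc n \<otimes> v'" unfolding v(2) v'(2) using jK V(4)[OF v'(1)] by (simp add: m_assoc)
      then show ?case using v'(1) by blast
    qed
    define v where "v n = inv (j [^] n) \<otimes> q" for n :: nat
    have vV: "v n \<in> V" "j [^] n \<otimes> v n = q" for n
    proof -
      obtain u where u: "u \<in> V" "q = j [^] n \<otimes> u" using dv by blast
      then have "v n = u" unfolding v_def using jn V(4)[OF u(1)] by simp
      then show "v n \<in> V" "j [^] n \<otimes> v n = q" using u by auto
    qed
    have vK: "v n \<in> carrier K" for n using V(4)[OF vV(1)] .
    have vs: "v n = j \<otimes> v (Suc n)" for n
    proof -
      have "j [^] n \<otimes> v n = j [^] n \<otimes> (j \<otimes> v (Suc n))" unfolding vV(2) using vV(2)[of "Suc n"] jK vK jn(2)[of n] by (simp add: m_assoc)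
      then show ?thesis using cancel_l[OF jn(2,1) vK] jK vK by simp
    qed
    define E where "E n = plus_gen V {\<zero>} (v n)" for n
    have Eid: "ideal_of V (E n)" "v n \<in> E n" for n
      unfolding E_def using plus_gen_ideal[OF L(1) zero_ideal_of[OF L(1)] vV(1)] by auto
    have Einc: "E n \<subseteq> E (Suc n)" for n
    proof -
      have "v n \<in> E (Suc n)" using ideal_ofD(4)[OF Eid(1) jV Eid(2)] vs[of n] by simp
      then show ?thesis unfolding E_def[of n] using plus_gen_subset[OF Eid(1)] ideal_ofD(2)[OF Eid(1)] by simp
    qed
    have nV: "noeth V" unfolding V_def by (rule noeth_lcl[OF assms(1,3)])
    obtain n where En: "E (Suc n) = E n"
    proof (rule noethD[of V E, OF nV Eid(1) Einc])
      fix N assume a: "\<And>n. N \<le> n \<Longrightarrow> E n = E N"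
      have "E (Suc N) = E N" by (rule a) simp
      then show thesis by (rule that)
    qed
    have "v (Suc n) \<in> E n" by (rule subsetD[OF equalityD1[OF En] Eid(2)])
    then have "\<exists>e a. v (Suc n) = e \<oplus> a \<otimes> v n \<and> e \<in> {\<zero>} \<and> a \<in> V" unfolding E_def plus_gen_def by (simp only: mem_Collect_eq)
    then obtain b where b: "b \<in> V" "v (Suc n) = \<zero> \<oplus> b \<otimes> v n" by blast
    have bK: "b \<in> carrier K" using V(4)[OF b(1)] .
    have "v (Suc n) = b \<otimes> v n" using b(2) bK vK[of n] by simp
    also have "\<dots> = b \<otimes> (j \<otimes> v (Suc n))" by (rule arg_cong[OF vs])
    finally have "v (Suc n) = b \<otimes> (j \<otimes> v (Suc n))" .
    then have "v (Suc n) \<otimes> \<one> = v (Suc n) \<otimes> (b \<otimes> j)" using bK jK vK by (simp add: m_ac)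
    moreover have "v (Suc n) \<noteq> \<zero>" using vV(2)[of "Suc n"] q(2) jn(2)[of "Suc n"] by auto
    ultimately have "b \<otimes> j = \<one>" using cancel_l[OF vK] bK jK by simp
    moreover have "b \<otimes> j \<in> N" using prime_ofD(7)[OF M(1) b(1) jN] .
    ultimately show False using prime_ofD(2)[OF M(1)] by simp
  qed
  show "vring (lcl C Q)"
    unfolding vring_def V_def[symmetric]
  proof (intro conjI L(1) ballI impI)
    fix z assume z: "z \<in> carrier K" "z \<noteq> \<zero>"
    obtain a b where ab: "a \<in> C" "b \<in> C" "b \<noteq> \<zero>" "z = a \<otimes> inv b" using assms(2) z(1) unfolding frac_def by blast
    have a0: "a \<noteq> \<zero>" using z(2) ab C(4) by auto
    obtain n v where v: "v \<in> V" "v \<notin> N" "a = j [^] (n::nat) \<otimes> v" using rep[of a] ab(1) L(2) a0 by blast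
    obtain l u where u: "u \<in> V" "u \<notin> N" "b = j [^] (l::nat) \<otimes> u" using rep[of b] ab(2,3) L(2) by blast
    have K: "v \<in> carrier K" "u \<in> carrier K" "v \<noteq> \<zero>" "u \<noteq> \<zero>"
      using V(4) v(1,2) u(1,2) prime_ofD(5)[OF M(1)] by auto
    have iu: "inv u \<in> V" "inv v \<in> V" using M(2) v u by blast+
    show "z \<in> V \<or> inv z \<in> V"
    proof (cases "l \<le> n")
      case True
      then have p: "j [^] n = j [^] (n - l) \<otimes> j [^] l" using jK by (simp add: nat_pow_mult)
      have "z = (j [^] (n - l) \<otimes> (v \<otimes> inv u)) \<otimes> (j [^] l \<otimes> inv (j [^] l))"
        unfolding ab(4) v(3) u(3) p using K jn jK by (simp add: inv_mult' m_ac del: r_inv_carr inv_cancel)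
      then have "z = j [^] (n - l) \<otimes> (v \<otimes> inv u)" using K jn by simp
      then show ?thesis using V(6) jn(3) v(1) iu by simp
    next
      case False
      then have p: "j [^] l = j [^] (l - n) \<otimes> j [^] n" using jK by (simp add: nat_pow_mult)
      have "inv z = b \<otimes> inv a" unfolding ab(4) using ab C(4) a0 by (simp add: inv_mult' m_comm)
      also have "\<dots> = (j [^] (l - n) \<otimes> (u \<otimes> inv v)) \<otimes> (j [^] n \<otimes> inv (j [^] n))"
        unfolding v(3) u(3) p using K jn jK by (simp add: inv_mult' m_ac del: r_inv_carr inv_cancel)
      finally have "inv z = j [^] (l - n) \<otimes> (u \<otimes> inv v)" using K jn by simp
      then show ?thesis using V(6) jn(3) u(1) iu by simp
    qed
  qed
  show "archimedean (lcl C Q)"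
    unfolding archimedean_def V_def[symmetric]
  proof (intro ballI impI)
    fix e q assume e: "e \<in> nonunits V" and q: "q \<in> V" "q \<noteq> \<zero>"
    have eN: "e \<in> N" using e NnV by blast
    obtain e' where e': "e' \<in> V" "e = j \<otimes> e'" using Nj[OF eN] by blast
    obtain n v where v: "v \<in> V" "v \<notin> N" "q = j [^] (n::nat) \<otimes> v" using rep[OF q] by blast
    have K: "v \<in> carrier K" "e' \<in> carrier K" "v \<noteq> \<zero>" using V(4) v(1,2) e'(1) prime_ofD(5)[OF M(1)] by auto
    have "e [^] n = q \<otimes> (inv v \<otimes> e' [^] n)" unfolding e'(2) v(3) using K jK jn by (simp add: nat_pow_distrib m_assoc)
    moreover have "inv v \<otimes> e' [^] n \<in> V" using V(6,9) M(2)[OF v(1,2)] e'(1) by simp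
    ultimately show "\<exists>n::nat. vdvd V q (e [^] n)" unfolding vdvd_def by blast
  qed
qed

lemma fg_vdvd:
  assumes "vring V" "A \<subseteq> V" "subring A K" "E \<subseteq> A" "set ys \<subseteq> E" "E = gens A {\<zero>} ys"
  shows "\<exists>g\<in>E. \<forall>f\<in>E. vdvd V g f"
proof -
  note sV = vringD(1)[OF assms(1)]
  note A = subringD[OF assms(3)]
  have min: "\<exists>g\<in>insert \<zero> (set ys). \<forall>f\<in>set ys. vdvd V g f" if "set ys \<subseteq> carrier K" for ys
    using that
  proof (induction ys)
    case (Cons f ys)
    then obtain g where g: "g \<in> insert \<zero> (set ys)" "\<And>f. f \<in> set ys \<Longrightarrow> vdvd V g f" by auto
    have k: "f \<in> carrier K" "g \<in> carrier K" using Cons.prems g(1) by auto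
    show ?case
    proof (cases "vdvd V g f")
      case True
      then show ?thesis using g by (intro bexI[of _ g]) auto
    next
      case False
      then have fg: "vdvd V f g" using vdvd_linear[OF assms(1) k(2,1)] by blast
      show ?thesis using g(2) vdvd_trans[OF sV k(1) fg] vdvd_refl[OF sV k(1)] by (intro bexI[of _ f]) auto
    qed
  qed simp
  have ysK: "set ys \<subseteq> carrier K" using assms(4,5) A(1) by blast
  obtain g where g: "g \<in> insert \<zero> (set ys)" "\<And>f. f \<in> set ys \<Longrightarrow> vdvd V g f" using min[OF ysK] by blast
  have gK: "g \<in> carrier K" using g(1) ysK by auto
  have "\<zero> \<in> E" unfolding assms(6) using gens_ideal[OF assms(3) zero_ideal_of[OF assms(3)]] assms(4,5) by blast
  then have gE: "g \<in> E" using g(1) assms(5) by blast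
  have "gens A {\<zero>} ys \<subseteq> {f \<in> carrier K. vdvd V g f}"
  proof (rule gens_subset_general)
    show "{\<zero>} \<subseteq> {f \<in> carrier K. vdvd V g f}" using vdvd_zero[OF sV gK] by simp
    show "set ys \<subseteq> {f \<in> carrier K. vdvd V g f}" using g(2) ysK by blast
    show "a \<oplus> b \<in> {f \<in> carrier K. vdvd V g f}" if "a \<in> {f \<in> carrier K. vdvd V g f}" "b \<in> {f \<in> carrier K. vdvd V g f}" for a b
      using that vdvd_add[OF sV gK] by simp
    show "s \<otimes> a \<in> {f \<in> carrier K. vdvd V g f}" if "s \<in> A" "a \<in> {f \<in> carrier K. vdvd V g f}" for s a
      using that vdvd_mult_right(2)[OF sV gK] subsetD[OF assms(2)] A(4) by simp
  qed
  then show ?thesis using gE unfolding assms(6) by blast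
qed

text \<open>Pass to the Noetherian ring \<open>C\<close> of those integral elements that a power of
  each \<open>e \<in> M\<close> carries into \<open>A\<close>, and take an associated prime
  \<open>Q\<close> of a multiple \<open>u\<close> of \<open>w\<close> modulo \<open>C\<close>. Since
  \<open>u\<close> is not integral, \<open>Q u\<close> is not contained in \<open>Q\<close>, and
  this makes \<open>Q\<close> principal after localization.\<close>

lemma local_essential_valuation:
  assumes "noeth A" "prime_of A M" "\<And>a. a \<in> A \<Longrightarrow> a \<notin> M \<Longrightarrow> inv a \<in> A" "frac A"
    "w \<in> carrier K" "w \<notin> ic A" "\<And>e. e \<in> M \<Longrightarrow> \<exists>k::nat. e [^] k \<otimes> w \<in> A"
  shows "\<exists>C Q. subring C K \<and> A \<subseteq> C \<and> C \<subseteq> ic A \<and> prime_of C Q \<and> vring (lcl C Q) \<and> archimedean (lcl C Q) \<and> w \<notin> lcl C Q"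
proof -
  note sA = noeth_subring[OF assms(1)]
  note A = subringD[OF sA] and M = prime_ofD[OF assms(2)]
  note B = ic_facts[OF sA]
  note BB = subringD[OF B(1)]
  \<comment> \<open>With \<open>M\<close> zero, \<open>A\<close> would be a field and hence all of
    \<open>K\<close>, leaving no room for \<open>w\<close>.\<close>
  have M0: "M \<noteq> {\<zero>}"
  proof
    assume M0: "M = {\<zero>}"
    obtain a b where ab: "a \<in> A" "b \<in> A" "b \<noteq> \<zero>" "w = a \<otimes> inv b" using assms(4,5) unfolding frac_def by blast
    then have "w \<in> A" using A(6) assms(3)[of b] M0 by simp
    then show False using assms(6) B(2) by blast
  qed
  define C where "C = {u \<in> ic A. \<forall>e\<in>M. \<exists>k::nat. e [^] k \<otimes> u \<in> A}"
  have eK: "e \<in> A" "e [^] k \<in> carrier K" "e [^] k \<in> A" if "e \<in> M" for e and k :: nat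
    using that M(4) A(4,9) by auto
  have AC: "A \<subseteq> C"
  proof
    fix a assume a: "a \<in> A"
    have "e [^] (0::nat) \<otimes> a \<in> A" for e using A(4)[OF a] a by simp
    then show "a \<in> C" unfolding C_def using a B(2) by blast
  qed
  have sC: "subring C K"
  proof (rule subringI)
    show "C \<subseteq> carrier K" unfolding C_def using BB(1) by blast
    show "\<one> \<in> C" using AC A(3) by blast
    fix u assume u: "u \<in> C"
    then have uB: "u \<in> ic A" "u \<in> carrier K" unfolding C_def using BB(4) by auto
    have "\<exists>k::nat. e [^] k \<otimes> \<ominus> u \<in> A" if e: "e \<in> M" for e
    proof -
      obtain k where k: "e [^] (k::nat) \<otimes> u \<in> A" using u e unfolding C_def by blast
      have "e [^] k \<otimes> \<ominus> u = \<ominus> (e [^] k \<otimes> u)" using eK(2)[OF e] uB by (simp add: r_minus)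
      then show ?thesis using A(5)[OF k] by metis
    qed
    then show "\<ominus> u \<in> C" unfolding C_def using BB(5)[OF uB(1)] by blast
    fix v assume v: "v \<in> C"
    then have vB: "v \<in> ic A" "v \<in> carrier K" unfolding C_def using BB(4) by auto
    have ex: "\<exists>k l. e [^] (k::nat) \<otimes> u \<in> A \<and> e [^] (l::nat) \<otimes> v \<in> A" if "e \<in> M" for e using u v that unfolding C_def by blast
    have "\<exists>k::nat. e [^] k \<otimes> (u \<otimes> v) \<in> A" if e: "e \<in> M" for e
    proof -
      obtain k l where kl: "e [^] (k::nat) \<otimes> u \<in> A" "e [^] (l::nat) \<otimes> v \<in> A" using ex[OF e] by blast
      have "e [^] (k + l) = e [^] k \<otimes> e [^] l" using A(4)[OF eK(1)[OF e]] by (simp add: nat_pow_mult)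
      then have "e [^] (k + l) \<otimes> (u \<otimes> v) = (e [^] k \<otimes> u) \<otimes> (e [^] l \<otimes> v)" using eK(2)[OF e] uB vB by (simp add: m_ac)
      then show ?thesis using A(6)[OF kl] by metis
    qed
    then show "u \<otimes> v \<in> C" unfolding C_def using BB(6)[OF uB(1) vB(1)] by blast
    have "\<exists>k::nat. e [^] k \<otimes> (u \<oplus> v) \<in> A" if e: "e \<in> M" for e
    proof -
      obtain k l where kl: "e [^] (k::nat) \<otimes> u \<in> A" "e [^] (l::nat) \<otimes> v \<in> A" using ex[OF e] by blast
      have "e [^] (k + l) = e [^] k \<otimes> e [^] l" using A(4)[OF eK(1)[OF e]] by (simp add: nat_pow_mult)
      then have "e [^] (k + l) \<otimes> (u \<oplus> v) = e [^] l \<otimes> (e [^] k \<otimes> u) \<oplus> e [^] k \<otimes> (e [^] l \<otimes> v)" 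
        using eK(2)[OF e] uB vB by (simp add: r_distr m_ac)
      moreover have "\<dots> \<in> A" using A(6,7) eK(3)[OF e] kl by simp
      ultimately show ?thesis by metis
    qed
    then show "u \<oplus> v \<in> C" unfolding C_def using BB(7)[OF uB(1) vB(1)] by blast
  qed
  note CC = subringD[OF sC]
  have CB: "C \<subseteq> ic A" unfolding C_def by blast
  have loc: "\<exists>k::nat. e [^] k \<otimes> c \<in> A" if "c \<in> C" "e \<in> M" for c e using that unfolding C_def by blast
  have nC: "noeth C" by (rule transform_noeth[OF assms(1-4) M0 sC AC loc])
  have wC: "w \<notin> C" using assms(6) CB by blast
  obtain c where c: "c \<in> C" "c \<otimes> w \<notin> C" "prime_of C {s \<in> C. s \<otimes> (c \<otimes> w) \<in> C}"
    by (rule associated_prime[OF nC CC(1,2,7,6) assms(5) wC])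
  define u where "u = c \<otimes> w"
  define Q where "Q = {s \<in> C. s \<otimes> u \<in> C}"
  have Qp: "prime_of C Q" using c(3) unfolding Q_def u_def .
  note Q = prime_ofD[OF Qp]
  have uK: "u \<in> carrier K" unfolding u_def using CC(4)[OF c(1)] assms(5) by simp
  have uC: "u \<notin> C" using c(2) unfolding u_def .
  have uT: "\<exists>k::nat. e [^] k \<otimes> u \<in> A" if e: "e \<in> M" for e
  proof -
    obtain k where k: "e [^] (k::nat) \<otimes> w \<in> A" using assms(7)[OF e] by blast
    obtain l where l: "e [^] (l::nat) \<otimes> c \<in> A" using loc[OF c(1) e] by blast
    have "e [^] (l + k) = e [^] l \<otimes> e [^] k" using A(4)[OF eK(1)[OF e]] by (simp add: nat_pow_mult)
    then have "e [^] (l + k) \<otimes> u = (e [^] l \<otimes> c) \<otimes> (e [^] k \<otimes> w)" unfolding u_def using eK(2)[OF e] CC(4)[OF c(1)] assms(5) by (simp add: m_ac)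
    then show ?thesis using A(6)[OF l k] by metis
  qed
  have uB: "u \<notin> ic A" using uC uT unfolding C_def by blast
  \<comment> \<open>This takes the place of the determinant trick. If \<open>Q u\<close> were inside
    \<open>Q\<close>, then in any \<open>V\<close> over \<open>A\<close> the least-valued
    \<open>g \<in> Q\<close> would divide \<open>g u\<close>, so \<open>u \<in> V\<close>. A power
    of \<open>\<mu>\<close> shows that \<open>g\<close> is not zero.\<close>
  have "\<exists>j\<in>Q. j \<otimes> u \<notin> Q"
  proof (rule ccontr)
    assume neg: "\<not> ?thesis"
    obtain \<mu> where mu: "\<mu> \<in> M" "\<mu> \<noteq> \<zero>" using M0 M(5) by blast
    obtain k where k: "\<mu> [^] (k::nat) \<otimes> u \<in> A" using uT[OF mu(1)] by blast
    have y: "\<mu> [^] k \<in> Q" "\<mu> [^] k \<noteq> \<zero>" unfolding Q_def using k eK[OF mu(1)] AC mu A(4) by auto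
    obtain ys where ys: "set ys \<subseteq> Q" "Q = gens C {\<zero>} ys" by (rule noeth_fg[OF nC Q(1)])
    have "u \<in> ic A" unfolding integral_closure_iff[OF sA]
    proof (intro conjI uK allI impI)
      fix V assume V: "vring V \<and> A \<subseteq> V"
      then have CV: "C \<subseteq> V" using B(3) CB by blast
      note sV = vringD(1)[OF conjunct1[OF V]]
      note VV = subringD[OF sV]
      obtain g where gQ: "g \<in> Q" and all: "\<And>f. f \<in> Q \<Longrightarrow> vdvd V g f"
        using fg_vdvd[OF conjunct1[OF V] CV sC Q(4) ys] by blast
      have gK: "g \<in> carrier K" using gQ Q(4) CC(4) by blast
      have g0: "g \<noteq> \<zero>"
      proof
        assume "g = \<zero>"
        then have "vdvd V \<zero> (\<mu> [^] k)" using all[OF y(1)] by simp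
        then show False using y(2) VV(4) unfolding vdvd_def by auto
      qed
      have "g \<otimes> u \<in> Q" using neg gQ by blast
      then have "vdvd V g (g \<otimes> u)" by (rule all)
      then obtain v where v: "v \<in> V" "g \<otimes> u = g \<otimes> v" unfolding vdvd_def by blast
      then have "u = v" using cancel_l[OF gK g0 uK VV(4)[OF v(1)]] by simp
      then show "u \<in> V" using v(1) by simp
    qed
    then show False using uB by blast
  qed
  then obtain j where j: "j \<in> Q" "j \<otimes> u \<notin> Q" by blast
  define h where "h = j \<otimes> u"
  have h: "h \<in> C" "h \<notin> Q" using j unfolding h_def Q_def by auto
  have jK: "j \<in> carrier K" using j(1) Q(4) CC(4) by blast
  have hK: "h \<in> carrier K" "h \<noteq> \<zero>" using h CC(4) Q(5) by auto
  have j0: "j \<noteq> \<zero>" using hK(2) uK unfolding h_def by auto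
  \<comment> \<open>With \<open>h = j u\<close> outside \<open>Q\<close> and
    \<open>e u \<in> C\<close>, the identity \<open>e = j (e u)/h\<close> exhibits \<open>j\<close>
    as a generator of the localized prime.\<close>
  have gen: "\<exists>v\<in>lcl C Q. e = j \<otimes> v" if e: "e \<in> Q" for e
  proof -
    have eu: "e \<otimes> u \<in> C" "e \<in> carrier K" using e Q(4) CC(4) unfolding Q_def by auto
    have "j \<otimes> ((e \<otimes> u) \<otimes> inv h) = (e \<otimes> h) \<otimes> inv h" unfolding h_def[symmetric]
    proof -
      have "j \<otimes> ((e \<otimes> u) \<otimes> inv h) = (e \<otimes> (j \<otimes> u)) \<otimes> inv h" using jK eu uK hK by (simp add: m_ac)
      then show "j \<otimes> ((e \<otimes> u) \<otimes> inv h) = (e \<otimes> h) \<otimes> inv h" unfolding h_def[symmetric] .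
    qed
    also have "\<dots> = e" using eu hK by simp
    finally show ?thesis using lclI[OF eu(1) h] by metis
  qed
  have fC: "frac C" by (rule frac_mono[OF assms(4) AC])
  note V = principal_maximal_vring[OF nC fC Qp j(1) j0 gen]
  note L = lcl_facts[OF sC Qp]
  note LL = subringD[OF L(1)]
  have "u \<notin> lcl C Q"
  proof
    assume u: "u \<in> lcl C Q"
    have "inv h \<in> lcl C Q" using L(3)[OF h] by blast
    then have "u \<otimes> inv h \<in> lcl C Q" using LL(6) u by blast
    moreover have "u \<otimes> inv h = inv j" unfolding h_def using jK j0 uK hK(2) unfolding h_def by (auto simp: inv_mult' m_ac)
    ultimately have "inv j \<in> lcl C Q" by simp
    moreover have "j \<in> {a \<otimes> inv s | a s. a \<in> Q \<and> s \<in> C - Q}" using lcl_maximal(3)[OF sC Qp] j(1) Q(4) by blast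
    ultimately show False using lcl_maximal(4)[OF sC Qp] j0 by blast
  qed
  then have "w \<notin> lcl C Q" unfolding u_def using LL(6) L(2) c(1) by blast
  then show ?thesis using sC AC CB Qp V by blast
qed

text \<open>An associated prime \<open>P\<close> of \<open>w1\<close> modulo the integral closure
  only gives \<open>P w1\<close> inside \<open>ic A\<close>, while the local lemma wants powers of
  the maximal ideal to carry the element into the ring itself. So the products of \<open>w1\<close>
  with generators of \<open>P\<close> are adjoined, which gives a Noetherian ring with the same
  integral closure, and the argument continues at a prime of it over \<open>P\<close>.\<close>

theorem essential_valuation:
  assumes "noeth A" "frac A" "w \<in> carrier K" "w \<notin> ic A"
  shows "\<exists>Q. prime_of (ic A) Q \<and> vring (lcl (ic A) Q) \<and> archimedean (lcl (ic A) Q) \<and> Q = ic A \<inter> nonunits (lcl (ic A) Q) \<and>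
    w \<notin> lcl (ic A) Q"
proof -
  note sA = noeth_subring[OF assms(1)]
  note A = subringD[OF sA]
  note B = ic_facts[OF sA]
  note BB = subringD[OF B(1)]
  have AB: "s \<in> ic A" if "s \<in> A" for s using that B(2) by blast
  obtain c where c: "c \<in> A" "c \<otimes> w \<notin> ic A" "prime_of A {s \<in> A. s \<otimes> (c \<otimes> w) \<in> ic A}"
    by (rule associated_prime[OF assms(1) BB(1,2,7) BB(6)[OF AB] assms(3,4)])
  define w1 where "w1 = c \<otimes> w"
  define P where "P = {s \<in> A. s \<otimes> w1 \<in> ic A}"
  have Pp: "prime_of A P" using c(3) unfolding P_def w1_def .
  note P = prime_ofD[OF Pp]
  have w1K: "w1 \<in> carrier K" unfolding w1_def using A(4)[OF c(1)] assms(3) by simp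
  obtain ps where ps: "set ps \<subseteq> P" "P = gens A {\<zero>} ps" by (rule noeth_fg[OF assms(1) P(1)])
  define us where "us = map (\<lambda>g. g \<otimes> w1) ps"
  have usB: "set us \<subseteq> ic A" unfolding us_def using ps(1) unfolding P_def by auto
  have usK: "set us \<subseteq> carrier K" using usB BB(1) by blast
  define A1 where "A1 = adjs A us"
  have nA1: "noeth A1" unfolding A1_def by (rule noeth_adjs[OF assms(1) usK])
  note sA1 = noeth_subring[OF nA1]
  note A1 = subringD[OF sA1]
  have AA1: "A \<subseteq> A1" "set us \<subseteq> A1" unfolding A1_def using adjs_facts[OF sA usK] by auto
  have A1B: "A1 \<subseteq> ic A" unfolding A1_def by (rule adjs_min[OF B(1,2) usB])
  have icA1: "ic A1 = ic A" by (rule ic_between[OF sA sA1 AA1(1) A1B])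
  have Pw: "g \<otimes> w1 \<in> A1" if g: "g \<in> P" for g
  proof -
    have "gens A {\<zero>} ps \<subseteq> {g \<in> A. g \<otimes> w1 \<in> A1}"
    proof (rule gens_subset_general)
      show "{\<zero>} \<subseteq> {g \<in> A. g \<otimes> w1 \<in> A1}" using A(2) A1(2) w1K by simp
      show "set ps \<subseteq> {g \<in> A. g \<otimes> w1 \<in> A1}" using ps(1) P(4) AA1(2) unfolding us_def by auto
      show "a \<oplus> b \<in> {g \<in> A. g \<otimes> w1 \<in> A1}" if "a \<in> {g \<in> A. g \<otimes> w1 \<in> A1}" "b \<in> {g \<in> A. g \<otimes> w1 \<in> A1}" for a b
        using that A(4,7) A1(7) w1K by (simp add: l_distr)
      show "s \<otimes> a \<in> {g \<in> A. g \<otimes> w1 \<in> A1}" if "s \<in> A" "a \<in> {g \<in> A. g \<otimes> w1 \<in> A1}" for s a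
        using that A(4,6) A1(6) subsetD[OF AA1(1)] w1K by (simp add: m_assoc)
    qed
    then show ?thesis using g ps(2) by blast
  qed
  \<comment> \<open>The localization of \<open>ic A\<close> at the complement of \<open>P\<close> in
    \<open>A\<close>. Taking annihilators modulo \<open>S\<close> forces the new prime
    \<open>P1\<close> of \<open>A1\<close> to contract into \<open>P\<close>.\<close>
  define S where "S = {z \<in> carrier K. \<exists>s\<in>A. s \<notin> P \<and> s \<otimes> z \<in> ic A}"
  have outP: "s \<otimes> t \<in> A" "s \<otimes> t \<notin> P" if "s \<in> A" "s \<notin> P" "t \<in> A" "t \<notin> P" for s t
    using that A(6) P(3) by blast+
  have SI: "z \<in> S" if "z \<in> carrier K" "s \<in> A" "s \<notin> P" "s \<otimes> z \<in> ic A" for z s using that unfolding S_def by blast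
  have BS: "ic A \<subseteq> S"
  proof
    fix z assume z: "z \<in> ic A"
    then show "z \<in> S" using SI[of z \<one>] A(3) P(2) BB(4) by simp
  qed
  have Sclosed: "a \<oplus> b \<in> S" if ab: "a \<in> S" "b \<in> S" for a b
  proof -
    obtain s t where st: "a \<in> carrier K" "s \<in> A" "s \<notin> P" "s \<otimes> a \<in> ic A" "b \<in> carrier K" "t \<in> A" "t \<notin> P" "t \<otimes> b \<in> ic A"
      using ab unfolding S_def by blast
    have "(s \<otimes> t) \<otimes> (a \<oplus> b) = t \<otimes> (s \<otimes> a) \<oplus> s \<otimes> (t \<otimes> b)" using st A(4) by (simp add: r_distr m_ac)
    also have "\<dots> \<in> ic A" using BB(6,7) AB st by simp
    finally show ?thesis using SI outP[of s t] st by simp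
  qed
  have Smult: "s \<otimes> b \<in> S" if sb: "s \<in> A1" "b \<in> S" for s b
  proof -
    obtain t where t: "b \<in> carrier K" "t \<in> A" "t \<notin> P" "t \<otimes> b \<in> ic A" using sb(2) unfolding S_def by blast
    have sB: "s \<in> ic A" "s \<in> carrier K" using sb(1) A1B BB(4) by auto
    have "t \<otimes> (s \<otimes> b) = s \<otimes> (t \<otimes> b)" using t sB A(4) by (simp add: m_lcomm)
    then show ?thesis using SI[of "s \<otimes> b" t] BB(6)[OF sB(1) t(4)] t sB by simp
  qed
  have w1S: "w1 \<notin> S" unfolding S_def P_def by blast
  have S0: "S \<subseteq> carrier K" "\<zero> \<in> S" using BS BB(2) unfolding S_def by auto
  obtain c1 where c1: "c1 \<in> A1" "c1 \<otimes> w1 \<notin> S" "prime_of A1 {s \<in> A1. s \<otimes> (c1 \<otimes> w1) \<in> S}"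
    by (rule associated_prime[OF nA1 S0 Sclosed Smult w1K w1S])
  define w2 where "w2 = c1 \<otimes> w1"
  define P1 where "P1 = {s \<in> A1. s \<otimes> w2 \<in> S}"
  have P1p: "prime_of A1 P1" using c1(3) unfolding P1_def w2_def .
  note P1 = prime_ofD[OF P1p]
  have c1K: "c1 \<in> carrier K" using A1(4) c1(1) by blast
  have w2K: "w2 \<in> carrier K" unfolding w2_def using c1K w1K by simp
  have Pw2: "g \<otimes> w2 \<in> A1" if g: "g \<in> P" for g
  proof -
    have "g \<otimes> w2 = c1 \<otimes> (g \<otimes> w1)" unfolding w2_def using g P(4) A(4) c1K w1K by (auto simp: m_lcomm)
    then show ?thesis using A1(6)[OF c1(1) Pw[OF g]] by simp
  qed
  have PP1: "P \<subseteq> P1" unfolding P1_def using Pw2 A1B BS P(4) AA1(1) by blast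
  have P1P: "P1 \<inter> A \<subseteq> P"
  proof
    fix s assume s: "s \<in> P1 \<inter> A"
    then have sK: "s \<in> carrier K" using A(4) by blast
    have "s \<otimes> w2 \<in> S" using s unfolding P1_def by blast
    then obtain t where t: "t \<in> A" "t \<notin> P" "t \<otimes> (s \<otimes> w2) \<in> ic A" unfolding S_def by blast
    show "s \<in> P"
    proof (rule ccontr)
      assume sP: "s \<notin> P"
      have "(t \<otimes> s) \<otimes> w2 = t \<otimes> (s \<otimes> w2)" using A(4)[OF t(1)] sK w2K by (simp add: m_assoc)
      then have "w2 \<in> S" using SI[OF w2K outP[OF t(1,2) _ sP]] s t(3) by simp
      then show False using c1(2) unfolding w2_def by blast
    qed
  qed
  define A2 where "A2 = lcl A1 P1"
  define M where "M = {a \<otimes> inv s | a s. a \<in> P1 \<and> s \<in> A1 - P1}"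
  note L = lcl_facts[OF sA1 P1p, folded A2_def]
  note LL = subringD[OF L(1)]
  note Mx = lcl_maximal[OF sA1 P1p, folded A2_def M_def]
  have nA2: "noeth A2" unfolding A2_def by (rule noeth_lcl[OF nA1 P1p])
  have fA2: "frac A2" by (rule frac_mono[OF assms(2)]) (use AA1(1) L(2) in blast)
  have w2n: "w2 \<notin> ic A2"
  proof
    assume "w2 \<in> ic A2"
    then obtain s where s: "s \<in> A1" "s \<notin> P1" "s \<otimes> w2 \<in> ic A1" unfolding A2_def by (rule ic_lcl[OF sA1 P1p])
    then have "s \<otimes> w2 \<in> S" using icA1 BS by blast
    then show False using s unfolding P1_def by blast
  qed
  \<comment> \<open>Elements of \<open>P\<close> carry \<open>w2\<close> into \<open>A1\<close>. An
    element of \<open>P1\<close> is integral over \<open>A\<close>, and by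
    \<open>integral_trailing\<close> some power of it, times a factor outside \<open>P1\<close>,
    lies in the ideal generated by \<open>P\<close> in \<open>A1\<close>.\<close>
  have loc: "\<exists>k::nat. e [^] k \<otimes> w2 \<in> A2" if e: "e \<in> M" for e
  proof -
    obtain a s where as: "a \<in> P1" "s \<in> A1" "s \<notin> P1" "e = a \<otimes> inv s" using e unfolding M_def by blast
    have aA1: "a \<in> A1" using as(1) P1(4) by blast
    have aB: "a \<in> ic A" using aA1 A1B by blast
    obtain k f where kf: "f \<in> A1" "f \<notin> P1" "a [^] (k::nat) \<otimes> f \<in> ideal_prod K A1 P"
      by (rule integral_trailing[OF sA Pp sA1 AA1(1) P1p PP1 P1P as(1) aB])
    have mul: "g \<otimes> w2 \<in> A1" if "g \<in> ideal_prod K A1 P" for g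
      using that
    proof induction
      case (prod i j)
      have "(i \<otimes> j) \<otimes> w2 = i \<otimes> (j \<otimes> w2)" using A1(4)[OF prod(1)] prod(2) P(4) A(4) w2K by (auto simp: m_assoc)
      then show ?case using A1(6)[OF prod(1) Pw2[OF prod(2)]] by simp
    next
      case (sum x y)
      have "ideal_prod K A1 P \<subseteq> carrier K" using ideal_prod_carr[OF A1(1)] P(4) A(1) by blast
      then have "x \<in> carrier K" "y \<in> carrier K" using sum by blast+
      then show ?case using sum A1(7) w2K by (simp add: l_distr)
    qed
    have K: "a \<in> carrier K" "f \<in> carrier K" "s \<in> carrier K" "f \<noteq> \<zero>" "s \<noteq> \<zero>"
      using A1(4) aA1 kf as P1(5) by auto
    have "inv f \<in> A2" "inv s \<in> A2" using L(3) kf as by blast+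
    moreover have "(a [^] k \<otimes> f) \<otimes> w2 \<in> A2" using mul[OF kf(3)] L(2) by blast
    moreover have "e [^] k \<otimes> w2 = inv s [^] k \<otimes> (inv f \<otimes> ((a [^] k \<otimes> f) \<otimes> w2))"
    proof -
      have "(a [^] k \<otimes> f) \<otimes> w2 = f \<otimes> (a [^] k \<otimes> w2)" using K w2K by (simp add: m_ac)
      then have "inv f \<otimes> ((a [^] k \<otimes> f) \<otimes> w2) = a [^] k \<otimes> w2" using K w2K by simp
      then show ?thesis unfolding as(4) using K w2K by (simp add: nat_pow_distrib m_ac)
    qed
    ultimately show ?thesis using LL(6,9) by metis
  qed
  obtain C Q where CQ: "subring C K" "A2 \<subseteq> C" "C \<subseteq> ic A2" "prime_of C Q" "vring (lcl C Q)" "archimedean (lcl C Q)" "w2 \<notin> lcl C Q"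
    using local_essential_valuation[OF nA2 Mx(1,2) fA2 w2K w2n loc] by blast
  define V where "V = lcl C Q"
  note sV = vringD(1)[OF CQ(5), folded V_def]
  note VV = subringD[OF sV]
  note N = nonunits_ideal[OF CQ(5), folded V_def]
  have CV: "C \<subseteq> V" unfolding V_def by (rule lcl_facts(2)[OF CQ(1,4)])
  have AV: "A \<subseteq> V" "A1 \<subseteq> V" using AA1(1) L(2) CQ(2) CV by blast+
  have BV: "ic A \<subseteq> V" by (rule B(3)[OF CQ(5)[folded V_def] AV(1)])
  \<comment> \<open>The center of \<open>V\<close> on \<open>ic A\<close>. It replaces the prime
    \<open>Q\<close> of the auxiliary ring \<open>C\<close> as the prime of the integral closure to
    be exhibited.\<close>
  define Q0 where "Q0 = ic A \<inter> nonunits V"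
  have unit: "inv b \<in> V" "b \<noteq> \<zero>" if b: "b \<in> V" "b \<notin> nonunits V" for b using b unfolding nonunits_def by blast+
  have notnon: "b \<notin> nonunits V" if "inv b \<in> V" "b \<noteq> \<zero>" for b using that unfolding nonunits_def by blast
  have Q0p: "prime_of (ic A) Q0" unfolding prime_of_def
  proof (intro conjI ballI impI)
    show "ideal_of (ic A) Q0" unfolding Q0_def
      using subsetD[OF BV] by (intro ideal_ofI) (auto simp: ideal_ofD(2-4)[OF N(1)] BB(2,6,7))
    show "\<one> \<notin> Q0" unfolding Q0_def using N(2) by blast
    fix a b assume ab: "a \<in> ic A" "b \<in> ic A" "a \<otimes> b \<in> Q0"
    show "a \<in> Q0 \<or> b \<in> Q0"
    proof (rule ccontr)
      assume neg: "\<not> (a \<in> Q0 \<or> b \<in> Q0)"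
      then have n: "a \<notin> nonunits V" "b \<notin> nonunits V" using ab unfolding Q0_def by blast+
      have aV: "a \<in> V" "b \<in> V" using ab BV by blast+
      have "inv (a \<otimes> b) = inv a \<otimes> inv b" using inv_mult' VV(4) aV unit n by simp
      then have "inv (a \<otimes> b) \<in> V" using VV(6) unit aV n by simp
      moreover have "a \<otimes> b \<noteq> \<zero>" using VV(4) aV unit n by simp
      ultimately show False using notnon ab(3) unfolding Q0_def by blast
    qed
  qed
  have "lcl (ic A) Q0 = V"
  proof (intro equalityI subsetI)
    fix z assume "z \<in> lcl (ic A) Q0"
    then obtain b s where *: "b \<in> ic A" "s \<in> ic A" "s \<notin> Q0" "z = b \<otimes> inv s" unfolding lcl_def by blast
    then have "s \<in> V" "s \<notin> nonunits V" using BV unfolding Q0_def by blast+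
    then show "z \<in> V" unfolding *(4) using VV(6) unit BV *(1) by blast
  next
    fix z assume "z \<in> V"
    then obtain b s where *: "b \<in> C" "s \<in> C" "s \<notin> Q" "z = b \<otimes> inv s" unfolding V_def lcl_def by blast
    \<comment> \<open>Elements of \<open>C\<close> are integral over the localization of
      \<open>A1\<close>, so factors from \<open>A1\<close> outside \<open>P1\<close> bring numerator
      and denominator into \<open>ic A\<close>. These factors are units of \<open>V\<close>, hence
      the new denominator avoids the center.\<close>
    have "b \<in> ic (lcl A1 P1)" "s \<in> ic (lcl A1 P1)" using * CQ(3) unfolding A2_def by blast+
    then obtain t t' where t: "t \<in> A1" "t \<notin> P1" "t \<otimes> b \<in> ic A1" and t': "t' \<in> A1" "t' \<notin> P1" "t' \<otimes> s \<in> ic A1"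
      using ic_lcl[OF sA1 P1p] by metis
    have iv: "inv t \<in> V" "inv t' \<in> V" "t \<noteq> \<zero>" "t' \<noteq> \<zero>" using L(3) t t' CQ(2) CV by blast+
    have sV': "inv s \<in> V" "s \<noteq> \<zero>" unfolding V_def using lcl_facts(3)[OF CQ(1,4)] * by blast+
    have K: "t \<in> carrier K" "t' \<in> carrier K" "b \<in> carrier K" "s \<in> carrier K"
      using A1(4) t t' * subringD(4)[OF CQ(1)] by blast+
    have 1: "t' \<otimes> (t \<otimes> b) \<in> ic A" "t \<otimes> (t' \<otimes> s) \<in> ic A" using t t' icA1 A1B BB(6) by blast+
    have "inv (t \<otimes> (t' \<otimes> s)) = inv t \<otimes> (inv t' \<otimes> inv s)" using K iv sV' by (simp add: inv_mult')
    then have "inv (t \<otimes> (t' \<otimes> s)) \<in> V" using VV(6) iv sV' by simp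
    then have 2: "t \<otimes> (t' \<otimes> s) \<notin> Q0" using notnon K iv sV' unfolding Q0_def by simp
    have "z = (t' \<otimes> (t \<otimes> b)) \<otimes> inv (t \<otimes> (t' \<otimes> s))"
      unfolding *(4) using K iv sV' by (subst div_eq_div) (auto simp: m_ac)
    then show "z \<in> lcl (ic A) Q0" using lclI[OF 1 2] by simp
  qed
  moreover have "w \<notin> V"
  proof
    assume "w \<in> V"
    then have "w2 \<in> V" unfolding w2_def w1_def using VV(6) AV c(1) c1(1) by blast
    then show False using CQ(7) unfolding V_def by blast
  qed
  ultimately show ?thesis using Q0p CQ(5,6) unfolding V_def[symmetric] Q0_def by (intro exI[of _ "ic A \<inter> nonunits V"]) simp
qed

text \<open>A nonzero prime below \<open>Q\<close> contains some \<open>q \<noteq> \<zero>\<close>;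
  in the localization a power of each \<open>e \<in> Q\<close> is a multiple of \<open>q\<close>, so
  it contains \<open>Q\<close>. The element \<open>w\<close> shows that the localization is not all
  of \<open>K\<close>, so \<open>Q\<close> is not zero.\<close>

lemma essential_height:
  assumes "subring B K" "frac B" "prime_of B Q" "archimedean (lcl B Q)" "Q = B \<inter> nonunits (lcl B Q)" "w \<in> carrier K" "w \<notin> lcl B Q"
  shows "prime_height (K\<lparr>carrier := B\<rparr>) Q = 1"
proof -
  note BB = subringD[OF assms(1)] and Q = prime_ofD[OF assms(3)]
  note L = lcl_facts[OF assms(1,3)]
  have Q0: "Q \<noteq> {\<zero>}"
  proof
    assume Q0: "Q = {\<zero>}"
    obtain a b where "a \<in> B" "b \<in> B" "b \<noteq> \<zero>" "w = a \<otimes> inv b" using assms(2,6) unfolding frac_def by blast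
    then show False using lclI[of a B b Q] Q0 assms(7) by simp
  qed
  have below: "P = Q" if P: "prime_of B P" "P \<subseteq> Q" "P \<noteq> {\<zero>}" for P
  proof
    note PP = prime_ofD[OF P(1)]
    obtain q where q: "q \<in> P" "q \<noteq> \<zero>" using P(3) PP(5) by blast
    have qB: "q \<in> B" using q(1) PP(4) by blast
    show "Q \<subseteq> P"
    proof
      fix e assume e: "e \<in> Q"
      have eB: "e \<in> B" using e Q(4) by blast
      have "e \<in> nonunits (lcl B Q)" "q \<in> lcl B Q" using e assms(5) qB L(2) by blast+
      then obtain n where "vdvd (lcl B Q) q (e [^] (n::nat))" using assms(4) q(2) unfolding archimedean_def by blast
      then obtain b s where *: "b \<in> B" "s \<in> B" "s \<notin> Q" "e [^] n = q \<otimes> (b \<otimes> inv s)" unfolding vdvd_def lcl_def by blast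
      have K: "b \<in> carrier K" "s \<in> carrier K" "q \<in> carrier K" "s \<noteq> \<zero>" using * qB BB(4) Q(5) by auto
      have "s \<otimes> e [^] n = b \<otimes> q" unfolding *(4) using K by (simp add: m_ac)
      then have "s \<otimes> e [^] n \<in> P" using PP(7)[OF *(1) q(1)] by simp
      then have "e [^] n \<in> P" using PP(3)[OF *(2) BB(9)[OF eB]] * P(2) by blast
      then show "e \<in> P" by (rule prime_of_pow[OF assms(1) P(1) eB])
    qed
  qed (use P in blast)
  have zp: "prime_of B {\<zero>}" unfolding prime_of_def using zero_ideal_of[OF assms(1)] BB(4) by auto
  have "n \<le> 1" if pc: "prime_chain (K\<lparr>carrier := B\<rparr>) n P" "P n = Q" for n P
  proof (rule ccontr)
    assume "\<not> n \<le> 1"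
    then obtain l where l: "n = Suc (Suc l)" by (metis One_nat_def le_SucI le_zero_eq not0_implies_Suc not_less_eq_eq le_refl)
    have pr: "prime_of B (P l)" "prime_of B (P (Suc l))" "P l \<subset> P (Suc l)" "P (Suc l) \<subset> Q"
      using pc l prime_of_iff[OF assms(1)] unfolding prime_chain_def by auto
    have "P (Suc l) \<noteq> {\<zero>}"
    proof
      assume "P (Suc l) = {\<zero>}"
      with pr(3) have "P l \<subset> {\<zero>}" by simp
      then show False using prime_ofD(5)[OF pr(1)] by blast
    qed
    then show False using below[OF pr(2)] pr(4) by blast
  qed
  moreover have "prime_chain (K\<lparr>carrier := B\<rparr>) 1 (\<lambda>i. if i = 0 then {\<zero>} else Q)"
    unfolding prime_chain_def prime_of_iff[OF assms(1)] using zp assms(3) Q0 Q(5) by auto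
  ultimately show ?thesis
    unfolding prime_height_def
    by (intro antisym Sup_least Sup_upper) (auto simp: one_enat_def intro!: exI[of _ 1] exI[of _ "\<lambda>i. if i = 0 then {\<zero>} else Q"])
qed

section \<open>Ideals of overrings\<close>

lemma Idl_facts:
  assumes "subring A K" "E \<subseteq> A"
  shows "ideal_of A (Idl\<^bsub>K\<lparr>carrier := A\<rparr>\<^esub> E)" "E \<subseteq> Idl\<^bsub>K\<lparr>carrier := A\<rparr>\<^esub> E"
    "\<And>F. ideal_of A F \<Longrightarrow> E \<subseteq> F \<Longrightarrow> Idl\<^bsub>K\<lparr>carrier := A\<rparr>\<^esub> E \<subseteq> F"
proof -
  interpret A: ring "K\<lparr>carrier := A\<rparr>" by (rule subring_is_ring[OF assms(1)])
  show "ideal_of A (Idl\<^bsub>K\<lparr>carrier := A\<rparr>\<^esub> E)"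
    using A.genideal_ideal[of E] assms ideal_of_iff[OF assms(1)] by simp
  show "E \<subseteq> Idl\<^bsub>K\<lparr>carrier := A\<rparr>\<^esub> E" using A.genideal_self[of E] assms(2) by simp
  show "\<And>F. ideal_of A F \<Longrightarrow> E \<subseteq> F \<Longrightarrow> Idl\<^bsub>K\<lparr>carrier := A\<rparr>\<^esub> E \<subseteq> F"
    using A.genideal_minimal ideal_of_iff[OF assms(1)] by blast
qed

lemma PIdl_eq: "PIdl\<^bsub>K\<lparr>carrier := A\<rparr>\<^esub> a = {b \<otimes> a | b. b \<in> A}"
  unfolding cgenideal_def by simp

text \<open>Being divisible in \<open>V\<close> by some element of \<open>E\<close> is stable under
  sums since of two elements of \<open>E\<close> one divides the other. Extension ideals can
  therefore be tested on generators.\<close>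

lemma vdvd_ideal:
  assumes "vring V" "A \<subseteq> V" "subring A K" "E \<subseteq> carrier K" "E \<noteq> {}"
  shows "ideal_of A {u \<in> A. \<exists>e\<in>E. vdvd V e u}"
proof (rule ideal_ofI)
  note sV = vringD(1)[OF assms(1)]
  note A = subringD[OF assms(3)]
  obtain e where e: "e \<in> E" using assms(5) by blast
  show "\<zero> \<in> {u \<in> A. \<exists>e\<in>E. vdvd V e u}" using vdvd_zero[OF sV] e assms(4) A(2) by blast
  fix a b assume "a \<in> {u \<in> A. \<exists>e\<in>E. vdvd V e u}" "b \<in> {u \<in> A. \<exists>e\<in>E. vdvd V e u}"
  then obtain e f where *: "a \<in> A" "b \<in> A" "e \<in> E" "f \<in> E" "vdvd V e a" "vdvd V f b" by blast
  have k: "e \<in> carrier K" "f \<in> carrier K" using * assms(4) by auto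
  have "\<exists>g\<in>E. vdvd V g (a \<oplus> b)"
    using vdvd_linear[OF assms(1) k]
  proof
    assume "vdvd V e f"
    then have "vdvd V e b" using vdvd_trans[OF sV k(1)] * by blast
    then show ?thesis using vdvd_add[OF sV k(1) *(5)] *(3) by blast
  next
    assume "vdvd V f e"
    then have "vdvd V f a" using vdvd_trans[OF sV k(2)] * by blast
    then show ?thesis using vdvd_add[OF sV k(2) _ *(6)] *(4) by blast
  qed
  then show "a \<oplus> b \<in> {u \<in> A. \<exists>e\<in>E. vdvd V e u}" using A(7) * by blast
next
  fix s a assume s: "s \<in> A" and "a \<in> {u \<in> A. \<exists>e\<in>E. vdvd V e u}"
  then obtain e where *: "a \<in> A" "e \<in> E" "vdvd V e a" by blast
  have "vdvd V e (s \<otimes> a)" using vdvd_mult_right(2)[OF vringD(1)[OF assms(1)] _ *(3)] s assms(2,4) *(2) by blast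
  then show "s \<otimes> a \<in> {u \<in> A. \<exists>e\<in>E. vdvd V e u}" using subringD(6)[OF assms(3) s] * by blast
qed blast

lemma Idl_vdvd:
  assumes "vring V" "A \<subseteq> V" "subring A K" "E \<subseteq> A" "E \<noteq> {}" "u \<in> Idl\<^bsub>K\<lparr>carrier := A\<rparr>\<^esub> E"
  shows "\<exists>e\<in>E. vdvd V e u"
proof -
  have EK: "E \<subseteq> carrier K" using assms(4) subringD(1)[OF assms(3)] by blast
  have "E \<subseteq> {u \<in> A. \<exists>e\<in>E. vdvd V e u}" using assms(4) EK vdvd_refl[OF vringD(1)[OF assms(1)]] by blast
  then show ?thesis using Idl_facts(3)[OF assms(3,4) vdvd_ideal[OF assms(1-3) EK assms(5)]] assms(6) by blast
qed

text \<open>The criterion for \<open>E^n\<close> tested on the pure powers \<open>e^n\<close> alone,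
  which have least value in \<open>E^n\<close> by \<open>ipw_vdvd\<close>.\<close>

lemma closure_power_iff:
  assumes "subring A K" "ideal_of A E"
  shows "z \<in> ideal_closure (K\<lparr>carrier := A\<rparr>) (ideal_power (K\<lparr>carrier := A\<rparr>) E n) \<longleftrightarrow>
    z \<in> A \<and> (\<forall>V. vring V \<and> A \<subseteq> V \<longrightarrow> (\<exists>e\<in>E. vdvd V (e [^] n) z))"
proof -
  have EK: "E \<subseteq> carrier K" "E \<noteq> {}" using ideal_ofD(1,2)[OF assms(2)] subringD(1)[OF assms(1)] by blast+
  have "(\<exists>e'\<in>ipw A E n. vdvd V e' z) \<longleftrightarrow> (\<exists>e\<in>E. vdvd V (e [^] n) z)" if V: "vring V" "A \<subseteq> V" for V
  proof
    assume "\<exists>e'\<in>ipw A E n. vdvd V e' z"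
    then obtain e' where e': "e' \<in> ipw A E n" "vdvd V e' z" by blast
    obtain e where e: "e \<in> E" "vdvd V (e [^] n) e'" using ipw_vdvd[OF V EK(2,1) e'(1)] by blast
    have "e [^] n \<in> carrier K" using e(1) EK by auto
    then show "\<exists>e\<in>E. vdvd V (e [^] n) z" using vdvd_trans[OF vringD(1)[OF V(1)] _ e(2) e'(2)] e(1) by blast
  next
    assume "\<exists>e\<in>E. vdvd V (e [^] n) z"
    then obtain e where e: "e \<in> E" "vdvd V (e [^] n) z" by blast
    have "e [^] n \<in> ipw A E n" using ipw_pow[OF assms, of e 1 n] e(1) ipw_1[OF assms] by simp
    then show "\<exists>e'\<in>ipw A E n. vdvd V e' z" using e(2) by blast
  qed
  then show ?thesis unfolding ipw_eq ideal_closure_iff[OF assms(1) ipw_ideal[OF assms]] by blast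
qed

lemma Inter_ideal:
  assumes "subring A K" "\<And>V. Pr V \<Longrightarrow> ideal_of A (F V)"
  shows "ideal_of A {z \<in> A. \<forall>V. Pr V \<longrightarrow> z \<in> F V}"
  by (rule ideal_ofI) (auto simp: subringD(2,6,7)[OF assms(1)] ideal_ofD(2-4)[OF assms(2)])

text \<open>By the valuative criterion the closure is an intersection of ideals cut out by valuation
  rings; transitivity of divisibility makes it its own closure.\<close>

lemma closure_closed:
  assumes "subring A K" "ideal_of A E"
  shows "ideal_of A (ideal_closure (K\<lparr>carrier := A\<rparr>) E)" "E \<subseteq> ideal_closure (K\<lparr>carrier := A\<rparr>) E"
    "complete_ideal (K\<lparr>carrier := A\<rparr>) (ideal_closure (K\<lparr>carrier := A\<rparr>) E)"
proof -
  note A = subringD[OF assms(1)]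
  have EK: "E \<subseteq> carrier K" "E \<noteq> {}" using ideal_ofD(1,2)[OF assms(2)] A(1) by blast+
  let ?C = "ideal_closure (K\<lparr>carrier := A\<rparr>) E"
  have C: "?C = {z \<in> A. \<forall>V. vring V \<and> A \<subseteq> V \<longrightarrow> z \<in> {u \<in> A. \<exists>e\<in>E. vdvd V e u}}"
    using ideal_closure_iff[OF assms] by blast
  have v: "ideal_of A {u \<in> A. \<exists>e\<in>E. vdvd V e u}" if "vring V \<and> A \<subseteq> V" for V
    using vdvd_ideal[OF _ _ assms(1) EK] that by blast
  show id: "ideal_of A ?C"
    unfolding C by (rule Inter_ideal[OF assms(1) v])
  have incl: "F \<subseteq> ideal_closure (K\<lparr>carrier := A\<rparr>) F" if F: "ideal_of A F" for F
  proof
    fix f assume f: "f \<in> F"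
    have fA: "f \<in> A" using f ideal_ofD(1)[OF F] by blast
    show "f \<in> ideal_closure (K\<lparr>carrier := A\<rparr>) F"
      unfolding ideal_closure_iff[OF assms(1) F] using fA f vdvd_refl[OF vringD(1) A(4)[OF fA]] by blast
  qed
  show "E \<subseteq> ?C" by (rule incl[OF assms(2)])
  have "ideal_closure (K\<lparr>carrier := A\<rparr>) ?C \<subseteq> ?C"
  proof
    fix z assume z: "z \<in> ideal_closure (K\<lparr>carrier := A\<rparr>) ?C"
    then have zz: "z \<in> A" "\<And>V. vring V \<and> A \<subseteq> V \<Longrightarrow> \<exists>e\<in>?C. vdvd V e z" unfolding ideal_closure_iff[OF assms(1) id] by blast+
    show "z \<in> ?C"
      unfolding ideal_closure_iff[OF assms]
    proof (intro conjI zz(1) allI impI)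
      fix V assume V: "vring V \<and> A \<subseteq> V"
      obtain e where e: "e \<in> ?C" "vdvd V e z" using zz(2)[OF V] by blast
      obtain f where f: "f \<in> E" "vdvd V f e" using e(1) V unfolding ideal_closure_iff[OF assms] by blast
      show "\<exists>e\<in>E. vdvd V e z" using vdvd_trans[OF vringD(1)[OF conjunct1[OF V]] _ f(2) e(2)] f(1) EK(1) by blast
    qed
  qed
  then show "complete_ideal (K\<lparr>carrier := A\<rparr>) ?C"
    unfolding complete_ideal_def ideal_of_iff[OF assms(1)] using id incl[OF id] by blast
qed

lemma vdvd_scale:
  assumes "subring V K" "t \<in> carrier K" "t \<noteq> \<zero>" "a \<in> carrier K" "b \<in> carrier K"
  shows "vdvd V (a \<otimes> t) (b \<otimes> t) \<longleftrightarrow> vdvd V a b"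
proof -
  have "b \<otimes> t = (a \<otimes> t) \<otimes> v \<longleftrightarrow> b = a \<otimes> v" if v: "v \<in> V" for v
  proof -
    have vK: "v \<in> carrier K" using subringD(4)[OF assms(1) v] .
    have "b \<otimes> t = (a \<otimes> t) \<otimes> v \<longleftrightarrow> t \<otimes> b = t \<otimes> (a \<otimes> v)" using assms vK by (simp add: m_ac)
    then show ?thesis using cancel_l[OF assms(2,3,5)] assms(4) vK by simp
  qed
  then show ?thesis unfolding vdvd_def by blast
qed

text \<open>A nonunit has positive value, so exponents of its powers can be compared. This is how
  equations between exponents are extracted later.\<close>

lemma nonunit_powers:
  assumes "vring V" "e \<in> nonunits V" "e \<noteq> \<zero>" "vdvd V (e [^] (a::nat)) (e [^] (b::nat))"
  shows "a \<le> b"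
proof (rule ccontr)
  note sV = vringD(1)[OF assms(1)]
  note V = subringD[OF sV]
  assume "\<not> a \<le> b"
  then obtain c where c: "a = b + Suc c" by (metis add_Suc_right less_imp_Suc_add not_le)
  have eV: "e \<in> V" using assms(2) unfolding nonunits_def by blast
  have eK: "e \<in> carrier K" using V(4)[OF eV] .
  obtain v where v: "v \<in> V" "e [^] b = e [^] a \<otimes> v" using assms(4) unfolding vdvd_def by blast
  have vK: "v \<in> carrier K" using V(4)[OF v(1)] .
  have "e [^] b \<otimes> \<one> = e [^] b \<otimes> (e \<otimes> (e [^] c \<otimes> v))"
    using v(2) eK vK unfolding c by (simp add: nat_pow_mult[symmetric] m_ac)
  then have "e \<otimes> (e [^] c \<otimes> v) = \<one>" using cancel_l[of "e [^] b" \<one>] eK assms(3) vK by simp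
  then have "inv e = e [^] c \<otimes> v" using eK vK by (intro comm_inv_char) auto
  then have "inv e \<in> V" using V(6,9) eV v(1) by simp
  then show False using assms(2,3) unfolding nonunits_def by blast
qed

text \<open>Quotients of finitely many generators of \<open>I\<close> suffice, so
  \<open>R[I/g]\<close> is Noetherian whenever \<open>R\<close> is. The last part is the universal
  property by which it is placed inside valuation rings.\<close>

lemma adjoin_quotients_adjs:
  assumes "subring R K" "ideal_of R I" "set ys \<subseteq> I" "I = gens R {\<zero>} ys" "g \<in> carrier K" "g \<noteq> \<zero>"
  shows "adjoin_quotients K R I g = adjs R (map (\<lambda>y. y \<otimes> inv g) ys)" (is "?L = ?A")
    "subring (adjoin_quotients K R I g) K"
    "R \<subseteq> adjoin_quotients K R I g" "\<And>y. y \<in> I \<Longrightarrow> y \<otimes> inv g \<in> adjoin_quotients K R I g"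
    "\<And>S. subring S K \<Longrightarrow> R \<subseteq> S \<Longrightarrow> (\<And>y. y \<in> I \<Longrightarrow> y \<otimes> inv g \<in> S) \<Longrightarrow> adjoin_quotients K R I g \<subseteq> S"
proof -
  note R = subringD[OF assms(1)] and I = ideal_ofD[OF assms(2)]
  have IK: "I \<subseteq> carrier K" using I(1) R(1) by blast
  have gi: "inv g \<in> carrier K" using assms(5,6) by simp
  have H: "R \<union> {z \<otimes> inv g | z. z \<in> I} \<subseteq> carrier K" using R(1) IK gi by auto
  show sub: "subring (adjoin_quotients K R I g) K" unfolding adjoin_quotients_def by (rule generate_ring_is_subring[OF H])
  show RL: "R \<subseteq> adjoin_quotients K R I g" "\<And>y. y \<in> I \<Longrightarrow> y \<otimes> inv g \<in> adjoin_quotients K R I g"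
    unfolding adjoin_quotients_def by (auto intro: generate_ring.incl)
  show min: "\<And>S. subring S K \<Longrightarrow> R \<subseteq> S \<Longrightarrow> (\<And>y. y \<in> I \<Longrightarrow> y \<otimes> inv g \<in> S) \<Longrightarrow> adjoin_quotients K R I g \<subseteq> S"
    unfolding adjoin_quotients_def by (rule generate_ring_min_subring1[OF H]) auto
  have ysK: "set (map (\<lambda>y. y \<otimes> inv g) ys) \<subseteq> carrier K" using assms(3) IK gi by auto
  note F = adjs_facts[OF assms(1) ysK]
  have sA: "subring ?A K" "R \<subseteq> ?A" using F by auto
  note A = subringD[OF sA(1)]
  show "?L = ?A"
  proof
    have "gens R {\<zero>} ys \<subseteq> {y \<in> carrier K. y \<otimes> inv g \<in> ?A}"
    proof (rule gens_subset_general)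
      show "{\<zero>} \<subseteq> {y \<in> carrier K. y \<otimes> inv g \<in> ?A}" using gi A(2) by simp
      show "set ys \<subseteq> {y \<in> carrier K. y \<otimes> inv g \<in> ?A}" using F assms(3) IK by auto
      show "a \<oplus> b \<in> {y \<in> carrier K. y \<otimes> inv g \<in> ?A}" if "a \<in> {y \<in> carrier K. y \<otimes> inv g \<in> ?A}" "b \<in> {y \<in> carrier K. y \<otimes> inv g \<in> ?A}" for a b
        using that gi A(7) by (simp add: l_distr)
      show "s \<otimes> a \<in> {y \<in> carrier K. y \<otimes> inv g \<in> ?A}" if "s \<in> R" "a \<in> {y \<in> carrier K. y \<otimes> inv g \<in> ?A}" for s a
        using that gi A(6) R(4) subsetD[OF sA(2)] by (simp add: m_assoc)
    qed
    then have "\<And>y. y \<in> I \<Longrightarrow> y \<otimes> inv g \<in> ?A" using assms(4) by blast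
    then show "?L \<subseteq> ?A" by (rule min[OF sA])
    show "?A \<subseteq> ?L" by (rule adjs_min[OF sub RL(1)]) (use RL(2) assms(3) in auto)
  qed
qed

end

section \<open>The blow-up chart \<open>S1\<close> and the transform of \<open>I\<close>\<close>

text \<open>\<open>I_sub\<close> and \<open>rad\<close> express that the radical of \<open>I\<close>
  is \<open>m\<close>. \<open>rees\<close> is the inclusion of \<open>m V\<close> in
  \<open>x V\<close>, divided by \<open>x\<close>; it is what places \<open>S1\<close> inside the
  Rees valuation rings.\<close>

locale blowup = reg_local +
  fixes I S1 :: "'a set" and x :: 'a and r :: nat
  assumes fracR: "frac R" and I_ideal: "ideal_of R I" and I_sub: "I \<subseteq> m" and rad: "\<And>e. e \<in> m \<Longrightarrow> \<exists>n::nat. e [^] n \<in> I"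
    and x_m: "x \<in> m" and x_2: "x \<notin> mp 2" and S1_def: "S1 = adjoin_quotients K R m x"
    and rees: "\<And>V y. V \<in> Rees K R I \<Longrightarrow> y \<in> m \<Longrightarrow> y \<otimes> inv x \<in> V"
    and ordI: "I \<subseteq> mp r" "\<not> I \<subseteq> mp (Suc r)"
begin

lemma x0: "x \<noteq> \<zero>" using x_2 mpD(2)[of 2] by blast

lemma xR: "x \<in> R" "x \<in> carrier K" using x_m mm(4) RR(4) by auto

lemma xn: "x [^] (n::nat) \<in> carrier K" "x [^] n \<noteq> \<zero>" "x [^] n \<in> R"
  using xR x0 RR(9) by auto

lemmas II = ideal_ofD[OF I_ideal]

lemma IK: "e \<in> I \<Longrightarrow> e \<in> carrier K" using II(1) RR(4) by blast

lemma I_ne: "\<exists>e\<in>I. e \<noteq> \<zero>" using rad[OF x_m] xn(2) by blast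

lemma S1_facts: "subring S1 K" "R \<subseteq> S1" "y \<in> m \<Longrightarrow> y \<otimes> inv x \<in> S1"
  "subring S K \<Longrightarrow> R \<subseteq> S \<Longrightarrow> (\<And>y. y \<in> m \<Longrightarrow> y \<otimes> inv x \<in> S) \<Longrightarrow> S1 \<subseteq> S"
  unfolding S1_def using adjoin_quotients_adjs(2-5)[OF sR mm(1) xs_m gens_m xR(2) x0] by blast+

lemmas SS = subringD[OF S1_facts(1)]

text \<open>\<open>S1\<close> is the increasing union of the fractional ideals
  \<open>m^n/x^n\<close>: numerators over different powers of \<open>x\<close> are brought together
  because \<open>x^k \<in> m^k\<close>. Divisibility by \<open>x\<close> in \<open>S1\<close> thus
  becomes a question about orders of numerators.\<close>

lemma S1_iff: "S1 = {f \<otimes> inv (x [^] n) | f n. f \<in> mp n}" (is "S1 = ?S")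
proof
  have inS: "f \<otimes> inv (x [^] n) \<in> ?S" if "f \<in> mp n" for f n using that by blast
  show "S1 \<subseteq> ?S"
  proof (rule S1_facts(4))
    show "R \<subseteq> ?S"
    proof
      fix a assume a: "a \<in> R"
      then have "a \<otimes> inv (x [^] (0::nat)) \<in> ?S" by (intro inS) simp
      then show "a \<in> ?S" using RR(4)[OF a] by simp
    qed
    show "y \<otimes> inv x \<in> ?S" if "y \<in> m" for y
    proof -
      have "y \<in> mp 1" using that mp_1 by blast
      then have "y \<otimes> inv (x [^] (1::nat)) \<in> ?S" by (rule inS)
      then show ?thesis using xR by simp
    qed
    show "subring ?S K"
    proof (rule subringI)
      show "?S \<subseteq> carrier K" using mp_carr xn by auto
      have "\<one> \<otimes> inv (x [^] (0::nat)) \<in> ?S" by (rule inS) (use RR(3) in simp)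
      then show "\<one> \<in> ?S" by simp
      fix h assume "h \<in> ?S"
      then obtain f n where f: "h = f \<otimes> inv (x [^] n)" "f \<in> mp n" by blast
      have "\<ominus> h = (\<ominus> f) \<otimes> inv (x [^] n)" unfolding f(1) using mp_carr[OF f(2)] xn by (simp add: l_minus)
      then show "\<ominus> h \<in> ?S" using inS[OF ideal_of_minus(1)[OF sR mp_ideal f(2)]] by simp
      fix h' assume "h' \<in> ?S"
      then obtain g k where g: "h' = g \<otimes> inv (x [^] k)" "g \<in> mp k" by blast
      have p: "x [^] n \<otimes> x [^] k = x [^] (n + k)" using xR by (simp add: nat_pow_mult)
      have "h \<otimes> h' = (f \<otimes> g) \<otimes> inv (x [^] (n + k))" unfolding f(1) g(1) p[symmetric]
        using mp_carr f(2) g(2) xn by (simp add: div_mult)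
      then show "h \<otimes> h' \<in> ?S" using inS[OF mp_mult[OF f(2) g(2)]] by simp
      have xmp: "x [^] i \<in> mp i" for i :: nat using mp_pow[of x 1 i] x_m mp_1 by simp
      have "f \<otimes> x [^] k \<in> mp (n + k)" "g \<otimes> x [^] n \<in> mp (n + k)" 
        using mp_mult[OF f(2) xmp[of k]] mp_mult[OF g(2) xmp[of n]] by (simp_all add: add.commute)
      then have "f \<otimes> x [^] k \<oplus> g \<otimes> x [^] n \<in> mp (n + k)" by (rule mpD(3))
      moreover have "h \<oplus> h' = (f \<otimes> x [^] k \<oplus> g \<otimes> x [^] n) \<otimes> inv (x [^] (n + k))" unfolding f(1) g(1) p[symmetric]
        using mp_carr f(2) g(2) xn by (simp add: div_add)
      ultimately show "h \<oplus> h' \<in> ?S" using inS by simp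
    qed
  qed
  have "f \<otimes> inv (x [^] n) \<in> S1" if "f \<in> mp n" for f n
    using that
  proof (induction n arbitrary: f)
    case 0
    then have "f \<in> R" by simp
    then show ?case using S1_facts(2) RR(4) by auto
  next
    case (Suc n)
    then have "f \<in> ideal_prod K (mp n) m" by simp
    then show ?case
    proof induction
      case (prod i j)
      have "(i \<otimes> j) \<otimes> inv (x [^] Suc n) = (i \<otimes> inv (x [^] n)) \<otimes> (j \<otimes> inv x)"
        using mp_carr[OF prod(1)] prod(2) mm(4) RR(4) xn xR x0 by (subst div_mult) auto
      then show ?case using SS(6)[OF Suc.IH[OF prod(1)] S1_facts(3)[OF prod(2)]] by simp
    next
      case (sum s t)
      have "ideal_prod K (mp n) m \<subseteq> carrier K" using mp_carr[of _ "Suc n"] by auto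
      then have "s \<in> carrier K" "t \<in> carrier K" using sum by blast+
      then show ?case using sum xn(1,2)[of "Suc n"] SS(7) by (simp add: l_distr del: nat_pow_Suc)
    qed
  qed
  then show "?S \<subseteq> S1" by blast
qed

lemma S1I: "f \<in> mp n \<Longrightarrow> f \<otimes> inv (x [^] n) \<in> S1" unfolding S1_iff by blast

lemma x_order: "x [^] n \<in> mp n" "x [^] n \<notin> mp (Suc n)"
proof -
  have "x \<in> mp 1" "x \<notin> mp (Suc 1)" using x_m mp_1 x_2 by (simp_all add: numeral_2_eq_2 del: ipw.simps)
  then show "x [^] n \<in> mp n" "x [^] n \<notin> mp (Suc n)" using mp_pow[of x 1 n] order_pow[of x 1 n] by simp_all
qed

text \<open>Multiplication by \<open>x^n\<close> raises the order by exactly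
  \<open>n\<close>.\<close>

lemma cancel_x:
  assumes "y \<in> R" "y \<otimes> x [^] (n::nat) \<in> mp (n + k)"
  shows "y \<in> mp k"
proof (rule ccontr)
  assume "y \<notin> mp k"
  then obtain e where e: "e < k" "y \<in> mp e" "y \<notin> mp (Suc e)" using order_exists[OF assms(1)] by blast
  have "y \<otimes> x [^] n \<notin> mp (Suc (e + n))" by (rule order_mult[OF e(2,3) x_order])
  moreover have "mp (n + k) \<subseteq> mp (Suc (e + n))" by (rule mp_antimono) (use e(1) in simp)
  ultimately show False using assms(2) by blast
qed

text \<open>\<open>x\<close> is prime in \<open>S1\<close>. If \<open>x\<close> does not divide
  \<open>c = f/x^k\<close>, then \<open>f\<close> has exact order \<open>k\<close>; multiplicativity
  of the order makes every factor of \<open>x\<close> in \<open>c e = x^n\<close> divide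
  \<open>e\<close>, and cancelling them all leaves \<open>c\<close> invertible.\<close>

lemma x_prime_unit:
  assumes "c \<in> S1" "\<And>c'. c' \<in> S1 \<Longrightarrow> c \<noteq> x \<otimes> c'" "e \<in> S1" "c \<otimes> e = x [^] (n::nat)"
  shows "inv c \<in> S1"
  using assms(3,4)
proof (induction n arbitrary: e)
  case 0
  have "inv c = e" using 0 SS(4) assms(1) by (intro comm_inv_char) auto
  then show ?case using 0 by simp
next
  case (Suc n)
  have step: "\<exists>b\<in>S1. a = x \<otimes> b" if a: "a = f \<otimes> inv (x [^] k)" "f \<in> mp (Suc k)" for a f k
  proof -
    have "x \<otimes> (f \<otimes> inv (x [^] Suc k)) = (f \<otimes> inv (x [^] k)) \<otimes> (x \<otimes> inv x)"
      using mp_carr[OF a(2)] xR x0 xn[of k] by (simp add: inv_mult' m_ac del: r_inv_carr inv_cancel)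
    also have "\<dots> = a" unfolding a(1) using mp_carr[OF a(2)] xR x0 xn[of k] by simp
    finally show ?thesis using S1I[OF a(2)] by metis
  qed
  obtain f k where f: "c = f \<otimes> inv (x [^] k)" "f \<in> mp k" using assms(1) unfolding S1_iff by blast
  obtain g l where g: "e = g \<otimes> inv (x [^] l)" "g \<in> mp l" using Suc.prems(1) unfolding S1_iff by blast
  have fn: "f \<notin> mp (Suc k)" using step[OF f(1)] assms(2) by blast
  have K: "f \<in> carrier K" "g \<in> carrier K" using mp_carr f g by auto
  define y where "y = x [^] Suc n"
  have yK: "y \<in> carrier K" unfolding y_def by (rule xn(1))
  have "(f \<otimes> g) \<otimes> inv (x [^] k \<otimes> x [^] l) = y" using Suc.prems(2) unfolding f(1) g(1) y_def[symmetric] using K xn by (simp add: div_mult)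
  then have "f \<otimes> g = y \<otimes> (x [^] k \<otimes> x [^] l)" using div_eq_iff(1)[of "f \<otimes> g" "x [^] k \<otimes> x [^] l" y] K xn(1,2) yK by simp
  also have "\<dots> = x [^] (Suc n + (k + l))" unfolding y_def by (simp only: nat_pow_mult[OF xR(2)])
  finally have "f \<otimes> g \<in> mp (Suc n + (k + l))" using x_order(1)[of "Suc n + (k + l)"] by (simp only:)
  then have "f \<otimes> g \<in> mp (Suc (k + l))" using mp_antimono[of "Suc (k + l)" "Suc n + (k + l)"] by auto
  then have "g \<in> mp (Suc l)" using order_mult[OF f(2) fn g(2)] by blast
  then obtain b where b: "b \<in> S1" "e = x \<otimes> b" using step[OF g(1)] by blast
  have K': "c \<in> carrier K" "b \<in> carrier K" using SS(4) assms(1) b(1) by auto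
  have "x \<otimes> (c \<otimes> b) = x \<otimes> x [^] n" using Suc.prems(2) b(2) K' xR by (simp add: m_ac)
  then have "c \<otimes> b = x [^] n" using cancel_l[OF xR(2) x0] K' xn by simp
  then show ?case by (rule Suc.IH[OF b(1)])
qed

text \<open>Whatever generator \<open>a\<close> the definition supplies, it is \<open>x^r\<close>
  times a unit. It is a multiple \<open>c x^r\<close> because \<open>I\<close> lies in
  \<open>x^r S1\<close>; and \<open>c\<close> divides a power of \<open>x\<close> but is not
  divisible by \<open>x\<close>.\<close>

lemma transform_eq:
  assumes "is_transform K S1 I I1"
  shows "I1 = {inv (x [^] r) \<otimes> z | z. z \<in> Idl\<^bsub>K\<lparr>carrier := S1\<rparr>\<^esub> I}"
proof -
  let ?J = "Idl\<^bsub>K\<lparr>carrier := S1\<rparr>\<^esub> I"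
  have IS: "I \<subseteq> S1" using II(1) S1_facts(2) by blast
  note J = Idl_facts[OF S1_facts(1) IS]
  note JJ = ideal_ofD[OF J(1)]
  obtain a where a: "a \<in> S1" "a \<noteq> \<zero>" "?J \<subseteq> {b \<otimes> a | b. b \<in> S1}"
    "\<And>b. b \<in> S1 \<Longrightarrow> ?J \<subseteq> {c \<otimes> b | c. c \<in> S1} \<Longrightarrow> {c \<otimes> a | c. c \<in> S1} \<subseteq> {c \<otimes> b | c. c \<in> S1}"
    "I1 = {inv a \<otimes> z | z. z \<in> ?J}"
    using assms unfolding is_transform_def Let_def PIdl_eq by blast
  have aK: "a \<in> carrier K" using SS(4)[OF a(1)] .
  have xS: "x [^] r \<in> S1" using xn(3) S1_facts(2) by blast
  have pid: "ideal_of S1 {b \<otimes> x [^] r | b. b \<in> S1}"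
  proof -
    have "ideal_of S1 (plus_gen S1 {\<zero>} (x [^] r))" by (rule plus_gen_ideal(1)[OF S1_facts(1) zero_ideal_of[OF S1_facts(1)] xS])
    moreover have "plus_gen S1 {\<zero>} (x [^] r) = {b \<otimes> x [^] r | b. b \<in> S1}"
    proof -
      have "\<zero> \<oplus> b \<otimes> x [^] r = b \<otimes> x [^] r" if "b \<in> S1" for b using SS(4)[OF that] xn by simp
      then show ?thesis unfolding plus_gen_def by force
    qed
    ultimately show ?thesis by simp
  qed
  have "I \<subseteq> {b \<otimes> x [^] r | b. b \<in> S1}"
  proof
    fix f assume f: "f \<in> I"
    then have "f \<otimes> inv (x [^] r) \<in> S1" using S1I ordI(1) by blast
    moreover have "f = (f \<otimes> inv (x [^] r)) \<otimes> x [^] r" using IK[OF f] xn by simp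
    ultimately show "f \<in> {b \<otimes> x [^] r | b. b \<in> S1}" by blast
  qed
  then have "?J \<subseteq> {b \<otimes> x [^] r | b. b \<in> S1}" by (rule J(3)[OF pid])
  then have sub: "{c \<otimes> a | c. c \<in> S1} \<subseteq> {c \<otimes> x [^] r | c. c \<in> S1}" by (rule a(4)[OF xS])
  have "\<one> \<otimes> a \<in> {c \<otimes> a | c. c \<in> S1}" using SS(3) by blast
  then have "a \<in> {c \<otimes> x [^] r | c. c \<in> S1}" using sub aK by auto
  then obtain c where c: "c \<in> S1" "a = c \<otimes> x [^] r" by blast
  have cK: "c \<in> carrier K" using SS(4)[OF c(1)] .
  have c0: "c \<noteq> \<zero>" using a(2) c(2) xn by auto
  \<comment> \<open>The exponent is raised by \<open>r\<close> so that, after cancelling the factor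
    \<open>x^r\<close> of \<open>a\<close>, a power of \<open>x\<close> with \<open>c\<close> as
    divisor remains.\<close>
  obtain N0 where N0: "x [^] (N0::nat) \<in> I" using rad[OF x_m] by blast
  have N: "x [^] (r + N0) \<in> I"
  proof -
    have "x [^] (r + N0) = x [^] r \<otimes> x [^] N0" using xR by (simp add: nat_pow_mult)
    then show ?thesis using II(4)[OF xn(3) N0] by simp
  qed
  then have "x [^] (r + N0) \<in> {b \<otimes> a | b. b \<in> S1}" using a(3) J(2) by blast
  then obtain e where e: "e \<in> S1" "x [^] (r + N0) = e \<otimes> a" by blast
  have eK: "e \<in> carrier K" using SS(4)[OF e(1)] .
  have "x [^] r \<otimes> x [^] N0 = e \<otimes> a" unfolding e(2)[symmetric] by (rule nat_pow_mult[OF xR(2)])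
  also have "\<dots> = x [^] r \<otimes> (c \<otimes> e)" unfolding c(2) using xn(1) eK cK by (simp add: m_ac)
  finally have "x [^] r \<otimes> x [^] N0 = x [^] r \<otimes> (c \<otimes> e)" .
  then have ce: "c \<otimes> e = x [^] N0" using cancel_l[OF xn(1,2)] xn cK eK by simp
  \<comment> \<open>Otherwise every element of \<open>I\<close> would be \<open>x^(r+1)\<close>
    times an element of \<open>S1\<close>, and hence of order at least \<open>r + 1\<close>.\<close>
  have "c \<noteq> x \<otimes> c'" if c': "c' \<in> S1" for c'
  proof
    assume cc: "c = x \<otimes> c'"
    have "I \<subseteq> mp (Suc r)"
    proof
      fix f assume f: "f \<in> I"
      then have "f \<in> {b \<otimes> a | b. b \<in> S1}" using a(3) J(2) by blast
      then obtain b where b: "b \<in> S1" "f = b \<otimes> a" by blast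
      obtain h n where h: "b \<otimes> c' = h \<otimes> inv (x [^] n)" "h \<in> mp n" using SS(6)[OF b(1) c'] unfolding S1_iff by blast
      have K: "b \<in> carrier K" "c' \<in> carrier K" "h \<in> carrier K" using SS(4) b(1) c' mp_carr[OF h(2)] by auto
      have "f = (b \<otimes> c') \<otimes> x [^] Suc r" unfolding b(2) c(2) cc using K xR by (simp add: m_ac)
      then have "f = h \<otimes> inv (x [^] n) \<otimes> x [^] Suc r" unfolding h(1) .
      moreover have "h \<otimes> inv (x [^] n) \<otimes> y \<otimes> x [^] n = h \<otimes> y" if y: "y \<in> carrier K" for y
      proof -
        have "h \<otimes> inv (x [^] n) \<otimes> y \<otimes> x [^] n = (h \<otimes> y) \<otimes> inv (x [^] n) \<otimes> x [^] n" using K y xn(1,2)[of n] by (simp add: m_ac del: inv_cancel)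
        then show ?thesis using K y xn(1,2)[of n] by simp
      qed
      ultimately have "f \<otimes> x [^] n = h \<otimes> x [^] Suc r" using xn(1)[of "Suc r"] by (simp only:)
      then have "f \<otimes> x [^] n \<in> mp (n + Suc r)" using mp_mult[OF h(2) x_order(1)[of "Suc r"]] by simp
      then show "f \<in> mp (Suc r)" by (rule cancel_x[OF subsetD[OF II(1) f]])
    qed
    then show False using ordI(2) by blast
  qed
  then have ic: "inv c \<in> S1" using x_prime_unit[OF c(1) _ e(1) ce] by blast
  have ia: "inv a \<otimes> z = inv (x [^] r) \<otimes> (inv c \<otimes> z)" if "z \<in> carrier K" for z
    unfolding c(2) using cK c0 xn(1,2) that by (simp add: inv_mult' m_ac)
  have JK: "z \<in> ?J \<Longrightarrow> z \<in> carrier K" for z using JJ(1) SS(4) by blast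
  show ?thesis unfolding a(5)
  proof (intro equalityI subsetI)
    fix u assume "u \<in> {inv a \<otimes> z | z. z \<in> ?J}"
    then obtain z where z: "z \<in> ?J" "u = inv a \<otimes> z" by blast
    then show "u \<in> {inv (x [^] r) \<otimes> z | z. z \<in> ?J}" using ia[OF JK] JJ(4)[OF ic z(1)] by blast
  next
    fix u assume "u \<in> {inv (x [^] r) \<otimes> z | z. z \<in> ?J}"
    then obtain z where z: "z \<in> ?J" "u = inv (x [^] r) \<otimes> z" by blast
    have "c \<otimes> z \<in> ?J" by (rule JJ(4)[OF c(1) z(1)])
    moreover have "inv a \<otimes> (c \<otimes> z) = u" unfolding z(2) using ia[OF JK[OF \<open>c \<otimes> z \<in> ?J\<close>]] cK c0 JK[OF z(1)] by simp
    ultimately show "u \<in> {inv a \<otimes> z | z. z \<in> ?J}" by blast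
  qed
qed

text \<open>The valuations of \<open>Rees I\<close> detect the integral closures of the powers of \<open>I\<close>, and by hypothesis they
  lie over \<open>S1\<close>.\<close>

lemma closure_descent:
  assumes "z \<in> R" "\<And>V. vring V \<Longrightarrow> S1 \<subseteq> V \<Longrightarrow> \<exists>e\<in>I. vdvd V (e [^] (k::nat)) z" "vring V" "R \<subseteq> V"
  shows "\<exists>e\<in>I. vdvd V (e [^] k) z"
proof -
  note sV = vringD(1)[OF assms(3)]
  have zK: "z \<in> carrier K" using assms(1) RR(4) by blast
  obtain ys where ys: "set ys \<subseteq> I" "I = gens R {\<zero>} ys" by (rule noeth_fg[OF noethR I_ideal])
  \<comment> \<open>As \<open>g\<close> has least value on \<open>I\<close>, the ring
    \<open>R[I/g]\<close> lies in \<open>V\<close>, and it suffices that \<open>z/g^k\<close> is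
    integral over it.\<close>
  obtain g where g: "g \<in> I" "\<And>f. f \<in> I \<Longrightarrow> vdvd V g f" using fg_vdvd[OF assms(3,4) sR II(1) ys] by blast
  have gK: "g \<in> carrier K" using IK[OF g(1)] .
  have g0: "g \<noteq> \<zero>"
  proof
    assume g0: "g = \<zero>"
    obtain e where e: "e \<in> I" "e \<noteq> \<zero>" using I_ne by blast
    obtain v where "v \<in> V" "e = \<zero> \<otimes> v" using g(2)[OF e(1)] g0 unfolding vdvd_def by blast
    then show False using e(2) subringD(4)[OF sV] by simp
  qed
  have gn: "g [^] k \<in> carrier K" "g [^] k \<noteq> \<zero>" using gK g0 by auto
  define A where "A = adjoin_quotients K R I g"
  note A = adjoin_quotients_adjs[OF sR I_ideal ys gK g0, folded A_def]
  have IKs: "I \<subseteq> carrier K" using IK by blast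
  have nA: "noeth A" unfolding A(1) by (rule noeth_adjs[OF noethR]) (use ys(1) IKs gK g0 in auto)
  note B = ic_facts[OF A(2)]
  note BB = subringD[OF B(1)]
  have AV: "A \<subseteq> V" by (rule A(5)[OF sV assms(4)]) (use g(2) vdvd_iff[OF sV gK IK g0] in blast)
  define w where "w = z \<otimes> inv (g [^] k)"
  have wK: "w \<in> carrier K" unfolding w_def using zK gn by simp
  have "w \<in> ic A"
  proof (rule ccontr)
    assume wn: "w \<notin> ic A"
    have fA: "frac A" by (rule frac_mono[OF fracR A(3)])
    obtain Q where Q: "prime_of (ic A) Q" "vring (lcl (ic A) Q)" "archimedean (lcl (ic A) Q)"
      "Q = ic A \<inter> nonunits (lcl (ic A) Q)" "w \<notin> lcl (ic A) Q"
      using essential_valuation[OF nA fA wK wn] by blast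
    define W where "W = lcl (ic A) Q"
    note L = lcl_facts[OF B(1) Q(1), folded W_def]
    note WW = subringD[OF L(1)]
    have RB: "R \<subseteq> ic A" using A(3) B(2) by blast
    have gB: "g \<in> ic A" using g(1) II(1) RB by blast
    have zW: "z \<in> W" using assms(1) RB L(2) by blast
    \<comment> \<open>Were \<open>g\<close> a unit of \<open>W\<close>, then \<open>z/g^k\<close>
      would lie in \<open>W\<close>. So \<open>Q\<close> contains \<open>g\<close> and, since the
      quotients \<open>f/g\<close> are in the ring, all of \<open>I\<close>, as membership in
      \<open>Rees K R I\<close> demands.\<close>
    have gQ: "g \<in> Q"
    proof (rule ccontr)
      assume "g \<notin> Q"
      then have "inv g \<in> W" using L(3)[OF gB] by blast
      then have "inv (g [^] k) \<in> W" using WW(9) inv_pow[OF gK g0] by simp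
      then have "w \<in> W" unfolding w_def using WW(6) zW by blast
      then show False using Q(5) unfolding W_def by blast
    qed
    have IQ: "I \<subseteq> Q"
    proof
      fix f assume f: "f \<in> I"
      have "(f \<otimes> inv g) \<otimes> g \<in> Q" using prime_ofD(7)[OF Q(1) _ gQ] A(4)[OF f] B(2) by blast
      then show "f \<in> Q" using IK[OF f] gK g0 by simp
    qed
    have fB: "frac (ic A)" by (rule frac_mono[OF fA B(2)])
    have ht: "prime_height (K\<lparr>carrier := ic A\<rparr>) Q = 1" by (rule essential_height[OF B(1) fB Q(1,3,4) wK Q(5)])
    have "W \<in> Rees K R I"
      unfolding Rees_def W_def lcl_localization
      using g(1) g0 ht IQ Q(1) prime_of_iff[OF B(1)] unfolding A_def by blast
    then have "y \<otimes> inv x \<in> W" if "y \<in> m" for y using rees that by blast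
    then have "S1 \<subseteq> W" using S1_facts(4)[OF L(1)] RB L(2) by blast
    then obtain e where e: "e \<in> I" "vdvd W (e [^] k) z" using assms(2) Q(2) unfolding W_def by blast
    have "vdvd W g e" using vdvd_iff[OF L(1) gK IK[OF e(1)] g0] A(4)[OF e(1)] B(2) L(2) by blast
    then have "vdvd W (g [^] k) (e [^] k)" by (rule vdvd_pow[OF L(1) gK])
    then have "vdvd W (g [^] k) z" using vdvd_trans[OF L(1) gn(1)] e(2) by blast
    then have "w \<in> W" unfolding w_def using vdvd_iff[OF L(1) gn(1) zK gn(2)] by blast
    then show False using Q(5) unfolding W_def by blast
  qed
  then have "w \<in> V" using B(3)[OF assms(3) AV] by blast
  then have "vdvd V (g [^] k) z" unfolding w_def using vdvd_iff[OF sV gn(1) zK gn(2)] by blast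
  then show ?thesis using g(1) by blast
qed

theorem projectively_full_descends:
  assumes tr: "is_transform K S1 I I1" and full: "projectively_full (K\<lparr>carrier := S1\<rparr>) I1"
    and J: "complete_ideal (K\<lparr>carrier := R\<rparr>) J" and ij: "0 < i" "0 < j"
    and cl: "ideal_closure (K\<lparr>carrier := R\<rparr>) (ideal_power (K\<lparr>carrier := R\<rparr>) I j)
      = ideal_closure (K\<lparr>carrier := R\<rparr>) (ideal_power (K\<lparr>carrier := R\<rparr>) J i)"
  shows "\<exists>k::nat. 0 < k \<and> J = ideal_closure (K\<lparr>carrier := R\<rparr>) (ideal_power (K\<lparr>carrier := R\<rparr>) I k)"
proof -
  have J_id: "ideal_of R J" "ideal_closure (K\<lparr>carrier := R\<rparr>) J = J"
    using J ideal_of_iff[OF sR] unfolding complete_ideal_def by auto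
  note JJ = ideal_ofD[OF J_id(1)]
  have JK: "g \<in> carrier K" if "g \<in> J" for g using that JJ(1) RR(4) by blast
  note cI = closure_power_iff[OF sR I_ideal] and cJ = closure_power_iff[OF sR J_id(1)]
  have pIJ: "\<exists>g\<in>J. vdvd V (g [^] i) (e [^] j)" if "vring V" "R \<subseteq> V" "e \<in> I" for V e
  proof -
    have "e [^] j \<in> carrier K" using IK[OF that(3)] by simp
    then have "e [^] j \<in> ideal_closure (K\<lparr>carrier := R\<rparr>) (ideal_power (K\<lparr>carrier := R\<rparr>) I j)"
      unfolding cI using that(3) II(1) RR(9) vdvd_refl[OF vringD(1)] by blast
    then show ?thesis using that(1,2) unfolding cl cJ by blast
  qed
  have pJI: "\<exists>e\<in>I. vdvd V (e [^] j) (g [^] i)" if "vring V" "R \<subseteq> V" "g \<in> J" for V g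
  proof -
    have "g [^] i \<in> carrier K" using JK[OF that(3)] by simp
    then have "g [^] i \<in> ideal_closure (K\<lparr>carrier := R\<rparr>) (ideal_power (K\<lparr>carrier := R\<rparr>) J i)"
      unfolding cJ using that(3) JJ(1) RR(9) vdvd_refl[OF vringD(1)] by blast
    then show ?thesis using that(1,2) unfolding cl[symmetric] cI by blast
  qed
  have powcl: "u [^] n \<in> ideal_closure (K\<lparr>carrier := R\<rparr>) (ideal_power (K\<lparr>carrier := R\<rparr>) E n)" 
    if "ideal_of R E" "u \<in> E" for u n E
  proof -
    have u: "u \<in> R" using that ideal_ofD(1) by blast
    then have "u [^] n \<in> carrier K" using RR(4,9) by blast
    then show ?thesis unfolding closure_power_iff[OF sR that(1)] using that(2) RR(9)[OF u] vdvd_refl[OF vringD(1)] by blast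
  qed
  have clord: "z \<in> mp (e * n)" if "ideal_of R E" "E \<subseteq> mp e" "z \<in> ideal_closure (K\<lparr>carrier := R\<rparr>) (ideal_power (K\<lparr>carrier := R\<rparr>) E n)" for z e n E
    using closure_order[OF ipw_ideal[OF sR that(1)] ipw_mp[OF that(1,2)]] that(3) unfolding ipw_eq by blast
  \<comment> \<open>An element of exact order \<open>r\<close> has a power \<open>f^j\<close> of
    exact order \<open>r j\<close> in the closure of \<open>J^i\<close>. This bounds the order of
    \<open>J\<close>, which is therefore finite, and gives one half of \<open>r j = s i\<close>; an
    element of \<open>J\<close> of exact order \<open>s\<close> gives the other.\<close>
  obtain f where f: "f \<in> I" "f \<in> mp r" "f \<notin> mp (Suc r)" using ordI by blast
  have fj: "f [^] j \<in> mp (r * j)" "f [^] j \<notin> mp (Suc (r * j))" using mp_pow[OF f(2)] order_pow[OF f(2,3)] by auto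
  have fjJ: "f [^] j \<in> ideal_closure (K\<lparr>carrier := R\<rparr>) (ideal_power (K\<lparr>carrier := R\<rparr>) J i)"
    using powcl[OF I_ideal f(1), of j] unfolding cl .
  have bound: "e * i \<le> r * j" if "J \<subseteq> mp e" for e
  proof (rule ccontr)
    assume "\<not> e * i \<le> r * j"
    then have "mp (e * i) \<subseteq> mp (Suc (r * j))" by (intro mp_antimono) simp
    then show False using clord[OF J_id(1) that fjJ] fj(2) by blast
  qed
  have "\<not> J \<subseteq> mp (Suc (r * j))"
  proof
    assume "J \<subseteq> mp (Suc (r * j))"
    then have "Suc (r * j) * i \<le> r * j" by (rule bound)
    moreover have "Suc (r * j) * 1 \<le> Suc (r * j) * i" using ij(1) by (intro mult_le_mono2) simp
    ultimately show False by simp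
  qed
  define s0 where "s0 = (LEAST e. \<not> J \<subseteq> mp e)"
  have s0: "\<not> J \<subseteq> mp s0" unfolding s0_def using \<open>\<not> J \<subseteq> mp (Suc (r * j))\<close> by (rule LeastI[of "\<lambda>e. \<not> J \<subseteq> mp e"])
  have "s0 \<noteq> 0" using s0 JJ(1) by (cases s0) auto
  then obtain s where s: "s0 = Suc s" by (cases s0) auto
  have Js: "J \<subseteq> mp s" using not_less_Least[of s "\<lambda>e. \<not> J \<subseteq> mp e"] s s0_def by auto
  obtain g1 where g1: "g1 \<in> J" "g1 \<in> mp s" "g1 \<notin> mp (Suc s)" using Js s0[unfolded s] by blast
  have "g1 [^] i \<in> mp (r * j)" using clord[OF I_ideal ordI(1)] powcl[OF J_id(1) g1(1), of i] unfolding cl[symmetric] by blast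
  then have "r * j \<le> s * i" using order_pow[OF g1(2,3), of i] mp_antimono[of "Suc (s * i)" "r * j"] by (meson not_less_eq_eq subsetD)
  then have rs: "r * j = s * i" using bound[OF Js] by simp
  have RS: "vring V \<Longrightarrow> S1 \<subseteq> V \<Longrightarrow> R \<subseteq> V" for V using S1_facts(2) by blast
  define ix where "ix n = inv (x [^] (n::nat))" for n
  have ix: "ix n \<in> carrier K" "ix n \<noteq> \<zero>" for n unfolding ix_def using xn by auto
  have ixp: "ix n [^] l = ix (n * l)" for n l :: nat 
    unfolding ix_def using xn xR by (simp add: inv_pow[symmetric] nat_pow_pow)
  have J_S1: "J \<subseteq> S1" and I_S1: "I \<subseteq> S1" using JJ(1) II(1) S1_facts(2) by blast+
  have J_ne: "J \<noteq> {}" "I \<noteq> {}" using JJ(2) II(2) by blast+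
  \<comment> \<open>The transform with a prescribed exponent: \<open>x^(-n)\<close> times the
    extension of \<open>E\<close>, within \<open>S1\<close>. It is used for \<open>I\<close> with
    exponent \<open>r\<close> and for \<open>J\<close> with exponent \<open>s\<close>.\<close>
  define trf where "trf E n = {u \<in> S1. u \<otimes> x [^] (n::nat) \<in> Idl\<^bsub>K\<lparr>carrier := S1\<rparr>\<^esub> E}" for E n
  have trf_id: "ideal_of S1 (trf E n)" if E: "E \<subseteq> S1" for E n
  proof (rule ideal_ofI)
    note T = ideal_ofD[OF Idl_facts(1)[OF S1_facts(1) E]]
    show "trf E n \<subseteq> S1" unfolding trf_def by blast
    show "\<zero> \<in> trf E n" unfolding trf_def using SS(2) T(2) xn by simp
    show "a \<oplus> b \<in> trf E n" if "a \<in> trf E n" "b \<in> trf E n" for a b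
      using that SS(4,7) T(3) xn unfolding trf_def by (simp add: l_distr)
    show "t \<otimes> a \<in> trf E n" if "t \<in> S1" "a \<in> trf E n" for t a
      using that SS(4,6) T(4) xn unfolding trf_def by (simp add: m_assoc)
  qed
  have trf_in: "e \<otimes> ix n \<in> trf E n" if E: "E \<subseteq> S1" "e \<in> E" "e \<in> mp n" for E n e
    unfolding trf_def ix_def using S1I[OF E(3)] Idl_facts(2)[OF S1_facts(1) E(1)] E(2) mp_carr[OF E(3)] xn by auto
  have trf_out: "\<exists>e\<in>E. vdvd V (e \<otimes> ix n) u" if V: "vring V" "S1 \<subseteq> V" and E: "E \<subseteq> S1" "E \<noteq> {}" "u \<in> trf E n" for V E n u
  proof -
    have u: "u \<in> carrier K" "u \<otimes> x [^] n \<in> Idl\<^bsub>K\<lparr>carrier := S1\<rparr>\<^esub> E" using E(3) SS(4) unfolding trf_def by auto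
    obtain e where e: "e \<in> E" "vdvd V e (u \<otimes> x [^] n)" using Idl_vdvd[OF V S1_facts(1) E(1,2) u(2)] by blast
    have eK: "e \<in> carrier K" using e(1) E(1) SS(4) by blast
    have "vdvd V (e \<otimes> ix n) (u \<otimes> x [^] n \<otimes> ix n)" using vdvd_scale[OF vringD(1)[OF V(1)] ix eK] e(2) u xn by simp
    moreover have "u \<otimes> x [^] n \<otimes> ix n = u" unfolding ix_def using u xn by simp
    ultimately show ?thesis using e(1) by auto
  qed
  have I1: "I1 = trf I r"
  proof -
    note T = ideal_ofD[OF Idl_facts(1)[OF S1_facts(1) I_S1]]
    have "I1 = {inv (x [^] r) \<otimes> z | z. z \<in> Idl\<^bsub>K\<lparr>carrier := S1\<rparr>\<^esub> I}" by (rule transform_eq[OF tr])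
    also have "\<dots> = trf I r"
    proof (intro equalityI subsetI)
      fix u assume "u \<in> {inv (x [^] r) \<otimes> z | z. z \<in> Idl\<^bsub>K\<lparr>carrier := S1\<rparr>\<^esub> I}"
      then obtain z where z: "z \<in> Idl\<^bsub>K\<lparr>carrier := S1\<rparr>\<^esub> I" "u = inv (x [^] r) \<otimes> z" by blast
      have zK: "z \<in> carrier K" using z(1) T(1) SS(4) by blast
      have ux: "u \<otimes> x [^] r = z" unfolding z(2) using zK xn[of r] by (simp add: m_comm[of _ z])
      have "Idl\<^bsub>K\<lparr>carrier := S1\<rparr>\<^esub> I \<subseteq> {z \<in> carrier K. inv (x [^] r) \<otimes> z \<in> S1}"
      proof -
        have "ideal_of S1 {z \<in> S1. inv (x [^] r) \<otimes> z \<in> S1}"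
          using xn[of r] by (intro ideal_ofI) (auto simp: SS(2,4,6,7) r_distr m_lcomm)
        moreover have "I \<subseteq> {z \<in> S1. inv (x [^] r) \<otimes> z \<in> S1}"
          using I_S1 S1I ordI(1) IK xn[of r] by (auto simp: m_comm)
        ultimately show ?thesis using Idl_facts(3)[OF S1_facts(1) I_S1] SS(4) by blast
      qed
      then have "u \<in> S1" using z by blast
      then show "u \<in> trf I r" unfolding trf_def using ux z(1) by simp
    next
      fix u assume u: "u \<in> trf I r"
      then have "u = inv (x [^] r) \<otimes> (u \<otimes> x [^] r)" using SS(4) xn[of r] unfolding trf_def by simp
      then show "u \<in> {inv (x [^] r) \<otimes> z | z. z \<in> Idl\<^bsub>K\<lparr>carrier := S1\<rparr>\<^esub> I}" using u unfolding trf_def by blast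
    qed
    finally show ?thesis .
  qed
  have I1_id: "ideal_of S1 I1" unfolding I1 by (rule trf_id[OF I_S1])
  have I1K: "u \<in> carrier K" if "u \<in> I1" for u using that ideal_ofD(1)[OF I1_id] SS(4) by blast
  have I1_in: "e \<otimes> ix r \<in> I1" if "e \<in> I" for e unfolding I1 using trf_in[OF I_S1 that] that ordI(1) by blast
  have I1_out: "\<exists>e\<in>I. vdvd V (e \<otimes> ix r) u" if "vring V" "S1 \<subseteq> V" "u \<in> I1" for V u
    using trf_out[OF that(1,2) I_S1 J_ne(2)] that(3) unfolding I1 by blast
  define J1 where "J1 = trf J s"
  have J1_id: "ideal_of S1 J1" unfolding J1_def by (rule trf_id[OF J_S1])
  have J1_in: "g \<otimes> ix s \<in> J1" if "g \<in> J" for g unfolding J1_def using trf_in[OF J_S1 that] that Js by blast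
  have J1_out: "\<exists>g\<in>J. vdvd V (g \<otimes> ix s) u" if "vring V" "S1 \<subseteq> V" "u \<in> J1" for V u
    using trf_out[OF that(1,2) J_S1 J_ne(1)] that(3) unfolding J1_def by blast
  \<comment> \<open>Projective fullness makes a statement about complete ideals, so the transform of
    \<open>J\<close> is replaced by its integral closure.\<close>
  define J' where "J' = ideal_closure (K\<lparr>carrier := S1\<rparr>) J1"
  note J' = closure_closed[OF S1_facts(1) J1_id, folded J'_def]
  have J'K: "u \<in> carrier K" if "u \<in> J'" for u using that ideal_ofD(1)[OF J'(1)] SS(4) by blast
  have J'_iff: "u \<in> J' \<longleftrightarrow> u \<in> S1 \<and> (\<forall>V. vring V \<and> S1 \<subseteq> V \<longrightarrow> (\<exists>g\<in>J. vdvd V (g \<otimes> ix s) u))" for u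
  proof -
    have "(\<exists>u'\<in>J1. vdvd V u' u) \<longleftrightarrow> (\<exists>g\<in>J. vdvd V (g \<otimes> ix s) u)" if V: "vring V" "S1 \<subseteq> V" for V
    proof
      assume "\<exists>u'\<in>J1. vdvd V u' u"
      then obtain u' where u': "u' \<in> J1" "vdvd V u' u" by blast
      obtain g where g: "g \<in> J" "vdvd V (g \<otimes> ix s) u'" using J1_out[OF V u'(1)] by blast
      have "g \<otimes> ix s \<in> carrier K" using JK[OF g(1)] ix by simp
      then show "\<exists>g\<in>J. vdvd V (g \<otimes> ix s) u" using vdvd_trans[OF vringD(1)[OF V(1)] _ g(2) u'(2)] g(1) by blast
    next
      assume "\<exists>g\<in>J. vdvd V (g \<otimes> ix s) u" then show "\<exists>u'\<in>J1. vdvd V u' u" using J1_in by blast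
    qed
    then show ?thesis unfolding J'_def ideal_closure_iff[OF S1_facts(1) J1_id] by blast
  qed
  \<comment> \<open>When \<open>n p = l q\<close>, both sides carry the same power of
    \<open>x\<close>, which cancels. The instances are \<open>r j = s i\<close> and, at the end,
    \<open>s = r k\<close>.\<close>
  have scaled: "vdvd V ((a \<otimes> ix n) [^] p) ((b \<otimes> ix l) [^] q) \<longleftrightarrow> vdvd V (a [^] p) (b [^] q)" 
    if V: "vring V" and ab: "a \<in> carrier K" "b \<in> carrier K" "n * p = l * q" for V a b n p l q
  proof -
    have "(a \<otimes> ix n) [^] p = a [^] p \<otimes> ix (n * p)" "(b \<otimes> ix l) [^] q = b [^] q \<otimes> ix (n * p)"
      using ab ix by (simp_all add: nat_pow_distrib ixp)
    then show ?thesis using vdvd_scale[OF vringD(1)[OF V] ix] ab by simp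
  qed
  have qIJ: "\<exists>g\<in>J'. vdvd V (g [^] i) (e [^] j)" if V: "vring V" "S1 \<subseteq> V" and e: "e \<in> I1" for V e
  proof -
    note sV = vringD(1)[OF V(1)]
    obtain e' where e': "e' \<in> I" "vdvd V (e' \<otimes> ix r) e" using I1_out[OF V e] by blast
    obtain g where g: "g \<in> J" "vdvd V (g [^] i) (e' [^] j)" using pIJ[OF V(1) RS[OF V] e'(1)] by blast
    have K: "e' \<otimes> ix r \<in> carrier K" "g \<otimes> ix s \<in> carrier K" using IK[OF e'(1)] JK[OF g(1)] ix by auto
    have "vdvd V ((g \<otimes> ix s) [^] i) ((e' \<otimes> ix r) [^] j)" using scaled[OF V(1) JK[OF g(1)] IK[OF e'(1)]] g(2) rs by simp
    then have "vdvd V ((g \<otimes> ix s) [^] i) (e [^] j)" using vdvd_trans[OF sV _ _ vdvd_pow[OF sV K(1) e'(2)]] K(2) by simp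
    then show ?thesis using J1_in[OF g(1)] J'(2) by blast
  qed
  have qJI: "\<exists>e\<in>I1. vdvd V (e [^] j) (g [^] i)" if V: "vring V" "S1 \<subseteq> V" and g: "g \<in> J'" for V g
  proof -
    note sV = vringD(1)[OF V(1)]
    obtain g' where g': "g' \<in> J" "vdvd V (g' \<otimes> ix s) g" using g V unfolding J'_iff by blast
    obtain e where e: "e \<in> I" "vdvd V (e [^] j) (g' [^] i)" using pJI[OF V(1) RS[OF V] g'(1)] by blast
    have K: "e \<otimes> ix r \<in> carrier K" "g' \<otimes> ix s \<in> carrier K" using IK[OF e(1)] JK[OF g'(1)] ix by auto
    have "vdvd V ((e \<otimes> ix r) [^] j) ((g' \<otimes> ix s) [^] i)" using scaled[OF V(1) IK[OF e(1)] JK[OF g'(1)]] e(2) rs by simp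
    then have "vdvd V ((e \<otimes> ix r) [^] j) (g [^] i)" using vdvd_trans[OF sV _ _ vdvd_pow[OF sV K(2) g'(2)]] K(1) by simp
    then show ?thesis using I1_in[OF e(1)] by blast
  qed
  have "projectively_equivalent (K\<lparr>carrier := S1\<rparr>) I1 J'"
  proof -
    have "(\<exists>e\<in>I1. vdvd V (e [^] j) u) \<longleftrightarrow> (\<exists>g\<in>J'. vdvd V (g [^] i) u)" if V: "vring V" "S1 \<subseteq> V" for V u
    proof
      assume "\<exists>e\<in>I1. vdvd V (e [^] j) u"
      then obtain e where e: "e \<in> I1" "vdvd V (e [^] j) u" by blast
      obtain g where g: "g \<in> J'" "vdvd V (g [^] i) (e [^] j)" using qIJ[OF V e(1)] by blast
      have "g [^] i \<in> carrier K" using J'K[OF g(1)] by simp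
      then show "\<exists>g\<in>J'. vdvd V (g [^] i) u" using vdvd_trans[OF vringD(1)[OF V(1)] _ g(2) e(2)] g(1) by blast
    next
      assume "\<exists>g\<in>J'. vdvd V (g [^] i) u"
      then obtain g where g: "g \<in> J'" "vdvd V (g [^] i) u" by blast
      obtain e where e: "e \<in> I1" "vdvd V (e [^] j) (g [^] i)" using qJI[OF V g(1)] by blast
      have "e [^] j \<in> carrier K" using I1K[OF e(1)] by simp
      then show "\<exists>e\<in>I1. vdvd V (e [^] j) u" using vdvd_trans[OF vringD(1)[OF V(1)] _ e(2) g(2)] e(1) by blast
    qed
    then have "ideal_closure (K\<lparr>carrier := S1\<rparr>) (ideal_power (K\<lparr>carrier := S1\<rparr>) I1 j) =
      ideal_closure (K\<lparr>carrier := S1\<rparr>) (ideal_power (K\<lparr>carrier := S1\<rparr>) J' i)"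
      unfolding set_eq_iff closure_power_iff[OF S1_facts(1) I1_id] closure_power_iff[OF S1_facts(1) J'(1)] by blast
    then show ?thesis unfolding projectively_equivalent_def using ij by blast
  qed
  then obtain k :: nat where k: "0 < k" "J' = ideal_closure (K\<lparr>carrier := S1\<rparr>) (ideal_power (K\<lparr>carrier := S1\<rparr>) I1 k)"
    using full J'(3) unfolding projectively_full_def by blast
  have J'_k: "u \<in> J' \<longleftrightarrow> u \<in> S1 \<and> (\<forall>V. vring V \<and> S1 \<subseteq> V \<longrightarrow> (\<exists>e\<in>I1. vdvd V (e [^] k) u))" for u
    unfolding k(2) closure_power_iff[OF S1_facts(1) I1_id] ..
  \<comment> \<open>Properness is part of projective fullness. It supplies a valuation ring in which
    \<open>I1\<close> consists of nonunits, where exponents of \<open>I1\<close> can be told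
    apart.\<close>
  have "\<one> \<notin> I1"
  proof
    assume "\<one> \<in> I1"
    then have "I1 = S1" using ideal_ofD(1,4)[OF I1_id] SS(4) by (metis r_one subsetI subset_antisym)
    then show False using full unfolding projectively_full_def by simp
  qed
  then obtain V where V: "vring V" "S1 \<subseteq> V" "I1 \<subseteq> nonunits V" using chevalley[OF S1_facts(1) I1_id] by metis
  \<comment> \<open>With \<open>e = g/x^r\<close> of least value in \<open>I1\<close>, the ideal
    \<open>I1^k\<close> has value \<open>k v(e)\<close>, and so has \<open>J'\<close>. Projective
    equivalence then reads \<open>j v(e) = k i v(e)\<close>, and \<open>v(e)\<close> is positive;
    the two inequalities are proved separately.\<close>
  have jki: "j = k * i"
  proof -
    note sV = vringD(1)[OF V(1)]
    obtain ys where ys: "set ys \<subseteq> I" "I = gens R {\<zero>} ys" by (rule noeth_fg[OF noethR I_ideal])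
    obtain g where g: "g \<in> I" "\<And>f. f \<in> I \<Longrightarrow> vdvd V g f" using fg_vdvd[OF V(1) RS[OF V(1,2)] sR II(1) ys] by blast
    define e where "e = g \<otimes> ix r"
    have g0: "g \<noteq> \<zero>"
    proof
      assume g0: "g = \<zero>"
      obtain e where e: "e \<in> I" "e \<noteq> \<zero>" using I_ne by blast
      obtain v where "v \<in> V" "e = \<zero> \<otimes> v" using g(2)[OF e(1)] g0 unfolding vdvd_def by blast
      then show False using e(2) subringD(4)[OF sV] by simp
    qed
    have e: "e \<in> I1" "e \<noteq> \<zero>" "e \<in> carrier K" unfolding e_def using I1_in[OF g(1)] IK[OF g(1)] ix g0 by auto
    have en: "e \<in> nonunits V" using V(3) e(1) by blast
    have emin: "vdvd V e u" if u: "u \<in> I1" for u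
    proof -
      obtain e' where e': "e' \<in> I" "vdvd V (e' \<otimes> ix r) u" using I1_out[OF V(1,2) u] by blast
      have "vdvd V e (e' \<otimes> ix r)" unfolding e_def using vdvd_scale[OF sV ix IK[OF g(1)] IK[OF e'(1)]] g(2)[OF e'(1)] by simp
      then show ?thesis using vdvd_trans[OF sV e(3)] e'(2) by blast
    qed
    have eS: "e \<in> S1" using e(1) ideal_ofD(1)[OF I1_id] by blast
    have ekK: "e [^] k \<in> carrier K" "e [^] j \<in> carrier K" using e(3) by auto
    have "e [^] k \<in> J'" unfolding J'_k using SS(9)[OF eS] e(1) vdvd_refl[OF vringD(1) ekK(1)] by blast
    then obtain e1 where e1: "e1 \<in> I1" "vdvd V (e1 [^] j) ((e [^] k) [^] i)" using qJI[OF V(1,2)] by blast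
    have "vdvd V (e [^] j) (e1 [^] j)" using vdvd_pow[OF sV e(3) emin[OF e1(1)]] .
    then have "vdvd V (e [^] j) (e [^] (k * i))" using vdvd_trans[OF sV ekK(2)] e1(2) e(3) by (simp add: nat_pow_pow)
    then have 1: "j \<le> k * i" by (rule nonunit_powers[OF V(1) en e(2)])
    obtain h where h: "h \<in> J'" "vdvd V (h [^] i) (e [^] j)" using qIJ[OF V(1,2) e(1)] by blast
    obtain e2 where e2: "e2 \<in> I1" "vdvd V (e2 [^] k) h" using h(1) V(1,2) unfolding J'_k by blast
    have "vdvd V (e [^] k) h" using vdvd_trans[OF sV ekK(1) vdvd_pow[OF sV e(3) emin[OF e2(1)]] e2(2)] .
    then have "vdvd V ((e [^] k) [^] i) (h [^] i)" by (rule vdvd_pow[OF sV ekK(1)])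
    then have "vdvd V ((e [^] k) [^] i) (e [^] j)" using vdvd_trans[OF sV _ _ h(2)] ekK(1) by simp
    then have "vdvd V (e [^] (k * i)) (e [^] j)" using e(3) by (simp add: nat_pow_pow)
    then have "k * i \<le> j" by (rule nonunit_powers[OF V(1) en e(2)])
    then show ?thesis using 1 by simp
  qed
  have srk: "s = r * k" using rs ij(1) unfolding jki by simp
  have ixs: "(b \<otimes> ix s) = (b \<otimes> ix s) [^] (1::nat)" if "b \<in> carrier K" for b using that ix by simp
  have sc: "vdvd V ((e \<otimes> ix r) [^] k) (z \<otimes> ix s) \<longleftrightarrow> vdvd V (e [^] k) z" if "vring V" "e \<in> carrier K" "z \<in> carrier K" for V e z
    using scaled[OF that, of r k s 1] that ix srk by simp
  have "J = ideal_closure (K\<lparr>carrier := R\<rparr>) (ideal_power (K\<lparr>carrier := R\<rparr>) I k)"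
  proof (intro equalityI subsetI)
    fix z assume z: "z \<in> J"
    have zR: "z \<in> R" "z \<in> carrier K" using z JJ(1) JK by auto
    have zJ': "z \<otimes> ix s \<in> J'" using J1_in[OF z] J'(2) by blast
    have "\<exists>e\<in>I. vdvd V (e [^] k) z" if V: "vring V" "S1 \<subseteq> V" for V
    proof -
      note sV = vringD(1)[OF V(1)]
      obtain u where u: "u \<in> I1" "vdvd V (u [^] k) (z \<otimes> ix s)" using zJ' V unfolding J'_k by blast
      obtain e where e: "e \<in> I" "vdvd V (e \<otimes> ix r) u" using I1_out[OF V u(1)] by blast
      have K: "e \<otimes> ix r \<in> carrier K" using IK[OF e(1)] ix by simp
      have "vdvd V ((e \<otimes> ix r) [^] k) (z \<otimes> ix s)" using vdvd_trans[OF sV _ vdvd_pow[OF sV K e(2)] u(2)] K by simp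
      then show ?thesis using sc[OF V(1) IK[OF e(1)] zR(2)] e(1) by blast
    qed
    then show "z \<in> ideal_closure (K\<lparr>carrier := R\<rparr>) (ideal_power (K\<lparr>carrier := R\<rparr>) I k)"
      unfolding cI using zR(1) closure_descent[OF zR(1)] by blast
  next
    fix z assume z: "z \<in> ideal_closure (K\<lparr>carrier := R\<rparr>) (ideal_power (K\<lparr>carrier := R\<rparr>) I k)"
    then have zR: "z \<in> R" "z \<in> carrier K" unfolding cI using RR(4) by auto
    \<comment> \<open>Completeness of the powers of \<open>m\<close> bounds the order of
      \<open>z\<close> below by \<open>r k = s\<close>, which is what brings \<open>z/x^s\<close>
      into \<open>S1\<close>.\<close>
    have "z \<in> mp s" using clord[OF I_ideal ordI(1) z] srk by simp
    then have zS: "z \<otimes> ix s \<in> S1" unfolding ix_def by (rule S1I)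
    have "\<exists>e\<in>I1. vdvd V (e [^] k) (z \<otimes> ix s)" if V: "vring V" "S1 \<subseteq> V" for V
    proof -
      obtain e where e: "e \<in> I" "vdvd V (e [^] k) z" using z V(1) RS[OF V] unfolding cI by blast
      then have "vdvd V ((e \<otimes> ix r) [^] k) (z \<otimes> ix s)" using sc[OF V(1) IK[OF e(1)] zR(2)] by blast
      then show ?thesis using I1_in[OF e(1)] by blast
    qed
    then have zJ': "z \<otimes> ix s \<in> J'" unfolding J'_k using zS by blast
    \<comment> \<open>The descent from \<open>S1\<close> to \<open>R\<close> is available for powers
      of \<open>I\<close> only. So it is applied to \<open>z^i\<close> and \<open>I^j\<close>,
      translated back to \<open>J^i\<close> by projective equivalence over \<open>R\<close>, and
      then the \<open>i\<close>-th root is taken in each valuation ring.\<close>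
    have div: "\<exists>e\<in>I. vdvd V (e [^] j) (z [^] i)" if V: "vring V" "S1 \<subseteq> V" for V
    proof -
      note sV = vringD(1)[OF V(1)]
      obtain g where g: "g \<in> J" "vdvd V (g \<otimes> ix s) (z \<otimes> ix s)" using zJ' V unfolding J'_iff by blast
      then have "vdvd V g z" using vdvd_scale[OF sV ix JK[OF g(1)] zR(2)] by simp
      then have gz: "vdvd V (g [^] i) (z [^] i)" by (rule vdvd_pow[OF sV JK[OF g(1)]])
      obtain e where e: "e \<in> I" "vdvd V (e [^] j) (g [^] i)" using pJI[OF V(1) RS[OF V] g(1)] by blast
      have "e [^] j \<in> carrier K" using IK[OF e(1)] by simp
      then show ?thesis using vdvd_trans[OF sV _ e(2) gz] e(1) by blast
    qed
    have "\<exists>g\<in>J. vdvd V g z" if V: "vring V" "R \<subseteq> V" for V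
    proof -
      obtain e where e: "e \<in> I" "vdvd V (e [^] j) (z [^] i)" using closure_descent[OF RR(9)[OF zR(1)] div V] by blast
      obtain g where g: "g \<in> J" "vdvd V (g [^] i) (e [^] j)" using pIJ[OF V e(1)] by blast
      have "g [^] i \<in> carrier K" using JK[OF g(1)] by simp
      then have "vdvd V (g [^] i) (z [^] i)" using vdvd_trans[OF vringD(1)[OF V(1)] _ g(2) e(2)] by blast
      then show ?thesis using vdvd_pow_cancel[OF V(1) JK[OF g(1)] zR(2) ij(1)] g(1) by blast
    qed
    then have "z \<in> ideal_closure (K\<lparr>carrier := R\<rparr>) J" unfolding ideal_closure_iff[OF sR J_id(1)] using zR(1) by blast
    then show "z \<in> J" using J_id(2) by simp
  qed
  then show ?thesis using k(1) by blast
qed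

end

section \<open>From the hypotheses of the theorem to the assumptions of the locales\<close>

context ambient_field
begin

lemma noeth_subring_record:
  assumes "subring A K" "noetherian_ring (K\<lparr>carrier := A\<rparr>)"
  shows "noeth A"
proof (rule noethI_fg[OF assms(1)])
  fix E assume "ideal_of A E"
  then have "ideal E (K\<lparr>carrier := A\<rparr>)" using ideal_of_iff[OF assms(1)] by blast
  from noetherian_ring.finetely_gen[OF assms(2) this]
  obtain F where F: "F \<subseteq> A" "finite F" "E = Idl\<^bsub>K\<lparr>carrier := A\<rparr>\<^esub> F" by auto
  have "F \<subseteq> E" unfolding F(3) by (rule Idl_facts(2)[OF assms(1) F(1)])
  moreover have "\<forall>E'. ideal_of A E' \<and> F \<subseteq> E' \<longrightarrow> E \<subseteq> E'"
    unfolding F(3) using Idl_facts(3)[OF assms(1) F(1)] by simp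
  ultimately show "\<exists>F. finite F \<and> F \<subseteq> E \<and> (\<forall>E'. ideal_of A E' \<and> F \<subseteq> E' \<longrightarrow> E \<subseteq> E')"
    using F(2) by (intro exI[of _ F]) simp
qed

text \<open>If \<open>a\<close> were not invertible in \<open>A\<close>, a proper ideal containing
  it could be enlarged to a maximal one, which has to be \<open>N\<close>.\<close>

lemma unit_of_unique_maximal:
  assumes "noeth A" "\<And>M. maximalideal M (K\<lparr>carrier := A\<rparr>) \<Longrightarrow> M = N" "a \<in> A" "a \<notin> N" "N \<subseteq> A" "\<zero> \<in> N"
  shows "inv a \<in> A"
proof (rule ccontr)
  note sA = noeth_subring[OF assms(1)]
  note A = subringD[OF sA]
  assume neg: "inv a \<notin> A"
  have aK: "a \<in> carrier K" "a \<noteq> \<zero>" using assms A(4) by auto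
  note p = plus_gen_ideal[OF sA zero_ideal_of[OF sA] assms(3)]
  let ?F = "{E. ideal_of A E \<and> a \<in> E \<and> \<one> \<notin> E}"
  have "\<one> \<notin> plus_gen A {\<zero>} a"
  proof
    assume "\<one> \<in> plus_gen A {\<zero>} a"
    then obtain b where b: "b \<in> A" "\<one> = \<zero> \<oplus> b \<otimes> a" unfolding plus_gen_def by blast
    then have "a \<otimes> b = \<one>" using aK A(4) by (simp add: m_comm)
    then have "inv a = b" using aK A(4)[OF b(1)] by (intro comm_inv_char) auto
    then show False using b(1) neg by simp
  qed
  then have F0: "plus_gen A {\<zero>} a \<in> ?F" using p by blast
  obtain M where M: "M \<in> ?F" "\<And>E. E \<in> ?F \<Longrightarrow> M \<subseteq> E \<Longrightarrow> E = M"
  proof (rule noeth_max[OF assms(1) F0])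
    fix M assume "M \<in> ?F" "\<And>E. E \<in> ?F \<Longrightarrow> M \<subseteq> E \<Longrightarrow> E = M"
    then show thesis by (rule that)
  qed simp
  have "maximalideal M (K\<lparr>carrier := A\<rparr>)"
  proof (rule maximalidealI)
    show "ideal M (K\<lparr>carrier := A\<rparr>)" using M(1) ideal_of_iff[OF sA] by blast
    show "carrier (K\<lparr>carrier := A\<rparr>) \<noteq> M" using M(1) A(3) by auto
    fix J assume J: "ideal J (K\<lparr>carrier := A\<rparr>)" "M \<subseteq> J"
    then have Ji: "ideal_of A J" using ideal_of_iff[OF sA] by blast
    show "J = M \<or> J = carrier (K\<lparr>carrier := A\<rparr>)"
    proof (cases "\<one> \<in> J")
      case True
      then have "A \<subseteq> J" using ideal_ofD(4)[OF Ji _ True] A(4) by (metis r_one subsetI)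
      then show ?thesis using ideal_ofD(1)[OF Ji] by auto
    next
      case False
      then show ?thesis using M(2)[of J] M(1) Ji J(2) by blast
    qed
  qed
  then show False using assms(2,4) M(1) by blast
qed

lemma regular_local_generators:
  assumes "fraction_field_of K R" "regular_local_ring (K\<lparr>carrier := R\<rparr>) m" "krull_dim (K\<lparr>carrier := R\<rparr>) = enat d" "d \<ge> 1"
    "infinite (carrier ((K\<lparr>carrier := R\<rparr>) Quot m))"
  shows "\<exists>xs. reg_local K R m xs"
proof -
  let ?R = "K\<lparr>carrier := R\<rparr>"
  have sR: "subring R K" using assms(1) unfolding fraction_field_of_def by blast
  note R = subringD[OF sR]
  have reg: "cring ?R" "noetherian_ring ?R" "maximalideal m ?R" "\<And>M. maximalideal M ?R \<Longrightarrow> M = m"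
    using assms(2) unfolding regular_local_ring_def by blast+
  obtain X where X: "X \<subseteq> R" "finite X" "m = Idl\<^bsub>?R\<^esub> X" "enat (card X) = krull_dim ?R"
    using assms(2) unfolding regular_local_ring_def by auto
  have nR: "noeth R" by (rule noeth_subring_record[OF sR reg(2)])
  have pm: "prime_of R m" using cring.maximalideal_prime[OF reg(1,3)] prime_of_iff[OF sR] by blast
  note M = prime_ofD[OF pm]
  have un: "inv a \<in> R" if "a \<in> R" "a \<notin> m" for a
    using unit_of_unique_maximal[OF nR reg(4) that M(4,5)] .
  obtain xs where xs: "set xs = X" "distinct xs" using finite_distinct_list[OF X(2)] by blast
  have len: "length xs = d" using distinct_card[OF xs(2)] xs(1) X(4) assms(3) by simp
  have xsR: "set xs \<subseteq> R" using xs X by blast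
  note G = gens_ideal[OF sR zero_ideal_of[OF sR] xsR]
  have "m = gens R {\<zero>} xs"
  proof
    show "m \<subseteq> gens R {\<zero>} xs" unfolding X(3) using Idl_facts(3)[OF sR X(1)] G xs(1) by blast
    show "gens R {\<zero>} xs \<subseteq> m" by (rule gens_subset[OF M(1)]) (use M(5) xs(1) X(3) Idl_facts(2)[OF sR X(1)] in auto)
  qed
  moreover have "xs \<noteq> []" using len assms(4) by auto
  moreover have "\<exists>k P. length xs \<le> k \<and> pch R k P m"
  proof -
    \<comment> \<open>If all chains had fewer than \<open>d\<close> links, their supremum would be
      at most \<open>d - 1\<close>, which for \<open>d \<ge> 1\<close> is less than
      \<open>d\<close>.\<close>
    have "\<exists>n P. prime_chain ?R n P \<and> d \<le> n"
    proof (rule ccontr)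
      assume neg: "\<not> ?thesis"
      have "krull_dim ?R \<le> enat (d - 1)" unfolding krull_dim_def
      proof (rule Sup_least)
        fix y assume "y \<in> {enat n | n. \<exists>P. prime_chain ?R n P}"
        then obtain n P where "y = enat n" "prime_chain ?R n P" by blast
        then have "\<not> d \<le> n" using neg by blast
        then show "y \<le> enat (d - 1)" using \<open>y = enat n\<close> by simp
      qed
      then show False using assms(3,4) by simp
    qed
    then obtain n P where P: "prime_chain ?R n P" "d \<le> n" by blast
    have pc: "pch R n (P 0) (P n)" by (rule prime_chain_pch[OF sR P(1)])
    have pn: "prime_of R (P n)" using pch_prime[OF pc] by blast
    have "P n \<subseteq> m"
    proof
      fix e assume e: "e \<in> P n"
      have eR: "e \<in> R" using e prime_ofD(4)[OF pn] by blast
      show "e \<in> m"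
      proof (rule ccontr)
        assume em: "e \<notin> m"
        then have "e \<noteq> \<zero>" using M(5) by blast
        moreover have "inv e \<otimes> e \<in> P n" using prime_ofD(7)[OF pn un[OF eR em] e] .
        ultimately show False using prime_ofD(2)[OF pn] R(4)[OF eR] by simp
      qed
    qed
    \<comment> \<open>Every prime ideal lies in \<open>m\<close>, as elements outside
      \<open>m\<close> are units; so the chain either ends in \<open>m\<close> or is prolonged by
      it.\<close>
    show ?thesis
    proof (cases "P n = m")
      case True then show ?thesis using pc P(2) len by blast
    next
      case False
      then have "pch R (Suc n) (P 0) m" using pch.step[OF pc pm] \<open>P n \<subseteq> m\<close> by blast
      then show ?thesis using P(2) len le_SucI by blast
    qed
  qed
  moreover have "\<exists>T\<subseteq>R. infinite T \<and> (\<forall>s\<in>T. \<forall>t\<in>T. s \<noteq> t \<longrightarrow> s \<ominus> t \<notin> m)"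
  proof -
    define f where "f a = a_r_coset ?R m a" for a
    have "carrier (?R Quot m) = f ` R"
      unfolding FactRing_def A_RCOSETS_def' f_def by auto
    then have inf: "infinite (f ` R)" using assms(5) by simp
    \<comment> \<open>One representative is chosen from each residue class.\<close>
    obtain T where T: "T \<subseteq> R" "f ` R = f ` T" "inj_on f T" by (metis subset_image_inj subset_refl)
    have "infinite T" using inf T(2) by auto
    moreover have "s \<ominus> t \<notin> m" if st: "s \<in> T" "t \<in> T" "s \<noteq> t" for s t
    proof
      assume a: "s \<ominus> t \<in> m"
      have k: "s \<in> carrier K" "t \<in> carrier K" using st T(1) R(4) by auto
      have mem: "f u = {h \<oplus> u | h. h \<in> m}" for u unfolding f_def a_r_coset_def r_coset_def by auto
      have "f s = f t" unfolding mem
      proof (intro equalityI subsetI)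
        fix y assume "y \<in> {h \<oplus> s | h. h \<in> m}"
        then obtain h where h: "h \<in> m" "y = h \<oplus> s" by blast
        have hK: "h \<in> carrier K" using h M(4) R(4) by blast
        have "y = (h \<oplus> (s \<ominus> t)) \<oplus> t" unfolding h(2) using hK k by algebra
        then show "y \<in> {h \<oplus> t | h. h \<in> m}" using M(6)[OF h(1) a] by blast
      next
        fix y assume "y \<in> {h \<oplus> t | h. h \<in> m}"
        then obtain h where h: "h \<in> m" "y = h \<oplus> t" by blast
        have hK: "h \<in> carrier K" using h M(4) R(4) by blast
        have "y = (h \<ominus> (s \<ominus> t)) \<oplus> s" unfolding h(2) using hK k by algebra
        then show "y \<in> {h \<oplus> s | h. h \<in> m}" using ideal_of_minus(2)[OF sR M(1) h(1) a] by blast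
      qed
      then show False using T(3) st unfolding inj_on_def by blast
    qed
    ultimately show ?thesis using T(1) by blast
  qed
  ultimately have "reg_local K R m xs"
    by unfold_locales (use nR pm un xsR in blast)+
  then show ?thesis by blast
qed

end

context blowup
begin

lemma transform_product:
  assumes "is_transform K S1 I I1"
  shows "Idl\<^bsub>K\<lparr>carrier := S1\<rparr>\<^esub> I = {x [^] r \<otimes> z | z. z \<in> I1}"
proof -
  note T = transform_eq[OF assms]
  have IS: "I \<subseteq> S1" using II(1) S1_facts(2) by blast
  have K: "z \<in> carrier K" if "z \<in> Idl\<^bsub>K\<lparr>carrier := S1\<rparr>\<^esub> I" for z
    using that ideal_ofD(1)[OF Idl_facts(1)[OF S1_facts(1) IS]] SS(4) by blast
  show ?thesis
  proof (intro equalityI subsetI)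
    fix z assume z: "z \<in> Idl\<^bsub>K\<lparr>carrier := S1\<rparr>\<^esub> I"
    then have "z = x [^] r \<otimes> (inv (x [^] r) \<otimes> z)" using K[OF z] xn[of r] by simp
    then show "z \<in> {x [^] r \<otimes> z | z. z \<in> I1}" using z unfolding T by blast
  next
    fix u assume "u \<in> {x [^] r \<otimes> z | z. z \<in> I1}"
    then obtain z where z: "z \<in> Idl\<^bsub>K\<lparr>carrier := S1\<rparr>\<^esub> I" "u = x [^] r \<otimes> (inv (x [^] r) \<otimes> z)" unfolding T by blast
    then show "u \<in> Idl\<^bsub>K\<lparr>carrier := S1\<rparr>\<^esub> I" using K[OF z(1)] xn[of r] by simp
  qed
qed

end

theorem proposition5p6:
  fixes K :: "('a, 'b) ring_scheme" and R m I S1 I1 :: "'a set" and x :: 'a and d r :: nat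
  assumes "fraction_field_of K R"
    and "regular_local_ring (K\<lparr>carrier := R\<rparr>) m"
    and "krull_dim (K\<lparr>carrier := R\<rparr>) = enat d" and "d \<ge> 2"
    and "infinite (carrier ((K\<lparr>carrier := R\<rparr>) Quot m))"
    and "complete_ideal (K\<lparr>carrier := R\<rparr>) I"
    and "primary_ideal (K\<lparr>carrier := R\<rparr>) I"
    and "ideal_radical (K\<lparr>carrier := R\<rparr>) I = m"
    and "x \<in> m" and "x \<notin> ideal_power (K\<lparr>carrier := R\<rparr>) m 2"
    and "\<forall>V \<in> Rees K R I. PIdl\<^bsub>K\<lparr>carrier := V\<rparr>\<^esub> x = Idl\<^bsub>K\<lparr>carrier := V\<rparr>\<^esub> m"
    and "S1 = adjoin_quotients K R m x"
    and "ideal_ord (K\<lparr>carrier := R\<rparr>) m I r"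
    and "is_transform K S1 I I1"
  shows "Idl\<^bsub>K\<lparr>carrier := S1\<rparr>\<^esub> I = {x [^]\<^bsub>K\<^esub> r \<otimes>\<^bsub>K\<^esub> z | z. z \<in> I1} \<and>
    (projectively_full (K\<lparr>carrier := S1\<rparr>) I1 \<longrightarrow> projectively_full (K\<lparr>carrier := R\<rparr>) I)"
proof -
  have "ambient_field K" using assms(1) unfolding fraction_field_of_def ambient_field_def by blast
  then interpret ambient_field K .
  obtain xs where "reg_local K R m xs" using regular_local_generators[OF assms(1-3) _ assms(5)] assms(4) by auto
  then interpret reg_local K R m xs .
  have Iid: "ideal_of R I" using assms(6) ideal_of_iff[OF sR] unfolding complete_ideal_def by blast
  have radI: "m = {a \<in> R. \<exists>n::nat. a [^]\<^bsub>K\<^esub> n \<in> I}"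
    using assms(8) unfolding ideal_radical_def by (simp add: nat_pow_carrier_update)
  have Im: "I \<subseteq> m"
  proof
    fix a assume a: "a \<in> I"
    have aR: "a \<in> R" using a ideal_ofD(1)[OF Iid] by blast
    have "a [^]\<^bsub>K\<^esub> (1::nat) \<in> I" using a RR(4)[OF aR] by simp
    then show "a \<in> m" unfolding radI using aR by blast
  qed
  interpret blowup K R m xs I S1 x r
  proof
    show "frac R" using assms(1) unfolding fraction_field_of_def frac_def by blast
    show "ideal_of R I" by (rule Iid)
    show "I \<subseteq> m" by (rule Im)
    show "\<exists>n::nat. e [^]\<^bsub>K\<^esub> n \<in> I" if "e \<in> m" for e using that unfolding radI by blast
    show "x \<in> m" by (rule assms(9))
    show "x \<notin> ipw R m 2" using assms(10) unfolding ipw_eq .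
    show "S1 = adjoin_quotients K R m x" by (rule assms(12))
    show "I \<subseteq> ipw R m r" "\<not> I \<subseteq> ipw R m (Suc r)" using assms(13) unfolding ideal_ord_def ipw_eq by blast+
    fix V y assume V: "V \<in> Rees K R I" and y: "y \<in> m"
    have xK: "x \<in> carrier K" using assms(9) mm(4) RR(4) by blast
    have x0: "x \<noteq> \<zero>\<^bsub>K\<^esub>" using assms(10) mpD(2)[of 2] unfolding ipw_eq by blast
    have "y \<in> Idl\<^bsub>K\<lparr>carrier := V\<rparr>\<^esub> m" using y unfolding genideal_def by blast
    then have "y \<in> {v \<otimes>\<^bsub>K\<^esub> x | v. v \<in> V}" using assms(11) V PIdl_eq by blast
    then obtain v where v: "v \<in> V" "y = v \<otimes>\<^bsub>K\<^esub> x" by blast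
    \<comment> \<open>Fractions could leave the field only through a zero denominator, whose inverse
      is unspecified; zero lies in the prime \<open>Q\<close> and so is no denominator.\<close>
    have VK: "V \<subseteq> carrier K"
    proof -
      obtain B Q a where B: "V = localization_in K B Q" "B = integral_closure_in K (adjoin_quotients K R I a)"
        and Q: "primeideal Q (K\<lparr>carrier := B\<rparr>)" using V unfolding Rees_def by blast
      have "B \<subseteq> carrier K" unfolding B(2) integral_closure_in_def by blast
      moreover have "\<zero>\<^bsub>K\<^esub> \<in> Q"
        using additive_subgroup.zero_closed[OF ideal.axioms(1)[OF primeideal.axioms(1)[OF Q]]] by simp
      then have "s \<noteq> \<zero>\<^bsub>K\<^esub>" if "s \<in> B - Q" for s using that by blast
      ultimately have "b \<otimes>\<^bsub>K\<^esub> inv\<^bsub>K\<^esub> s \<in> carrier K" if "b \<in> B" "s \<in> B - Q" for b s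
        using that by (simp add: subset_iff)
      then show ?thesis unfolding B(1) localization_in_def by blast
    qed
    have "y \<otimes>\<^bsub>K\<^esub> inv\<^bsub>K\<^esub> x = v" using v VK xK x0 by auto
    then show "y \<otimes>\<^bsub>K\<^esub> inv\<^bsub>K\<^esub> x \<in> V" using v(1) by simp
  qed
  have "projectively_full (K\<lparr>carrier := R\<rparr>) I" if full: "projectively_full (K\<lparr>carrier := S1\<rparr>) I1"
    unfolding projectively_full_def
  proof (intro conjI allI impI)
    obtain e where e: "e \<in> I" "e \<noteq> \<zero>\<^bsub>K\<^esub>" using I_ne by blast
    have "b = \<zero>\<^bsub>K\<^esub>" if "b \<in> R" "e \<otimes>\<^bsub>K\<^esub> b = \<zero>\<^bsub>K\<^esub>" for b using that e(2) IK[OF e(1)] RR(4) by auto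
    then show "regular_ideal (K\<lparr>carrier := R\<rparr>) I"
      unfolding regular_ideal_def using e(1) Iid ideal_of_iff[OF sR] by auto
    show "I \<noteq> carrier (K\<lparr>carrier := R\<rparr>)" using assms(7) unfolding primary_ideal_def by blast
    fix J assume "complete_ideal (K\<lparr>carrier := R\<rparr>) J \<and> projectively_equivalent (K\<lparr>carrier := R\<rparr>) I J"
    then obtain i j :: nat where "complete_ideal (K\<lparr>carrier := R\<rparr>) J" "0 < i" "0 < j"
      "ideal_closure (K\<lparr>carrier := R\<rparr>) (ideal_power (K\<lparr>carrier := R\<rparr>) I j)
        = ideal_closure (K\<lparr>carrier := R\<rparr>) (ideal_power (K\<lparr>carrier := R\<rparr>) J i)"
      unfolding projectively_equivalent_def by blast
    then show "\<exists>k::nat. 0 < k \<and> J = ideal_closure (K\<lparr>carrier := R\<rparr>) (ideal_power (K\<lparr>carrier := R\<rparr>) I k)"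
      by (rule projectively_full_descends[OF assms(14) full])
  qed
  then show ?thesis using transform_product[OF assms(14)] by blast
qed

end
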